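(* Let $f\in L^2(I;V^* )$, $u_0\in H_\sigma$, and let $(u,p)\in\mathcal{W}(I)\times L^2(I;L^2_0(\Omega))$ be the solution of the unsteady Stokes equations $$\partial_tu(t)+(-\Delta)u(t)+\nabla p(t)=f(t)\text{ in }V^*,\qquad\operatorname{div}u(t)=0\text{ a.e. in }\Omega,\qquad\text{for a.e. }t\in I,\qquad u(0)=u_0\text{ in }H ,$$ and let $z\coloneqq\nabla u-p\,\mathrm{I}_d$ a.e. in $Q$. Then, for every $(y,\lambda)\in L^2(I;Y^* )\times\mathcal{W}(I)$ with $\lambda\in L^2(I;V_\sigma)$ and $\operatorname{div}y=\partial_t\lambda-f$ in $L^2(I;V^* )$, $$\tfrac12\|\operatorname{dev}(y-z)\|_Q^2+\tfrac12\|\nabla(\lambda-u)\|_Q^2+\tfrac12\|(\lambda-u)(T)\|_H^2=\tfrac12\|\operatorname{dev}y-\nabla\lambda\|_Q^2+\tfrac12\|\lambda(0)-u_0\|_H^2 .$$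
   Context: $\Omega\subseteq\mathbb{R}^d$ is a bounded Lipschitz domain; $I=(0,T)$, $0<T<\infty$; $Q=I\times\Omega$. $V=W^{1,2}_0(\Omega;\mathbb{R}^d)$ (full Dirichlet boundary) with norm $\|\nabla\cdot\|_{L^2(\Omega)}$, $H=L^2(\Omega;\mathbb{R}^d)$, $Y=Y^*=L^2(\Omega;\mathbb{R}^{d\times d})$. $V_\sigma=\{v\in V\mid\operatorname{div}v=0\text{ a.e. in }\Omega\}$ and $H_\sigma$ is the closure of $V_\sigma$ in $H$. $L^2_0(\Omega)=\{q\in L^2(\Omega)\mid\int_\Omega q\,dx=0\}$. $V\hookrightarrow H\cong H^*\hookrightarrow V^*$ is the usual evolution triple and $\mathcal{W}(I)=\{v\in L^2(I;V)\mid\partial_tv\in L^2(I;V^* )\}\hookrightarrow C^0(\overline I;H)$. $L=\nabla\colon V\to Y$, $\langle L^*y,v\rangle_V=\int_\Omega y:\nabla v\,dx$; in $V^*$, $\operatorname{div}y$ for a tensor field $y\in Y^*$ means $-L^*y$. $\langle(-\Delta)v,w\rangle_V=\int_\Omega\nabla v:\nabla w\,dx$; $\nabla\colon L^2_0(\Omega)\to V^*$, $\langle\nabla q,v\rangle_V=-\int_\Omega q\operatorname{div}v\,dx$. $\operatorname{dev}A=A-\frac1d\operatorname{tr}(A)\mathrm{I}_d$. Operators act pointwise in time. $\|\cdot\|_Q$ is the $L^2(Q)$-norm. *)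

theory Defs
  imports "HOL-Analysis.Analysis"
begin

text \<open>Lebesgue and Sobolev functions are represented by total functions whose values outside
  \<open>\<Omega>\<close> (resp. outside the time interval) are irrelevant; equality in these spaces is equality
  almost everywhere.\<close>

type_synonym 'd vfield = "real^'d \<Rightarrow> real^'d"
type_synonym 'd tfield = "real^'d \<Rightarrow> real^'d^'d"

text \<open>Near each boundary point, \<open>\<Omega>\<close> is the set above the graph of a Lipschitz function
  over the hyperplane orthogonal to some unit vector \<open>n\<close>.\<close>

definition lipschitz_domain :: "'a::euclidean_space set \<Rightarrow> bool" where
  "lipschitz_domain \<Omega> \<longleftrightarrow> open \<Omega> \<and> connected \<Omega> \<and> \<Omega> \<noteq> {} \<and>
     (\<forall>x0\<in>frontier \<Omega>. \<exists>r>0. \<exists>n \<gamma> C. norm n = 1 \<and> C-lipschitz_on {w. w \<bullet> n = 0} \<gamma> \<and>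
        \<Omega> \<inter> ball x0 r = {x \<in> ball x0 r. x \<bullet> n > \<gamma> (x - (x \<bullet> n) *\<^sub>R n)})"

primrec Ck :: "nat \<Rightarrow> ('a::euclidean_space \<Rightarrow> 'b::euclidean_space) \<Rightarrow> bool" where
  "Ck 0 f \<longleftrightarrow> continuous_on UNIV f"
| "Ck (Suc k) f \<longleftrightarrow> (\<forall>x. f differentiable at x) \<and>
     (\<forall>b\<in>Basis. Ck k (\<lambda>x. frechet_derivative f (at x) b))"

definition test_functions :: "'a::euclidean_space set \<Rightarrow> ('a \<Rightarrow> 'b::euclidean_space) set" where
  "test_functions S = {\<phi>. (\<forall>k. Ck k \<phi>) \<and> (\<exists>K. compact K \<and> K \<subseteq> S \<and> (\<forall>x. x \<notin> K \<longrightarrow> \<phi> x = 0))}"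

definition L2 :: "'a::euclidean_space set \<Rightarrow> ('a \<Rightarrow> 'b::euclidean_space) set" where
  "L2 S = {g. g \<in> borel_measurable (lebesgue_on S) \<and>
              integrable (lebesgue_on S) (\<lambda>x. (norm (g x))\<^sup>2)}"

definition L2_norm :: "'a::euclidean_space set \<Rightarrow> ('a \<Rightarrow> 'b::euclidean_space) \<Rightarrow> real" where
  "L2_norm S g = sqrt (integral\<^sup>L (lebesgue_on S) (\<lambda>x. (norm (g x))\<^sup>2))"

definition L2_mean_zero :: "'a::euclidean_space set \<Rightarrow> ('a \<Rightarrow> real) set" where
  "L2_mean_zero \<Omega> = {q \<in> L2 \<Omega>. integral\<^sup>L (lebesgue_on \<Omega>) q = 0}"

text \<open>Convention: \<open>(\<nabla>v) $ i $ j = \<partial>\<^sub>j v\<^sub>i\<close>, as for \<open>jacobian\<close>.\<close>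

definition weak_gradient :: "(real^'d) set \<Rightarrow> 'd::finite vfield \<Rightarrow> 'd tfield \<Rightarrow> bool" where
  "weak_gradient \<Omega> v G \<longleftrightarrow> (\<forall>\<phi>\<in>test_functions \<Omega>. \<forall>i j.
     (LINT x|lebesgue_on \<Omega>. v x $ i * frechet_derivative \<phi> (at x) (axis j 1)) =
     - (LINT x|lebesgue_on \<Omega>. G x $ i $ j * \<phi> x))"

definition grad :: "(real^'d) set \<Rightarrow> 'd::finite vfield \<Rightarrow> 'd tfield" where
  "grad \<Omega> v = (SOME G. G \<in> L2 \<Omega> \<and> weak_gradient \<Omega> v G)"

definition div_field :: "(real^'d) set \<Rightarrow> 'd::finite vfield \<Rightarrow> real^'d \<Rightarrow> real" where
  "div_field \<Omega> v x = trace (grad \<Omega> v x)"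

definition H1 :: "(real^'d) set \<Rightarrow> 'd::finite vfield set" where
  "H1 \<Omega> = {v \<in> L2 \<Omega>. \<exists>G\<in>L2 \<Omega>. weak_gradient \<Omega> v G}"

text \<open>The space $V = W^{1,2}_0$, as the closure of the test functions in $W^{1,2}$.\<close>

definition V :: "(real^'d) set \<Rightarrow> 'd::finite vfield set" where
  "V \<Omega> = {v \<in> H1 \<Omega>. \<exists>\<phi>::nat \<Rightarrow> 'd vfield. (\<forall>n. \<phi> n \<in> test_functions \<Omega>) \<and>
      (\<lambda>n. L2_norm \<Omega> (\<phi> n - v)) \<longlonglongrightarrow> 0 \<and>
      (\<lambda>n. L2_norm \<Omega> (\<lambda>x. jacobian (\<phi> n) (at x) - grad \<Omega> v x)) \<longlonglongrightarrow> 0}"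

definition V_norm :: "(real^'d) set \<Rightarrow> 'd::finite vfield \<Rightarrow> real" where
  "V_norm \<Omega> v = L2_norm \<Omega> (grad \<Omega> v)"

definition V_sigma :: "(real^'d) set \<Rightarrow> 'd::finite vfield set" where
  "V_sigma \<Omega> = {v \<in> V \<Omega>. AE x in lebesgue_on \<Omega>. div_field \<Omega> v x = 0}"

definition H_sigma :: "(real^'d) set \<Rightarrow> 'd::finite vfield set" where
  "H_sigma \<Omega> = {h \<in> L2 \<Omega>. \<exists>v. (\<forall>n. v n \<in> V_sigma \<Omega>) \<and> (\<lambda>n. L2_norm \<Omega> (v n - h)) \<longlonglongrightarrow> 0}"

text \<open>Only the restriction of a functional to \<open>V \<Omega>\<close> matters. Boundedness implies that it
  respects a.e. equality.\<close>

definition V_dual :: "(real^'d) set \<Rightarrow> ('d::finite vfield \<Rightarrow> real) set" where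
  "V_dual \<Omega> = {F. (\<forall>v\<in>V \<Omega>. \<forall>w\<in>V \<Omega>. \<forall>a b. F (\<lambda>x. a *\<^sub>R v x + b *\<^sub>R w x) = a * F v + b * F w) \<and>
     (\<exists>C. \<forall>v\<in>V \<Omega>. \<bar>F v\<bar> \<le> C * V_norm \<Omega> v)}"

definition V_dual_norm :: "(real^'d) set \<Rightarrow> ('d::finite vfield \<Rightarrow> real) \<Rightarrow> real" where
  "V_dual_norm \<Omega> F = (SUP v\<in>{v \<in> V \<Omega>. V_norm \<Omega> v \<le> 1}. \<bar>F v\<bar>)"

definition neg_laplace :: "(real^'d) set \<Rightarrow> 'd::finite vfield \<Rightarrow> 'd vfield \<Rightarrow> real" where
  "neg_laplace \<Omega> v w = (LINT x|lebesgue_on \<Omega>. grad \<Omega> v x \<bullet> grad \<Omega> w x)"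

definition pressure_grad :: "(real^'d) set \<Rightarrow> (real^'d \<Rightarrow> real) \<Rightarrow> 'd::finite vfield \<Rightarrow> real" where
  "pressure_grad \<Omega> q v = - (LINT x|lebesgue_on \<Omega>. q x * div_field \<Omega> v x)"

definition L_adjoint :: "(real^'d) set \<Rightarrow> 'd::finite tfield \<Rightarrow> 'd vfield \<Rightarrow> real" where
  "L_adjoint \<Omega> y v = (LINT x|lebesgue_on \<Omega>. y x \<bullet> grad \<Omega> v x)"

definition div_dual :: "(real^'d) set \<Rightarrow> 'd::finite tfield \<Rightarrow> 'd vfield \<Rightarrow> real" where
  "div_dual \<Omega> y v = - L_adjoint \<Omega> y v"

definition deviator :: "real^'d^'d \<Rightarrow> real^'d::finite^'d" where
  "deviator A = A - (trace A / real CARD('d)) *\<^sub>R mat 1"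

text \<open>The space $L^2(I;X)$ of strongly measurable functions, where \<open>X\<close> is a set of functions
  with a (semi-)norm \<open>N\<close> whose kernel consists of the representatives of zero.\<close>

definition bochner_L2 ::
  "real set \<Rightarrow> ('a \<Rightarrow> 'b::real_vector) set \<Rightarrow> (('a \<Rightarrow> 'b) \<Rightarrow> real) \<Rightarrow> (real \<Rightarrow> 'a \<Rightarrow> 'b) set" where
  "bochner_L2 I X N = {g. (AE t in lebesgue_on I. g t \<in> X) \<and>
     (\<exists>s. (\<forall>n. simple_function (lebesgue_on I) (s n) \<and> s n ` I \<subseteq> X) \<and>
          (AE t in lebesgue_on I. (\<lambda>n. N (s n t - g t)) \<longlonglongrightarrow> 0)) \<and>
     integrable (lebesgue_on I) (\<lambda>t. (N (g t))\<^sup>2)}"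

abbreviation L2_V :: "real \<Rightarrow> (real^'d) set \<Rightarrow> (real \<Rightarrow> 'd::finite vfield) set" where
  "L2_V T \<Omega> \<equiv> bochner_L2 {0<..<T} (V \<Omega>) (V_norm \<Omega>)"

abbreviation L2_V_sigma :: "real \<Rightarrow> (real^'d) set \<Rightarrow> (real \<Rightarrow> 'd::finite vfield) set" where
  "L2_V_sigma T \<Omega> \<equiv> bochner_L2 {0<..<T} (V_sigma \<Omega>) (V_norm \<Omega>)"

abbreviation L2_V_dual :: "real \<Rightarrow> (real^'d) set \<Rightarrow> (real \<Rightarrow> 'd::finite vfield \<Rightarrow> real) set" where
  "L2_V_dual T \<Omega> \<equiv> bochner_L2 {0<..<T} (V_dual \<Omega>) (V_dual_norm \<Omega>)"

abbreviation L2_Y :: "real \<Rightarrow> (real^'d) set \<Rightarrow> (real \<Rightarrow> 'd::finite tfield) set" where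
  "L2_Y T \<Omega> \<equiv> bochner_L2 {0<..<T} (L2 \<Omega>) (L2_norm \<Omega>)"

abbreviation L2_mean_zero_time :: "real \<Rightarrow> (real^'d) set \<Rightarrow> (real \<Rightarrow> real^'d::finite \<Rightarrow> real) set" where
  "L2_mean_zero_time T \<Omega> \<equiv> bochner_L2 {0<..<T} (L2_mean_zero \<Omega>) (L2_norm \<Omega>)"

text \<open>Distributional time derivative in $V^*$; \<open>v t\<close> acts on \<open>V\<close> through the inner product
  of $H$, and the identity of $V^*$-valued integrals is written out on each \<open>\<xi> \<in> V \<Omega>\<close>.\<close>

definition weak_dt ::
  "real \<Rightarrow> (real^'d) set \<Rightarrow> (real \<Rightarrow> 'd::finite vfield) \<Rightarrow> (real \<Rightarrow> 'd vfield \<Rightarrow> real) \<Rightarrow> bool" where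
  "weak_dt T \<Omega> v w \<longleftrightarrow> (\<forall>\<phi>\<in>test_functions {0<..<T}. \<forall>\<xi>\<in>V \<Omega>.
     (LINT t|lebesgue_on {0<..<T}. \<phi> t * w t \<xi>) =
     - (LINT t|lebesgue_on {0<..<T}. deriv \<phi> t * (LINT x|lebesgue_on \<Omega>. v t x \<bullet> \<xi> x)))"

definition W :: "real \<Rightarrow> (real^'d) set \<Rightarrow> (real \<Rightarrow> 'd::finite vfield) set" where
  "W T \<Omega> = {v \<in> L2_V T \<Omega>. \<exists>w\<in>L2_V_dual T \<Omega>. weak_dt T \<Omega> v w}"

definition dt ::
  "real \<Rightarrow> (real^'d) set \<Rightarrow> (real \<Rightarrow> 'd::finite vfield) \<Rightarrow> real \<Rightarrow> 'd vfield \<Rightarrow> real" where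
  "dt T \<Omega> v = (SOME w. w \<in> L2_V_dual T \<Omega> \<and> weak_dt T \<Omega> v w)"

text \<open>The representative of \<open>v\<close> in $C^0([0,T];H)$; pointwise values in time refer to it.\<close>

definition cont_rep ::
  "real \<Rightarrow> (real^'d) set \<Rightarrow> (real \<Rightarrow> 'd::finite vfield) \<Rightarrow> real \<Rightarrow> 'd vfield" where
  "cont_rep T \<Omega> v = (SOME c. (\<forall>t\<in>{0..T}. c t \<in> L2 \<Omega>) \<and>
     (\<forall>t\<in>{0..T}. ((\<lambda>s. L2_norm \<Omega> (c s - c t)) \<longlongrightarrow> 0) (at t within {0..T})) \<and>
     (AE t in lebesgue_on {0<..<T}. AE x in lebesgue_on \<Omega>. c t x = v t x))"

text \<open>The identification of $L^2(I;L^2(\Omega))$ with $L^2(Q)$: \<open>Q_rep\<close> is a jointly measurable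
  function on \<open>Q\<close> with the given time slices (unique up to null sets of \<open>Q\<close>).\<close>

definition Q_rep ::
  "real \<Rightarrow> (real^'d) set \<Rightarrow> (real \<Rightarrow> 'd::finite tfield) \<Rightarrow> real \<times> (real^'d) \<Rightarrow> real^'d^'d" where
  "Q_rep T \<Omega> g = (SOME F. F \<in> borel_measurable (lebesgue_on ({0<..<T} \<times> \<Omega>)) \<and>
     (AE t in lebesgue_on {0<..<T}. AE x in lebesgue_on \<Omega>. F (t, x) = g t x))"

definition Q_norm :: "real \<Rightarrow> (real^'d) set \<Rightarrow> (real \<Rightarrow> 'd::finite tfield) \<Rightarrow> real" where
  "Q_norm T \<Omega> g = L2_norm ({0<..<T} \<times> \<Omega>) (Q_rep T \<Omega> g)"

end

theory Submission
  imports Defs "HOL-Computational_Algebra.Polynomial"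
begin

text \<open>Let $e = \lambda - u$. Subtracting the momentum equation from the constraint gives
  $\langle\partial_t e, v\rangle = -\int (y-z):\nabla v$ for all $v \in V$. Both velocities are solenoidal, hence
  $\operatorname{dev} y - \nabla\lambda = \operatorname{dev}(y-z) - \nabla e$ and
  $\int (y-z):\nabla e = \int \operatorname{dev}(y-z):\nabla e$. Expanding the square of the former and integrating
  in time leaves the term $2\int_I\langle\partial_t e, e\rangle = \|e(T)\|_H^2 - \|e(0)\|_H^2$.

  The latter identity and the embedding $\mathcal W(I) \hookrightarrow C^0(\overline I;H)$ are obtained by mollifying
  the function $(s,t) \mapsto (v(s),v(t))_H$ on the square near its diagonal: this shows that
  $\|v\|_H^2$ and, for almost every $r$, $\|v - v(r)\|_H^2$ are primitives of integrable functions.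
  Choosing good values of $r$ in short intervals yields a modulus of continuity, and completeness of $H$
  provides the values at the remaining times.\<close>

section \<open>Smooth test functions, the fundamental lemma and the lemma of du Bois-Reymond\<close>

text \<open>The weak time derivative is tested only with products phi(t) xi, xi fixed in
  \<open>V\<close>, so it determines nothing at a single time and nothing on the diagonal of the
  square, which is a null set; yet the energy identity lives on this diagonal. The way out is to
  take xi = v(s): for each s the map t -> (v(s),v(t))_H then has a scalar weak derivative, and by
  symmetry the same holds in s. A mollifier supported in s > t averages over a strip that shrinks to
  the diagonal. Replacing off-diagonal by diagonal values costs only the mean of ||v(s)-v(t)||_V^2
  over this strip, which tends to zero by strong measurability; Poincare's inequality carries this
  over to H. All integrals stay scalar in this way. A second obstacle is that \<open>grad\<close>,
  \<open>dt\<close>, \<open>cont_rep\<close> and \<open>Q_rep\<close> are choices among almost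
  everywhere equal candidates, so existence has to be supplied, as well as agreement where two
  choices meet. The pressure drops out twice: as a multiple of the identity it has no deviator, and
  it is orthogonal to the divergence of a solenoidal test function.\<close>

lemma Ck_const: "Ck k (\<lambda>x::'a::euclidean_space. c::'b::euclidean_space)"
  by (induction k arbitrary: c) (auto simp: frechet_derivative_const)

text \<open>The recursive clause of \<open>Ck\<close> speaks of \<open>frechet_derivative\<close>;
  by uniqueness of the derivative any explicit formula may take its place, which is how the
  inductive closure rules below proceed.\<close>

lemma Ck_cong_frechet:
  assumes "\<And>x. (f has_derivative f' x) (at x)" and "\<And>b. b \<in> Basis \<Longrightarrow> Ck k (\<lambda>x. f' x b)"
  shows "Ck (Suc k) f"
proof -
  have "frechet_derivative f (at x) = f' x" for x
    using frechet_derivative_at[OF assms(1)] by simp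
  then show ?thesis
    using assms by (auto simp: differentiable_def)
qed

lemma Ck_SucD:
  assumes "Ck (Suc k) f"
  shows "(f has_derivative frechet_derivative f (at x)) (at x)"
    and "b \<in> Basis \<Longrightarrow> Ck k (\<lambda>x. frechet_derivative f (at x) b)"
  using assms by (auto simp: frechet_derivative_works)

lemma Ck_Suc_imp: "Ck (Suc k) f \<Longrightarrow> Ck k f"
proof (induction k arbitrary: f)
  case 0
  then show ?case
    by (auto simp: continuous_on_eq_continuous_at differentiable_imp_continuous_within)
next
  case (Suc k)
  then show ?case by (auto simp del: Ck.simps(1))
qed

lemma Ck_add:
  "Ck k f \<Longrightarrow> Ck k g \<Longrightarrow> Ck k (\<lambda>x. f x + g x)"
proof (induction k arbitrary: f g)
  case 0
  then show ?case by (auto intro: continuous_intros)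
next
  case (Suc k)
  show ?case
    by (rule Ck_cong_frechet[OF has_derivative_add[OF Ck_SucD(1)[OF Suc.prems(1)] Ck_SucD(1)[OF Suc.prems(2)]]])
       (use Suc in \<open>auto intro: Ck_SucD\<close>)
qed

lemma Ck_scaleR_const:
  "Ck k f \<Longrightarrow> Ck k (\<lambda>x. c *\<^sub>R f x)"
proof (induction k arbitrary: f)
  case 0
  then show ?case by (auto intro: continuous_intros)
next
  case (Suc k)
  show ?case
    by (rule Ck_cong_frechet[OF has_derivative_scaleR_right[OF Ck_SucD(1)[OF Suc.prems(1)]]])
       (use Suc in \<open>auto intro: Ck_SucD\<close>)
qed

lemma Ck_diff:
  "Ck k f \<Longrightarrow> Ck k g \<Longrightarrow> Ck k (\<lambda>x. f x - g x)"
  using Ck_add[of k f "\<lambda>x. (-1) *\<^sub>R g x"] Ck_scaleR_const[of k g "-1"] by simp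

lemma Ck_mult:
  fixes f g :: "'a::euclidean_space \<Rightarrow> real"
  shows "Ck k f \<Longrightarrow> Ck k g \<Longrightarrow> Ck k (\<lambda>x. f x * g x)"
proof (induction k arbitrary: f g)
  case 0
  then show ?case by (auto intro: continuous_intros)
next
  case (Suc k)
  show ?case
    by (rule Ck_cong_frechet[OF has_derivative_mult[OF Ck_SucD(1)[OF Suc.prems(1)] Ck_SucD(1)[OF Suc.prems(2)]]])
       (use Suc in \<open>auto intro!: Ck_add intro: Ck_SucD Ck_Suc_imp simp del: Ck.simps\<close>)
qed

lemma Ck_prod:
  fixes f :: "'i \<Rightarrow> 'a::euclidean_space \<Rightarrow> real"
  assumes "finite I" "\<And>i. i \<in> I \<Longrightarrow> Ck k (f i)"
  shows "Ck k (\<lambda>x. \<Prod>i\<in>I. f i x)"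
  using assms by (induction I rule: finite_induct) (auto intro: Ck_const Ck_mult)

text \<open>The derivative in direction b is the constant \<open>l b\<close> times the composition
  of the derivative of f with the same affine map, so the induction closes if f is kept
  arbitrary.\<close>

lemma Ck_compose_affine:
  fixes f :: "real \<Rightarrow> real" and l :: "'a::euclidean_space \<Rightarrow> real"
  assumes l: "bounded_linear l"
  shows "Ck k f \<Longrightarrow> Ck k (\<lambda>x. f (l x + c))"
proof (induction k arbitrary: f)
  case 0
  have "continuous_on UNIV (\<lambda>x. l x + c)"
    by (intro continuous_intros linear_continuous_on l)
  with 0 show ?case
    using continuous_on_compose2[of UNIV f UNIV "\<lambda>x. l x + c"] by auto
next
  case (Suc k)
  have *: "((\<lambda>x. f (l x + c)) has_derivative (\<lambda>b. l b *\<^sub>R frechet_derivative f (at (l x + c)) 1)) (at x)" for x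
  proof -
    have 1: "((\<lambda>x. l x + c) has_derivative l) (at x)"
      using has_derivative_add_const[OF bounded_linear_imp_has_derivative[OF l]] .
    have 2: "bounded_linear (frechet_derivative f (at (l x + c)))"
      using Ck_SucD(1)[OF Suc.prems] has_derivative_bounded_linear by blast
    have "((\<lambda>x. f (l x + c)) has_derivative (\<lambda>b. frechet_derivative f (at (l x + c)) (l b))) (at x)"
      using has_derivative_compose[OF 1 Ck_SucD(1)[OF Suc.prems, of "l x + c"]] .
    moreover have "frechet_derivative f (at (l x + c)) (l b) = l b *\<^sub>R frechet_derivative f (at (l x + c)) 1" for b
      using linear_scale[OF bounded_linear.linear[OF 2], of "l b" 1] by simp
    ultimately show ?thesis by simp
  qed
  have "Ck k (\<lambda>x. frechet_derivative f (at x) 1)"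
    using Ck_SucD(2)[OF Suc.prems, of 1] by simp
  from Suc.IH[OF this] show ?case
    by (intro Ck_cong_frechet[OF *] Ck_scaleR_const)
qed

section \<open>Smooth cutoff functions built from exp(-1/s)\<close>

definition flat_exp :: "real poly \<Rightarrow> real \<Rightarrow> real" where
  "flat_exp p s = (if s > 0 then poly p (1/s) * exp (- (1/s)) else 0)"

lemma poly_exp_tendsto: "((\<lambda>y::real. poly p y * exp (- y)) \<longlongrightarrow> 0) at_top"
proof -
  have "((\<lambda>y. \<Sum>i\<le>degree p. coeff p i * (y ^ i / exp y)) \<longlongrightarrow> (\<Sum>i\<le>degree p. coeff p i * 0)) at_top"
    by (intro tendsto_intros tendsto_power_div_exp_0)
  then show ?thesis
    by (simp add: poly_altdef exp_minus divide_inverse sum_distrib_right mult.assoc)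
qed

text \<open>With q = 1/s the derivative of p(q) exp(-q) is q^2 (p(q) - p'(q)) exp(-q). The family is
  thus closed under differentiation, and smoothness of every order follows by one induction over all
  p; \<open>[:0,0,1:]\<close> is the square of the indeterminate.\<close>

lemma flat_exp_has_derivative:
  "(flat_exp p has_real_derivative flat_exp ([:0,0,1:] * (p - pderiv p)) s) (at s)"
proof -
  consider "s > 0" | "s < 0" | "s = 0" by linarith
  then show ?thesis
  proof cases
    case 1
    have "((\<lambda>s. poly p (1/s) * exp (- (1/s))) has_real_derivative flat_exp ([:0,0,1:] * (p - pderiv p)) s) (at s)"
      using 1 unfolding flat_exp_def
      by (auto intro!: derivative_eq_intros DERIV_chain2[OF poly_DERIV] simp: field_simps power2_eq_square)
    then show ?thesis
      by (rule has_field_derivative_transform_within_open[of _ _ _ "{0<..}"])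
         (use 1 in \<open>auto simp: flat_exp_def\<close>)
  next
    case 2
    have "((\<lambda>s. 0) has_real_derivative flat_exp ([:0,0,1:] * (p - pderiv p)) s) (at s)"
      using 2 unfolding flat_exp_def by auto
    then show ?thesis
      by (rule has_field_derivative_transform_within_open[of _ _ _ "{..<0}"])
         (use 2 in \<open>auto simp: flat_exp_def\<close>)
  next
    case 3
    \<comment> \<open>The right difference quotient at 0 is p(1/h) exp(-1/h) / h; the division by h
      is absorbed by raising the polynomial to \<open>pCons 0 p\<close>.\<close>
    have "((\<lambda>h. poly (pCons 0 p) (inverse h) * exp (- inverse h)) \<longlongrightarrow> 0) (at_right 0)"
      by (rule filterlim_compose[OF poly_exp_tendsto filterlim_inverse_at_top_right])
    then have r: "((\<lambda>h. flat_exp p h / h) \<longlongrightarrow> 0) (at_right 0)"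
      by (rule Lim_transform_eventually)
         (auto simp: flat_exp_def eventually_at_filter field_simps)
    have "((\<lambda>h. flat_exp p h / h) \<longlongrightarrow> 0) (at_left 0)"
      by (rule Lim_transform_eventually[OF tendsto_const])
         (auto simp: flat_exp_def eventually_at_filter)
    with r have "((\<lambda>h. flat_exp p h / h) \<longlongrightarrow> 0) (at 0)"
      using filterlim_split_at by blast
    then show ?thesis
      unfolding 3 has_field_derivative_iff by (simp add: flat_exp_def)
  qed
qed

lemma Ck_real_deriv:
  fixes f :: "real \<Rightarrow> real"
  assumes "\<And>x. (f has_real_derivative f' x) (at x)" "Ck k f'"
  shows "Ck (Suc k) f"
  by (rule Ck_cong_frechet[where f' = "\<lambda>x. (*) (f' x)"])
     (use assms in \<open>auto simp: has_field_derivative_def\<close>)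

lemma Ck_flat_exp: "Ck k (flat_exp p)"
proof (induction k arbitrary: p)
  case 0
  then show ?case
    using DERIV_isCont[OF flat_exp_has_derivative] by (simp add: continuous_on_eq_continuous_at)
next
  case (Suc k)
  show ?case
    by (rule Ck_real_deriv[OF flat_exp_has_derivative Suc.IH])
qed

lemma test_functions_CkD: "\<phi> \<in> test_functions S \<Longrightarrow> Ck k \<phi>"
  by (simp add: test_functions_def)

lemma test_functions_continuous: "\<phi> \<in> test_functions S \<Longrightarrow> continuous_on UNIV \<phi>"
  using test_functions_CkD[of \<phi> S 0] by simp

lemma test_functions_has_derivative:
  "\<phi> \<in> test_functions S \<Longrightarrow> (\<phi> has_derivative frechet_derivative \<phi> (at x)) (at x)"
  using test_functions_CkD[of \<phi> S 1] by (auto simp: frechet_derivative_works)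

lemma test_functions_supp: 
  assumes "\<phi> \<in> test_functions S" 
  obtains K where "compact K" "K \<subseteq> S" "\<And>x. x \<notin> K \<Longrightarrow> \<phi> x = 0"
  using assms by (auto simp: test_functions_def)

lemma frechet_derivative_outside_support:
  assumes "compact K" "\<And>x. x \<notin> K \<Longrightarrow> \<phi> x = 0" "x \<notin> K"
  shows "frechet_derivative \<phi> (at x) = (\<lambda>h. 0)"
proof -
  have "open (- K)" using assms(1) by (simp add: compact_imp_closed open_Compl)
  then have "(\<phi> has_derivative (\<lambda>h. 0)) (at x)"
    by (rule has_derivative_transform_within_open[OF has_derivative_const[of 0]]) (use assms in auto)
  then show ?thesis using frechet_derivative_at by metis
qed

lemma test_functions_deriv:
  assumes "\<phi> \<in> test_functions S" "b \<in> Basis"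
  shows "(\<lambda>x. frechet_derivative \<phi> (at x) b) \<in> test_functions S"
proof -
  obtain K where K: "compact K" "K \<subseteq> S" "\<And>x. x \<notin> K \<Longrightarrow> \<phi> x = 0"
    using test_functions_supp[OF assms(1)] by blast
  have "frechet_derivative \<phi> (at x) b = 0" if "x \<notin> K" for x
    using frechet_derivative_outside_support[OF K(1,3) that] by simp
  moreover have "Ck k (\<lambda>x. frechet_derivative \<phi> (at x) b)" for k
    using Ck_SucD(2)[OF test_functions_CkD[OF assms(1), of "Suc k"] assms(2)] .
  ultimately show ?thesis
    using K(1,2) by (auto simp: test_functions_def)
qed

lemma test_functions_diff:
  assumes "\<phi> \<in> test_functions S" "\<psi> \<in> test_functions S"
  shows "(\<lambda>x. \<phi> x - \<psi> x) \<in> test_functions S"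
proof -
  obtain K where K: "compact K" "K \<subseteq> S" "\<And>x. x \<notin> K \<Longrightarrow> \<phi> x = 0"
    using test_functions_supp[OF assms(1)] by blast
  obtain K' where K': "compact K'" "K' \<subseteq> S" "\<And>x. x \<notin> K' \<Longrightarrow> \<psi> x = 0"
    using test_functions_supp[OF assms(2)] by blast
  have "\<phi> x - \<psi> x = 0" if "x \<notin> K \<union> K'" for x
    using that K(3)[of x] K'(3)[of x] by simp
  with K(1,2) K'(1,2) have "\<exists>L. compact L \<and> L \<subseteq> S \<and> (\<forall>x. x \<notin> L \<longrightarrow> \<phi> x - \<psi> x = 0)"
    by (intro exI[of _ "K \<union> K'"]) auto
  then show ?thesis
    unfolding test_functions_def
    using assms by (simp add: test_functions_CkD Ck_diff)
qed

lemma test_functions_scaleR: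
  assumes "\<phi> \<in> test_functions S"
  shows "(\<lambda>x. c *\<^sub>R \<phi> x) \<in> test_functions S"
proof -
  obtain K where K: "compact K" "K \<subseteq> S" "\<And>x. x \<notin> K \<Longrightarrow> \<phi> x = 0"
    using test_functions_supp[OF assms(1)] by blast
  show ?thesis
    unfolding test_functions_def
    using assms K by (auto simp: test_functions_CkD intro!: Ck_scaleR_const exI[of _ K])
qed

lemma test_functions_bounded:
  assumes "\<phi> \<in> test_functions S"
  obtains M where "M > 0" "\<And>x. norm (\<phi> x) \<le> M"
proof -
  obtain K where K: "compact K" "K \<subseteq> S" "\<And>x. x \<notin> K \<Longrightarrow> \<phi> x = 0"
    using test_functions_supp[OF assms] by blast
  have "compact (\<phi> ` K)"
    by (rule compact_continuous_image[OF continuous_on_subset[OF test_functions_continuous[OF assms]] K(1)]) auto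
  then obtain M where M: "\<And>x. x \<in> K \<Longrightarrow> norm (\<phi> x) \<le> M"
    by (meson compact_imp_bounded bounded_iff imageI)
  show ?thesis
  proof (rule that[of "max M 1"])
    show "norm (\<phi> x) \<le> max M 1" for x
      using M[of x] K(3)[of x] by (cases "x \<in> K") auto
  qed auto
qed

lemma test_functions_measurable:
  "\<phi> \<in> test_functions S \<Longrightarrow> \<phi> \<in> borel_measurable borel"
  using borel_measurable_continuous_onI[OF test_functions_continuous] .

lemma flat_exp_1_bounds: "0 \<le> flat_exp 1 s" "flat_exp 1 s \<le> 1" "s \<le> 0 \<Longrightarrow> flat_exp 1 s = 0"
  by (auto simp: flat_exp_def)

lemma flat_exp_1_tendsto:
  assumes "s > 0" shows "(\<lambda>k. flat_exp 1 (real (Suc k) * s)) \<longlonglongrightarrow> 1"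
proof -
  have "(\<lambda>k. exp (- (1 / s * inverse (real (Suc k))))) \<longlonglongrightarrow> exp (- (1 / s * 0))"
    by (intro tendsto_intros LIMSEQ_inverse_real_of_nat)
  moreover have "flat_exp 1 (real (Suc k) * s) = exp (- (1 / s * inverse (real (Suc k))))" for k
    using assms by (simp add: flat_exp_def field_simps zero_less_mult_iff del: of_nat_Suc)
  ultimately show ?thesis by simp
qed

text \<open>For s > 0 the value \<open>flat_exp 1 (real (Suc k) * s)\<close> tends to 1, so growing
  k makes the bumps converge to the indicator of the open box. \<open>Suc k\<close> keeps the
  scaling positive, and already k = 0 gives a usable bump.\<close>

definition box_bump :: "'a::euclidean_space \<Rightarrow> 'a \<Rightarrow> nat \<Rightarrow> 'a \<Rightarrow> real" where
  "box_bump a b k x = (\<Prod>i\<in>Basis. flat_exp 1 (real (Suc k) * ((x - a) \<bullet> i)) * flat_exp 1 (real (Suc k) * ((b - x) \<bullet> i)))"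

lemma box_bump_bounds: "0 \<le> box_bump a b k x" "box_bump a b k x \<le> 1"
  unfolding box_bump_def
  by (auto intro!: prod_nonneg prod_le_1 mult_le_one flat_exp_1_bounds mult_nonneg_nonneg)

lemma box_bump_outside: "x \<notin> box a b \<Longrightarrow> box_bump a b k x = 0"
proof -
  assume "x \<notin> box a b"
  then obtain i where i: "i \<in> Basis" "\<not> (a \<bullet> i < x \<bullet> i \<and> x \<bullet> i < b \<bullet> i)"
    by (auto simp: box_def)
  then have "real (Suc k) * ((x - a) \<bullet> i) \<le> 0 \<or> real (Suc k) * ((b - x) \<bullet> i) \<le> 0"
    by (auto simp: inner_diff_left mult_le_0_iff)
  then have "flat_exp 1 (real (Suc k) * ((x - a) \<bullet> i)) * flat_exp 1 (real (Suc k) * ((b - x) \<bullet> i)) = 0"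
    using flat_exp_1_bounds(3) by fastforce
  then show ?thesis
    unfolding box_bump_def using i(1) by (metis (no_types, lifting) finite_Basis prod_zero)
qed

lemma box_bump_tendsto: "(\<lambda>k. box_bump a b k x) \<longlonglongrightarrow> indicator (box a b) x"
proof (cases "x \<in> box a b")
  case True
  have "(\<lambda>k. box_bump a b k x) \<longlonglongrightarrow> (\<Prod>i\<in>(Basis::'a set). 1 * 1)"
    unfolding box_bump_def
    by (intro tendsto_prod tendsto_mult flat_exp_1_tendsto)
       (use True in \<open>auto simp: box_def inner_diff_left\<close>)
  then show ?thesis using True by simp
qed (simp add: box_bump_outside)

lemma box_bump_test:
  assumes "cbox a b \<subseteq> S"
  shows "box_bump a b k \<in> test_functions S"
proof -
  have "Ck m (box_bump a b k)" for m
  proof -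
    have 1: "Ck m (\<lambda>x. flat_exp 1 (real (Suc k) * ((x - a) \<bullet> i)))" for i :: 'a
    proof -
      have "bounded_linear (\<lambda>x::'a. real (Suc k) * (x \<bullet> i))"
        by (intro bounded_linear_intros)
      from Ck_compose_affine[OF this Ck_flat_exp, of m 1 "- (real (Suc k) * (a \<bullet> i))"]
      show ?thesis by (simp add: inner_diff_left algebra_simps)
    qed
    have 2: "Ck m (\<lambda>x. flat_exp 1 (real (Suc k) * ((b - x) \<bullet> i)))" for i :: 'a
    proof -
      have "bounded_linear (\<lambda>x::'a. - (real (Suc k) * (x \<bullet> i)))"
        by (intro bounded_linear_minus bounded_linear_intros)
      from Ck_compose_affine[OF this Ck_flat_exp, of m 1 "real (Suc k) * (b \<bullet> i)"]
      show ?thesis by (simp add: inner_diff_left algebra_simps)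
    qed
    show ?thesis
      unfolding box_bump_def by (intro Ck_prod Ck_mult 1 2) auto
  qed
  then show ?thesis
    unfolding test_functions_def
    using assms box_bump_outside[of _ a b k] box_subset_cbox[of a b]
    by (auto intro!: exI[of _ "cbox a b"])
qed

text \<open>Dominated convergence along \<open>box_bump\<close> gives a vanishing integral of g over
  every box inside S. Lebesgue differentiation with cubes that have x as a corner then forces g x =
  0 for almost every x in S.\<close>

theorem fundamental_lemma:
  fixes g :: "'a::euclidean_space \<Rightarrow> real"
  assumes "open S" and g: "integrable lebesgue g"
    and test: "\<And>\<phi>. \<phi> \<in> test_functions S \<Longrightarrow> (LINT x|lebesgue. g x * \<phi> x) = 0"
  shows "AE x in lebesgue. x \<in> S \<longrightarrow> g x = 0"
proof -
  have meas[measurable]: "g \<in> borel_measurable lebesgue" using g by auto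
  have box0: "integral (cbox a b) g = 0" if "cbox a b \<subseteq> S" for a b
  proof -
    have "(\<lambda>k. LINT x|lebesgue. g x * box_bump a b k x) \<longlonglongrightarrow> (LINT x|lebesgue. g x * indicator (box a b) x)"
    proof (rule integral_dominated_convergence[where w = "\<lambda>x. \<bar>g x\<bar>"])
      show "AE x in lebesgue. (\<lambda>k. g x * box_bump a b k x) \<longlonglongrightarrow> g x * indicator (box a b) x"
        by (intro AE_I2 tendsto_intros box_bump_tendsto)
      show "AE x in lebesgue. norm (g x * box_bump a b k x) \<le> \<bar>g x\<bar>" for k
        using box_bump_bounds[of a b k] by (auto simp: abs_mult intro!: AE_I2 mult_left_le)
      show "(\<lambda>x. g x * box_bump a b k x) \<in> borel_measurable lebesgue" for k
        using test_functions_measurable[OF box_bump_test[OF that, of k]]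
        by (intro borel_measurable_times meas measurable_completion) simp
      show "(\<lambda>x. g x * indicat_real (box a b) x) \<in> borel_measurable lebesgue"
        by (intro borel_measurable_times meas borel_measurable_indicator) simp
    qed (use g in auto)
    moreover have "(LINT x|lebesgue. g x * box_bump a b k x) = 0" for k
      by (rule test[OF box_bump_test[OF that]])
    ultimately have "(LINT x|lebesgue. g x * indicator (box a b) x) = 0"
      by (simp add: LIMSEQ_const_iff)
    moreover have "set_integrable lebesgue (box a b) g"
      unfolding set_integrable_def using integrable_mult_indicator[OF _ g, of "box a b"] by simp
    ultimately have "integral (box a b) g = 0"
      using set_lebesgue_integral_eq_integral(2)[of "box a b" g]
      by (simp add: set_lebesgue_integral_def mult.commute)
    then show ?thesis by (simp add: integral_open_interval)
  qed
  have "g integrable_on cbox a b" for a b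
  proof -
    have "set_integrable lebesgue (cbox a b) g"
      unfolding set_integrable_def using integrable_mult_indicator[OF _ g, of "cbox a b"] by simp
    then show ?thesis by (rule set_lebesgue_integral_eq_integral(1))
  qed
  then obtain N where N: "negligible N"
    "\<And>x e. x \<notin> N \<Longrightarrow> 0 < e \<Longrightarrow> \<exists>d>0. \<forall>h. 0 < h \<and> h < d \<longrightarrow> 
        norm(integral (cbox x (x + h *\<^sub>R One)) g /\<^sub>R h ^ DIM('a) - g x) < e"
    using integrable_ccontinuous_explicit[of g] by metis
  have "g x = 0" if xS: "x \<in> S" and xN: "x \<notin> N" for x
  proof (rule ccontr)
    assume "g x \<noteq> 0"
    then obtain d where d: "d > 0" "\<And>h. 0 < h \<Longrightarrow> h < d \<Longrightarrow> 
        norm(integral (cbox x (x + h *\<^sub>R One)) g /\<^sub>R h ^ DIM('a) - g x) < norm (g x)"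
      using N(2)[OF xN, of "norm (g x)"] by auto
    obtain r where r: "r > 0" "ball x r \<subseteq> S"
      using \<open>open S\<close> xS openE by blast
    \<comment> \<open>The cube with corner x and side h has diameter h times
      \<open>norm One\<close>; the bound by r keeps it inside the ball, and the summand 1 gives a
      strict inequality.\<close>
    define h where "h = min (d/2) (r / (2 * (1 + norm (One::'a))))"
    have "r / (2 * (1 + norm (One::'a))) > 0"
      using r(1) by (intro divide_pos_pos mult_pos_pos add_pos_nonneg) auto
    then have h: "h > 0" "h < d" unfolding h_def using d(1) by (auto simp: min_less_iff_disj)
    have "h * norm (One::'a) < r"
    proof -
      have "h * norm (One::'a) \<le> r / (2 * (1 + norm (One::'a))) * norm (One::'a)"
        unfolding h_def by (intro mult_right_mono) auto
      also have "\<dots> < r" using r(1) by (simp add: field_simps add_pos_nonneg)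
      finally show ?thesis .
    qed
    have "cbox x (x + h *\<^sub>R One) \<subseteq> ball x r"
    proof
      fix y assume y: "y \<in> cbox x (x + h *\<^sub>R One)"
      have "norm (y - x) \<le> norm (h *\<^sub>R (One::'a))"
        by (rule norm_le_componentwise)
           (use y h in \<open>auto simp: cbox_def inner_diff_left inner_add_left algebra_simps\<close>)
      then show "y \<in> ball x r"
        using \<open>h * norm One < r\<close> h by (simp add: dist_norm norm_minus_commute)
    qed
    then have "integral (cbox x (x + h *\<^sub>R One)) g = 0"
      using box0 r(2) by blast
    with d(2)[OF h] show False by simp
  qed
  moreover have "AE x in lebesgue. x \<notin> N"
    using N(1) by (simp add: AE_not_in negligible_iff_null_sets)
  ultimately show ?thesis by auto
qed

section \<open>Primitives on the real line and weak derivatives\<close>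

lemma integrable_pair_mult:
  fixes f :: "'a::euclidean_space \<Rightarrow> real" and g :: "'b::euclidean_space \<Rightarrow> real"
  assumes "integrable lborel f" "integrable lborel g"
  shows "integrable (lborel \<Otimes>\<^sub>M lborel) (\<lambda>(x,y). f x * g y)"
proof (rule lborel_pair.Fubini_integrable)
  show "integrable lborel (\<lambda>x. LINT y|lborel. norm (case (x, y) of (x, y) \<Rightarrow> f x * g y))"
    using assms by (simp add: abs_mult)
qed (use assms in auto)

lemma test_functions_deriv_real:
  fixes \<phi> :: "real \<Rightarrow> real"
  assumes "\<phi> \<in> test_functions S"
  shows "(\<phi> has_real_derivative deriv \<phi> x) (at x)" "deriv \<phi> \<in> test_functions S"
proof -
  have d: "(\<phi> has_real_derivative deriv \<phi> x) (at x)" for x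
    using test_functions_has_derivative[OF assms, of x]
    by (metis DERIV_deriv_iff_real_differentiable differentiable_def)
  then have "frechet_derivative \<phi> (at x) 1 = deriv \<phi> x" for x
    using frechet_derivative_at[of \<phi> "(*) (deriv \<phi> x)" x]
    by (metis has_field_derivative_def mult_1_right)
  then show "deriv \<phi> \<in> test_functions S"
    using test_functions_deriv[OF assms, of 1] by simp
  show "(\<phi> has_real_derivative deriv \<phi> x) (at x)" by (rule d)
qed

lemma test_functions_integrable:
  fixes \<phi> :: "'a::euclidean_space \<Rightarrow> real"
  assumes "\<phi> \<in> test_functions S"
  shows "integrable lborel \<phi>"
proof -
  obtain K where K: "compact K" "K \<subseteq> S" "\<And>x. x \<notin> K \<Longrightarrow> \<phi> x = 0"
    using test_functions_supp[OF assms] by blast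
  have "integrable lborel (\<lambda>x. indicator K x *\<^sub>R \<phi> x)"
    by (rule borel_integrable_compact[OF K(1)])
       (rule continuous_on_subset[OF test_functions_continuous[OF assms]], simp)
  moreover have "(\<lambda>x. indicator K x *\<^sub>R \<phi> x) = \<phi>"
    using K(3) by (auto simp: fun_eq_iff indicator_def)
  ultimately show ?thesis by simp
qed

definition prim :: "(real \<Rightarrow> real) \<Rightarrow> real \<Rightarrow> real" where
  "prim b t = (LINT s|lborel. indicator {..t} s * b s)"

lemma integrable_indicator_mult:
  fixes b :: "'a \<Rightarrow> real"
  assumes "integrable M b" "A \<in> sets M"
  shows "integrable M (\<lambda>s. indicator A s * b s)"
  using integrable_mult_indicator[OF assms(2,1)] by simp

lemma prim_diff:
  assumes "integrable lborel b" "s \<le> t"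
  shows "prim b t - prim b s = (LINT \<tau>|lborel. indicator {s<..t} \<tau> * b \<tau>)"
proof -
  have "prim b t - prim b s = (LINT \<tau>|lborel. indicator {..t} \<tau> * b \<tau> - indicator {..s} \<tau> * b \<tau>)"
    unfolding prim_def
    by (rule Bochner_Integration.integral_diff[symmetric]) (auto intro: integrable_indicator_mult assms)
  also have "\<dots> = (LINT \<tau>|lborel. indicator {s<..t} \<tau> * b \<tau>)"
    by (rule Bochner_Integration.integral_cong) (use assms(2) in \<open>auto simp: indicator_def\<close>)
  finally show ?thesis .
qed

lemma prim_abs_le: 
  assumes "integrable lborel b"
  shows "\<bar>prim b t\<bar> \<le> (LINT s|lborel. \<bar>b s\<bar>)"
proof -
  have "\<bar>prim b t\<bar> \<le> (LINT s|lborel. \<bar>indicator {..t} s * b s\<bar>)"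
    unfolding prim_def by (rule integral_abs_bound)
  also have "\<dots> \<le> (LINT s|lborel. \<bar>b s\<bar>)"
    by (intro integral_mono integrable_abs integrable_indicator_mult assms)
       (auto simp: indicator_def)
  finally show ?thesis .
qed

text \<open>Along a sequence tending to t0 the indicators of the half lines converge at every point
  but t0, and the absolute value of b dominates.\<close>

lemma continuous_prim:
  assumes b: "integrable lborel b"
  shows "continuous_on UNIV (prim b)"
proof -
  have "isCont (prim b) t0" for t0
  proof (rule continuous_at_sequentiallyI)
    fix u :: "nat \<Rightarrow> real" assume u: "u \<longlonglongrightarrow> t0"
    show "(\<lambda>n. prim b (u n)) \<longlonglongrightarrow> prim b t0"
      unfolding prim_def
    proof (rule integral_dominated_convergence[where w = "\<lambda>s. \<bar>b s\<bar>"])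
      have "(\<lambda>n. indicator {..u n} s * b s) \<longlonglongrightarrow> indicator {..t0} s * b s" if "s \<noteq> t0" for s
      proof -
        have "\<forall>\<^sub>F n in sequentially. indicator {..u n} s * b s = indicator {..t0} s * b s"
        proof (cases "s < t0")
          case True
          show ?thesis using order_tendstoD(1)[OF u True] 
            by eventually_elim (use True in auto)
        next
          case False
          with that have "t0 < s" by simp
          show ?thesis using order_tendstoD(2)[OF u \<open>t0 < s\<close>] 
            by eventually_elim (use \<open>t0 < s\<close> in auto)
        qed
        then show ?thesis by (rule tendsto_eventually)
      qed
      moreover have "AE s in lborel. s \<noteq> t0" by (rule AE_lborel_singleton)
      ultimately show "AE s in lborel. (\<lambda>n. indicator {..u n} s * b s) \<longlonglongrightarrow> indicator {..t0} s * b s"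
        by auto
    qed (use b in \<open>auto simp: indicator_def\<close>)
  qed
  then show ?thesis by (simp add: continuous_on_eq_continuous_at)
qed

lemma test_function_tail_integral:
  fixes \<phi> :: "real \<Rightarrow> real"
  assumes "\<phi> \<in> test_functions S" "bounded S"
  shows "(LINT t|lborel. indicator {s..} t * deriv \<phi> t) = - \<phi> s"
proof -
  obtain K where K: "compact K" "K \<subseteq> S" "\<And>x. x \<notin> K \<Longrightarrow> \<phi> x = 0"
    using test_functions_supp[OF assms(1)] by blast
  obtain R where R: "\<And>x. x \<in> S \<Longrightarrow> \<bar>x\<bar> \<le> R"
    using assms(2) by (auto simp: bounded_iff)
  \<comment> \<open>A point not left of s and strictly beyond the bounded set S, where the test
    function and its derivative vanish; the half line may be cut off there.\<close>
  define U where "U = max s (R + 1)"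
  have out: "\<phi> t = 0" "deriv \<phi> t = 0" if "t \<ge> R + 1" for t
  proof -
    have "t \<notin> K" using that R K(2) by force
    then show "\<phi> t = 0" by (rule K)
    have "deriv \<phi> t = frechet_derivative \<phi> (at t) 1"
      using frechet_derivative_at[of \<phi> "(*) (deriv \<phi> t)" t] test_functions_deriv_real(1)[OF assms(1), of t]
      by (metis has_field_derivative_def mult_1_right)
    then show "deriv \<phi> t = 0"
      using frechet_derivative_outside_support[OF K(1,3) \<open>t \<notin> K\<close>] by simp
  qed
  have "(LINT t|lborel. indicator {s..} t * deriv \<phi> t) = (LINT t|lborel. deriv \<phi> t * indicator {s..U} t)"
    by (rule Bochner_Integration.integral_cong)
       (use out in \<open>auto simp: indicator_def U_def max_def not_le split: if_splits\<close>)
  also have "\<dots> = \<phi> U - \<phi> s"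
    by (rule integral_FTC_Icc_real)
       (auto simp: U_def test_functions_deriv_real(1)[OF assms(1)]
         continuous_on_eq_continuous_at[of UNIV, simplified, THEN iffD1, OF test_functions_continuous[OF test_functions_deriv_real(2)[OF assms(1)]]])
  also have "\<phi> U = 0" using out(1)[of U] by (simp add: U_def)
  finally show ?thesis by simp
qed

text \<open>Fubini on the half plane s \<le> t: read as a condition on t, the indicator leaves the
  tail integral of the derivative of the test function, which is minus its value at s.\<close>

lemma weak_derivative_prim:
  assumes b: "integrable lborel b" and phi: "\<phi> \<in> test_functions S" "bounded S"
  shows "(LINT t|lborel. deriv \<phi> t * prim b t) = - (LINT s|lborel. \<phi> s * b s)"
proof -
  have d: "integrable lborel (deriv \<phi>)"
    by (rule test_functions_integrable[OF test_functions_deriv_real(2)[OF phi(1)]])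
  have int: "integrable (lborel \<Otimes>\<^sub>M lborel) (\<lambda>(s, t). indicator {s..} t * (b s * deriv \<phi> t))"
    by (rule Bochner_Integration.integrable_bound[OF integrable_pair_mult[OF b d]])
       (use b d in \<open>auto simp: indicator_def split: if_splits\<close>)
  have "(LINT t|lborel. deriv \<phi> t * prim b t) = (LINT t|lborel. LINT s|lborel. indicator {s..} t * (b s * deriv \<phi> t))"
    unfolding prim_def
    by (rule Bochner_Integration.integral_cong)
       (auto simp: integral_mult_right_zero[symmetric] indicator_def intro!: Bochner_Integration.integral_cong simp del: integral_mult_right_zero)
  also have "\<dots> = (LINT s|lborel. LINT t|lborel. indicator {s..} t * (b s * deriv \<phi> t))"
    by (rule lborel_pair.Fubini_integral[OF int])
  also have "\<dots> = (LINT s|lborel. b s * (LINT t|lborel. indicator {s..} t * deriv \<phi> t))"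
    by (rule Bochner_Integration.integral_cong)
       (auto simp: integral_mult_right_zero[symmetric] mult_ac simp del: integral_mult_right_zero)
  also have "\<dots> = (LINT s|lborel. b s * (- \<phi> s))"
    using test_function_tail_integral[OF phi] by simp
  also have "\<dots> = - (LINT s|lborel. \<phi> s * b s)" by (simp add: mult.commute)
  finally show ?thesis .
qed

text \<open>The primitive vanishes left of the support in any case; the vanishing mean makes it
  vanish to the right as well, so it has compact support again.\<close>

lemma test_functions_prim:
  fixes h :: "real \<Rightarrow> real"
  assumes h: "h \<in> test_functions {0<..<T}" and int0: "(LINT s|lborel. h s) = 0"
  shows "prim h \<in> test_functions {0<..<T}" "deriv (prim h) = h"
proof -
  obtain K where K: "compact K" "K \<subseteq> {0<..<T}" "\<And>x. x \<notin> K \<Longrightarrow> h x = 0"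
    using test_functions_supp[OF h] by blast
  obtain a b where ab: "\<And>x. x \<in> K \<Longrightarrow> a \<le> x \<and> x \<le> b" "{a..b} \<subseteq> {0<..<T}"
  proof (cases "K = {}")
    case True
    then show ?thesis using that[of 1 0] by auto
  next
    case False
    obtain a b where "a \<in> K" "b \<in> K" "\<And>x. x \<in> K \<Longrightarrow> a \<le> x" "\<And>x. x \<in> K \<Longrightarrow> x \<le> b"
      using compact_attains_inf[OF K(1) False] compact_attains_sup[OF K(1) False] by blast
    moreover have "{a..b} \<subseteq> {0<..<T}" using \<open>a \<in> K\<close> \<open>b \<in> K\<close> K(2) by fastforce
    ultimately show ?thesis using that[of a b] by blast
  qed
  have hi: "integrable lborel h" by (rule test_functions_integrable[OF h])
  have cont: "continuous_on S h" for S
    by (rule continuous_on_subset[OF test_functions_continuous[OF h]]) simp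
  have left: "prim h t = 0" if "t < a" for t
  proof -
    have "indicator {..t} s * h s = 0" for s
      using that ab(1)[of s] K(3)[of s] by (cases "s \<in> K") (auto simp: indicator_def)
    then have "(\<lambda>s. indicator {..t} s * h s) = (\<lambda>s. 0)" by blast
    then show ?thesis unfolding prim_def by simp
  qed
  have right: "prim h t = 0" if "t > b" for t
  proof -
    have "indicator {..t} s * h s = h s" for s
      using that ab(1)[of s] K(3)[of s] by (cases "s \<in> K") (auto simp: indicator_def)
    then have "(\<lambda>s. indicator {..t} s * h s) = h" by blast
    then show ?thesis unfolding prim_def by (simp add: int0)
  qed
  have der: "(prim h has_real_derivative h t) (at t)" for t
  proof -
    \<comment> \<open>A lower limit left of both t and the support of h: the primitive vanishes
      there, so near t it is an ordinary integral with fixed lower limit.\<close>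
    define A where "A = min t a - 1"
    have eq: "prim h x = integral {A..x} h" if "x \<in> {A<..<t+1}" for x
    proof -
      have "prim h A = 0" by (rule left) (auto simp: A_def)
      then have "prim h x = (LINT s|lborel. indicator {A<..x} s * h s)"
        using prim_diff[OF hi, of A x] that by simp
      also have "\<dots> = (LINT s|lborel. indicator {A..x} s * h s)"
        using AE_lborel_singleton[of A]
        by (intro integral_cong_AE) (use test_functions_measurable[OF h] in \<open>auto simp: indicator_def\<close>)
      also have "\<dots> = integral {A..x} h"
        using set_borel_integral_eq_integral(2)[of "{A..x}" h] integrable_indicator_mult[OF hi, of "{A..x}"]
        by (simp add: set_lebesgue_integral_def set_integrable_def)
      finally show ?thesis .
    qed
    have "((\<lambda>x. integral {A..x} h) has_real_derivative h t) (at t within {A..t+1})"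
      by (rule integral_has_real_derivative[OF cont]) (auto simp: A_def)
    then have "((\<lambda>x. integral {A..x} h) has_real_derivative h t) (at t)"
      by (simp add: A_def at_within_Icc_at)
    then show ?thesis
      by (rule has_field_derivative_transform_within_open[of _ _ _ "{A<..<t+1}"])
         (auto simp: A_def eq)
  qed
  then show "deriv (prim h) = h" by (auto intro: DERIV_imp_deriv)
  have "Ck k (prim h)" for k
    by (rule Ck_Suc_imp[OF Ck_real_deriv[OF der test_functions_CkD[OF h]]])
  then show "prim h \<in> test_functions {0<..<T}"
    unfolding test_functions_def using ab(2) left right
    by (auto intro!: exI[of _ "{a..b}"] simp: not_le)
qed

text \<open>The difference of g and the primitive of b has weak derivative zero. Any test function
  becomes a derivative of a test function once its mean is removed by a multiple of one fixed bump
  \<psi>; the fundamental lemma then applies to the difference minus a constant.\<close>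

theorem du_Bois_Reymond:
  fixes g b :: "real \<Rightarrow> real"
  assumes T: "T > 0" and g: "integrable lborel g" and b: "integrable lborel b"
    and weak: "\<And>\<phi>. \<phi> \<in> test_functions {0<..<T} \<Longrightarrow>
      (LINT t|lborel. \<phi> t * b t) = - (LINT t|lborel. deriv \<phi> t * g t)"
  obtains C where "AE t in lborel. t \<in> {0<..<T} \<longrightarrow> g t = C + prim b t"
proof -
  let ?J = "{0<..<T}"
  have indI: "integrable lborel (indicator ?J :: real \<Rightarrow> real)"
    by (rule integrable_real_indicator) (use T in auto)
  define G where "G t = indicator ?J t * (g t - prim b t)" for t
  have primI: "integrable lborel (\<lambda>t. indicator ?J t * prim b t)"
  proof (rule Bochner_Integration.integrable_bound)
    show "integrable lborel (\<lambda>t. indicator ?J t * (LINT s|lborel. \<bar>b s\<bar>))"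
      using indI by simp
    show "AE t in lborel. norm (indicator ?J t * prim b t) \<le> norm (indicator ?J t * (LINT s|lborel. \<bar>b s\<bar>))"
      using prim_abs_le[OF b] by (auto simp: abs_mult indicator_def intro: order_trans)
    show "(\<lambda>t. indicator ?J t * prim b t) \<in> borel_measurable lborel"
      using borel_measurable_continuous_onI[OF continuous_prim[OF b]] by simp
  qed
  have GI: "integrable lborel G"
    using Bochner_Integration.integrable_diff[OF integrable_indicator_mult[OF g, of ?J] primI]
    by (simp add: G_def[abs_def] right_diff_distrib)
  have supp: "\<phi> t * indicator ?J t = \<phi> t" if phi: "\<phi> \<in> test_functions ?J" for \<phi> :: "real \<Rightarrow> real" and t
  proof -
    obtain K where "K \<subseteq> ?J" "\<And>x. x \<notin> K \<Longrightarrow> \<phi> x = 0"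
      using test_functions_supp[OF phi] by blast
    then show ?thesis by (cases "t \<in> K") (auto simp: indicator_def)
  qed
  have mult: "integrable lborel (\<lambda>t. \<phi> t * f t)" if phi: "\<phi> \<in> test_functions ?J" and f: "integrable lborel f" for \<phi> f :: "real \<Rightarrow> real"
  proof -
    obtain M where M: "M > 0" "\<And>x. norm (\<phi> x) \<le> M" using test_functions_bounded[OF phi] by blast
    show ?thesis
      by (rule Bochner_Integration.integrable_bound[of _ "\<lambda>t. M * f t"])
         (use M f test_functions_measurable[OF phi] in \<open>auto simp: abs_mult intro!: mult_right_mono\<close>)
  qed
  have G0: "(LINT t|lborel. deriv \<phi> t * G t) = 0" if phi: "\<phi> \<in> test_functions ?J" for \<phi> :: "real \<Rightarrow> real"
  proof -
    note d = test_functions_deriv_real(2)[OF phi]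
    have e: "deriv \<phi> t * (indicator ?J t * x) = deriv \<phi> t * x" for x t
      using supp[OF d, of t] by (metis mult.assoc)
    have "(LINT t|lborel. deriv \<phi> t * G t) = (LINT t|lborel. deriv \<phi> t * g t - deriv \<phi> t * (indicator ?J t * prim b t))"
      by (simp only: G_def right_diff_distrib e)
    also have "\<dots> = (LINT t|lborel. deriv \<phi> t * g t) - (LINT t|lborel. deriv \<phi> t * (indicator ?J t * prim b t))"
      by (intro Bochner_Integration.integral_diff mult d g primI)
    also have "\<dots> = (LINT t|lborel. deriv \<phi> t * g t) - (LINT t|lborel. deriv \<phi> t * prim b t)"
      by (simp only: e)
    also have "\<dots> = 0"
      using weak[OF phi] weak_derivative_prim[OF b phi] by simp
    finally show ?thesis .
  qed
  define \<psi> :: "real \<Rightarrow> real" where "\<psi> = box_bump (T/4) (3*T/4) 0"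
  have psi: "\<psi> \<in> test_functions ?J"
    unfolding \<psi>_def by (rule box_bump_test) (use T in auto)
  have psiI: "integrable lborel \<psi>" by (rule test_functions_integrable[OF psi])
  have psi_pos: "(LINT t|lborel. \<psi> t) > 0"
  proof -
    have "\<psi> t > 0" if "t \<in> {T/4<..<3*T/4}" for t
      using that by (auto simp: \<psi>_def box_bump_def flat_exp_def)
    have "(LINT t|lborel. \<psi> t) \<noteq> 0"
    proof
      assume "(LINT t|lborel. \<psi> t) = 0"
      then have "AE t in lborel. \<psi> t = 0"
        by (subst (asm) integral_nonneg_eq_0_iff_AE[OF psiI]) (simp_all add: \<psi>_def box_bump_bounds)
      then have "AE t in lborel. t \<notin> {T/4<..<3*T/4}"
        by eventually_elim (use \<open>\<And>t. t \<in> {T/4<..<3*T/4} \<Longrightarrow> \<psi> t > 0\<close> in force)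
      then have "{T/4<..<3*T/4} \<in> null_sets lborel"
        by (subst (asm) AE_iff_null_sets[symmetric]) auto
      then show False using T by auto
    qed
    moreover have "(LINT t|lborel. \<psi> t) \<ge> 0"
      by (rule Bochner_Integration.integral_nonneg) (simp add: \<psi>_def box_bump_bounds)
    ultimately show ?thesis by simp
  qed
  \<comment> \<open>The mean of G weighted by the bump; it is the constant that survives when the
    multiple of \<psi> is subtracted from a test function.\<close>
  define C where "C = (LINT t|lborel. \<psi> t * G t) / (LINT t|lborel. \<psi> t)"
  have "AE t in lebesgue. t \<in> ?J \<longrightarrow> G t - C * indicator ?J t = 0"
  proof (rule fundamental_lemma)
    have I: "integrable lborel (\<lambda>t. G t - C * indicator ?J t)"
      using GI indI by simp
    then show "integrable lebesgue (\<lambda>t. G t - C * indicator ?J t)"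
      by (subst integrable_completion) auto
    fix \<eta> :: "real \<Rightarrow> real" assume chi: "\<eta> \<in> test_functions ?J"
    have chiI: "integrable lborel \<eta>" by (rule test_functions_integrable[OF chi])
    define c where "c = (LINT t|lborel. \<eta> t) / (LINT t|lborel. \<psi> t)"
    define h where "h t = \<eta> t - c * \<psi> t" for t
    have h: "h \<in> test_functions ?J"
      unfolding h_def[abs_def] using test_functions_diff[OF chi test_functions_scaleR[OF psi, of c]] by simp
    have "(LINT t|lborel. h t) = 0"
      unfolding h_def using psi_pos psiI chiI by (simp add: c_def)
    note hp = test_functions_prim[OF h this]
    have "0 = (LINT t|lborel. h t * G t)"
      using G0[OF hp(1)] by (simp add: hp(2))
    also have "\<dots> = (LINT t|lborel. \<eta> t * G t - c * (\<psi> t * G t))"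
      by (simp add: h_def algebra_simps)
    also have "\<dots> = (LINT t|lborel. \<eta> t * G t) - c * (LINT t|lborel. \<psi> t * G t)"
      using mult[OF chi GI] mult[OF psi GI] by simp
    also have "\<dots> = (LINT t|lborel. \<eta> t * G t) - C * (LINT t|lborel. \<eta> t * indicator ?J t)"
      by (simp add: supp[OF chi] C_def c_def)
    also have "\<dots> = (LINT t|lborel. \<eta> t * G t - C * (\<eta> t * indicator ?J t))"
      using mult[OF chi GI] chiI by (simp add: supp[OF chi])
    also have "\<dots> = (LINT t|lborel. (G t - C * indicator ?J t) * \<eta> t)"
      by (simp add: algebra_simps)
    also have "\<dots> = (LINT t|lebesgue. (G t - C * indicator ?J t) * \<eta> t)"
      by (rule integral_completion[symmetric]) (use I test_functions_measurable[OF chi] in auto)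
    finally show "(LINT t|lebesgue. (G t - C * indicator ?J t) * \<eta> t) = 0" by simp
  qed auto
  then have "AE t in lborel. t \<in> ?J \<longrightarrow> G t - C * indicator ?J t = 0"
    by (simp add: AE_completion_iff)
  then have "AE t in lborel. t \<in> ?J \<longrightarrow> g t = C + prim b t"
    by eventually_elim (auto simp: G_def)
  then show ?thesis by (rule that)
qed

section \<open>The space $L^2$ and weak gradients\<close>

text \<open>The integral of (f - c g)^2 is a nonnegative quadratic polynomial in c, evaluated at its
  minimiser C / B.\<close>

lemma Cauchy_Schwarz_integral:
  fixes f g :: "'a \<Rightarrow> real"
  assumes f: "integrable M (\<lambda>x. (f x)\<^sup>2)" and g: "integrable M (\<lambda>x. (g x)\<^sup>2)" and fg: "integrable M (\<lambda>x. f x * g x)"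
  shows "(LINT x|M. f x * g x) \<le> sqrt (LINT x|M. (f x)\<^sup>2) * sqrt (LINT x|M. (g x)\<^sup>2)"
proof -
  define A B C where "A = (LINT x|M. (f x)\<^sup>2)" and "B = (LINT x|M. (g x)\<^sup>2)" and "C = (LINT x|M. f x * g x)"
  have *: "0 \<le> A - 2 * c * C + c\<^sup>2 * B" for c
  proof -
    have "0 \<le> (LINT x|M. (f x - c * g x)\<^sup>2)" by simp
    also have "(\<lambda>x. (f x - c * g x)\<^sup>2) = (\<lambda>x. (f x)\<^sup>2 - 2 * c * (f x * g x) + c\<^sup>2 * (g x)\<^sup>2)"
      by (rule ext) (simp add: power2_diff power_mult_distrib)
    also have "(LINT x|M. (f x)\<^sup>2 - 2 * c * (f x * g x) + c\<^sup>2 * (g x)\<^sup>2) = A - 2 * c * C + c\<^sup>2 * B"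
      using f g fg by (simp add: A_def B_def C_def)
    finally show ?thesis .
  qed
  have AB: "A \<ge> 0" "B \<ge> 0" by (auto simp: A_def B_def)
  have "C\<^sup>2 \<le> A * B"
  proof (cases "B = 0")
    case True
    have "C = 0"
    proof (rule ccontr)
      assume "C \<noteq> 0"
      \<comment> \<open>With B = 0 the polynomial is affine in c, and at this c its value is
        -1.\<close>
      then show False using *[of "(A + 1) / (2 * C)"] True by (simp add: field_simps)
    qed
    then show ?thesis using AB by simp
  next
    case False
    with AB have "B > 0" by simp
    then show ?thesis using *[of "C / B"] by (simp add: field_simps power2_eq_square)
  qed
  then have "\<bar>C\<bar> \<le> sqrt (A * B)" by (simp add: real_le_rsqrt abs_le_square_iff)
  then show ?thesis by (simp add: A_def B_def C_def real_sqrt_mult)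
qed

section \<open>The seminormed space of square integrable functions\<close>

lemma L2I: "g \<in> borel_measurable (lebesgue_on S) \<Longrightarrow> integrable (lebesgue_on S) (\<lambda>x. (norm (g x))\<^sup>2) \<Longrightarrow> g \<in> L2 S"
  and L2_measurable: "g \<in> L2 S \<Longrightarrow> g \<in> borel_measurable (lebesgue_on S)"
  and L2_integrable_sq: "g \<in> L2 S \<Longrightarrow> integrable (lebesgue_on S) (\<lambda>x. (norm (g x))\<^sup>2)"
  by (auto simp: L2_def)

lemma L2_norm_nonneg[simp]: "0 \<le> L2_norm S g"
  by (simp add: L2_norm_def)

lemma L2_norm_sq: "(L2_norm S g)\<^sup>2 = (LINT x|lebesgue_on S. (norm (g x))\<^sup>2)"
  by (simp add: L2_norm_def)

lemma L2_dominated: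
  assumes "f \<in> L2 S" "g \<in> borel_measurable (lebesgue_on S)"
    and le: "AE x in lebesgue_on S. norm (g x) \<le> C * norm (f x)"
  shows "g \<in> L2 S" "C \<ge> 0 \<Longrightarrow> L2_norm S g \<le> C * L2_norm S f"
proof -
  have le2: "AE x in lebesgue_on S. (norm (g x))\<^sup>2 \<le> C\<^sup>2 * (norm (f x))\<^sup>2"
    using le by eventually_elim (metis norm_ge_zero power_mono power_mult_distrib)
  have "integrable (lebesgue_on S) (\<lambda>x. (norm (g x))\<^sup>2)"
  proof (rule Bochner_Integration.integrable_bound)
    show "integrable (lebesgue_on S) (\<lambda>x. C\<^sup>2 * (norm (f x))\<^sup>2)"
      using L2_integrable_sq[OF assms(1)] by simp
    show "AE x in lebesgue_on S. norm ((norm (g x))\<^sup>2) \<le> norm (C\<^sup>2 * (norm (f x))\<^sup>2)"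
      using le2 by simp
  qed (use assms(2) in measurable)
  then show g: "g \<in> L2 S" using assms(2) by (rule L2I[rotated])
  assume "C \<ge> 0"
  have "(L2_norm S g)\<^sup>2 \<le> (LINT x|lebesgue_on S. C\<^sup>2 * (norm (f x))\<^sup>2)"
    unfolding L2_norm_sq
    by (rule integral_mono_AE[OF L2_integrable_sq[OF g] _ le2]) (use L2_integrable_sq[OF assms(1)] in simp)
  also have "\<dots> = (C * L2_norm S f)\<^sup>2"
    by (simp add: L2_norm_sq power_mult_distrib)
  finally show "L2_norm S g \<le> C * L2_norm S f"
    by (rule power2_le_imp_le) (use \<open>C \<ge> 0\<close> in simp)
qed

lemma L2_norm_cong_AE:
  assumes "AE x in lebesgue_on S. f x = g x"
  shows "f \<in> borel_measurable (lebesgue_on S) \<Longrightarrow> g \<in> borel_measurable (lebesgue_on S) \<Longrightarrow> L2_norm S f = L2_norm S g"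
  unfolding L2_norm_def by (intro arg_cong[of _ _ sqrt] integral_cong_AE) (use assms in auto)

lemma L2_norm_product_integrable:
  assumes "f \<in> L2 S" "g \<in> L2 S"
  shows "integrable (lebesgue_on S) (\<lambda>x. norm (f x) * norm (g x))"
proof (rule Bochner_Integration.integrable_bound)
  show "integrable (lebesgue_on S) (\<lambda>x. (norm (f x))\<^sup>2 + (norm (g x))\<^sup>2)"
    using assms by (simp add: L2_integrable_sq)
  have "norm (f x) * norm (g x) \<le> (norm (f x))\<^sup>2 + (norm (g x))\<^sup>2" for x
  proof -
    have "2 * (norm (f x) * norm (g x)) \<le> (norm (f x))\<^sup>2 + (norm (g x))\<^sup>2"
      using sum_squares_bound[of "norm (f x)" "norm (g x)"] by (simp add: mult.assoc)
    moreover have "0 \<le> norm (f x) * norm (g x)" by simp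
    ultimately show ?thesis by linarith
  qed
  then show "AE x in lebesgue_on S. norm (norm (f x) * norm (g x)) \<le> norm ((norm (f x))\<^sup>2 + (norm (g x))\<^sup>2)"
    by simp
qed (use assms[THEN L2_measurable] in measurable)

lemma L2_product_le:
  assumes "f \<in> L2 S" "g \<in> L2 S"
  shows "(LINT x|lebesgue_on S. norm (f x) * norm (g x)) \<le> L2_norm S f * L2_norm S g"
  unfolding L2_norm_def
  by (rule Cauchy_Schwarz_integral) (use assms in \<open>auto intro: L2_integrable_sq L2_norm_product_integrable\<close>)

lemma L2_inner_integrable:
  assumes "f \<in> L2 S" "g \<in> L2 S"
  shows "integrable (lebesgue_on S) (\<lambda>x. f x \<bullet> g x)"
  by (rule Bochner_Integration.integrable_bound[OF L2_norm_product_integrable[OF assms]])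
     (use assms[THEN L2_measurable] in \<open>auto simp: Cauchy_Schwarz_ineq2\<close>)

lemma L2_inner_le:
  assumes "f \<in> L2 S" "g \<in> L2 S"
  shows "\<bar>LINT x|lebesgue_on S. f x \<bullet> g x\<bar> \<le> L2_norm S f * L2_norm S g"
proof -
  have "\<bar>LINT x|lebesgue_on S. f x \<bullet> g x\<bar> \<le> (LINT x|lebesgue_on S. \<bar>f x \<bullet> g x\<bar>)"
    by (rule integral_abs_bound)
  also have "\<dots> \<le> (LINT x|lebesgue_on S. norm (f x) * norm (g x))"
    by (rule integral_mono)
       (use assms in \<open>auto intro: L2_inner_integrable L2_norm_product_integrable simp: Cauchy_Schwarz_ineq2\<close>)
  finally show ?thesis using L2_product_le[OF assms] by simp
qed

lemma L2_lincomb: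
  assumes "f \<in> L2 S" "g \<in> L2 S"
  shows "(\<lambda>x. a *\<^sub>R f x + b *\<^sub>R g x) \<in> L2 S"
proof (rule L2I)
  show m: "(\<lambda>x. a *\<^sub>R f x + b *\<^sub>R g x) \<in> borel_measurable (lebesgue_on S)"
    using assms[THEN L2_measurable] by measurable
  have "integrable (lebesgue_on S) (\<lambda>x. a\<^sup>2 * (norm (f x))\<^sup>2 + 2 * (a * b * (f x \<bullet> g x)) + b\<^sup>2 * (norm (g x))\<^sup>2)"
    using L2_integrable_sq[OF assms(1)] L2_integrable_sq[OF assms(2)] L2_inner_integrable[OF assms] by simp
  moreover have "(norm (a *\<^sub>R f x + b *\<^sub>R g x))\<^sup>2 = a\<^sup>2 * (norm (f x))\<^sup>2 + 2 * (a * b * (f x \<bullet> g x)) + b\<^sup>2 * (norm (g x))\<^sup>2" for x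
    unfolding power2_norm_eq_inner
    by (simp add: inner_add_left inner_add_right inner_commute[of "g x" "f x"] power2_eq_square) algebra
  ultimately show "integrable (lebesgue_on S) (\<lambda>x. (norm (a *\<^sub>R f x + b *\<^sub>R g x))\<^sup>2)"
    by (simp only:)
qed

lemma L2_diff: "f \<in> L2 S \<Longrightarrow> g \<in> L2 S \<Longrightarrow> (\<lambda>x. f x - g x) \<in> L2 S"
  using L2_lincomb[of f S g 1 "-1"] by simp

lemma L2_minus: "f \<in> L2 S \<Longrightarrow> g \<in> L2 S \<Longrightarrow> f - g \<in> L2 S"
  using L2_diff[of f S g] by (simp add: fun_diff_def)

lemma L2_norm_diff_sq:
  assumes "f \<in> L2 S" "g \<in> L2 S"
  shows "(L2_norm S (f - g))\<^sup>2 = (L2_norm S f)\<^sup>2 + (L2_norm S g)\<^sup>2 - 2 * (LINT x|lebesgue_on S. f x \<bullet> g x)"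
proof -
  have "(L2_norm S (f - g))\<^sup>2 = (LINT x|lebesgue_on S. (norm (f x))\<^sup>2 + (norm (g x))\<^sup>2 - 2 * (f x \<bullet> g x))"
    unfolding L2_norm_sq power2_norm_eq_inner
    by (intro Bochner_Integration.integral_cong refl)
       (simp add: inner_diff_left inner_diff_right inner_commute)
  then show ?thesis
    using L2_integrable_sq[OF assms(1)] L2_integrable_sq[OF assms(2)] L2_inner_integrable[OF assms]
    by (simp add: L2_norm_sq)
qed

lemma L2_norm_minus_commute: "L2_norm S (f - g) = L2_norm S (g - f)"
  by (simp add: L2_norm_def norm_minus_commute)

lemma L2_norm_triangle_minus:
  assumes "f \<in> L2 S" "g \<in> L2 S"
  shows "L2_norm S (f - g) \<le> L2_norm S f + L2_norm S g"
proof -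
  have "(L2_norm S (f - g))\<^sup>2 \<le> (L2_norm S f + L2_norm S g)\<^sup>2"
    using L2_inner_le[OF assms] by (simp add: L2_norm_diff_sq[OF assms] power2_sum)
  then show ?thesis by (rule power2_le_imp_le) simp
qed

lemma L2_norm_triangle:
  assumes "f \<in> L2 S" "g \<in> L2 S" "h \<in> L2 S"
  shows "L2_norm S (f - h) \<le> L2_norm S (f - g) + L2_norm S (g - h)"
proof -
  have "f - h = (f - g) - (h - g)" by (simp add: fun_eq_iff)
  then show ?thesis
    using L2_norm_triangle_minus[OF L2_minus[OF assms(1,2)] L2_minus[OF assms(3,2)]]
    by (simp add: L2_norm_minus_commute[of S h g])
qed

lemma L2_norm_eq_0_AE:
  assumes "f \<in> L2 S" "L2_norm S f = 0"
  shows "AE x in lebesgue_on S. f x = 0"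
proof -
  have "(LINT x|lebesgue_on S. (norm (f x))\<^sup>2) = 0" using assms(2) L2_norm_sq[of S f] by simp
  then show ?thesis
    using integral_nonneg_eq_0_iff_AE[OF L2_integrable_sq[OF assms(1)]] by simp
qed

lemma L2_zero: "(\<lambda>x. 0) \<in> L2 S" by (auto intro: L2I)

lemma L2_norm_zero: "L2_norm S (\<lambda>x. 0) = 0" by (simp add: L2_norm_def)

text \<open>On a set of finite measure the bounded factor is itself square integrable, so the
  product is an inner product of two elements of \<open>L2\<close>.\<close>

lemma L2_bounded_mult_integrable:
  fixes f :: "'a::euclidean_space \<Rightarrow> real"
  assumes S: "S \<in> lmeasurable" and f: "f \<in> L2 S"
    and m: "m \<in> borel_measurable borel" and M: "\<And>x. \<bar>m x\<bar> \<le> M"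
  shows "integrable (lebesgue_on S) (\<lambda>x. f x * m x)"
proof -
  interpret finite_measure "lebesgue_on S" by (rule finite_measure_lebesgue_on[OF S])
  have m': "m \<in> borel_measurable (lebesgue_on S)"
    by (rule measurable_restrict_space1, rule measurable_completion) (use m in simp)
  have "m \<in> L2 S"
  proof (rule L2I[OF m'])
    show "integrable (lebesgue_on S) (\<lambda>x. (norm (m x))\<^sup>2)"
      by (rule integrable_const_bound[of _ "M\<^sup>2"])
         (use m' order_trans[OF M abs_ge_self] in \<open>auto intro!: AE_I2 simp: abs_le_square_iff[symmetric]\<close>)
  qed
  from L2_inner_integrable[OF f this] show ?thesis by simp
qed

lemma lebesgue_on_integrable_iff:
  fixes f :: "'a::euclidean_space \<Rightarrow> 'b::{banach, second_countable_topology}"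
  assumes "S \<in> sets lebesgue"
  shows "integrable (lebesgue_on S) f \<longleftrightarrow> integrable lebesgue (\<lambda>x. indicator S x *\<^sub>R f x)"
    and "integral\<^sup>L (lebesgue_on S) f = integral\<^sup>L lebesgue (\<lambda>x. indicator S x *\<^sub>R f x)"
  using assms by (simp_all add: integrable_restrict_space[of S lebesgue] integral_restrict_space[of S lebesgue])

lemma AE_lebesgue_on_iff:
  assumes "S \<in> sets lebesgue"
  shows "(AE x in lebesgue_on S. P x) \<longleftrightarrow> (AE x in lborel. x \<in> S \<longrightarrow> P x)"
  using assms by (simp add: AE_restrict_space_iff AE_completion_iff)

section \<open>Weak gradients on a bounded open set\<close>

locale bounded_open =
  fixes \<Omega> :: "(real^'d::finite) set"
  assumes open_dom: "open \<Omega>" and bounded_dom: "bounded \<Omega>"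
begin

lemma dom_lmeasurable: "\<Omega> \<in> lmeasurable"
  using open_dom bounded_dom lmeasurable_open by blast

lemma dom_sets: "\<Omega> \<in> sets lebesgue"
  using dom_lmeasurable by (simp add: fmeasurableD)

lemma frechet_test_bounded:
  fixes \<phi> :: "real^'d \<Rightarrow> real"
  assumes "\<phi> \<in> test_functions \<Omega>"
  obtains M where "\<And>x. \<bar>frechet_derivative \<phi> (at x) (axis j 1)\<bar> \<le> M"
    "(\<lambda>x. frechet_derivative \<phi> (at x) (axis j 1)) \<in> borel_measurable borel"
proof -
  have "axis j (1::real) \<in> Basis" by (auto simp: axis_in_Basis_iff)
  note d = test_functions_deriv[OF assms this]
  show ?thesis
    using test_functions_bounded[OF d] test_functions_measurable[OF d] that
    by (metis real_norm_def)
qed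

lemma L2_component:
  fixes v :: "'d vfield" assumes "v \<in> L2 \<Omega>" shows "(\<lambda>x. v x $ i) \<in> L2 \<Omega>"
proof (rule L2_dominated(1)[OF assms, of _ 1])
  show "(\<lambda>x. v x $ i) \<in> borel_measurable (lebesgue_on \<Omega>)"
    using L2_measurable[OF assms] by (simp add: cart_eq_inner_axis)
  show "AE x in lebesgue_on \<Omega>. norm (v x $ i) \<le> 1 * norm (v x)"
    using component_le_norm_cart by (auto intro!: AE_I2)
qed

lemma L2_component2:
  fixes G :: "'d tfield" assumes "G \<in> L2 \<Omega>" shows "(\<lambda>x. G x $ i $ j) \<in> L2 \<Omega>"
proof (rule L2_component)
  show "(\<lambda>x. G x $ i) \<in> L2 \<Omega>"
  proof (rule L2_dominated(1)[OF assms, of _ 1])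
    have "(\<lambda>A::real^'d^'d. A $ i) \<in> borel_measurable borel"
      by (intro borel_measurable_continuous_onI continuous_on_component continuous_on_id)
    then show "(\<lambda>x. G x $ i) \<in> borel_measurable (lebesgue_on \<Omega>)"
      using measurable_compose[OF L2_measurable[OF assms]] by blast
    show "AE x in lebesgue_on \<Omega>. norm (G x $ i) \<le> 1 * norm (G x)"
      using Finite_Cartesian_Product.norm_nth_le by (auto intro!: AE_I2)
  qed
qed

text \<open>Since \<open>grad\<close> is an arbitrary choice, every statement about it has to go
  through this uniqueness; it is the fundamental lemma applied to each entry.\<close>

lemma weak_gradient_unique:
  assumes G: "G \<in> L2 \<Omega>" "weak_gradient \<Omega> v G" and G': "G' \<in> L2 \<Omega>" "weak_gradient \<Omega> v G'"
  shows "AE x in lebesgue_on \<Omega>. G x = G' x"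
proof -
  have "AE x in lebesgue_on \<Omega>. G x $ i $ j = G' x $ i $ j" for i j
  proof -
    let ?g = "\<lambda>x. indicator \<Omega> x *\<^sub>R (G x $ i $ j - G' x $ i $ j)"
    have I: "integrable (lebesgue_on \<Omega>) (\<lambda>x. H x $ i $ j * \<phi> x)" 
      if "H \<in> L2 \<Omega>" "\<phi> \<in> borel_measurable borel" "\<And>x. \<bar>\<phi> x\<bar> \<le> M" for H :: "'d tfield" and \<phi> M
      by (rule L2_bounded_mult_integrable[OF dom_lmeasurable L2_component2[OF that(1)] that(2,3)])
    have "AE x in lebesgue. x \<in> \<Omega> \<longrightarrow> ?g x = 0"
    proof (rule fundamental_lemma[OF open_dom])
      have "integrable (lebesgue_on \<Omega>) (\<lambda>x. G x $ i $ j - G' x $ i $ j)"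
        using I[OF G(1), of "\<lambda>_. 1" 1] I[OF G'(1), of "\<lambda>_. 1" 1] by simp
      then show "integrable lebesgue ?g"
        by (simp add: lebesgue_on_integrable_iff[OF dom_sets])
      fix \<phi> :: "real^'d \<Rightarrow> real" assume phi: "\<phi> \<in> test_functions \<Omega>"
      obtain M where M: "\<And>x. \<bar>\<phi> x\<bar> \<le> M" using test_functions_bounded[OF phi] by auto
      have "(LINT x|lebesgue. ?g x * \<phi> x) = (LINT x|lebesgue_on \<Omega>. G x $ i $ j * \<phi> x - G' x $ i $ j * \<phi> x)"
        by (simp add: lebesgue_on_integrable_iff(2)[OF dom_sets] left_diff_distrib mult.assoc)
      also have "\<dots> = (LINT x|lebesgue_on \<Omega>. G x $ i $ j * \<phi> x) - (LINT x|lebesgue_on \<Omega>. G' x $ i $ j * \<phi> x)"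
        using I[OF G(1) test_functions_measurable[OF phi] M] I[OF G'(1) test_functions_measurable[OF phi] M] by simp
      also have "\<dots> = 0" using G(2) G'(2) phi unfolding weak_gradient_def by (metis (no_types, lifting) add.inverse_inverse diff_self)
      finally show "(LINT x|lebesgue. ?g x * \<phi> x) = 0" .
    qed
    then show ?thesis
      by (simp add: AE_restrict_space_iff dom_sets)
  qed
  then have "AE x in lebesgue_on \<Omega>. \<forall>i. \<forall>j. G x $ i $ j = G' x $ i $ j"
    by (simp add: AE_all_countable)
  then show ?thesis by eventually_elim (simp add: vec_eq_iff)
qed

lemma weak_gradient_lincomb:
  assumes v: "v \<in> L2 \<Omega>" "G \<in> L2 \<Omega>" "weak_gradient \<Omega> v G"
    and w: "w \<in> L2 \<Omega>" "G' \<in> L2 \<Omega>" "weak_gradient \<Omega> w G'"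
  shows "weak_gradient \<Omega> (\<lambda>x. a *\<^sub>R v x + b *\<^sub>R w x) (\<lambda>x. a *\<^sub>R G x + b *\<^sub>R G' x)"
  unfolding weak_gradient_def
proof (intro ballI allI)
  fix \<phi> :: "real^'d \<Rightarrow> real" and i j assume phi: "\<phi> \<in> test_functions \<Omega>"
  let ?d = "\<lambda>x. frechet_derivative \<phi> (at x) (axis j 1)"
  obtain M where M: "\<And>x. \<bar>?d x\<bar> \<le> M" "?d \<in> borel_measurable borel"
    using frechet_test_bounded[OF phi] by blast
  obtain M' where M': "\<And>x. \<bar>\<phi> x\<bar> \<le> M'" using test_functions_bounded[OF phi] by auto
  have 1: "integrable (lebesgue_on \<Omega>) (\<lambda>x. v x $ i * ?d x)" "integrable (lebesgue_on \<Omega>) (\<lambda>x. w x $ i * ?d x)"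
    by (rule L2_bounded_mult_integrable[OF dom_lmeasurable L2_component M(2,1)], fact)+
  have 2: "integrable (lebesgue_on \<Omega>) (\<lambda>x. G x $ i $ j * \<phi> x)" "integrable (lebesgue_on \<Omega>) (\<lambda>x. G' x $ i $ j * \<phi> x)"
    by (rule L2_bounded_mult_integrable[OF dom_lmeasurable L2_component2 test_functions_measurable[OF phi] M'], fact)+
  have "(LINT x|lebesgue_on \<Omega>. (a *\<^sub>R v x + b *\<^sub>R w x) $ i * ?d x) =
      a * (LINT x|lebesgue_on \<Omega>. v x $ i * ?d x) + b * (LINT x|lebesgue_on \<Omega>. w x $ i * ?d x)"
    using 1 by (simp add: distrib_right mult.assoc)
  also have "\<dots> = - (a * (LINT x|lebesgue_on \<Omega>. G x $ i $ j * \<phi> x) + b * (LINT x|lebesgue_on \<Omega>. G' x $ i $ j * \<phi> x))"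
    using v(3) w(3) phi by (simp add: weak_gradient_def)
  also have "\<dots> = - (LINT x|lebesgue_on \<Omega>. (a *\<^sub>R G x + b *\<^sub>R G' x) $ i $ j * \<phi> x)"
    using 2 by (simp add: distrib_right mult.assoc)
  finally show "(LINT x|lebesgue_on \<Omega>. (a *\<^sub>R v x + b *\<^sub>R w x) $ i * ?d x) =
     - (LINT x|lebesgue_on \<Omega>. (a *\<^sub>R G x + b *\<^sub>R G' x) $ i $ j * \<phi> x)" .
qed

lemma H1_grad:
  assumes "v \<in> H1 \<Omega>"
  shows "v \<in> L2 \<Omega>" "grad \<Omega> v \<in> L2 \<Omega>" "weak_gradient \<Omega> v (grad \<Omega> v)"
proof -
  show "v \<in> L2 \<Omega>" using assms by (simp add: H1_def)
  have "\<exists>G. G \<in> L2 \<Omega> \<and> weak_gradient \<Omega> v G" using assms by (auto simp: H1_def)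
  from someI_ex[OF this] show "grad \<Omega> v \<in> L2 \<Omega>" "weak_gradient \<Omega> v (grad \<Omega> v)"
    by (simp_all add: grad_def)
qed

lemma H1_lincomb:
  assumes "v \<in> H1 \<Omega>" "w \<in> H1 \<Omega>"
  shows "(\<lambda>x. a *\<^sub>R v x + b *\<^sub>R w x) \<in> H1 \<Omega>"
    and "AE x in lebesgue_on \<Omega>. grad \<Omega> (\<lambda>x. a *\<^sub>R v x + b *\<^sub>R w x) x = a *\<^sub>R grad \<Omega> v x + b *\<^sub>R grad \<Omega> w x"
proof -
  note v = H1_grad[OF assms(1)] and w = H1_grad[OF assms(2)]
  note G = L2_lincomb[OF v(2) w(2), of a b] weak_gradient_lincomb[OF v w, of a b]
  show H: "(\<lambda>x. a *\<^sub>R v x + b *\<^sub>R w x) \<in> H1 \<Omega>"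
    using L2_lincomb[OF v(1) w(1)] G by (auto simp: H1_def)
  show "AE x in lebesgue_on \<Omega>. grad \<Omega> (\<lambda>x. a *\<^sub>R v x + b *\<^sub>R w x) x = a *\<^sub>R grad \<Omega> v x + b *\<^sub>R grad \<Omega> w x"
    by (rule weak_gradient_unique[OF H1_grad(2,3)[OF H] G])
qed

end

section \<open>Poincare's inequality and the spaces $V$ and $V^*$\<close>

lemma has_derivative_along:
  fixes \<psi> :: "'a::euclidean_space \<Rightarrow> real"
  assumes "\<And>x. (\<psi> has_derivative D x) (at x)"
  shows "((\<lambda>t. \<psi> (x + t *\<^sub>R e)) has_real_derivative D (x + t *\<^sub>R e) e) (at t)"
proof -
  have "((\<lambda>t. x + t *\<^sub>R e) has_derivative (\<lambda>h. h *\<^sub>R e)) (at t)"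
    by (auto intro!: derivative_eq_intros)
  from has_derivative_compose[OF this assms]
  have "((\<lambda>t. \<psi> (x + t *\<^sub>R e)) has_derivative (\<lambda>h. D (x + t *\<^sub>R e) (h *\<^sub>R e))) (at t)" .
  moreover have "D (x + t *\<^sub>R e) (h *\<^sub>R e) = D (x + t *\<^sub>R e) e * h" for h
    using linear_scale[OF has_derivative_linear[OF assms[of "x + t *\<^sub>R e"]], of h e] by simp
  ultimately show ?thesis by (simp add: has_field_derivative_def)
qed

lemma integral_translate:
  fixes f :: "'a::euclidean_space \<Rightarrow> real"
  assumes "f \<in> borel_measurable borel"
  shows "(LINT x|lborel. f (x + c)) = (LINT x|lborel. f x)"
proof -
  have "(LINT x|lborel. f x) = (LINT x|distr lborel borel ((+) c). f x)"
    by (simp add: lborel_distr_plus)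
  also have "\<dots> = (LINT x|lborel. f (c + x))"
    by (rule integral_distr) (use assms in auto)
  finally show ?thesis by (simp add: add.commute)
qed

text \<open>By translation invariance each difference quotient has integral zero, and the quotients
  converge to the directional derivative under a common integrable bound.\<close>

lemma integral_directional_derivative_eq_0:
  fixes \<psi> :: "'a::euclidean_space \<Rightarrow> real"
  assumes der: "\<And>x. (\<psi> has_derivative D x) (at x)"
    and cont: "continuous_on UNIV (\<lambda>x. D x e)"
    and K: "compact K" "\<And>x. x \<notin> K \<Longrightarrow> \<psi> x = 0"
  shows "(LINT x|lborel. D x e) = 0"
proof -
  have psi_cont: "continuous_on UNIV \<psi>"
    using der by (auto simp: continuous_on_eq_continuous_at intro: has_derivative_continuous)
  have meas: "\<psi> \<in> borel_measurable borel" "(\<lambda>x. D x e) \<in> borel_measurable borel"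
    using psi_cont cont by (auto intro: borel_measurable_continuous_onI)
  have out: "D x e = 0" if "x \<notin> K" for x
    using frechet_derivative_outside_support[OF K that] frechet_derivative_at[OF der[of x]] by simp
  obtain M where M: "\<And>x. \<bar>D x e\<bar> \<le> M"
  proof -
    have "compact ((\<lambda>x. D x e) ` K)"
      by (rule compact_continuous_image[OF continuous_on_subset[OF cont] K(1)]) auto
    then obtain M where M: "\<And>x. x \<in> K \<Longrightarrow> \<bar>D x e\<bar> \<le> M"
      by (metis compact_imp_bounded bounded_iff imageI real_norm_def)
    show ?thesis
    proof (rule that[of "max M 0"])
      show "\<bar>D x e\<bar> \<le> max M 0" for x
        using M[of x] out[of x] by (cases "x \<in> K") auto
    qed
  qed
  define q where "q n x = (\<psi> (x + inverse (real (Suc n)) *\<^sub>R e) - \<psi> x) * real (Suc n)" for n x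
  obtain R where R: "\<And>x. x \<in> K \<Longrightarrow> norm x \<le> R"
    using compact_imp_bounded[OF K(1)] by (auto simp: bounded_iff)
  have psiI: "integrable lborel \<psi>"
  proof -
    have "integrable lborel (\<lambda>x. indicator K x *\<^sub>R \<psi> x)"
      by (rule borel_integrable_compact[OF K(1)]) (rule continuous_on_subset[OF psi_cont], simp)
    moreover have "(\<lambda>x. indicator K x *\<^sub>R \<psi> x) = \<psi>"
      using K(2) by (auto simp: fun_eq_iff indicator_def)
    ultimately show ?thesis by simp
  qed
  have q0: "(LINT x|lborel. q n x) = 0" for n
  proof -
    have 1: "integrable lborel (\<lambda>x. \<psi> (x + c))" for c
    proof -
      have "integrable (distr lborel borel ((+) c)) \<psi>" using psiI by (simp add: lborel_distr_plus)
      then show ?thesis by (subst (asm) integrable_distr_eq) (use meas in \<open>auto simp: add.commute\<close>)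
    qed
    show ?thesis
      unfolding q_def using 1 psiI integral_translate[OF meas(1)] by simp
  qed
  have "(\<lambda>n. LINT x|lborel. q n x) \<longlonglongrightarrow> (LINT x|lborel. D x e)"
  \<comment> \<open>The steps are at most 1, so all quotients vanish outside the ball of radius R
    plus the norm of e; inside, the mean value theorem bounds them by the maximum M of the
    derivative.\<close>
  proof (rule integral_dominated_convergence[where w = "\<lambda>x. M * indicator (cball 0 (R + norm e)) x"])
    show "AE x in lborel. (\<lambda>n. q n x) \<longlonglongrightarrow> D x e"
    proof (rule AE_I2)
      fix x
      have "((\<lambda>h. (\<psi> (x + h *\<^sub>R e) - \<psi> x) / h) \<longlongrightarrow> D x e) (at 0)"
        using has_derivative_along[OF der, of x e 0] by (simp add: has_field_derivative_iff)
      moreover have "filterlim (\<lambda>n. inverse (real (Suc n))) (at 0) sequentially"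
        using LIMSEQ_inverse_real_of_nat by (simp add: filterlim_at)
      ultimately have "(\<lambda>n. (\<psi> (x + inverse (real (Suc n)) *\<^sub>R e) - \<psi> x) / inverse (real (Suc n))) \<longlonglongrightarrow> D x e"
        by (rule filterlim_compose)
      then show "(\<lambda>n. q n x) \<longlonglongrightarrow> D x e" by (simp add: q_def divide_inverse)
    qed
    show "AE x in lborel. norm (q n x) \<le> M * indicator (cball 0 (R + norm e)) x" for n
    proof (rule AE_I2)
      fix x :: 'a
      define h where "h = inverse (real (Suc n))"
      have h: "0 < h" "h \<le> 1" by (auto simp: h_def inverse_le_1_iff)
      obtain z where z: "\<psi> (x + h *\<^sub>R e) - \<psi> (x + 0 *\<^sub>R e) = (h - 0) * D (x + z *\<^sub>R e) e"
        using MVT2[OF h(1), of "\<lambda>t. \<psi> (x + t *\<^sub>R e)" "\<lambda>t. D (x + t *\<^sub>R e) e"] has_derivative_along[OF der] by blast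
      have "q n x = D (x + z *\<^sub>R e) e"
        using z h by (simp add: q_def h_def divide_simps)
      then have "\<bar>q n x\<bar> \<le> M" using M by simp
      moreover have "q n x = 0" if "norm x > R + norm e"
      proof -
        have "norm (h *\<^sub>R e) \<le> norm e" using h by (simp add: mult_left_le_one_le)
        then have "norm (x + h *\<^sub>R e) > R"
          using that norm_diff_ineq[of x "h *\<^sub>R e"] by linarith
        moreover have "norm x > R" using that norm_ge_zero[of e] by linarith
        ultimately have "x + h *\<^sub>R e \<notin> K" "x \<notin> K" using R by force+
        then show ?thesis using K(2) by (simp add: q_def h_def)
      qed
      ultimately show "norm (q n x) \<le> M * indicator (cball 0 (R + norm e)) x"
        by (auto simp: indicator_def)
    qed
    show "integrable lborel (\<lambda>x. M * indicator (cball 0 (R + norm e)) x)"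
      by (intro integrable_mult_right impI integrable_real_indicator) (use emeasure_bounded_finite[OF bounded_cball] in auto)
  qed (use meas in \<open>auto simp: q_def\<close>)
  then show ?thesis by (simp add: q0 LIMSEQ_const_iff)
qed

lemma norm_column_le:
  fixes A :: "real^'n::finite^'m::finite"
  shows "norm (A *v axis j 1) \<le> norm A"
proof -
  have "(norm (A *v axis j 1))\<^sup>2 = (\<Sum>i\<in>UNIV. (A $ i $ j)\<^sup>2)"
    unfolding power2_norm_eq_inner inner_vec_def
    by (simp add: matrix_vector_mult_basis column_def power2_eq_square)
  also have "\<dots> \<le> (\<Sum>i\<in>UNIV. (norm (A $ i))\<^sup>2)"
    by (intro sum_mono) (use component_le_norm_cart in \<open>simp add: abs_le_square_iff[symmetric]\<close>)
  also have "\<dots> = (norm A)\<^sup>2"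
    by (simp add: norm_vec_def L2_set_def sum_nonneg)
  finally show ?thesis by (rule power2_le_imp_le) simp
qed

context bounded_open
begin

lemma jacobian_L2:
  fixes \<phi> :: "'d vfield"
  assumes "\<phi> \<in> test_functions \<Omega>"
  shows "(\<lambda>x. jacobian \<phi> (at x)) \<in> L2 \<Omega>" "continuous_on UNIV (\<lambda>x. jacobian \<phi> (at x))"
    "frechet_derivative \<phi> (at x) (axis j 1) = jacobian \<phi> (at x) *v axis j 1"
proof -
  have ax: "axis j (1::real) \<in> Basis" for j :: 'd by (auto simp: axis_in_Basis_iff)
  have lin: "linear (frechet_derivative \<phi> (at x))" for x
    using test_functions_has_derivative[OF assms] has_derivative_linear by blast
  show "frechet_derivative \<phi> (at x) (axis j 1) = jacobian \<phi> (at x) *v axis j 1"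
    unfolding jacobian_def using matrix_vector_mul(2)[OF lin] by metis
  have c: "continuous_on UNIV (\<lambda>x. jacobian \<phi> (at x) $ i $ j)" for i j
    unfolding jacobian_def matrix_def
    using test_functions_continuous[OF test_functions_deriv[OF assms ax, of j]]
    by (simp add: continuous_on_component)
  have "continuous_on UNIV (\<lambda>x. \<chi> i j. jacobian \<phi> (at x) $ i $ j)"
    by (intro continuous_on_vec_lambda c)
  then show c: "continuous_on UNIV (\<lambda>x. jacobian \<phi> (at x))" by simp
  obtain K where K: "compact K" "K \<subseteq> \<Omega>" "\<And>x. x \<notin> K \<Longrightarrow> \<phi> x = 0"
    using test_functions_supp[OF assms] by blast
  have out: "jacobian \<phi> (at x) = 0" if "x \<notin> K" for x
    unfolding jacobian_def using frechet_derivative_outside_support[OF K(1,3) that]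
    by (simp add: matrix_def vec_eq_iff)
  have "integrable lborel (\<lambda>x. indicator K x *\<^sub>R (norm (jacobian \<phi> (at x)))\<^sup>2)"
    by (rule borel_integrable_compact[OF K(1)]) (intro continuous_intros continuous_on_subset[OF c], simp)
  moreover have "indicator K x *\<^sub>R (norm (jacobian \<phi> (at x)))\<^sup>2 = indicator \<Omega> x *\<^sub>R (norm (jacobian \<phi> (at x)))\<^sup>2" for x
    using out[of x] K(2) by (cases "x \<in> K") (auto simp: indicator_def)
  ultimately have I: "integrable lborel (\<lambda>x. indicator \<Omega> x *\<^sub>R (norm (jacobian \<phi> (at x)))\<^sup>2)" by (simp only:)
  show "(\<lambda>x. jacobian \<phi> (at x)) \<in> L2 \<Omega>"
  proof (rule L2I)
    show "(\<lambda>x. jacobian \<phi> (at x)) \<in> borel_measurable (lebesgue_on \<Omega>)"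
      by (rule measurable_restrict_space1, rule measurable_completion)
         (use borel_measurable_continuous_onI[OF c] in simp)
    show "integrable (lebesgue_on \<Omega>) (\<lambda>x. (norm (jacobian \<phi> (at x)))\<^sup>2)"
      unfolding lebesgue_on_integrable_iff[OF dom_sets]
      using I by (subst integrable_completion) auto
  qed
qed

lemma test_L2:
  fixes \<phi> :: "real^'d \<Rightarrow> 'b::euclidean_space"
  assumes "\<phi> \<in> test_functions \<Omega>"
  shows "\<phi> \<in> L2 \<Omega>"
proof (rule L2I)
  interpret finite_measure "lebesgue_on \<Omega>" by (rule finite_measure_lebesgue_on[OF dom_lmeasurable])
  show m: "\<phi> \<in> borel_measurable (lebesgue_on \<Omega>)"
    by (rule measurable_restrict_space1, rule measurable_completion)
       (use test_functions_measurable[OF assms] in simp)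
  obtain M where M: "\<And>x. norm (\<phi> x) \<le> M" using test_functions_bounded[OF assms] by blast
  show "integrable (lebesgue_on \<Omega>) (\<lambda>x. (norm (\<phi> x))\<^sup>2)"
    by (rule integrable_const_bound[of _ "M\<^sup>2"])
       (use m M in \<open>auto intro!: AE_I2 power_mono\<close>)
qed

text \<open>Integrates the derivative of $(x \cdot e)\,|\varphi(x)|^2$ in the direction $e$.\<close>

lemma Poincare_test:
  fixes \<phi> :: "'d vfield"
  assumes phi: "\<phi> \<in> test_functions \<Omega>" and R: "\<And>x. x \<in> \<Omega> \<Longrightarrow> norm x \<le> R" "R \<ge> 0"
  shows "L2_norm \<Omega> \<phi> \<le> 2 * R * L2_norm \<Omega> (\<lambda>x. jacobian \<phi> (at x))"
proof -
  \<comment> \<open>Some coordinate direction: being a basis vector, it makes the derivative along e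
    a test function again, and that derivative is a column of the Jacobian.\<close>
  define e :: "real^'d" where "e = axis (SOME j. True) 1"
  have e: "norm e = 1" "e \<in> Basis" by (auto simp: e_def axis_in_Basis_iff)
  define d where "d x = frechet_derivative \<phi> (at x)" for x
  have d: "(\<phi> has_derivative d x) (at x)" for x
    using test_functions_has_derivative[OF phi] by (simp add: d_def)
  have de: "d x e = jacobian \<phi> (at x) *v e" for x
    using jacobian_L2(3)[OF phi] by (simp add: d_def e_def)
  obtain K where K: "compact K" "K \<subseteq> \<Omega>" "\<And>x. x \<notin> K \<Longrightarrow> \<phi> x = 0"
    using test_functions_supp[OF phi] by blast
  let ?D = "\<lambda>x h. (h \<bullet> e) * (\<phi> x \<bullet> \<phi> x) + (x \<bullet> e) * (2 * (\<phi> x \<bullet> d x h))"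
  have "(LINT x|lborel. ?D x e) = 0"
  proof (rule integral_directional_derivative_eq_0[where D = ?D and \<psi> = "\<lambda>x. (x \<bullet> e) * (\<phi> x \<bullet> \<phi> x)", OF _ _ K(1)])
    show "((\<lambda>x. (x \<bullet> e) * (\<phi> x \<bullet> \<phi> x)) has_derivative ?D x) (at x)" for x
      by (auto intro!: derivative_eq_intros d simp: inner_commute algebra_simps)
    have "continuous_on UNIV (\<lambda>x. d x e)"
      using test_functions_continuous[OF test_functions_deriv[OF phi e(2)]] by (simp add: d_def)
    then show "continuous_on UNIV (\<lambda>x. ?D x e)"
      by (intro continuous_intros test_functions_continuous[OF phi])
    show "(x \<bullet> e) * (\<phi> x \<bullet> \<phi> x) = 0" if "x \<notin> K" for x using K(3)[OF that] by simp
  qed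
  moreover have "(\<lambda>x. ?D x e) = (\<lambda>x. indicator \<Omega> x *\<^sub>R ?D x e)"
  proof
    show "?D x e = indicator \<Omega> x *\<^sub>R ?D x e" for x
      using K(2) K(3)[of x] by (cases "x \<in> K") (auto simp: indicator_def)
  qed
  ultimately have "(LINT x|lborel. indicator \<Omega> x *\<^sub>R ?D x e) = 0" by (simp only:)
  moreover have dm: "(\<lambda>x. d x e) \<in> L2 \<Omega>"
    using test_L2[OF test_functions_deriv[OF phi e(2)]] by (simp add: d_def)
  have ue: "e \<bullet> e = 1" using e(1) by (simp add: norm_eq_1)
  have meas: "(\<lambda>x. indicator \<Omega> x *\<^sub>R ?D x e) \<in> borel_measurable lborel"
    using test_functions_measurable[OF phi] test_functions_measurable[OF test_functions_deriv[OF phi e(2)]] open_dom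
    by (intro borel_measurable_scaleR borel_measurable_indicator) (auto simp: d_def)
  ultimately have z: "(LINT x|lebesgue_on \<Omega>. ?D x e) = 0"
    unfolding lebesgue_on_integrable_iff[OF dom_sets] by (subst integral_completion) auto
  note pL = test_L2[OF phi]
  \<comment> \<open>The weight is attached to the derivative, so that Cauchy-Schwarz yields the norm
    of \<phi> times at most R times the norm of the Jacobian.\<close>
  have xd: "(\<lambda>x. (x \<bullet> e) *\<^sub>R d x e) \<in> L2 \<Omega>" "L2_norm \<Omega> (\<lambda>x. (x \<bullet> e) *\<^sub>R d x e) \<le> R * L2_norm \<Omega> (\<lambda>x. jacobian \<phi> (at x))"
  proof -
    have m: "(\<lambda>x. (x \<bullet> e) *\<^sub>R d x e) \<in> borel_measurable (lebesgue_on \<Omega>)"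
      by (intro borel_measurable_scaleR L2_measurable[OF dm] measurable_restrict_space1 measurable_completion) simp
    have le: "AE x in lebesgue_on \<Omega>. norm ((x \<bullet> e) *\<^sub>R d x e) \<le> R * norm (jacobian \<phi> (at x))"
    proof (rule AE_I2)
      fix x assume "x \<in> space (lebesgue_on \<Omega>)"
      then have "\<bar>x \<bullet> e\<bar> \<le> R"
        using Cauchy_Schwarz_ineq2[of x e] e R(1)[of x] by simp
      moreover have "norm (d x e) \<le> norm (jacobian \<phi> (at x))"
        using norm_column_le[of "jacobian \<phi> (at x)"] by (simp add: de) (simp add: e_def)
      ultimately show "norm ((x \<bullet> e) *\<^sub>R d x e) \<le> R * norm (jacobian \<phi> (at x))"
        using R(2) by (simp add: mult_mono)
    qed
    show "(\<lambda>x. (x \<bullet> e) *\<^sub>R d x e) \<in> L2 \<Omega>" "L2_norm \<Omega> (\<lambda>x. (x \<bullet> e) *\<^sub>R d x e) \<le> R * L2_norm \<Omega> (\<lambda>x. jacobian \<phi> (at x))"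
      using L2_dominated[OF jacobian_L2(1)[OF phi] m le] R(2) by auto
  qed
  have "(L2_norm \<Omega> \<phi>)\<^sup>2 + 2 * (LINT x|lebesgue_on \<Omega>. \<phi> x \<bullet> (x \<bullet> e) *\<^sub>R d x e) = (LINT x|lebesgue_on \<Omega>. ?D x e)"
  proof -
    have "(LINT x|lebesgue_on \<Omega>. ?D x e) = (LINT x|lebesgue_on \<Omega>. (norm (\<phi> x))\<^sup>2 + 2 * (\<phi> x \<bullet> (x \<bullet> e) *\<^sub>R d x e))"
      by (intro Bochner_Integration.integral_cong refl) (simp add: ue power2_norm_eq_inner)
    then show ?thesis
      using L2_integrable_sq[OF pL] L2_inner_integrable[OF pL xd(1)] by (simp add: L2_norm_sq)
  qed
  then have "(L2_norm \<Omega> \<phi>)\<^sup>2 \<le> 2 * (L2_norm \<Omega> \<phi> * L2_norm \<Omega> (\<lambda>x. (x \<bullet> e) *\<^sub>R d x e))"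
    using z L2_inner_le[OF pL xd(1)] by linarith
  also have "\<dots> \<le> 2 * (L2_norm \<Omega> \<phi> * (R * L2_norm \<Omega> (\<lambda>x. jacobian \<phi> (at x))))"
    using xd(2) by (intro mult_left_mono) auto
  finally have "L2_norm \<Omega> \<phi> * L2_norm \<Omega> \<phi> \<le> L2_norm \<Omega> \<phi> * (2 * R * L2_norm \<Omega> (\<lambda>x. jacobian \<phi> (at x)))"
    by (simp add: power2_eq_square algebra_simps)
  then show ?thesis
    using R(2) by (cases "L2_norm \<Omega> \<phi> = 0") (auto simp: mult_le_cancel_left less_le)
qed

lemma jacobian_lincomb:
  fixes \<phi> \<psi> :: "'d vfield"
  assumes "\<phi> \<in> test_functions \<Omega>" "\<psi> \<in> test_functions \<Omega>"
  shows "jacobian (\<lambda>x. a *\<^sub>R \<phi> x + b *\<^sub>R \<psi> x) (at x) = a *\<^sub>R jacobian \<phi> (at x) + b *\<^sub>R jacobian \<psi> (at x)"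
proof -
  have "((\<lambda>x. a *\<^sub>R \<phi> x + b *\<^sub>R \<psi> x) has_derivative
      (\<lambda>h. a *\<^sub>R frechet_derivative \<phi> (at x) h + b *\<^sub>R frechet_derivative \<psi> (at x) h)) (at x)"
    by (intro derivative_intros test_functions_has_derivative[OF assms(1)] test_functions_has_derivative[OF assms(2)])
  from frechet_derivative_at[OF this, symmetric] show ?thesis
    by (simp add: jacobian_def matrix_def vec_eq_iff)
qed

section \<open>Linear structure of the space V\<close>

lemma V_H1: "v \<in> V \<Omega> \<Longrightarrow> v \<in> H1 \<Omega>"
  by (simp add: V_def)

lemma V_L2: "v \<in> V \<Omega> \<Longrightarrow> v \<in> L2 \<Omega>"
  and V_grad_L2: "v \<in> V \<Omega> \<Longrightarrow> grad \<Omega> v \<in> L2 \<Omega>"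
  by (simp_all add: V_H1 H1_grad)

lemma test_functions_lincomb:
  assumes "\<phi> \<in> test_functions S" "\<psi> \<in> test_functions S"
  shows "(\<lambda>x. a *\<^sub>R \<phi> x + b *\<^sub>R \<psi> x) \<in> test_functions S"
  using test_functions_diff[OF test_functions_scaleR[OF assms(1), of a] test_functions_scaleR[OF assms(2), of "-b"]]
  by simp

lemma L2_norm_lincomb_le:
  assumes "f \<in> L2 \<Omega>" "g \<in> L2 \<Omega>"
  shows "L2_norm \<Omega> (\<lambda>x. a *\<^sub>R f x + b *\<^sub>R g x) \<le> \<bar>a\<bar> * L2_norm \<Omega> f + \<bar>b\<bar> * L2_norm \<Omega> g"
proof -
  have 1: "(\<lambda>x. c *\<^sub>R h x) \<in> L2 \<Omega>" "L2_norm \<Omega> (\<lambda>x. c *\<^sub>R h x) \<le> \<bar>c\<bar> * L2_norm \<Omega> h"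
    if "h \<in> L2 \<Omega>" for h :: "real^'d \<Rightarrow> 'a" and c
  proof -
    have "(\<lambda>x. c *\<^sub>R h x) \<in> borel_measurable (lebesgue_on \<Omega>)" using L2_measurable[OF that] by simp
    from L2_dominated[OF that this, of "\<bar>c\<bar>"]
    show "(\<lambda>x. c *\<^sub>R h x) \<in> L2 \<Omega>" "L2_norm \<Omega> (\<lambda>x. c *\<^sub>R h x) \<le> \<bar>c\<bar> * L2_norm \<Omega> h" by auto
  qed
  have "(\<lambda>x. a *\<^sub>R f x + b *\<^sub>R g x) = (\<lambda>x. a *\<^sub>R f x) - (\<lambda>x. (-b) *\<^sub>R g x)"
    by (simp add: fun_eq_iff)
  then show ?thesis
    using L2_norm_triangle_minus[OF 1(1)[OF assms(1), of a] 1(1)[OF assms(2), of "-b"]]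
      1(2)[OF assms(1), of a] 1(2)[OF assms(2), of "-b"] by simp
qed

text \<open>The same combinations of the approximating test functions serve. The gradient of the
  combination is known only almost everywhere, hence the passage through
  \<open>L2_norm_cong_AE\<close>.\<close>

lemma V_lincomb:
  assumes "v \<in> V \<Omega>" "w \<in> V \<Omega>"
  shows "(\<lambda>x. a *\<^sub>R v x + b *\<^sub>R w x) \<in> V \<Omega>"
proof -
  obtain \<phi> where p: "\<And>n. \<phi> n \<in> test_functions \<Omega>" "(\<lambda>n. L2_norm \<Omega> (\<phi> n - v)) \<longlonglongrightarrow> 0"
      "(\<lambda>n. L2_norm \<Omega> (\<lambda>x. jacobian (\<phi> n) (at x) - grad \<Omega> v x)) \<longlonglongrightarrow> 0"
    using assms(1) by (auto simp: V_def)
  obtain \<psi> where q: "\<And>n. \<psi> n \<in> test_functions \<Omega>" "(\<lambda>n. L2_norm \<Omega> (\<psi> n - w)) \<longlonglongrightarrow> 0"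
      "(\<lambda>n. L2_norm \<Omega> (\<lambda>x. jacobian (\<psi> n) (at x) - grad \<Omega> w x)) \<longlonglongrightarrow> 0"
    using assms(2) by (auto simp: V_def)
  let ?z = "\<lambda>x. a *\<^sub>R v x + b *\<^sub>R w x" and ?p = "\<lambda>n x. a *\<^sub>R \<phi> n x + b *\<^sub>R \<psi> n x"
  note H = H1_lincomb[OF V_H1[OF assms(1)] V_H1[OF assms(2)], of a b]
  have lim: "(\<lambda>n. \<bar>a\<bar> * f n + \<bar>b\<bar> * g n) \<longlonglongrightarrow> 0" if "f \<longlonglongrightarrow> 0" "g \<longlonglongrightarrow> 0" for f g :: "nat \<Rightarrow> real"
    using tendsto_add[OF tendsto_mult[OF tendsto_const that(1)] tendsto_mult[OF tendsto_const that(2)], of "\<bar>a\<bar>" "\<bar>b\<bar>"]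
    by simp
  have 1: "L2_norm \<Omega> (?p n - ?z) \<le> \<bar>a\<bar> * L2_norm \<Omega> (\<phi> n - v) + \<bar>b\<bar> * L2_norm \<Omega> (\<psi> n - w)" for n
  proof -
    have "?p n - ?z = (\<lambda>x. a *\<^sub>R (\<phi> n - v) x + b *\<^sub>R (\<psi> n - w) x)"
      by (simp add: fun_eq_iff algebra_simps)
    then show ?thesis
      using L2_norm_lincomb_le[OF L2_minus[OF test_L2[OF p(1)] V_L2[OF assms(1)]] L2_minus[OF test_L2[OF q(1)] V_L2[OF assms(2)]]]
      by simp
  qed
  have 2: "L2_norm \<Omega> (\<lambda>x. jacobian (?p n) (at x) - grad \<Omega> ?z x) \<le>
      \<bar>a\<bar> * L2_norm \<Omega> (\<lambda>x. jacobian (\<phi> n) (at x) - grad \<Omega> v x) + \<bar>b\<bar> * L2_norm \<Omega> (\<lambda>x. jacobian (\<psi> n) (at x) - grad \<Omega> w x)" for n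
  proof -
    have "L2_norm \<Omega> (\<lambda>x. jacobian (?p n) (at x) - grad \<Omega> ?z x) =
        L2_norm \<Omega> (\<lambda>x. a *\<^sub>R (jacobian (\<phi> n) (at x) - grad \<Omega> v x) + b *\<^sub>R (jacobian (\<psi> n) (at x) - grad \<Omega> w x))"
    proof (rule L2_norm_cong_AE)
      show "AE x in lebesgue_on \<Omega>. jacobian (?p n) (at x) - grad \<Omega> ?z x =
          a *\<^sub>R (jacobian (\<phi> n) (at x) - grad \<Omega> v x) + b *\<^sub>R (jacobian (\<psi> n) (at x) - grad \<Omega> w x)"
        using H(2) by eventually_elim (simp add: jacobian_lincomb[OF p(1) q(1)] algebra_simps)
    qed (intro L2_measurable L2_lincomb L2_diff jacobian_L2(1) p(1) q(1) V_grad_L2 H1_grad(2)[OF H(1)]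
          assms test_functions_lincomb)+
    then show ?thesis
      using L2_norm_lincomb_le[OF L2_diff[OF jacobian_L2(1)[OF p(1)] V_grad_L2[OF assms(1)]] L2_diff[OF jacobian_L2(1)[OF q(1)] V_grad_L2[OF assms(2)]]]
      by simp
  qed
  show ?thesis
    unfolding V_def
  proof (intro CollectI conjI H(1) exI[of _ ?p] allI)
    show "?p n \<in> test_functions \<Omega>" for n by (rule test_functions_lincomb[OF p(1) q(1)])
    show "(\<lambda>n. L2_norm \<Omega> (?p n - ?z)) \<longlonglongrightarrow> 0"
      by (rule tendsto_sandwich[OF _ _ tendsto_const lim[OF p(2) q(2)]]) (use 1 in \<open>simp_all add: always_eventually\<close>)
    show "(\<lambda>n. L2_norm \<Omega> (\<lambda>x. jacobian (?p n) (at x) - grad \<Omega> ?z x)) \<longlonglongrightarrow> 0"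
      by (rule tendsto_sandwich[OF _ _ tendsto_const lim[OF p(3) q(3)]]) (use 2 in \<open>simp_all add: always_eventually\<close>)
  qed
qed

lemma V_norm_lincomb:
  assumes "v \<in> V \<Omega>" "w \<in> V \<Omega>"
  shows "V_norm \<Omega> (\<lambda>x. a *\<^sub>R v x + b *\<^sub>R w x) = L2_norm \<Omega> (\<lambda>x. a *\<^sub>R grad \<Omega> v x + b *\<^sub>R grad \<Omega> w x)"
  unfolding V_norm_def
  by (rule L2_norm_cong_AE[OF H1_lincomb(2)[OF V_H1[OF assms(1)] V_H1[OF assms(2)]]])
     (intro L2_measurable V_grad_L2 V_lincomb L2_lincomb assms)+

lemma V_diff:
  assumes "v \<in> V \<Omega>" "w \<in> V \<Omega>"
  shows "v - w \<in> V \<Omega>" "V_norm \<Omega> (v - w) = L2_norm \<Omega> (grad \<Omega> v - grad \<Omega> w)"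
    "AE x in lebesgue_on \<Omega>. grad \<Omega> (v - w) x = grad \<Omega> v x - grad \<Omega> w x"
  using V_lincomb[OF assms, of 1 "-1"] V_norm_lincomb[OF assms, of 1 "-1"]
    H1_lincomb(2)[OF V_H1[OF assms(1)] V_H1[OF assms(2)], of 1 "-1"]
  by (simp_all add: fun_diff_def)

lemma V_zero: "(\<lambda>x. 0) \<in> V \<Omega>"
proof -
  have z: "(\<lambda>x. 0::'b::euclidean_space) \<in> test_functions \<Omega>" for \<Omega> :: "'a::euclidean_space set"
    by (auto simp: test_functions_def Ck_const)
  have w: "weak_gradient \<Omega> (\<lambda>x. 0) (\<lambda>x. 0)" by (simp add: weak_gradient_def)
  have H: "(\<lambda>x. 0) \<in> H1 \<Omega>" using w by (auto simp: H1_def L2_zero)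
  have g: "AE x in lebesgue_on \<Omega>. grad \<Omega> (\<lambda>x. 0) x = 0"
    by (rule weak_gradient_unique[OF H1_grad(2,3)[OF H] L2_zero w])
  have J: "jacobian (\<lambda>x::real^'d. 0::real^'d) (at x) = 0" for x
    by (simp add: jacobian_def frechet_derivative_const matrix_def vec_eq_iff)
  have "L2_norm \<Omega> (\<lambda>x. - grad \<Omega> (\<lambda>x. 0) x) = L2_norm \<Omega> (\<lambda>x. 0 :: real^'d^'d)"
    by (rule L2_norm_cong_AE) (use g L2_measurable[OF H1_grad(2)[OF H]] in auto)
  then show ?thesis
    unfolding V_def using H z
    by (auto simp: J L2_norm_zero fun_diff_def intro!: exI[of _ "\<lambda>n x. 0"])
qed

lemma V_norm_zero: "V_norm \<Omega> (\<lambda>x. 0) = 0"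
  using V_norm_lincomb[OF V_zero V_zero, of 0 0] by (simp add: L2_norm_zero)

lemma V_norm_nonneg[simp]: "0 \<le> V_norm \<Omega> v" by (simp add: V_norm_def)

text \<open>Both sides of the inequality for test functions are continuous along an approximating
  sequence. The constant 2 R combines the factor 2 from differentiating the square with the bound R
  on the coordinate.\<close>

lemma Poincare:
  obtains C where "C \<ge> 0" "\<And>v. v \<in> V \<Omega> \<Longrightarrow> L2_norm \<Omega> v \<le> C * V_norm \<Omega> v"
proof -
  obtain R where R: "\<And>x. x \<in> \<Omega> \<Longrightarrow> norm x \<le> R" "R > 0"
    using bounded_dom by (auto simp: bounded_pos)
  show ?thesis
  proof (rule that[of "2 * R"])
    show "2 * R \<ge> 0" using R by simp
    fix v assume v: "v \<in> V \<Omega>"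
    obtain \<phi> where p: "\<And>n. \<phi> n \<in> test_functions \<Omega>" "(\<lambda>n. L2_norm \<Omega> (\<phi> n - v)) \<longlonglongrightarrow> 0"
        "(\<lambda>n. L2_norm \<Omega> (\<lambda>x. jacobian (\<phi> n) (at x) - grad \<Omega> v x)) \<longlonglongrightarrow> 0"
      using v by (auto simp: V_def)
    note L = test_L2[OF p(1)] jacobian_L2(1)[OF p(1)] V_L2[OF v] V_grad_L2[OF v]
    have "L2_norm \<Omega> v \<le> L2_norm \<Omega> (\<phi> n - v) + 2 * R * (L2_norm \<Omega> (\<lambda>x. jacobian (\<phi> n) (at x) - grad \<Omega> v x) + V_norm \<Omega> v)" for n
    proof -
      have 1: "L2_norm \<Omega> f \<le> L2_norm \<Omega> (g - f) + L2_norm \<Omega> g" if "f \<in> L2 \<Omega>" "g \<in> L2 \<Omega>" for f g :: "real^'d \<Rightarrow> 'e::euclidean_space"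
      proof -
        have "f = g - (g - f)" by (simp add: fun_eq_iff)
        then show ?thesis using L2_norm_triangle_minus[OF that(2) L2_minus[OF that(2,1)]] by simp
      qed
      have "L2_norm \<Omega> v \<le> L2_norm \<Omega> (\<phi> n - v) + L2_norm \<Omega> (\<phi> n)" by (rule 1[OF L(3) L(1)])
      moreover have "L2_norm \<Omega> (\<phi> n) \<le> 2 * R * L2_norm \<Omega> (\<lambda>x. jacobian (\<phi> n) (at x))"
        by (rule Poincare_test[OF p(1)]) (use R in auto)
      moreover have "L2_norm \<Omega> (\<lambda>x. jacobian (\<phi> n) (at x)) \<le> L2_norm \<Omega> (\<lambda>x. jacobian (\<phi> n) (at x) - grad \<Omega> v x) + V_norm \<Omega> v"
        using 1[OF L(2)[of n] L(4)] L2_norm_minus_commute[of \<Omega> "grad \<Omega> v" "\<lambda>x. jacobian (\<phi> n) (at x)"]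
        by (simp add: V_norm_def fun_diff_def)
      then have "2 * R * L2_norm \<Omega> (\<lambda>x. jacobian (\<phi> n) (at x)) \<le> 2 * R * (L2_norm \<Omega> (\<lambda>x. jacobian (\<phi> n) (at x) - grad \<Omega> v x) + V_norm \<Omega> v)"
        using R by simp
      ultimately show ?thesis by linarith
    qed
    moreover have "(\<lambda>n. L2_norm \<Omega> (\<phi> n - v) + 2 * R * (L2_norm \<Omega> (\<lambda>x. jacobian (\<phi> n) (at x) - grad \<Omega> v x) + V_norm \<Omega> v))
        \<longlonglongrightarrow> 0 + 2 * R * (0 + V_norm \<Omega> v)"
      by (intro tendsto_intros p)
    ultimately show "L2_norm \<Omega> v \<le> 2 * R * V_norm \<Omega> v"
      by (intro LIMSEQ_le_const[of _ "2 * R * V_norm \<Omega> v"]) auto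
  qed
qed

section \<open>The dual space and its norm\<close>

lemma V_dual_diff_arg:
  assumes "F \<in> V_dual \<Omega>" "v \<in> V \<Omega>" "w \<in> V \<Omega>"
  shows "F (v - w) = F v - F w"
proof -
  have "F (\<lambda>x. 1 *\<^sub>R v x + (-1) *\<^sub>R w x) = 1 * F v + (-1) * F w"
    using assms unfolding V_dual_def by blast
  then show ?thesis by (simp add: fun_diff_def)
qed

lemma V_dual_scale_arg:
  assumes "F \<in> V_dual \<Omega>" "v \<in> V \<Omega>"
  shows "F (\<lambda>x. c *\<^sub>R v x) = c * F v"
proof -
  have "F (\<lambda>x. c *\<^sub>R v x + 0 *\<^sub>R v x) = c * F v + 0 * F v"
    using assms unfolding V_dual_def by blast
  then show ?thesis by simp
qed

lemma V_dual_norm_bdd: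
  assumes "F \<in> V_dual \<Omega>" shows "bdd_above ((\<lambda>v. \<bar>F v\<bar>) ` {v \<in> V \<Omega>. V_norm \<Omega> v \<le> 1})"
proof -
  obtain C where C: "\<And>v. v \<in> V \<Omega> \<Longrightarrow> \<bar>F v\<bar> \<le> C * V_norm \<Omega> v"
    using assms unfolding V_dual_def by blast
  show ?thesis
  proof (rule bdd_aboveI2[of _ _ "\<bar>C\<bar>"])
    fix v assume v: "v \<in> {v \<in> V \<Omega>. V_norm \<Omega> v \<le> 1}"
    have "C * V_norm \<Omega> v \<le> \<bar>C\<bar> * 1" using v by (intro mult_mono) auto
    with C[of v] v show "\<bar>F v\<bar> \<le> \<bar>C\<bar>" by auto
  qed
qed

text \<open>For positive norm v is scaled to the unit ball. A v of norm zero cannot be scaled; there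
  the boundedness constant in \<open>V_dual\<close> gives F v = 0.\<close>

lemma V_dual_le:
  assumes F: "F \<in> V_dual \<Omega>" and v: "v \<in> V \<Omega>"
  shows "\<bar>F v\<bar> \<le> V_dual_norm \<Omega> F * V_norm \<Omega> v"
proof (cases "V_norm \<Omega> v = 0")
  case True
  then show ?thesis using F v by (fastforce simp: V_dual_def)
next
  case False
  let ?c = "1 / V_norm \<Omega> v"
  have pos: "V_norm \<Omega> v > 0" using False V_norm_nonneg[of v] by linarith
  have "(\<lambda>x. ?c *\<^sub>R v x) \<in> V \<Omega>" using V_lincomb[OF v v, of ?c 0] by simp
  moreover have "V_norm \<Omega> (\<lambda>x. ?c *\<^sub>R v x) \<le> 1"
    using V_norm_lincomb[OF v v, of ?c 0] L2_norm_lincomb_le[OF V_grad_L2[OF v] V_grad_L2[OF v], of ?c 0] pos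
    by (simp add: V_norm_def)
  ultimately have "\<bar>F (\<lambda>x. ?c *\<^sub>R v x)\<bar> \<le> V_dual_norm \<Omega> F"
    unfolding V_dual_norm_def by (intro cSUP_upper V_dual_norm_bdd F) auto
  then show ?thesis using pos by (simp add: V_dual_scale_arg[OF F v] abs_mult field_simps)
qed

lemma V_dual_norm_least:
  assumes "\<And>v. v \<in> V \<Omega> \<Longrightarrow> V_norm \<Omega> v \<le> 1 \<Longrightarrow> \<bar>F v\<bar> \<le> C"
  shows "V_dual_norm \<Omega> F \<le> C"
  unfolding V_dual_norm_def
  by (rule cSUP_least) (use V_zero V_norm_zero assms in \<open>auto intro!: exI[of _ "\<lambda>x. 0"]\<close>)

lemma V_dual_norm_nonneg: 
  assumes "F \<in> V_dual \<Omega>" shows "V_dual_norm \<Omega> F \<ge> 0"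
proof -
  have "\<bar>F (\<lambda>x. 0)\<bar> \<le> V_dual_norm \<Omega> F"
    unfolding V_dual_norm_def by (intro cSUP_upper V_dual_norm_bdd assms) (use V_zero V_norm_zero in auto)
  then show ?thesis by linarith
qed

lemma V_dual_diff:
  assumes F: "F \<in> V_dual \<Omega>" and G: "G \<in> V_dual \<Omega>"
  shows "F - G \<in> V_dual \<Omega>"
proof -
  have "\<bar>(F - G) v\<bar> \<le> (V_dual_norm \<Omega> F + V_dual_norm \<Omega> G) * V_norm \<Omega> v" if "v \<in> V \<Omega>" for v
    using V_dual_le[OF F that] V_dual_le[OF G that] by (simp add: distrib_right)
  moreover have "(F - G) (\<lambda>x. a *\<^sub>R v x + b *\<^sub>R w x) = a * (F - G) v + b * (F - G) w"
    if "v \<in> V \<Omega>" "w \<in> V \<Omega>" for a b v w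
    using F G that unfolding V_dual_def by (simp add: algebra_simps)
  ultimately show ?thesis unfolding V_dual_def by blast
qed

lemma V_dual_norm_triangle:
  assumes F: "F \<in> V_dual \<Omega>" and G: "G \<in> V_dual \<Omega>" and H: "H \<in> V_dual \<Omega>"
  shows "V_dual_norm \<Omega> (F - H) \<le> V_dual_norm \<Omega> (F - G) + V_dual_norm \<Omega> (G - H)"
proof (rule V_dual_norm_least)
  fix v assume v: "v \<in> V \<Omega>" "V_norm \<Omega> v \<le> 1"
  have "\<bar>A v\<bar> \<le> V_dual_norm \<Omega> A" if "A \<in> V_dual \<Omega>" for A
    using V_dual_le[OF that v(1)] mult_left_le[OF v(2) V_dual_norm_nonneg[OF that]] by simp
  from this[OF V_dual_diff[OF F G]] this[OF V_dual_diff[OF G H]]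
  show "\<bar>(F - H) v\<bar> \<le> V_dual_norm \<Omega> (F - G) + V_dual_norm \<Omega> (G - H)" by simp
qed

lemma V_dual_norm_commute: "V_dual_norm \<Omega> (F - G) = V_dual_norm \<Omega> (G - F)"
  by (simp add: V_dual_norm_def abs_minus_commute)

lemma V_dual_zero: "(\<lambda>v. 0) \<in> V_dual \<Omega>" "V_dual_norm \<Omega> (\<lambda>v. 0) = 0"
proof -
  show z: "(\<lambda>v. 0) \<in> V_dual \<Omega>" by (auto simp: V_dual_def intro!: exI[of _ 0])
  show "V_dual_norm \<Omega> (\<lambda>v. 0) = 0"
    using V_dual_norm_least[of "\<lambda>v. 0" 0] V_dual_norm_nonneg[OF z] by simp
qed

end

text \<open>The common frame of \<open>L2\<close>, \<open>V\<close> and \<open>V_dual\<close>, which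
  are sets of representatives and not vector spaces modulo null functions. The axioms are relative
  to X because \<open>V_dual_norm\<close> is a real supremum and has no meaning for unbounded
  functionals.\<close>

locale seminormed_set =
  fixes X :: "('a \<Rightarrow> 'b::real_vector) set" and N :: "('a \<Rightarrow> 'b) \<Rightarrow> real"
  assumes zero_mem: "(\<lambda>_. 0) \<in> X" and diff_mem: "f \<in> X \<Longrightarrow> g \<in> X \<Longrightarrow> f - g \<in> X"
    and N_zero: "N (\<lambda>_. 0) = 0" and N_nonneg: "f \<in> X \<Longrightarrow> 0 \<le> N f"
    and N_commute: "f \<in> X \<Longrightarrow> g \<in> X \<Longrightarrow> N (f - g) = N (g - f)"
    and N_triangle: "f \<in> X \<Longrightarrow> g \<in> X \<Longrightarrow> h \<in> X \<Longrightarrow> N (f - h) \<le> N (f - g) + N (g - h)"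

lemma seminormed_set_L2: "seminormed_set (L2 S) (L2_norm S)"
  by unfold_locales (auto intro: L2_zero L2_norm_zero L2_minus L2_norm_minus_commute L2_norm_triangle)

context bounded_open
begin

lemma seminormed_set_V: "seminormed_set (V \<Omega>) (V_norm \<Omega>)"
  by unfold_locales
     (auto simp: V_diff V_zero V_norm_zero L2_norm_minus_commute intro!: L2_norm_triangle V_grad_L2)

lemma seminormed_set_V_dual: "seminormed_set (V_dual \<Omega>) (V_dual_norm \<Omega>)"
  by unfold_locales
     (auto simp: V_dual_zero V_dual_norm_nonneg V_dual_norm_commute intro!: V_dual_norm_triangle V_dual_diff)

end

section \<open>Square integrable vector-valued functions and mollification\<close>

lemma AE_lborel_null_set:
  assumes "AE x in lborel. P x"
  shows "\<exists>N\<in>null_sets lborel. \<forall>x. x \<notin> N \<longrightarrow> P x"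
proof -
  from assms have "\<exists>N\<in>null_sets lborel. {x. \<not> P x} \<subseteq> N"
    by (simp add: eventually_ae_filter)
  then show ?thesis by blast
qed

text \<open>A normalised bump on the open interval from 0 to 1/(j+1). The support is one-sided:
  \<open>kern j (s - t)\<close> differs from 0 only for t < s, so the diagonal is never
  touched.\<close>

definition kern :: "nat \<Rightarrow> real \<Rightarrow> real" where
  "kern j t = box_bump 0 (inverse (real (Suc j))) 0 t / (LINT t|lborel. box_bump 0 (inverse (real (Suc j))) 0 t)"

lemma kern_bump_pos: "0 < (LINT t|lborel. box_bump 0 (inverse (real (Suc j))) 0 t)"
proof -
  let ?h = "inverse (real (Suc j))" 
  let ?b = "box_bump 0 ?h 0"
  have I: "integrable lborel ?b"
    by (rule test_functions_integrable[OF box_bump_test[of 0 ?h UNIV]]) simp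
  have pos: "?b t > 0" if "t \<in> {0<..<?h}" for t
    using that by (auto simp: box_bump_def flat_exp_def)
  have "(LINT t|lborel. ?b t) \<noteq> 0"
  proof
    assume "(LINT t|lborel. ?b t) = 0"
    then have "AE t in lborel. ?b t = 0"
      by (subst (asm) integral_nonneg_eq_0_iff_AE[OF I]) (simp_all add: box_bump_bounds)
    then have "AE t in lborel. t \<notin> {0<..<?h}"
      by eventually_elim (use pos in force)
    then have "{0<..<?h} \<in> null_sets lborel"
      by (subst (asm) AE_iff_null_sets[symmetric]) auto
    then show False by auto
  qed
  moreover have "(LINT t|lborel. ?b t) \<ge> 0"
    by (rule Bochner_Integration.integral_nonneg) (simp add: box_bump_bounds)
  ultimately show ?thesis by simp
qed

lemma kern_nonneg: "0 \<le> kern j t"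
  using kern_bump_pos[of j] by (simp add: kern_def box_bump_bounds)

lemma kern_outside: "t \<notin> {0<..<inverse (real (Suc j))} \<Longrightarrow> kern j t = 0"
  using box_bump_outside[of t 0 "inverse (real (Suc j))" 0] by (simp add: kern_def box_real)

lemma kern_test: "kern j \<in> test_functions {0..inverse (real (Suc j))}"
  using test_functions_scaleR[OF box_bump_test[of 0 "inverse (real (Suc j))" "{0..inverse (real (Suc j))}" 0],
      of "1 / (LINT t|lborel. box_bump 0 (inverse (real (Suc j))) 0 t)"]
  by (simp add: kern_def[abs_def])

lemma kern_measurable[measurable]: "kern j \<in> borel_measurable borel"
  by (rule test_functions_measurable[OF kern_test])

lemma kern_integrable: "integrable lborel (kern j)"
  by (rule test_functions_integrable[OF kern_test])

lemma kern_integral: "(LINT t|lborel. kern j t) = 1"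
  using kern_bump_pos[of j] by (simp add: kern_def)

lemma kern_nn_integral: "(\<integral>\<^sup>+t. ennreal (kern j t) \<partial>lborel) = 1"
  by (subst nn_integral_eq_integral) (auto simp: kern_integrable kern_integral kern_nonneg)

lemma kern_nn_integral_left: "(\<integral>\<^sup>+s. ennreal (kern j (s - t)) \<partial>lborel) = 1"
  using nn_integral_real_affine[of "\<lambda>s. ennreal (kern j s)" 1 "-t"] kern_nn_integral[of j]
  by (simp add: algebra_simps)

lemma kern_nn_integral_right: "(\<integral>\<^sup>+t. ennreal (kern j (s - t)) \<partial>lborel) = 1"
  using nn_integral_real_affine[of "\<lambda>t. ennreal (kern j t)" "-1" s] kern_nn_integral[of j]
  by simp

lemma kern_conv_fst:
  fixes h :: "real \<Rightarrow> ennreal"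
  assumes [measurable]: "h \<in> borel_measurable borel"
  shows "(\<integral>\<^sup>+s. \<integral>\<^sup>+t. ennreal (kern j (s - t)) * h s \<partial>lborel \<partial>lborel) = (\<integral>\<^sup>+s. h s \<partial>lborel)"
  by (simp add: nn_integral_multc kern_nn_integral_right)

lemma kern_conv_snd:
  fixes h :: "real \<Rightarrow> ennreal"
  assumes [measurable]: "h \<in> borel_measurable borel"
  shows "(\<integral>\<^sup>+s. \<integral>\<^sup>+t. ennreal (kern j (s - t)) * h t \<partial>lborel \<partial>lborel) = (\<integral>\<^sup>+s. h s \<partial>lborel)"
proof -
  have "(\<integral>\<^sup>+s. \<integral>\<^sup>+t. ennreal (kern j (s - t)) * h t \<partial>lborel \<partial>lborel) = (\<integral>\<^sup>+t. \<integral>\<^sup>+s. ennreal (kern j (s - t)) * h t \<partial>lborel \<partial>lborel)"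
    by (rule lborel_pair.Fubini') measurable
  then show ?thesis by (simp add: nn_integral_multc kern_nn_integral_left)
qed


text \<open>As the kernel has mass one in each variable separately, this is a weighted mean over the
  strip 0 < s - t < 1/(j+1). With values in \<open>ennreal\<close>, additivity and Fubini require
  measurability only.\<close>

definition kdbl :: "nat \<Rightarrow> (real \<Rightarrow> real \<Rightarrow> ennreal) \<Rightarrow> ennreal" where
  "kdbl j f = (\<integral>\<^sup>+s. \<integral>\<^sup>+t. ennreal (kern j (s - t)) * f s t \<partial>lborel \<partial>lborel)"

lemma kdbl_mono: "(\<And>s t. kern j (s - t) \<noteq> 0 \<Longrightarrow> f s t \<le> g s t) \<Longrightarrow> kdbl j f \<le> kdbl j g"
  unfolding kdbl_def by (intro nn_integral_mono) (metis ennreal_0 mult_left_mono mult_zero_left zero_le)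

lemma kdbl_add:
  assumes [measurable]: "(\<lambda>(s, t). f s t) \<in> borel_measurable (lborel \<Otimes>\<^sub>M lborel)"
    "(\<lambda>(s, t). g s t) \<in> borel_measurable (lborel \<Otimes>\<^sub>M lborel)"
  shows "kdbl j (\<lambda>s t. f s t + g s t) = kdbl j f + kdbl j g"
  unfolding kdbl_def by (simp add: distrib_left nn_integral_add)

lemma kdbl_cmult:
  assumes [measurable]: "(\<lambda>(s, t). f s t) \<in> borel_measurable (lborel \<Otimes>\<^sub>M lborel)"
  shows "kdbl j (\<lambda>s t. c * f s t) = c * kdbl j f"
  unfolding kdbl_def by (simp add: mult.left_commute nn_integral_cmult)

lemma kdbl_sum:
  assumes "finite I" "\<And>i. i \<in> I \<Longrightarrow> (\<lambda>(s, t). f i s t) \<in> borel_measurable (lborel \<Otimes>\<^sub>M lborel)"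
  shows "kdbl j (\<lambda>s t. \<Sum>i\<in>I. f i s t) = (\<Sum>i\<in>I. kdbl j (f i))"
  using assms
proof (induction I rule: finite_induct)
  case empty
  then show ?case by (simp add: kdbl_def)
next
  case (insert x F)
  have "(\<lambda>(s, t). \<Sum>i\<in>F. f i s t) \<in> borel_measurable (lborel \<Otimes>\<^sub>M lborel)"
    using insert.prems by (simp add: split_beta' borel_measurable_sum)
  with insert show ?case by (simp add: kdbl_add)
qed

lemma kdbl_fst: "h \<in> borel_measurable borel \<Longrightarrow> kdbl j (\<lambda>s t. h s) = (\<integral>\<^sup>+s. h s \<partial>lborel)"
  and kdbl_snd: "h \<in> borel_measurable borel \<Longrightarrow> kdbl j (\<lambda>s t. h t) = (\<integral>\<^sup>+s. h s \<partial>lborel)"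
  unfolding kdbl_def by (simp_all add: kern_conv_fst kern_conv_snd)

text \<open>Continuity of translations for an indicator. A lies between a compact K and an open U at
  positive distance d from each other's complement; once the kernel is shorter than d, points s and
  t separated by A have at least one member in U - K. This set has measure at most e/2 and is
  counted once for each variable.\<close>

lemma kern_set_small:
  fixes A :: "real set"
  assumes A: "A \<in> sets borel" "bounded A" and e: "e > 0"
  shows "\<forall>\<^sub>F j in sequentially. kdbl j (\<lambda>s t. ennreal \<bar>indicator A s - indicator A t\<bar>) \<le> ennreal e"
proof -
  have AL: "A \<in> sets lebesgue" using A(1) by simp
  have e4: "0 < e / 4" using e by simp
  obtain U where U: "open U" "A \<subseteq> U" "emeasure lebesgue (U - A) < ennreal (e/4)"
    by (rule sets_lebesgue_outer_open[OF AL e4])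
  obtain K where K: "closed K" "K \<subseteq> A" "emeasure lebesgue (A - K) < ennreal (e/4)"
    by (rule sets_lebesgue_inner_closed[OF AL e4])
  have cK: "compact K" using K A(2) by (simp add: compact_eq_bounded_closed bounded_subset)
  obtain d where d: "d > 0" "\<And>x y. x \<in> K \<Longrightarrow> y \<in> - U \<Longrightarrow> d \<le> dist x y"
  proof -
    have "K \<inter> - U = {}" "closed (- U)" using U(1,2) K(2) by auto
    from separate_compact_closed[OF cK this(2,1)] show ?thesis using that by blast
  qed
  have UK: "U - K \<in> sets borel" using U K by auto
  have "emeasure lborel (U - K) \<le> ennreal (e/2)"
  proof -
    have "emeasure lborel (U - K) = emeasure lebesgue ((U - A) \<union> (A - K))"
    proof -
      have "(U - A) \<union> (A - K) = U - K" using U(2) K(2) by auto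
      then show ?thesis using UK by simp
    qed
    also have "\<dots> \<le> emeasure lebesgue (U - A) + emeasure lebesgue (A - K)"
      by (rule emeasure_subadditive) (use AL U(1) K(1) in auto)
    also have "\<dots> \<le> ennreal (e/4) + ennreal (e/4)"
      using U(3) K(3) by (intro add_mono) auto
    also have "\<dots> = ennreal (e/2)" using e by (simp flip: ennreal_plus)
    finally show ?thesis .
  qed
  have "\<forall>\<^sub>F j in sequentially. inverse (real (Suc j)) < d"
    using order_tendstoD(2)[OF LIMSEQ_inverse_real_of_nat d(1)] .
  then show ?thesis
  proof eventually_elim
    case (elim j)
    have le: "ennreal \<bar>indicator A s - indicator A t\<bar> \<le> indicator (U - K) s + indicator (U - K) t"
      if "kern j (s - t) \<noteq> 0" for s t
    proof -
      have "dist s t < d" using that kern_outside[of "s - t" j] elim by (force simp: dist_real_def)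
      then have "t \<in> U" if "s \<in> K" using d(2)[of s t] that by force
      moreover have "s \<in> U" if "t \<in> K" using d(2)[of t s] that \<open>dist s t < d\<close> by (force simp: dist_commute)
      ultimately show ?thesis
        using U(2) K(2) by (auto simp: indicator_def)
    qed
    have [measurable]: "U - K \<in> sets borel" by (rule UK)
    have "kdbl j (\<lambda>s t. ennreal \<bar>indicator A s - indicator A t\<bar>) \<le> kdbl j (\<lambda>s t. indicator (U - K) s + indicator (U - K) t)"
      by (rule kdbl_mono[OF le])
    also have "\<dots> = kdbl j (\<lambda>s t. indicator (U - K) s) + kdbl j (\<lambda>s t. indicator (U - K) t)"
      by (rule kdbl_add) measurable
    also have "\<dots> = emeasure lborel (U - K) + emeasure lborel (U - K)"
      using UK by (simp add: kdbl_fst kdbl_snd)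
    also have "\<dots> \<le> ennreal (e/2) + ennreal (e/2)"
      by (intro add_mono) fact+
    also have "\<dots> = ennreal e" using e by (simp flip: ennreal_plus)
    finally show ?case .
  qed
qed

section \<open>Simple approximations in time and their means near the diagonal\<close>

context seminormed_set
begin

text \<open>Pointwise convergence serves the measurability proofs, convergence in mean square the
  estimates near the diagonal. All functions vanish outside the interval, so integrals may be taken
  over the whole line.\<close>

definition approx :: "real \<Rightarrow> (real \<Rightarrow> 'a \<Rightarrow> 'b) \<Rightarrow> (nat \<Rightarrow> real \<Rightarrow> 'a \<Rightarrow> 'b) \<Rightarrow> bool" where
  "approx T g s \<longleftrightarrow> (\<forall>t. g t \<in> X) \<and> (\<forall>n t. s n t \<in> X) \<and> (\<forall>n. simple_function lborel (s n)) \<and>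
     (\<forall>n t. t \<notin> {0<..<T} \<longrightarrow> g t = (\<lambda>_. 0) \<and> s n t = (\<lambda>_. 0)) \<and>
     (\<forall>t. (\<lambda>n. N (s n t - g t)) \<longlonglongrightarrow> 0) \<and> integrable lborel (\<lambda>t. (N (g t))\<^sup>2) \<and>
     (\<forall>n. integrable lborel (\<lambda>t. (N (s n t - g t))\<^sup>2)) \<and>
     (\<lambda>n. LINT t|lborel. (N (s n t - g t))\<^sup>2) \<longlonglongrightarrow> 0"

lemma N_diff_self: "f \<in> X \<Longrightarrow> N (f - f) = 0"
  using N_zero by (simp add: fun_diff_def)

lemma N_le_add: "f \<in> X \<Longrightarrow> g \<in> X \<Longrightarrow> N f \<le> N (f - g) + N g"
  using N_triangle[of f g "\<lambda>_. 0"] zero_mem by (simp add: fun_diff_def)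

lemma N_diff_le: "f \<in> X \<Longrightarrow> g \<in> X \<Longrightarrow> N (f - g) \<le> N f + N g"
  using N_triangle[of f "\<lambda>_. 0" g] N_commute[of "\<lambda>_. 0" g] zero_mem by (simp add: fun_diff_def)

lemma N_abs_diff: "f \<in> X \<Longrightarrow> g \<in> X \<Longrightarrow> \<bar>N f - N g\<bar> \<le> N (f - g)"
  using N_le_add[of f g] N_le_add[of g f] N_commute[of f g] by linarith

lemma N_tendsto:
  assumes "\<And>n. f n \<in> X" "g \<in> X" "(\<lambda>n. N (f n - g)) \<longlonglongrightarrow> 0"
  shows "(\<lambda>n. N (f n)) \<longlonglongrightarrow> N g"
proof -
  have "(\<lambda>n. N (f n) - N g) \<longlonglongrightarrow> 0"
    by (rule Lim_null_comparison[OF _ assms(3)]) (use N_abs_diff assms in auto)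
  then show ?thesis by (simp add: LIM_zero_iff)
qed

lemma N_diff_tendsto:
  assumes "\<And>n. f n \<in> X" "g \<in> X" "(\<lambda>n. N (f n - g)) \<longlonglongrightarrow> 0"
    and "\<And>n. f' n \<in> X" "g' \<in> X" "(\<lambda>n. N (f' n - g')) \<longlonglongrightarrow> 0"
  shows "(\<lambda>n. N (f n - f' n)) \<longlonglongrightarrow> N (g - g')"
proof -
  have "(\<lambda>n. N (f n - f' n) - N (g - g')) \<longlonglongrightarrow> 0"
  proof (rule Lim_null_comparison)
    show "(\<lambda>n. N (f n - g) + N (f' n - g')) \<longlonglongrightarrow> 0"
      using tendsto_add[OF assms(3,6)] by simp
    have "\<bar>N (f n - f' n) - N (g - g')\<bar> \<le> N (f n - g) + N (f' n - g')" for n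
    proof -
      note m = assms(1)[of n] assms(2) assms(4)[of n] assms(5)
      show ?thesis
        using N_triangle[OF m(1,2,3)] N_triangle[OF m(2,4,3)] N_triangle[OF m(2,1,4)] N_triangle[OF m(1,3,4)]
          N_commute[OF m(4,3)] N_commute[OF m(1,2)] by linarith
    qed
    then show "\<forall>\<^sub>F n in sequentially. norm (N (f n - f' n) - N (g - g')) \<le> N (f n - g) + N (f' n - g')"
      by simp
  qed
  then show ?thesis by (simp add: LIM_zero_iff)
qed

text \<open>Strongly measurable functions are replaced by everywhere defined ones with Borel measurable,
  everywhere convergent simple approximations, so that no completed product measure is needed.\<close>

lemma approx_exists:
  assumes g: "g \<in> bochner_L2 {0<..<T} X N"
  obtains g' s where "approx T g' s" "AE t in lborel. t \<in> {0<..<T} \<longrightarrow> g' t = g t"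
proof -
  let ?J = "{0<..<T}"
  have JL: "?J \<in> sets lebesgue" by simp
  obtain \<sigma> where \<sigma>: "\<And>n. simple_function (lebesgue_on ?J) (\<sigma> n)" "\<And>n. \<sigma> n ` ?J \<subseteq> X"
    "AE t in lebesgue_on ?J. (\<lambda>n. N (\<sigma> n t - g t)) \<longlonglongrightarrow> 0"
    and gX: "AE t in lebesgue_on ?J. g t \<in> X"
    and gI: "integrable (lebesgue_on ?J) (\<lambda>t. (N (g t))\<^sup>2)"
    using g unfolding bochner_L2_def by blast
  have "\<exists>\<tau>. simple_function lborel \<tau> \<and> (AE t in lborel. t \<in> ?J \<longrightarrow> \<sigma> n t = \<tau> t)" for n
  proof -
    have "simple_function lebesgue (\<lambda>t. if t \<in> ?J then \<sigma> n t else (\<lambda>_. 0))"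
      unfolding simple_function_def
    proof (intro conjI ballI)
      have "(\<lambda>t. if t \<in> ?J then \<sigma> n t else (\<lambda>_. 0)) ` space lebesgue \<subseteq> insert (\<lambda>_. 0) (\<sigma> n ` space (lebesgue_on ?J))"
        by auto
      then show "finite ((\<lambda>t. if t \<in> ?J then \<sigma> n t else (\<lambda>_. 0)) ` space lebesgue)"
        using \<sigma>(1)[of n] by (meson finite_insert finite_subset simple_function_def)
      fix x
      have "\<sigma> n -` {x} \<inter> ?J \<in> sets lebesgue"
      proof -
        have "\<sigma> n -` {x} \<inter> space (lebesgue_on ?J) \<in> sets (lebesgue_on ?J)"
          by (rule simple_functionD(2)[OF \<sigma>(1)])
        then show ?thesis using JL by (simp add: sets_restrict_space_iff)
      qed
      moreover have "(\<lambda>t. if t \<in> ?J then \<sigma> n t else (\<lambda>_. 0)) -` {x} \<inter> space lebesgue =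
          (\<sigma> n -` {x} \<inter> ?J) \<union> (if x = (\<lambda>_. 0) then - ?J else {})"
        by auto
      ultimately show "(\<lambda>t. if t \<in> ?J then \<sigma> n t else (\<lambda>_. 0)) -` {x} \<inter> space lebesgue \<in> sets lebesgue"
        using JL by (auto simp: Compl_in_sets_lebesgue intro!: sets.Un)
    qed
    from completion_ex_simple_function[OF this] obtain \<tau> where
      "simple_function lborel \<tau>" "AE t in lborel. (if t \<in> ?J then \<sigma> n t else (\<lambda>_. 0)) = \<tau> t" by blast
    moreover from this(2) have "AE t in lborel. t \<in> ?J \<longrightarrow> \<sigma> n t = \<tau> t"
      by eventually_elim auto
    ultimately show ?thesis by blast
  qed
  then have "\<exists>\<tau>. \<forall>n. simple_function lborel (\<tau> n) \<and> (AE t in lborel. t \<in> ?J \<longrightarrow> \<sigma> n t = \<tau> n t)"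
    by (intro choice allI)
  then obtain \<tau> where \<tau>: "\<And>n. simple_function lborel (\<tau> n)" "\<And>n. AE t in lborel. t \<in> ?J \<longrightarrow> \<sigma> n t = \<tau> n t"
    by blast
  have "AE t in lborel. t \<in> ?J \<longrightarrow> g t \<in> X \<and> (\<lambda>n. N (\<sigma> n t - g t)) \<longlonglongrightarrow> 0 \<and> (\<forall>n. \<sigma> n t = \<tau> n t)"
  proof -
    have "AE t in lborel. \<forall>n. t \<in> ?J \<longrightarrow> \<sigma> n t = \<tau> n t"
      unfolding AE_all_countable using \<tau>(2) by blast
    with gX \<sigma>(3) show ?thesis
      unfolding AE_lebesgue_on_iff[OF JL] by eventually_elim auto
  qed
  from AE_lborel_null_set[OF this] obtain N0 where N0':
    "N0 \<in> null_sets lborel"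
    "\<And>t. t \<notin> N0 \<Longrightarrow> t \<in> ?J \<longrightarrow> g t \<in> X \<and> (\<lambda>n. N (\<sigma> n t - g t)) \<longlonglongrightarrow> 0 \<and> (\<forall>n. \<sigma> n t = \<tau> n t)"
    by blast
  have N0: "N0 \<in> null_sets lborel"
    "\<And>t. t \<in> ?J \<Longrightarrow> t \<notin> N0 \<Longrightarrow> g t \<in> X \<and> (\<lambda>n. N (\<sigma> n t - g t)) \<longlonglongrightarrow> 0 \<and> (\<forall>n. \<sigma> n t = \<tau> n t)"
    using N0' by blast+
  \<comment> \<open>All exceptional null sets are collected in \<open>N0\<close>; the function and
    its approximations are set to zero there and outside the interval, which makes every later
    statement hold at each t.\<close>
  let ?G = "?J - N0"
  have G[measurable]: "?G \<in> sets lborel" using N0(1) by auto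
  define g' where "g' t = (if t \<in> ?G then g t else (\<lambda>_. 0))" for t
  define s0 where "s0 n t = (if t \<in> ?G then \<tau> n t else (\<lambda>_. 0))" for n t
  have g'X: "g' t \<in> X" for t using N0(2) zero_mem by (auto simp: g'_def)
  have s0X: "s0 n t \<in> X" for n t
  proof (cases "t \<in> ?G")
    case True
    then have "\<tau> n t = \<sigma> n t" using N0(2)[of t] by auto
    moreover have "\<sigma> n t \<in> X" using \<sigma>(2)[of n] True by blast
    ultimately show ?thesis using True by (simp add: s0_def)
  next
    case False
    then have "s0 n t = (\<lambda>_. 0)" unfolding s0_def by (rule if_not_P)
    then show ?thesis using zero_mem by simp
  qed
  have s0S: "simple_function lborel (s0 n)" for n
    unfolding s0_def[abs_def] by (rule simple_function_If_set[OF \<tau>(1)]) (use G in auto)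
  have s0lim: "(\<lambda>n. N (s0 n t - g' t)) \<longlonglongrightarrow> 0" for t
  proof (cases "t \<in> ?G")
    case True
    then have "s0 n t = \<sigma> n t" for n using N0(2)[of t] by (auto simp: s0_def)
    moreover have "g' t = g t" using True by (simp add: g'_def)
    moreover have "(\<lambda>n. N (\<sigma> n t - g t)) \<longlonglongrightarrow> 0" using N0(2)[of t] True by blast
    ultimately show ?thesis by (simp only:)
  next
    case False
    have "N (s0 n t - g' t) = 0" for n
      unfolding s0_def g'_def if_not_P[OF False] by (rule N_diff_self[OF zero_mem])
    then show ?thesis by simp
  qed
  have g'N[measurable]: "(\<lambda>t. N (g' t)) \<in> borel_measurable lborel"
  proof (rule borel_measurable_LIMSEQ_real)
    show "(\<lambda>n. N (s0 n t)) \<longlonglongrightarrow> N (g' t)" for t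
      by (rule N_tendsto[OF s0X g'X s0lim])
    show "(\<lambda>t. N (s0 n t)) \<in> borel_measurable lborel" for n
      by (rule borel_measurable_simple_function[OF simple_function_compose1[OF s0S]])
  qed
  \<comment> \<open>Truncation for dominated convergence: an approximation of norm larger than twice
    that of the limit is replaced by zero. Where the limit has positive norm this is eventually
    inactive; where it has norm zero the truncated approximation is at distance zero
    already.\<close>
  define s where "s n t = (if N (s0 n t) \<le> 2 * N (g' t) then s0 n t else (\<lambda>_. 0))" for n t
  have sX: "s n t \<in> X" for n t using s0X zero_mem by (simp add: s_def)
  have sS: "simple_function lborel (s n)" for n
  proof -
    have [measurable]: "(\<lambda>t. N (s0 n t)) \<in> borel_measurable lborel"
      by (rule borel_measurable_simple_function[OF simple_function_compose1[OF s0S]])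
    have "{t \<in> space lborel. N (s0 n t) \<le> 2 * N (g' t)} \<in> sets lborel" by measurable
    from simple_function_If[OF s0S _ this] show ?thesis
      unfolding s_def[abs_def] by simp
  qed
  have sle: "N (s n t) \<le> 2 * N (g' t)" for n t
    using N_nonneg[OF g'X, of t] N_zero by (simp add: s_def)
  have s3: "N (s n t - g' t) \<le> 3 * N (g' t)" for n t
    using N_diff_le[OF sX[of n t] g'X[of t]] sle[of n t] by linarith
  have slim: "(\<lambda>n. N (s n t - g' t)) \<longlonglongrightarrow> 0" for t
  proof (cases "N (g' t) = 0")
    case True
    then have "N (s n t - g' t) = 0" for n
      using s3[of n t] N_nonneg[OF diff_mem[OF sX[of n t] g'X[of t]]] by simp
    then show ?thesis by simp
  next
    case False
    then have pos: "N (g' t) < 2 * N (g' t)" using N_nonneg[OF g'X, of t] by linarith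
    have "\<forall>\<^sub>F n in sequentially. N (s0 n t) < 2 * N (g' t)"
      by (rule order_tendstoD(2)[OF N_tendsto[OF s0X g'X s0lim] pos])
    then have "\<forall>\<^sub>F n in sequentially. N (s0 n t - g' t) = N (s n t - g' t)"
      by eventually_elim (simp add: s_def)
    then show ?thesis by (rule Lim_transform_eventually[OF s0lim])
  qed
  have ae: "AE t in lborel. t \<in> ?J \<longrightarrow> g' t = g t"
    using AE_not_in[OF N0(1)] by eventually_elim (simp add: g'_def)
  have g'I: "integrable lborel (\<lambda>t. (N (g' t))\<^sup>2)"
  proof -
    have "integrable lebesgue (\<lambda>t. indicator ?J t *\<^sub>R (N (g t))\<^sup>2)"
      using gI by (simp only: lebesgue_on_integrable_iff(1)[OF JL])
    moreover have g'out: "g' t = (\<lambda>_. 0)" if "t \<notin> ?J" for t using that by (auto simp: g'_def)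
    have "AE t in lebesgue. indicator ?J t *\<^sub>R (N (g t))\<^sup>2 = (N (g' t))\<^sup>2"
      unfolding AE_completion_iff using ae
      by eventually_elim (auto simp: indicator_def N_zero g'out)
    moreover have "(\<lambda>t. (N (g' t))\<^sup>2) \<in> borel_measurable lebesgue"
      by (rule measurable_completion) measurable
    ultimately have "integrable lebesgue (\<lambda>t. (N (g' t))\<^sup>2)"
      by (subst integrable_cong_AE[symmetric]) auto
    then show ?thesis by (subst (asm) integrable_completion) auto
  qed
  have diffM: "(\<lambda>t. N (s n t - g' t)) \<in> borel_measurable lborel" for n
  proof (rule borel_measurable_LIMSEQ_real)
    show "(\<lambda>m. N (s n t - s m t)) \<longlonglongrightarrow> N (s n t - g' t)" for t
      by (rule N_diff_tendsto) (auto intro: sX g'X slim simp: N_diff_self[OF sX])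
    show "(\<lambda>t. N (s n t - s m t)) \<in> borel_measurable lborel" for m
      by (rule borel_measurable_simple_function[OF simple_function_compose2[OF sS sS]])
  qed
  have sq: "(N (s n t - g' t))\<^sup>2 \<le> 9 * (N (g' t))\<^sup>2" for n t
    using power_mono[OF s3[of n t] N_nonneg[OF diff_mem[OF sX[of n t] g'X[of t]]], of 2] by (simp add: power_mult_distrib)
  have "approx T g' s"
    unfolding approx_def
  proof (intro conjI allI impI g'X sX sS slim g'I)
    fix n t assume "t \<notin> ?J"
    then show "g' t = (\<lambda>_. 0)" "s n t = (\<lambda>_. 0)" by (auto simp: g'_def s_def s0_def)
  next
    fix n
    show "integrable lborel (\<lambda>t. (N (s n t - g' t))\<^sup>2)"
      by (rule Bochner_Integration.integrable_bound[of _ "\<lambda>t. 9 * (N (g' t))\<^sup>2"])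
         (use g'I diffM sq in auto)
  next
    have "(\<lambda>n. LINT t|lborel. (N (s n t - g' t))\<^sup>2) \<longlonglongrightarrow> (LINT t::real|lborel. 0\<^sup>2)"
    proof (rule integral_dominated_convergence[where w = "\<lambda>t. 9 * (N (g' t))\<^sup>2"])
      show "AE t in lborel. (\<lambda>n. (N (s n t - g' t))\<^sup>2) \<longlonglongrightarrow> 0\<^sup>2"
        by (intro AE_I2 tendsto_power slim)
    qed (use g'I diffM sq in auto)
    then show "(\<lambda>n. LINT t|lborel. (N (s n t - g' t))\<^sup>2) \<longlonglongrightarrow> 0" by simp
  qed
  then show ?thesis using ae by (rule that)
qed

text \<open>No measurability of N is assumed: composition with an arbitrary map keeps simple
  functions simple, also on the product space, and the general case is a pointwise limit.\<close>

lemma approx_measurable: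
  assumes "approx T g s"
  shows "(\<lambda>t. N (g t)) \<in> borel_measurable borel"
    "(\<lambda>t. N (s n t - g t)) \<in> borel_measurable borel"
    "(\<lambda>(a, b). N (s n a - s n b)) \<in> borel_measurable (lborel \<Otimes>\<^sub>M lborel)"
    "(\<lambda>(a, b). N (g a - g b)) \<in> borel_measurable (lborel \<Otimes>\<^sub>M lborel)"
proof -
  have gX: "g t \<in> X" and sX: "s n t \<in> X" and S: "simple_function lborel (s n)"
    and lim: "(\<lambda>n. N (s n t - g t)) \<longlonglongrightarrow> 0" for n t
    using assms by (auto simp: approx_def)
  have "(\<lambda>t. N (g t)) \<in> borel_measurable lborel"
  proof (rule borel_measurable_LIMSEQ_real)
    show "(\<lambda>n. N (s n t)) \<longlonglongrightarrow> N (g t)" for t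
      by (rule N_tendsto[OF sX gX lim])
    show "(\<lambda>t. N (s n t)) \<in> borel_measurable lborel" for n
      by (rule borel_measurable_simple_function[OF simple_function_compose1[OF S]])
  qed
  then show "(\<lambda>t. N (g t)) \<in> borel_measurable borel" by simp
  have "(\<lambda>t. N (s n t - g t)) \<in> borel_measurable lborel"
  proof (rule borel_measurable_LIMSEQ_real)
    show "(\<lambda>m. N (s n t - s m t)) \<longlonglongrightarrow> N (s n t - g t)" for t
      by (rule N_diff_tendsto) (auto intro: sX gX lim simp: N_diff_self[OF sX])
    show "(\<lambda>t. N (s n t - s m t)) \<in> borel_measurable lborel" for m
      by (rule borel_measurable_simple_function[OF simple_function_compose2[OF S S]])
  qed
  then show "(\<lambda>t. N (s n t - g t)) \<in> borel_measurable borel" by simp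
  have 1: "(\<lambda>p. N (s n (fst p) - s n (snd p))) \<in> borel_measurable (lborel \<Otimes>\<^sub>M lborel)" for n
    by (rule borel_measurable_simple_function[OF simple_function_compose2[where h = "\<lambda>x y. N (x - y)",
        OF simple_function_comp[OF measurable_fst S] simple_function_comp[OF measurable_snd S]]])
  then show "(\<lambda>(a, b). N (s n a - s n b)) \<in> borel_measurable (lborel \<Otimes>\<^sub>M lborel)"
    by (simp add: split_beta')
  have "(\<lambda>p. N (g (fst p) - g (snd p))) \<in> borel_measurable (lborel \<Otimes>\<^sub>M lborel)"
    by (rule borel_measurable_LIMSEQ_real[OF N_diff_tendsto[OF sX gX lim sX gX lim] 1])
  then show "(\<lambda>(a, b). N (g a - g b)) \<in> borel_measurable (lborel \<Otimes>\<^sub>M lborel)"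
    by (simp add: split_beta')
qed

text \<open>A simple function jumps only across the boundaries of its finitely many level sets, so
  the squared difference is at most 4 M^2 times a sum of differences of indicators, each handled by
  \<open>kern_set_small\<close>.\<close>

lemma approx_simple_kern:
  assumes ap: "approx T g s" and e: "e > 0"
  shows "\<forall>\<^sub>F j in sequentially. kdbl j (\<lambda>a b. ennreal ((N (s n a - s n b))\<^sup>2)) \<le> ennreal e"
proof -
  have sX: "s n t \<in> X" and S: "simple_function lborel (s n)" and out: "t \<notin> {0<..<T} \<Longrightarrow> s n t = (\<lambda>_. 0)" for t
    using ap by (auto simp: approx_def)
  \<comment> \<open>The level set of zero is unbounded and is left out; of two different values at
    least one is still in \<open>?R\<close>.\<close>
  let ?R = "range (s n) - {\<lambda>_. 0}"
  have fin: "finite (range (s n))" using simple_functionD(1)[OF S] by simp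
  define A where "A x = s n -` {x}" for x
  have A: "A x \<in> sets borel" for x using simple_functionD(2)[OF S, of "{x}"] by (simp add: A_def)
  have Ab: "bounded (A x)" if "x \<in> ?R" for x
  proof (rule bounded_subset)
    show "bounded {0<..<T}" by simp
    show "A x \<subseteq> {0<..<T}" using out that by (force simp: A_def)
  qed
  obtain M where M: "M > 0" "\<And>t. N (s n t) \<le> M"
  proof (rule that[of "1 + Max (N ` range (s n))"])
    have le: "N (s n t) \<le> Max (N ` range (s n))" for t using fin by (intro Max_ge) auto
    show "1 + Max (N ` range (s n)) > 0" using le[of 0] N_nonneg[OF sX, of 0] by linarith
    show "N (s n t) \<le> 1 + Max (N ` range (s n))" for t using le[of t] by linarith
  qed
  let ?c = "4 * M\<^sup>2"
  have c: "?c > 0" using M by simp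
  \<comment> \<open>The tolerance is shared among the level sets and divided by the factor 4 M^2;
    the summand 1 covers the case that there are none.\<close>
  define e' where "e' = e / (?c * (1 + real (card ?R)))"
  have e': "e' > 0" unfolding e'_def using e c by (intro divide_pos_pos mult_pos_pos add_pos_nonneg) auto
  have le: "ennreal ((N (s n a - s n b))\<^sup>2) \<le> ennreal ?c * (\<Sum>x\<in>?R. ennreal \<bar>indicator (A x) a - indicator (A x) b\<bar>)" for a b
  proof (cases "s n a = s n b")
    case True
    then show ?thesis using N_diff_self[OF sX, of b] by simp
  next
    case False
    have "N (s n a - s n b) \<le> 2 * M" using N_diff_le[OF sX[of a] sX[of b]] M(2)[of a] M(2)[of b] by linarith
    then have "(N (s n a - s n b))\<^sup>2 \<le> ?c"
      using power_mono[OF _ N_nonneg[OF diff_mem[OF sX[of a] sX[of b]]], of "2 * M" 2] by (simp add: power_mult_distrib)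
    then have "ennreal ((N (s n a - s n b))\<^sup>2) \<le> ennreal ?c * 1" by (simp add: ennreal_leI)
    also have "\<dots> \<le> ennreal ?c * (\<Sum>x\<in>?R. ennreal \<bar>indicator (A x) a - indicator (A x) b\<bar>)"
    proof (rule mult_left_mono)
      obtain x where x: "x \<in> ?R" "x = s n a \<or> x = s n b"
      proof (cases "s n a = (\<lambda>_. 0)")
        case True
        then show ?thesis using that[of "s n b"] False by auto
      next
        case False
        then show ?thesis using that[of "s n a"] by auto
      qed
      have "1 \<le> ennreal \<bar>indicator (A x) a - indicator (A x) b\<bar>"
        using x(2) False by (auto simp: A_def indicator_def)
      also have "\<dots> \<le> (\<Sum>x\<in>?R. ennreal \<bar>indicator (A x) a - indicator (A x) b\<bar>)"
        using fin x(1) by (intro member_le_sum) auto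
      finally show "1 \<le> (\<Sum>x\<in>?R. ennreal \<bar>indicator (A x) a - indicator (A x) b\<bar>)" .
    qed simp
    finally show ?thesis .
  qed
  have "\<forall>\<^sub>F j in sequentially. \<forall>x\<in>?R. kdbl j (\<lambda>a b. ennreal \<bar>indicator (A x) a - indicator (A x) b\<bar>) \<le> ennreal e'"
    using fin by (intro eventually_ball_finite ballI kern_set_small A Ab e') auto
  then show ?thesis
  proof eventually_elim
    case (elim j)
    have m: "(\<lambda>(a, b). ennreal \<bar>indicator (A x) a - indicator (A x) b\<bar>) \<in> borel_measurable (lborel \<Otimes>\<^sub>M lborel)" for x
    proof -
      have [measurable]: "A x \<in> sets borel" by (rule A)
      show ?thesis by measurable
    qed
    have "kdbl j (\<lambda>a b. ennreal ((N (s n a - s n b))\<^sup>2)) \<le>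
        kdbl j (\<lambda>a b. ennreal ?c * (\<Sum>x\<in>?R. ennreal \<bar>indicator (A x) a - indicator (A x) b\<bar>))"
      by (rule kdbl_mono[OF le])
    also have "\<dots> = ennreal ?c * kdbl j (\<lambda>a b. \<Sum>x\<in>?R. ennreal \<bar>indicator (A x) a - indicator (A x) b\<bar>)"
      using m by (intro kdbl_cmult) (simp add: split_beta' borel_measurable_sum)
    also have "\<dots> = ennreal ?c * (\<Sum>x\<in>?R. kdbl j (\<lambda>a b. ennreal \<bar>indicator (A x) a - indicator (A x) b\<bar>))"
      using fin by (subst kdbl_sum) (auto intro: m)
    also have "\<dots> \<le> ennreal ?c * (\<Sum>x\<in>?R. ennreal e')"
      using elim by (intro mult_left_mono sum_mono) auto
    also have "\<dots> = ennreal (?c * (real (card ?R) * e'))"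
      using e' c by (simp add: ennreal_mult ennreal_of_nat_eq_real_of_nat)
    also have "\<dots> \<le> ennreal e"
    proof (rule ennreal_leI)
      have "?c * (real (card ?R) * e') \<le> ?c * ((1 + real (card ?R)) * e')"
        using c e' by (intro mult_left_mono mult_right_mono) auto
      also have "\<dots> = e" using c by (simp add: e'_def add_pos_nonneg less_imp_neq[symmetric] field_simps)
      finally show "?c * (real (card ?R) * e') \<le> e" .
    qed
    finally show ?case .
  qed
qed

text \<open>One approximation s n is fixed with mean square error below e/9, and g(a) - g(b) is
  split at s n a and s n b. The square of a sum of three terms costs a factor 3, and each of the
  three means is at most e/9.\<close>

lemma approx_kern_tendsto:
  assumes ap: "approx T g s"
  shows "(\<lambda>j. kdbl j (\<lambda>a b. ennreal ((N (g a - g b))\<^sup>2))) \<longlonglongrightarrow> 0"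
proof -
  have gX: "g t \<in> X" and sX: "s n t \<in> X" for n t
    using ap by (auto simp: approx_def)
  note m = approx_measurable[OF ap]
  have ev: "\<forall>\<^sub>F j in sequentially. kdbl j (\<lambda>a b. ennreal ((N (g a - g b))\<^sup>2)) \<le> ennreal e" if e: "e > 0" for e
  proof -
    have "\<forall>\<^sub>F n in sequentially. (LINT t|lborel. (N (s n t - g t))\<^sup>2) < e / 9"
      using ap e by (intro order_tendstoD(2)[of _ 0]) (auto simp: approx_def)
    then obtain n where n: "(LINT t|lborel. (N (s n t - g t))\<^sup>2) < e / 9"
      by (auto simp: eventually_sequentially)
    have nn: "(\<integral>\<^sup>+t. ennreal ((N (s n t - g t))\<^sup>2) \<partial>lborel) \<le> ennreal (e / 9)"
      using ap n by (subst nn_integral_eq_integral) (auto simp: approx_def intro: ennreal_leI)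
    have e9: "e / 9 > 0" using e by simp
    show ?thesis
      using approx_simple_kern[OF ap e9, of n]
    proof eventually_elim
      case (elim j)
      let ?d = "\<lambda>t. ennreal ((N (s n t - g t))\<^sup>2)" and ?m = "\<lambda>a b. ennreal ((N (s n a - s n b))\<^sup>2)"
      have [measurable]: "?d \<in> borel_measurable borel" using m(2)[of n] by measurable
      have mm[measurable]: "(\<lambda>(a, b). ?m a b) \<in> borel_measurable (lborel \<Otimes>\<^sub>M lborel)"
        using m(3)[of n] by (simp add: split_beta')
      have le: "ennreal ((N (g a - g b))\<^sup>2) \<le> 3 * (?d a + (?m a b + ?d b))" for a b
      proof -
        let ?x = "N (s n a - g a)" and ?y = "N (s n a - s n b)" and ?z = "N (s n b - g b)"
        have "N (g a - g b) \<le> ?x + ?y + ?z"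
          using N_triangle[OF gX[of a] sX[of n a] gX[of b]] N_triangle[OF sX[of n a] sX[of n b] gX[of b]]
            N_commute[OF gX[of a] sX[of n a]] by linarith
        then have "(N (g a - g b))\<^sup>2 \<le> (?x + ?y + ?z)\<^sup>2"
          by (rule power_mono) (rule N_nonneg[OF diff_mem[OF gX gX]])
        also have "\<dots> \<le> 3 * (?x\<^sup>2 + (?y\<^sup>2 + ?z\<^sup>2))"
          using sum_squares_bound[of ?x ?y] sum_squares_bound[of ?x ?z] sum_squares_bound[of ?y ?z]
          by (simp add: power2_sum power2_eq_square algebra_simps)
        finally have "ennreal ((N (g a - g b))\<^sup>2) \<le> ennreal (3 * (?x\<^sup>2 + (?y\<^sup>2 + ?z\<^sup>2)))" by (rule ennreal_leI)
        also have "\<dots> = 3 * (?d a + (?m a b + ?d b))"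
          by (simp add: ennreal_mult ennreal_plus del: distrib_left_numeral)
        finally show ?thesis .
      qed
      have fs: "kdbl j (\<lambda>a b. ?d a) = (\<integral>\<^sup>+t. ?d t \<partial>lborel)" "kdbl j (\<lambda>a b. ?d b) = (\<integral>\<^sup>+t. ?d t \<partial>lborel)"
        by (rule kdbl_fst kdbl_snd, measurable)+
      have "kdbl j (\<lambda>a b. ennreal ((N (g a - g b))\<^sup>2)) \<le> kdbl j (\<lambda>a b. 3 * (?d a + (?m a b + ?d b)))"
        by (rule kdbl_mono[OF le])
      also have "\<dots> = 3 * kdbl j (\<lambda>a b. ?d a + (?m a b + ?d b))"
        by (rule kdbl_cmult) measurable
      also have "kdbl j (\<lambda>a b. ?d a + (?m a b + ?d b)) = kdbl j (\<lambda>a b. ?d a) + kdbl j (\<lambda>a b. ?m a b + ?d b)"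
        by (rule kdbl_add) measurable
      also have "kdbl j (\<lambda>a b. ?m a b + ?d b) = kdbl j ?m + kdbl j (\<lambda>a b. ?d b)"
        by (rule kdbl_add) measurable
      also have "3 * (kdbl j (\<lambda>a b. ?d a) + (kdbl j ?m + kdbl j (\<lambda>a b. ?d b))) \<le>
          3 * (ennreal (e / 9) + (ennreal (e / 9) + ennreal (e / 9)))"
        using elim nn by (intro mult_left_mono add_mono) (simp_all add: fs)
      also have "\<dots> = ennreal e"
        using e by (simp add: ennreal_plus[symmetric] ennreal_mult[symmetric] del: ennreal_plus flip: ennreal_numeral)
      finally show ?case .
    qed
  qed
  show ?thesis
  proof (rule order_tendstoI)
    fix a :: ennreal assume "0 < a"
    then obtain e where e: "e > 0" "ennreal e < a"
      by (metis dense ennreal_cases ennreal_less_zero_iff less_top not_less_iff_gr_or_eq top_greatest linorder_not_le)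
    show "\<forall>\<^sub>F j in sequentially. kdbl j (\<lambda>a b. ennreal ((N (g a - g b))\<^sup>2)) < a"
      using ev[OF e(1)] by eventually_elim (use e(2) in auto)
  qed auto
qed

end

section \<open>The energy identity in scalar form\<close>

abbreviation pair_integrable :: "(real \<Rightarrow> real \<Rightarrow> real) \<Rightarrow> bool" where
  "pair_integrable f \<equiv> integrable (lborel \<Otimes>\<^sub>M lborel) (\<lambda>(s, t). f s t)"

abbreviation pair_integral :: "(real \<Rightarrow> real \<Rightarrow> real) \<Rightarrow> real" where
  "pair_integral f \<equiv> integral\<^sup>L (lborel \<Otimes>\<^sub>M lborel) (\<lambda>(s, t). f s t)"

abbreviation pair_measurable :: "(real \<Rightarrow> real \<Rightarrow> real) \<Rightarrow> bool" where
  "pair_measurable f \<equiv> (\<lambda>(s, t). f s t) \<in> borel_measurable (lborel \<Otimes>\<^sub>M lborel)"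

lemma pair_integrable_bound:
  assumes "pair_measurable f" "integrable lborel a" "integrable lborel c" "\<And>s t. \<bar>f s t\<bar> \<le> a s * c t"
  shows "pair_integrable f"
  by (rule Bochner_Integration.integrable_bound[OF integrable_pair_mult[OF assms(2,3)]])
     (use assms(1,4) in \<open>auto intro!: AE_I2 order_trans[OF assms(4) abs_ge_self]\<close>)

lemma pair_integrable_weight:
  assumes f: "pair_integrable f" and w: "pair_measurable w" "\<And>s t. \<bar>w s t\<bar> \<le> M"
  shows "pair_integrable (\<lambda>s t. w s t * f s t)"
proof (rule Bochner_Integration.integrable_bound)
  show "integrable (lborel \<Otimes>\<^sub>M lborel) (\<lambda>p. M * (case p of (s, t) \<Rightarrow> f s t))" using f by simp
  show "(\<lambda>(s, t). w s t * f s t) \<in> borel_measurable (lborel \<Otimes>\<^sub>M lborel)"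
    using w(1) borel_measurable_integrable[OF f] by (simp add: split_beta')
  have "\<bar>w s t * f s t\<bar> \<le> \<bar>M * f s t\<bar>" for s t
    using order_trans[OF w(2)[of s t] abs_ge_self] by (simp add: abs_mult mult_right_mono)
  then show "AE p in lborel \<Otimes>\<^sub>M lborel. norm (case p of (s, t) \<Rightarrow> w s t * f s t) \<le> norm (M * (case p of (s, t) \<Rightarrow> f s t))"
    by (auto intro!: AE_I2)
qed

lemma kern_pair_measurable: "pair_measurable (\<lambda>s t. kern j (s - t))"
  by measurable

lemma kern_bounded: obtains M where "M > 0" "\<And>x. \<bar>kern j x\<bar> \<le> M"
  using test_functions_bounded[OF kern_test[of j]] by (metis real_norm_def)

lemma integral_kern_left: "integrable lborel (\<lambda>s. kern j (s - t))" "(LINT s|lborel. kern j (s - t)) = 1"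
proof -
  show "integrable lborel (\<lambda>s. kern j (s - t))"
    by (rule integrableI_nonneg) (auto simp: kern_nn_integral_left kern_nonneg)
  show "(LINT s|lborel. kern j (s - t)) = 1"
    by (subst integral_eq_nn_integral) (auto simp: kern_nn_integral_left kern_nonneg)
qed

lemma integral_kern_right: "integrable lborel (\<lambda>t. kern j (s - t))" "(LINT t|lborel. kern j (s - t)) = 1"
proof -
  show "integrable lborel (\<lambda>t. kern j (s - t))"
    by (rule integrableI_nonneg) (auto simp: kern_nn_integral_right kern_nonneg)
  show "(LINT t|lborel. kern j (s - t)) = 1"
    by (subst integral_eq_nn_integral) (auto simp: kern_nn_integral_right kern_nonneg)
qed

lemma kern_pair_fst:
  assumes G: "integrable lborel G"
  shows "pair_integrable (\<lambda>s t. kern j (s - t) * G s)" "pair_integral (\<lambda>s t. kern j (s - t) * G s) = (LINT s|lborel. G s)"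
proof -
  have [measurable]: "G \<in> borel_measurable borel" using G by auto
  show I: "pair_integrable (\<lambda>s t. kern j (s - t) * G s)"
  proof (rule lborel_pair.Fubini_integrable)
    show "integrable lborel (\<lambda>s. LINT t|lborel. norm (case (s, t) of (s, t) \<Rightarrow> kern j (s - t) * G s))"
      using G by (simp add: abs_mult kern_nonneg integral_kern_right)
    show "AE s in lborel. integrable lborel (\<lambda>t. case (s, t) of (s, t) \<Rightarrow> kern j (s - t) * G s)"
      by (simp add: integral_kern_right)
  qed measurable
  show "pair_integral (\<lambda>s t. kern j (s - t) * G s) = (LINT s|lborel. G s)"
    using lborel_pair.integral_fst[OF I] by (simp add: integral_kern_right)
qed

lemma kern_pair_snd:
  assumes G: "integrable lborel G"
  shows "pair_integrable (\<lambda>s t. kern j (s - t) * G t)" "pair_integral (\<lambda>s t. kern j (s - t) * G t) = (LINT s|lborel. G s)"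
proof -
  have [measurable]: "G \<in> borel_measurable borel" using G by auto
  have "integrable (lborel \<Otimes>\<^sub>M lborel) (\<lambda>(t, s). kern j (s - t) * G t)"
  proof (rule lborel_pair.Fubini_integrable)
    show "integrable lborel (\<lambda>t. LINT s|lborel. norm (case (t, s) of (t, s) \<Rightarrow> kern j (s - t) * G t))"
      using G by (simp add: abs_mult kern_nonneg integral_kern_left)
    show "AE t in lborel. integrable lborel (\<lambda>s. case (t, s) of (t, s) \<Rightarrow> kern j (s - t) * G t)"
      by (simp add: integral_kern_left)
  qed measurable
  from lborel_pair.integrable_product_swap[OF this]
  show I: "pair_integrable (\<lambda>s t. kern j (s - t) * G t)" by (simp add: split_beta')
  show "pair_integral (\<lambda>s t. kern j (s - t) * G t) = (LINT s|lborel. G s)"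
    using lborel_pair.integral_snd[OF I] by (simp add: integral_kern_left)
qed

lemma kdbl_eq_pair:
  assumes [measurable]: "(\<lambda>(s, t). f s t) \<in> borel_measurable (lborel \<Otimes>\<^sub>M lborel)"
  shows "kdbl j f = (\<integral>\<^sup>+p. (case p of (s, t) \<Rightarrow> ennreal (kern j (s - t)) * f s t) \<partial>(lborel \<Otimes>\<^sub>M lborel))"
  unfolding kdbl_def by (subst lborel.nn_integral_fst[symmetric]) simp_all

lemma kern_pair_diff_le:
  assumes F: "pair_integrable (\<lambda>s t. kern j (s - t) * F s t)" and G: "pair_integrable (\<lambda>s t. kern j (s - t) * G s t)"
    and m: "pair_measurable F" "pair_measurable G"
  shows "ennreal \<bar>pair_integral (\<lambda>s t. kern j (s - t) * F s t) - pair_integral (\<lambda>s t. kern j (s - t) * G s t)\<bar>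
     \<le> kdbl j (\<lambda>s t. ennreal \<bar>F s t - G s t\<bar>)"
proof -
  have m': "(\<lambda>(s, t). ennreal \<bar>F s t - G s t\<bar>) \<in> borel_measurable (lborel \<Otimes>\<^sub>M lborel)"
    using m by (simp add: split_beta')
  let ?H = "\<lambda>p. (case p of (s, t) \<Rightarrow> kern j (s - t) * F s t) - (case p of (s, t) \<Rightarrow> kern j (s - t) * G s t)"
  have eq: "pair_integral (\<lambda>s t. kern j (s - t) * F s t) - pair_integral (\<lambda>s t. kern j (s - t) * G s t) =
      integral\<^sup>L (lborel \<Otimes>\<^sub>M lborel) ?H"
    by (rule Bochner_Integration.integral_diff[OF F G, symmetric])
  have le: "ennreal (norm (integral\<^sup>L (lborel \<Otimes>\<^sub>M lborel) ?H)) \<le> (\<integral>\<^sup>+p. ennreal (norm (?H p)) \<partial>(lborel \<Otimes>\<^sub>M lborel))"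
    by (rule integral_norm_bound_ennreal[OF Bochner_Integration.integrable_diff[OF F G]])
  have nn: "(\<integral>\<^sup>+p. ennreal (norm (?H p)) \<partial>(lborel \<Otimes>\<^sub>M lborel)) = kdbl j (\<lambda>s t. ennreal \<bar>F s t - G s t\<bar>)"
    unfolding kdbl_eq_pair[OF m']
    by (intro nn_integral_cong)
       (auto simp: right_diff_distrib[symmetric] abs_mult kern_nonneg ennreal_mult split: prod.splits)
  show ?thesis
    using le unfolding nn unfolding eq[symmetric] real_norm_def .
qed

lemma tendsto_of_ennreal_bound:
  fixes x :: "nat \<Rightarrow> real"
  assumes "\<And>j. ennreal \<bar>x j - L\<bar> \<le> y j" "y \<longlonglongrightarrow> 0"
  shows "x \<longlonglongrightarrow> L"
proof -
  have "(\<lambda>j. ennreal \<bar>x j - L\<bar>) \<longlonglongrightarrow> ennreal 0"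
    unfolding ennreal_0
    by (rule tendsto_sandwich[where f = "\<lambda>_. 0" and h = y]) (use assms in auto)
  then have "(\<lambda>j. \<bar>x j - L\<bar>) \<longlonglongrightarrow> 0"
    by (rule tendsto_ennrealD) auto
  then show ?thesis by (simp add: tendsto_rabs_zero_iff LIM_zero_iff)
qed

text \<open>G plays the part of the trace of F on the diagonal, but is tied to F only through the
  means over the strip. This version compares F with a function of the first time, the next one with
  a function of the second.\<close>

lemma kern_limit_fst:
  assumes F: "\<And>j. pair_integrable (\<lambda>s t. kern j (s - t) * F s t)" "pair_measurable F" and G: "integrable lborel G"
    and lim: "(\<lambda>j. kdbl j (\<lambda>s t. ennreal \<bar>F s t - G s\<bar>)) \<longlonglongrightarrow> 0"
  shows "(\<lambda>j. pair_integral (\<lambda>s t. kern j (s - t) * F s t)) \<longlonglongrightarrow> (LINT s|lborel. G s)"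
proof (rule tendsto_of_ennreal_bound[OF _ lim])
  have [measurable]: "G \<in> borel_measurable borel" using G by auto
  fix j
  show "ennreal \<bar>pair_integral (\<lambda>s t. kern j (s - t) * F s t) - (LINT s|lborel. G s)\<bar> \<le> kdbl j (\<lambda>s t. ennreal \<bar>F s t - G s\<bar>)"
    using kern_pair_diff_le[OF F(1) kern_pair_fst(1)[OF G] F(2), of j] by (simp add: kern_pair_fst(2)[OF G])
qed

lemma kern_limit_snd:
  assumes F: "\<And>j. pair_integrable (\<lambda>s t. kern j (s - t) * F s t)" "pair_measurable F" and G: "integrable lborel G"
    and lim: "(\<lambda>j. kdbl j (\<lambda>s t. ennreal \<bar>F s t - G t\<bar>)) \<longlonglongrightarrow> 0"
  shows "(\<lambda>j. pair_integral (\<lambda>s t. kern j (s - t) * F s t)) \<longlonglongrightarrow> (LINT s|lborel. G s)"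
proof (rule tendsto_of_ennreal_bound[OF _ lim])
  have [measurable]: "G \<in> borel_measurable borel" using G by auto
  fix j
  show "ennreal \<bar>pair_integral (\<lambda>s t. kern j (s - t) * F s t) - (LINT s|lborel. G s)\<bar> \<le> kdbl j (\<lambda>s t. ennreal \<bar>F s t - G t\<bar>)"
    using kern_pair_diff_le[OF F(1) kern_pair_snd(1)[OF G] F(2), of j] by (simp add: kern_pair_snd(2)[OF G])
qed

lemma test_functions_mult:
  fixes \<phi> \<psi> :: "real \<Rightarrow> real"
  assumes "\<phi> \<in> test_functions S" "\<And>k. Ck k \<psi>"
  shows "(\<lambda>x. \<phi> x * \<psi> x) \<in> test_functions S"
proof -
  obtain K where K: "compact K" "K \<subseteq> S" "\<And>x. x \<notin> K \<Longrightarrow> \<phi> x = 0"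
    using test_functions_supp[OF assms(1)] by blast
  then have "\<phi> x * \<psi> x = 0" if "x \<notin> K" for x using that by simp
  moreover have "Ck k (\<lambda>x. \<phi> x * \<psi> x)" for k
    by (rule Ck_mult[OF test_functions_CkD[OF assms(1)] assms(2)])
  ultimately show ?thesis
    unfolding test_functions_def using K(1,2) by blast
qed

lemma kern_reflect:
  assumes "{s - inverse (real (Suc j))..s} \<subseteq> S"
  shows "(\<lambda>t. kern j (s - t)) \<in> test_functions S" 
    and "deriv (\<lambda>t. kern j (s - t)) t = - deriv (kern j) (s - t)"
proof -
  have "Ck k (\<lambda>t. kern j (- t + s))" for k
    by (rule Ck_compose_affine[OF bounded_linear_minus[OF bounded_linear_ident] test_functions_CkD[OF kern_test]])
  moreover have "kern j (s - t) = 0" if "t \<notin> {s - inverse (real (Suc j))..s}" for t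
    by (rule kern_outside) (use that in auto)
  ultimately show "(\<lambda>t. kern j (s - t)) \<in> test_functions S"
    unfolding test_functions_def using assms by (auto intro!: exI[of _ "{s - inverse (real (Suc j))..s}"])
  have "((\<lambda>t. kern j (s - t)) has_real_derivative deriv (kern j) (s - t) * (- 1)) (at t)"
    by (rule DERIV_chain2[OF test_functions_deriv_real(1)[OF kern_test]]) (auto intro!: derivative_eq_intros)
  then show "deriv (\<lambda>t. kern j (s - t)) t = - deriv (kern j) (s - t)"
    by (simp add: DERIV_imp_deriv)
qed

lemma kern_shift:
  shows "Ck k (\<lambda>s. kern j (s - t))" "((\<lambda>s. kern j (s - t)) has_real_derivative deriv (kern j) (s - t)) (at s)"
proof -
  show "Ck k (\<lambda>s. kern j (s - t))"
    using Ck_compose_affine[OF bounded_linear_ident test_functions_CkD[OF kern_test], of k j "- t"] by simp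
  have "((\<lambda>s. kern j (s - t)) has_real_derivative deriv (kern j) (s - t) * 1) (at s)"
    by (rule DERIV_chain2[OF test_functions_deriv_real(1)[OF kern_test]]) (auto intro!: derivative_eq_intros)
  then show "((\<lambda>s. kern j (s - t)) has_real_derivative deriv (kern j) (s - t)) (at s)" by simp
qed

text \<open>On the bounded interval |x| \<le> x^2 + 1 provides an integrable bound.\<close>

lemma integrable_of_square:
  fixes f :: "real \<Rightarrow> real"
  assumes "f \<in> borel_measurable borel" "integrable lborel (\<lambda>x. (f x)\<^sup>2)" "\<And>t. t \<notin> {0<..<T} \<Longrightarrow> f t = 0"
  shows "integrable lborel f"
proof (rule Bochner_Integration.integrable_bound)
  have "integrable lborel (indicator {0<..<T} :: real \<Rightarrow> real)"
    by (cases "T > 0") auto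
  then show "integrable lborel (\<lambda>t. (f t)\<^sup>2 + indicator {0<..<T} t)" using assms(2) by simp
  have "\<bar>f t\<bar> \<le> (f t)\<^sup>2 + indicator {0<..<T} t" for t
  proof (cases "t \<in> {0<..<T}")
    case True
    have "2 * \<bar>f t\<bar> * 1 \<le> \<bar>f t\<bar>\<^sup>2 + 1\<^sup>2" by (rule sum_squares_bound)
    moreover have "0 \<le> \<bar>f t\<bar>\<^sup>2" by simp
    ultimately show ?thesis using True by simp
  qed (use assms(3) in simp)
  then show "AE t in lborel. norm (f t) \<le> norm ((f t)\<^sup>2 + indicator {0<..<T} t)"
    by (auto intro!: AE_I2 order_trans[OF _ abs_ge_self])
qed (use assms(1) in simp)

text \<open>The scalar shadow of an evolution triple: $D(s,t) = (v(s),v(t))_H$, $B(s,t) = \langle w(t),v(s)\rangle$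
  for $w = \partial_t v$, and $\delta(s,t) = \|v(s)-v(t)\|_V$.\<close>

locale energy_pair =
  fixes T :: real and D B \<delta> :: "real \<Rightarrow> real \<Rightarrow> real" and h \<nu> \<beta> :: "real \<Rightarrow> real" and C :: real
  assumes T: "0 < T"
    and D_meas: "pair_measurable D" and B_meas: "pair_measurable B" and \<delta>_meas: "pair_measurable \<delta>"
    and h_meas: "h \<in> borel_measurable borel" and \<nu>_meas: "\<nu> \<in> borel_measurable borel" and \<beta>_meas: "\<beta> \<in> borel_measurable borel"
    and D_sym: "D s t = D t s" and D_diag: "D s s = (h s)\<^sup>2"
    and D_bound: "\<bar>D s t\<bar> \<le> h s * h t" and D_diff: "\<bar>D s t - D s s\<bar> \<le> h s * (C * \<delta> s t)"
    and m_nonneg: "0 \<le> D s s + D t t - 2 * D s t" and m_le: "D s s + D t t - 2 * D s t \<le> C\<^sup>2 * (\<delta> s t)\<^sup>2"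
    and B_bound: "\<bar>B s t\<bar> \<le> \<nu> s * \<beta> t" and B_diff: "\<bar>B s t - B t t\<bar> \<le> \<delta> s t * \<beta> t"
    and nonneg: "0 \<le> h s" "0 \<le> \<nu> s" "0 \<le> \<beta> s" "0 \<le> \<delta> s t" "0 \<le> C"
    and \<delta>_sym: "\<delta> s t = \<delta> t s"
    and h_sq: "integrable lborel (\<lambda>t. (h t)\<^sup>2)" and \<nu>_sq: "integrable lborel (\<lambda>t. (\<nu> t)\<^sup>2)" and \<beta>_sq: "integrable lborel (\<lambda>t. (\<beta> t)\<^sup>2)"
    and zero: "t \<notin> {0<..<T} \<Longrightarrow> h t = 0" "t \<notin> {0<..<T} \<Longrightarrow> \<nu> t = 0" "t \<notin> {0<..<T} \<Longrightarrow> \<beta> t = 0"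
    and weak: "AE s in lborel. \<forall>\<phi>\<in>test_functions {0<..<T}.
       (LINT t|lborel. \<phi> t * B s t) = - (LINT t|lborel. deriv \<phi> t * D s t)"
    and kern_\<delta>: "(\<lambda>j. kdbl j (\<lambda>s t. ennreal ((\<delta> s t)\<^sup>2))) \<longlonglongrightarrow> 0"
begin

lemmas [measurable] = h_meas \<nu>_meas \<beta>_meas

lemma h_int: "integrable lborel h" and \<nu>_int: "integrable lborel \<nu>" and \<beta>_int: "integrable lborel \<beta>"
  using integrable_of_square[OF h_meas h_sq zero(1)] integrable_of_square[OF \<nu>_meas \<nu>_sq zero(2)]
    integrable_of_square[OF \<beta>_meas \<beta>_sq zero(3)] by auto

lemma D_int: "pair_integrable D" by (rule pair_integrable_bound[OF D_meas h_int h_int D_bound])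

lemma B_int: "pair_integrable B" by (rule pair_integrable_bound[OF B_meas \<nu>_int \<beta>_int B_bound])

lemma swap_int: "pair_integrable f \<Longrightarrow> pair_integrable (\<lambda>s t. f t s)"
  using lborel_pair.integrable_product_swap[of "\<lambda>(s, t). f s t"] by (simp add: split_beta')

lemma swap_meas: "pair_measurable f \<Longrightarrow> pair_measurable (\<lambda>s t. f t s)"
  using measurable_compose[OF measurable_pair_swap', of "\<lambda>(s, t). f s t" lborel lborel] by (simp add: split_beta')

lemma diag_meas: "pair_measurable f \<Longrightarrow> (\<lambda>t. f t t) \<in> borel_measurable borel"
proof -
  assume f: "pair_measurable f"
  have "(\<lambda>t::real. (t, t)) \<in> lborel \<rightarrow>\<^sub>M lborel \<Otimes>\<^sub>M lborel" by measurable
  from measurable_compose[OF this f] show ?thesis by simp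
qed

lemma sec_meas: "pair_measurable f \<Longrightarrow> f s \<in> borel_measurable borel"
  using measurable_compose[OF measurable_Pair1'[of s lborel lborel], of "\<lambda>(s, t). f s t"] by simp

lemma product_int:
  fixes a c :: "real \<Rightarrow> real"
  assumes [measurable]: "a \<in> borel_measurable borel" "c \<in> borel_measurable borel"
    and sq: "integrable lborel (\<lambda>t. (a t)\<^sup>2)" "integrable lborel (\<lambda>t. (c t)\<^sup>2)"
  shows "integrable lborel (\<lambda>t. a t * c t)"
proof (rule Bochner_Integration.integrable_bound)
  show "integrable lborel (\<lambda>t. (a t)\<^sup>2 + (c t)\<^sup>2)" using sq by simp
  have "\<bar>a t * c t\<bar> \<le> (a t)\<^sup>2 + (c t)\<^sup>2" for t
  proof -
    have "2 * \<bar>a t\<bar> * \<bar>c t\<bar> \<le> \<bar>a t\<bar>\<^sup>2 + \<bar>c t\<bar>\<^sup>2" by (rule sum_squares_bound)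
    moreover have "0 \<le> \<bar>a t\<bar> * \<bar>c t\<bar>" by simp
    ultimately have "\<bar>a t\<bar> * \<bar>c t\<bar> \<le> (a t)\<^sup>2 + (c t)\<^sup>2" unfolding power2_abs by linarith
    then show ?thesis by (simp add: abs_mult)
  qed
  then show "AE t in lborel. norm (a t * c t) \<le> norm ((a t)\<^sup>2 + (c t)\<^sup>2)"
    by (auto intro!: AE_I2 order_trans[OF _ abs_ge_self])
qed measurable

lemma Bdiag_int: "integrable lborel (\<lambda>t. B t t)"
  by (rule Bochner_Integration.integrable_bound[OF product_int[OF \<nu>_meas \<beta>_meas \<nu>_sq \<beta>_sq]])
     (use diag_meas[OF B_meas] B_bound in \<open>auto intro!: AE_I2 order_trans[OF _ abs_ge_self]\<close>)

text \<open>The weighted Young inequality x y \<le> e x^2 + y^2/e: the first term has total mass e A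
  for every j, the second tends to zero by \<open>kern_\<delta>\<close> for fixed e.\<close>

lemma kdbl_product_tendsto:
  fixes a :: "real \<Rightarrow> real"
  assumes a: "a \<in> borel_measurable borel" "integrable lborel (\<lambda>t. (a t)\<^sup>2)" 
  shows "(\<lambda>j. kdbl j (\<lambda>s t. ennreal (\<bar>a s\<bar> * \<delta> s t))) \<longlonglongrightarrow> 0"
    and "(\<lambda>j. kdbl j (\<lambda>s t. ennreal (\<bar>a t\<bar> * \<delta> s t))) \<longlonglongrightarrow> 0"
proof -
  have [measurable]: "a \<in> borel_measurable borel" by fact
  have dm[measurable]: "(\<lambda>(s, t). ennreal ((\<delta> s t)\<^sup>2)) \<in> borel_measurable (lborel \<Otimes>\<^sub>M lborel)"
    using \<delta>_meas by (simp add: split_beta')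
  define A where "A = (LINT t|lborel. (a t)\<^sup>2)"
  have A: "A \<ge> 0" "(\<integral>\<^sup>+t. ennreal ((a t)\<^sup>2) \<partial>lborel) = ennreal A"
    using nn_integral_eq_integral[OF a(2)] by (auto simp: A_def)
  have main: "f \<longlonglongrightarrow> 0" if f: "\<And>e j. e > 0 \<Longrightarrow> f j \<le> ennreal (e * A) + ennreal (1/e) * kdbl j (\<lambda>s t. ennreal ((\<delta> s t)\<^sup>2))" for f :: "nat \<Rightarrow> ennreal"
  proof (rule order_tendstoI)
    fix x :: ennreal assume "0 < x"
    then obtain r where r: "r > 0" "ennreal r < x"
      by (metis dense ennreal_cases ennreal_less_zero_iff less_top not_less_iff_gr_or_eq top_greatest linorder_not_le)
    \<comment> \<open>Chosen so that e A is at most r/2; A + 1 is positive even when A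
      vanishes.\<close>
    define e where "e = r / (2 * (A + 1))"
    have e: "e > 0" "e * A \<le> r / 2" using r A by (auto simp: e_def field_simps)
    have "(\<lambda>j. ennreal (1/e) * kdbl j (\<lambda>s t. ennreal ((\<delta> s t)\<^sup>2))) \<longlonglongrightarrow> ennreal (1/e) * 0"
      by (intro ennreal_tendsto_cmult kern_\<delta>) simp
    then have "\<forall>\<^sub>F j in sequentially. ennreal (1/e) * kdbl j (\<lambda>s t. ennreal ((\<delta> s t)\<^sup>2)) < ennreal (r/2)"
      using r by (intro order_tendstoD(2)) auto
    then show "\<forall>\<^sub>F j in sequentially. f j < x"
    proof eventually_elim
      case (elim j)
      have "f j \<le> ennreal (e * A) + ennreal (1/e) * kdbl j (\<lambda>s t. ennreal ((\<delta> s t)\<^sup>2))" by (rule f[OF e(1)])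
      also have "\<dots> \<le> ennreal (r/2) + ennreal (r/2)"
        using elim e by (intro add_mono ennreal_leI) auto
      also have "\<dots> = ennreal r" using r by (simp flip: ennreal_plus)
      finally show ?case using r(2) by simp
    qed
  qed auto
  have le: "ennreal (x * y) \<le> ennreal e * ennreal (x\<^sup>2) + ennreal (1/e) * ennreal (y\<^sup>2)" if "e > 0" "x \<ge> 0" "y \<ge> 0" for x y e :: real
  proof -
    have "2 * (sqrt e * x) * (y / sqrt e) \<le> (sqrt e * x)\<^sup>2 + (y / sqrt e)\<^sup>2" by (rule sum_squares_bound)
    then have "2 * (x * y) \<le> e * x\<^sup>2 + 1/e * y\<^sup>2"
      using that by (simp add: power_mult_distrib power_divide)
    moreover have "0 \<le> x * y" using that by simp
    ultimately have "x * y \<le> e * x\<^sup>2 + 1/e * y\<^sup>2" by linarith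
    then have "ennreal (x * y) \<le> ennreal (e * x\<^sup>2 + 1/e * y\<^sup>2)" by (rule ennreal_leI)
    also have "\<dots> = ennreal e * ennreal (x\<^sup>2) + ennreal (1/e) * ennreal (y\<^sup>2)"
      using that by (simp add: ennreal_plus ennreal_mult del: times_divide_eq_left divide_ennreal)
    finally show ?thesis .
  qed
  show "(\<lambda>j. kdbl j (\<lambda>s t. ennreal (\<bar>a s\<bar> * \<delta> s t))) \<longlonglongrightarrow> 0"
  proof (rule main)
    fix e :: real and j assume e: "e > 0"
    have "kdbl j (\<lambda>s t. ennreal (\<bar>a s\<bar> * \<delta> s t)) \<le> kdbl j (\<lambda>s t. ennreal e * ennreal ((a s)\<^sup>2) + ennreal (1/e) * ennreal ((\<delta> s t)\<^sup>2))"
      using le[OF e abs_ge_zero nonneg(4)] by (intro kdbl_mono) simp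
    also have "\<dots> = ennreal e * kdbl j (\<lambda>s t. ennreal ((a s)\<^sup>2)) + ennreal (1/e) * kdbl j (\<lambda>s t. ennreal ((\<delta> s t)\<^sup>2))"
      by (subst kdbl_add, measurable, subst kdbl_cmult, measurable, subst kdbl_cmult, measurable)
    also have "kdbl j (\<lambda>s t. ennreal ((a s)\<^sup>2)) = ennreal A"
      using A(2) by (subst kdbl_fst) auto
    finally show "kdbl j (\<lambda>s t. ennreal (\<bar>a s\<bar> * \<delta> s t)) \<le> ennreal (e * A) + ennreal (1/e) * kdbl j (\<lambda>s t. ennreal ((\<delta> s t)\<^sup>2))"
      using e A(1) by (simp add: ennreal_mult)
  qed
  show "(\<lambda>j. kdbl j (\<lambda>s t. ennreal (\<bar>a t\<bar> * \<delta> s t))) \<longlonglongrightarrow> 0"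
  proof (rule main)
    fix e :: real and j assume e: "e > 0"
    have "kdbl j (\<lambda>s t. ennreal (\<bar>a t\<bar> * \<delta> s t)) \<le> kdbl j (\<lambda>s t. ennreal e * ennreal ((a t)\<^sup>2) + ennreal (1/e) * ennreal ((\<delta> s t)\<^sup>2))"
      using le[OF e abs_ge_zero nonneg(4)] by (intro kdbl_mono) simp
    also have "\<dots> = ennreal e * kdbl j (\<lambda>s t. ennreal ((a t)\<^sup>2)) + ennreal (1/e) * kdbl j (\<lambda>s t. ennreal ((\<delta> s t)\<^sup>2))"
      by (subst kdbl_add, measurable, subst kdbl_cmult, measurable, subst kdbl_cmult, measurable)
    also have "kdbl j (\<lambda>s t. ennreal ((a t)\<^sup>2)) = ennreal A"
      using A(2) by (subst kdbl_snd) auto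
    finally show "kdbl j (\<lambda>s t. ennreal (\<bar>a t\<bar> * \<delta> s t)) \<le> ennreal (e * A) + ennreal (1/e) * kdbl j (\<lambda>s t. ennreal ((\<delta> s t)\<^sup>2))"
      using e A(1) by (simp add: ennreal_mult)
  qed
qed

end

lemma test_functions_outside: "\<phi> \<in> test_functions S \<Longrightarrow> x \<notin> S \<Longrightarrow> \<phi> x = 0"
  by (auto simp: test_functions_def)

context energy_pair
begin

lemma kern_deriv_bounded:
  obtains M where "M > 0" "\<And>x. \<bar>deriv (kern j) x\<bar> \<le> M" "deriv (kern j) \<in> borel_measurable borel"
proof -
  note d = test_functions_deriv_real(2)[OF kern_test[of j]]
  obtain M where "M > 0" "\<And>x. norm (deriv (kern j) x) \<le> M" using test_functions_bounded[OF d] by blast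
  then show ?thesis using that test_functions_measurable[OF d] by simp
qed

text \<open>Tests the weak equations for $\partial_t D$ and $\partial_s D$ with $\varphi(s)\,\eta_j(s-t)$; in the sum
  the derivatives of the mollifier cancel, and only values off the diagonal occur.\<close>

lemma weak_kern:
  assumes phi: "\<phi> \<in> test_functions {0<..<T}" and K: "\<And>s. \<phi> s \<noteq> 0 \<Longrightarrow> inverse (real (Suc j)) < s"
  shows "pair_integral (\<lambda>s t. kern j (s - t) * (\<phi> s * B s t)) + pair_integral (\<lambda>s t. kern j (s - t) * (\<phi> s * B t s))
     = - pair_integral (\<lambda>s t. kern j (s - t) * (deriv \<phi> s * D s t))"
    and "pair_integrable (\<lambda>s t. kern j (s - t) * (\<phi> s * B s t))" "pair_integrable (\<lambda>s t. kern j (s - t) * (\<phi> s * B t s))"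
    "pair_integrable (\<lambda>s t. kern j (s - t) * (deriv \<phi> s * D s t))"
proof -
  let ?J = "{0<..<T}" and ?k = "kern j" and ?k' = "deriv (kern j)"
  note dphi = test_functions_deriv_real[OF phi]
  obtain M where M: "M > 0" "\<And>x. \<bar>\<phi> x\<bar> \<le> M" using test_functions_bounded[OF phi] by (metis real_norm_def)
  obtain M1 where M1: "M1 > 0" "\<And>x. \<bar>deriv \<phi> x\<bar> \<le> M1" using test_functions_bounded[OF dphi(2)] by (metis real_norm_def)
  obtain M2 where M2: "M2 > 0" "\<And>x. \<bar>?k x\<bar> \<le> M2" using kern_bounded[of j] by metis
  obtain M3 where M3: "M3 > 0" "\<And>x. \<bar>?k' x\<bar> \<le> M3" "?k' \<in> borel_measurable borel" using kern_deriv_bounded[of j] by metis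
  have [measurable]: "\<phi> \<in> borel_measurable borel" "deriv \<phi> \<in> borel_measurable borel" "?k' \<in> borel_measurable borel"
    using test_functions_measurable[OF phi] test_functions_measurable[OF dphi(2)] M3 by auto
  have w: "pair_integrable (\<lambda>s t. (a s * b (s - t)) * f s t)"
    if [measurable]: "a \<in> borel_measurable borel" "b \<in> borel_measurable borel"
      and "\<And>x. \<bar>a x\<bar> \<le> Ma" "\<And>x. \<bar>b x\<bar> \<le> Mb" "Ma > 0" and "pair_integrable f" for a b Ma Mb f
    by (rule pair_integrable_weight[where M = "Ma * Mb", OF that(6)]) (measurable, use that in \<open>simp add: abs_mult mult_mono'\<close>)
  note BI = B_int swap_int[OF B_int]
  have i1: "pair_integrable (\<lambda>s t. \<phi> s * ?k (s - t) * B s t)" "pair_integrable (\<lambda>s t. \<phi> s * ?k (s - t) * B t s)"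
    by (rule w[OF _ _ M(2) M2(2) M(1)], measurable, fact BI)+
  have i2: "pair_integrable (\<lambda>s t. \<phi> s * ?k' (s - t) * D s t)"
    by (rule w[OF _ _ M(2) M3(2) M(1)], measurable, fact D_int)
  have i3: "pair_integrable (\<lambda>s t. deriv \<phi> s * ?k (s - t) * D s t)"
    by (rule w[OF _ _ M1(2) M2(2) M1(1)], measurable, fact D_int)
  \<comment> \<open>Here s is frozen and t is the variable of the weak equation. Differentiating
    \<open>kern j (s - t)\<close> in t gives a minus sign that cancels the one of the weak
    equation.\<close>
  have X1: "pair_integral (\<lambda>s t. \<phi> s * ?k (s - t) * B s t) = pair_integral (\<lambda>s t. \<phi> s * ?k' (s - t) * D s t)"
    unfolding lborel_pair.integral_fst[OF i1(1), symmetric] lborel_pair.integral_fst[OF i2, symmetric]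
  proof (rule integral_cong_AE)
    show "(\<lambda>s. LINT t|lborel. \<phi> s * ?k (s - t) * B s t) \<in> borel_measurable lborel"
      "(\<lambda>s. LINT t|lborel. \<phi> s * ?k' (s - t) * D s t) \<in> borel_measurable lborel"
      using lborel_pair.integrable_fst[OF i1(1)] lborel_pair.integrable_fst[OF i2] by auto
    show "AE s in lborel. (LINT t|lborel. \<phi> s * ?k (s - t) * B s t) = (LINT t|lborel. \<phi> s * ?k' (s - t) * D s t)"
      using weak
    proof eventually_elim
      case (elim s)
      show ?case
      proof (cases "\<phi> s = 0")
        case False
        then have "s \<in> ?J" using test_functions_outside[OF phi] by blast
        \<comment> \<open>Only here does the distance of the support of \<phi> from 0 enter: the
          kernel reaches back from s by 1/(j+1) and has to stay inside the interval.\<close>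
        then have "{s - inverse (real (Suc j))..s} \<subseteq> ?J" using K[OF False] by auto
        note r = kern_reflect[OF this]
        have "(LINT t|lborel. ?k (s - t) * B s t) = - (LINT t|lborel. deriv (\<lambda>t. ?k (s - t)) t * D s t)"
          by (rule bspec[OF elim r(1)])
        also have "\<dots> = (LINT t|lborel. ?k' (s - t) * D s t)" by (simp add: r(2))
        finally show ?thesis by (simp add: mult.assoc)
      qed simp
    qed
  qed
  \<comment> \<open>Now t is frozen and s is the variable; the test function is the product of
    \<phi> and the shifted kernel, supported where \<phi> is. Symmetry of D turns the result into
    the same integrand as in X1, with the opposite sign, plus the term with the derivative of
    \<phi>.\<close>
  have X2: "pair_integral (\<lambda>s t. \<phi> s * ?k (s - t) * B t s) =
      - (pair_integral (\<lambda>s t. deriv \<phi> s * ?k (s - t) * D s t) + pair_integral (\<lambda>s t. \<phi> s * ?k' (s - t) * D s t))"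
  proof -
    have i4: "pair_integrable (\<lambda>s t. deriv \<phi> s * ?k (s - t) * D s t + \<phi> s * ?k' (s - t) * D s t)"
      using Bochner_Integration.integrable_add[OF i3 i2] by (simp add: split_beta')
    have "pair_integral (\<lambda>s t. \<phi> s * ?k (s - t) * B t s) = pair_integral (\<lambda>s t. - (deriv \<phi> s * ?k (s - t) * D s t + \<phi> s * ?k' (s - t) * D s t))"
    proof -
      have i5: "pair_integrable (\<lambda>s t. - (deriv \<phi> s * ?k (s - t) * D s t + \<phi> s * ?k' (s - t) * D s t))"
        using Bochner_Integration.integrable_minus[OF i4] by (simp add: split_beta')
      show ?thesis
        unfolding lborel_pair.integral_snd[OF i1(2), symmetric] lborel_pair.integral_snd[OF i5, symmetric]
      proof (rule integral_cong_AE)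
        show "(\<lambda>t. LINT s|lborel. \<phi> s * ?k (s - t) * B t s) \<in> borel_measurable lborel"
          "(\<lambda>t. LINT s|lborel. - (deriv \<phi> s * ?k (s - t) * D s t + \<phi> s * ?k' (s - t) * D s t)) \<in> borel_measurable lborel"
          using lborel_pair.integrable_snd[OF i1(2)] lborel_pair.integrable_snd[OF i5] by auto
        show "AE t in lborel. (LINT s|lborel. \<phi> s * ?k (s - t) * B t s) =
            (LINT s|lborel. - (deriv \<phi> s * ?k (s - t) * D s t + \<phi> s * ?k' (s - t) * D s t))"
          using weak
        proof eventually_elim
          case (elim t)
          have tf: "(\<lambda>s. \<phi> s * ?k (s - t)) \<in> test_functions ?J"
            by (rule test_functions_mult[OF phi kern_shift(1)])
          have "deriv (\<lambda>s. \<phi> s * ?k (s - t)) s = deriv \<phi> s * ?k (s - t) + \<phi> s * ?k' (s - t)" for s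
            using DERIV_mult[OF dphi(1)[of s] kern_shift(2)[of j t s]] by (auto intro!: DERIV_imp_deriv simp: mult.commute)
          then have d: "deriv (\<lambda>s. \<phi> s * ?k (s - t)) = (\<lambda>s. deriv \<phi> s * ?k (s - t) + \<phi> s * ?k' (s - t))" by blast
          have "(LINT s|lborel. \<phi> s * ?k (s - t) * B t s) = - (LINT s|lborel. deriv (\<lambda>s. \<phi> s * ?k (s - t)) s * D t s)"
            by (rule bspec[OF elim tf])
          also have "\<dots> = (LINT s|lborel. - (deriv \<phi> s * ?k (s - t) * D s t + \<phi> s * ?k' (s - t) * D s t))"
            unfolding d integral_minus[symmetric] by (simp add: D_sym[of t] distrib_right)
          finally show ?case .
        qed
      qed
    qed
    also have "\<dots> = - pair_integral (\<lambda>s t. deriv \<phi> s * ?k (s - t) * D s t + \<phi> s * ?k' (s - t) * D s t)"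
      unfolding split_beta' by (rule integral_minus)
    also have "pair_integral (\<lambda>s t. deriv \<phi> s * ?k (s - t) * D s t + \<phi> s * ?k' (s - t) * D s t) =
        pair_integral (\<lambda>s t. deriv \<phi> s * ?k (s - t) * D s t) + pair_integral (\<lambda>s t. \<phi> s * ?k' (s - t) * D s t)"
      using Bochner_Integration.integral_add[OF i3 i2] by (simp add: split_beta')
    finally show ?thesis .
  qed
  have c: "\<And>x y z::real. kern j x * (y * z) = y * kern j x * z" by simp
  show "pair_integral (\<lambda>s t. ?k (s - t) * (\<phi> s * B s t)) + pair_integral (\<lambda>s t. ?k (s - t) * (\<phi> s * B t s))
     = - pair_integral (\<lambda>s t. ?k (s - t) * (deriv \<phi> s * D s t))"
    unfolding c using X1 X2 by linarith
  show "pair_integrable (\<lambda>s t. ?k (s - t) * (\<phi> s * B s t))" "pair_integrable (\<lambda>s t. ?k (s - t) * (\<phi> s * B t s))"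
    "pair_integrable (\<lambda>s t. ?k (s - t) * (deriv \<phi> s * D s t))"
    unfolding c by (fact i1 i3)+
qed

text \<open>The limit of \<open>weak_kern\<close> as the strip shrinks. The two integrals with B
  converge to the same diagonal integral, which is the origin of the factor 2.\<close>

lemma weak_energy:
  assumes phi: "\<phi> \<in> test_functions {0<..<T}"
  shows "(LINT t|lborel. \<phi> t * (2 * B t t)) = - (LINT t|lborel. deriv \<phi> t * D t t)"
proof -
  note dphi = test_functions_deriv_real[OF phi]
  obtain M where M: "M > 0" "\<And>x. \<bar>\<phi> x\<bar> \<le> M" using test_functions_bounded[OF phi] by (metis real_norm_def)
  obtain M1 where M1: "M1 > 0" "\<And>x. \<bar>deriv \<phi> x\<bar> \<le> M1" using test_functions_bounded[OF dphi(2)] by (metis real_norm_def)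
  have [measurable]: "\<phi> \<in> borel_measurable borel" "deriv \<phi> \<in> borel_measurable borel"
    using test_functions_measurable[OF phi] test_functions_measurable[OF dphi(2)] by auto
  note [measurable] = B_meas D_meas swap_meas[OF B_meas] diag_meas[OF B_meas] diag_meas[OF D_meas]
  \<comment> \<open>A positive lower bound of the support of \<phi>; \<open>weak_kern\<close>
    applies as soon as 1/(j+1) is below it.\<close>
  obtain a where a: "a > 0" "\<And>s. \<phi> s \<noteq> 0 \<Longrightarrow> a < s"
  proof -
    obtain K where K: "compact K" "K \<subseteq> {0<..<T}" "\<And>x. x \<notin> K \<Longrightarrow> \<phi> x = 0"
      using test_functions_supp[OF phi] by blast
    show ?thesis
    proof (cases "K = {}")
      case True
      then have "\<phi> s = 0" for s using K(3) by simp
      then show ?thesis using that[of 1] by simp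
    next
      case False
      then obtain m where "m \<in> K" "\<And>x. x \<in> K \<Longrightarrow> m \<le> x" using compact_attains_inf[OF K(1)] by blast
      then have "m / 2 > 0" "\<And>s. \<phi> s \<noteq> 0 \<Longrightarrow> m / 2 < s" using K(2,3) by force+
      then show ?thesis by (rule that)
    qed
  qed
  have ev: "\<forall>\<^sub>F j in sequentially. inverse (real (Suc j)) < a"
    by (rule order_tendstoD(2)[OF LIMSEQ_inverse_real_of_nat a(1)])
  have bint: "integrable lborel (\<lambda>t. w t * g t)" 
    if [measurable]: "w \<in> borel_measurable borel" and "\<And>x. \<bar>w x\<bar> \<le> c" and g: "integrable lborel g" for w g :: "real \<Rightarrow> real" and c
    by (rule Bochner_Integration.integrable_bound[of _ "\<lambda>t. c * g t"])
       (use g order_trans[OF that(2) abs_ge_self] in \<open>auto simp: abs_mult mult_right_mono\<close>)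
  have nI: "integrable lborel (\<lambda>t. D t t)" using h_sq by (simp add: D_diag)
  note GB = bint[OF _ M(2) Bdiag_int] and GD = bint[OF _ M1(2) nI]
  have "\<exists>M. \<forall>x. \<bar>kern j x\<bar> \<le> M" for j using kern_bounded[of j] by metis
  then obtain M2 where M2: "\<And>j x. \<bar>kern j x\<bar> \<le> M2 j" by metis
  have kint: "pair_integrable (\<lambda>s t. kern j (s - t) * (w s * f s t))" 
    if [measurable]: "w \<in> borel_measurable borel" and "\<And>x. \<bar>w x\<bar> \<le> c" and f: "pair_integrable f" for w c f j
  proof -
    have "pair_integrable (\<lambda>s t. w s * f s t)"
      by (rule pair_integrable_weight[OF f _ that(2)]) measurable
    then show ?thesis by (rule pair_integrable_weight[OF _ kern_pair_measurable M2])
  qed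
  have L1: "(\<lambda>j. pair_integral (\<lambda>s t. kern j (s - t) * (\<phi> s * B t s))) \<longlonglongrightarrow> (LINT s|lborel. \<phi> s * B s s)"
  proof (rule kern_limit_fst)
    show "pair_integrable (\<lambda>s t. kern j (s - t) * (\<phi> s * B t s))" for j
      by (rule kint[OF _ M(2) swap_int[OF B_int]]) measurable
    show "pair_measurable (\<lambda>s t. \<phi> s * B t s)" using swap_meas[OF B_meas] by (simp add: split_beta')
    show "integrable lborel (\<lambda>s. \<phi> s * B s s)" by (rule GB) measurable
    have lim: "(\<lambda>j. kdbl j (\<lambda>s t. ennreal (\<bar>M * \<beta> s\<bar> * \<delta> s t))) \<longlonglongrightarrow> 0"
      using \<beta>_sq by (intro kdbl_product_tendsto(1)) (auto simp: power_mult_distrib)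
    have "ennreal \<bar>\<phi> s * B t s - \<phi> s * B s s\<bar> \<le> ennreal (\<bar>M * \<beta> s\<bar> * \<delta> s t)" for s t
    proof (rule ennreal_leI)
      have "\<bar>\<phi> s * B t s - \<phi> s * B s s\<bar> = \<bar>\<phi> s\<bar> * \<bar>B t s - B s s\<bar>"
        by (simp add: abs_mult right_diff_distrib[symmetric])
      also have "\<dots> \<le> M * (\<delta> t s * \<beta> s)"
        using M B_diff[of t s] by (intro mult_mono) auto
      finally show "\<bar>\<phi> s * B t s - \<phi> s * B s s\<bar> \<le> \<bar>M * \<beta> s\<bar> * \<delta> s t"
        using M nonneg(3)[of s] by (simp add: \<delta>_sym[of t s] abs_mult mult_ac)
    qed
    then show "(\<lambda>j. kdbl j (\<lambda>s t. ennreal \<bar>\<phi> s * B t s - \<phi> s * B s s\<bar>)) \<longlonglongrightarrow> 0"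
      by (intro tendsto_sandwich[OF _ _ tendsto_const lim] always_eventually allI kdbl_mono) auto
  qed
  \<comment> \<open>In \<open>B s t\<close> the functional sits at time t, so only the argument may
    be moved and the trace has to be taken at t. The weight \<phi> s must therefore be exchanged for
    \<phi> t, at the cost of \<open>M1\<close> times the length 1/(j+1) of the kernel.\<close>
  have L2: "(\<lambda>j. pair_integral (\<lambda>s t. kern j (s - t) * (\<phi> s * B s t))) \<longlonglongrightarrow> (LINT s|lborel. \<phi> s * B s s)"
  proof (rule kern_limit_snd)
    show "pair_integrable (\<lambda>s t. kern j (s - t) * (\<phi> s * B s t))" for j
      by (rule kint[OF _ M(2) B_int]) measurable
    show "pair_measurable (\<lambda>s t. \<phi> s * B s t)" using B_meas by (simp add: split_beta')
    show "integrable lborel (\<lambda>s. \<phi> s * B s s)" by (rule GB) measurable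
    have lim: "(\<lambda>j. kdbl j (\<lambda>s t. ennreal (\<bar>M * \<beta> t\<bar> * \<delta> s t))) \<longlonglongrightarrow> 0"
      using \<beta>_sq by (intro kdbl_product_tendsto(2)) (auto simp: power_mult_distrib)
    define b where "b = (\<integral>\<^sup>+t. ennreal \<bar>B t t\<bar> \<partial>lborel)"
    have b: "b < top" using Bdiag_int unfolding b_def integrable_iff_bounded by simp
    have "(\<lambda>j. inverse (real (Suc j))) \<longlonglongrightarrow> 0" by (rule LIMSEQ_inverse_real_of_nat)
    then have "(\<lambda>j. ennreal (M1 * inverse (real (Suc j)))) \<longlonglongrightarrow> ennreal (M1 * 0)"
      by (intro tendsto_ennrealI tendsto_mult tendsto_const)
    then have "(\<lambda>j. ennreal (M1 * inverse (real (Suc j)))) \<longlonglongrightarrow> 0" by simp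
    then have "(\<lambda>j. b * ennreal (M1 * inverse (real (Suc j)))) \<longlonglongrightarrow> b * 0"
      using b by (intro ennreal_tendsto_cmult) auto
    from tendsto_add[OF lim this]
    have lim2: "(\<lambda>j. kdbl j (\<lambda>s t. ennreal (\<bar>M * \<beta> t\<bar> * \<delta> s t)) + b * ennreal (M1 * inverse (real (Suc j)))) \<longlonglongrightarrow> 0"
      by simp
    have le: "kdbl j (\<lambda>s t. ennreal \<bar>\<phi> s * B s t - \<phi> t * B t t\<bar>) \<le>
        kdbl j (\<lambda>s t. ennreal (\<bar>M * \<beta> t\<bar> * \<delta> s t)) + b * ennreal (M1 * inverse (real (Suc j)))" for j
    proof -
      let ?i = "inverse (real (Suc j))"
      have p: "ennreal \<bar>\<phi> s * B s t - \<phi> t * B t t\<bar> \<le> ennreal (\<bar>M * \<beta> t\<bar> * \<delta> s t) + ennreal (M1 * ?i) * ennreal \<bar>B t t\<bar>"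
        if "kern j (s - t) \<noteq> 0" for s t
      proof -
        have st: "t < s" "s - t < ?i" using that kern_outside[of "s - t" j] by auto
        obtain z where "\<phi> s - \<phi> t = (s - t) * deriv \<phi> z"
          using MVT2[OF st(1), of \<phi> "deriv \<phi>"] dphi(1) by blast
        then have "\<bar>\<phi> s - \<phi> t\<bar> \<le> ?i * M1"
          using st M1(2)[of z] by (simp add: abs_mult mult_mono)
        then have 1: "\<bar>\<phi> s - \<phi> t\<bar> * \<bar>B t t\<bar> \<le> M1 * ?i * \<bar>B t t\<bar>"
          by (intro mult_right_mono) (simp_all add: mult.commute)
        have 2: "\<bar>\<phi> s\<bar> * \<bar>B s t - B t t\<bar> \<le> M * (\<delta> s t * \<beta> t)"
          using M B_diff[of s t] by (intro mult_mono) auto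
        have "\<phi> s * B s t - \<phi> t * B t t = \<phi> s * (B s t - B t t) + (\<phi> s - \<phi> t) * B t t" by algebra
        then have "\<bar>\<phi> s * B s t - \<phi> t * B t t\<bar> \<le> \<bar>\<phi> s\<bar> * \<bar>B s t - B t t\<bar> + \<bar>\<phi> s - \<phi> t\<bar> * \<bar>B t t\<bar>"
          by (metis abs_triangle_ineq abs_mult)
        with 1 2 have "\<bar>\<phi> s * B s t - \<phi> t * B t t\<bar> \<le> \<bar>M * \<beta> t\<bar> * \<delta> s t + M1 * ?i * \<bar>B t t\<bar>"
          using M nonneg(3)[of t] by (simp add: abs_mult mult_ac)
        then have "ennreal \<bar>\<phi> s * B s t - \<phi> t * B t t\<bar> \<le> ennreal (\<bar>M * \<beta> t\<bar> * \<delta> s t + M1 * ?i * \<bar>B t t\<bar>)"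
          by (rule ennreal_leI)
        also have "\<dots> = ennreal (\<bar>M * \<beta> t\<bar> * \<delta> s t) + ennreal (M1 * ?i * \<bar>B t t\<bar>)"
          using M1(1) nonneg(4)[of s t] by (intro ennreal_plus mult_nonneg_nonneg) auto
        also have "ennreal (M1 * ?i * \<bar>B t t\<bar>) = ennreal (M1 * ?i) * ennreal \<bar>B t t\<bar>"
          using M1(1) by (intro ennreal_mult mult_nonneg_nonneg) auto
        finally show ?thesis .
      qed
      have [measurable]: "(\<lambda>(s, t). ennreal (\<bar>M * \<beta> t\<bar> * \<delta> s t)) \<in> borel_measurable (lborel \<Otimes>\<^sub>M lborel)"
        using \<delta>_meas by (simp add: split_beta')
      have "kdbl j (\<lambda>s t. ennreal \<bar>\<phi> s * B s t - \<phi> t * B t t\<bar>) \<le>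
          kdbl j (\<lambda>s t. ennreal (\<bar>M * \<beta> t\<bar> * \<delta> s t) + ennreal (M1 * ?i) * ennreal \<bar>B t t\<bar>)"
        by (rule kdbl_mono[OF p])
      also have "\<dots> = kdbl j (\<lambda>s t. ennreal (\<bar>M * \<beta> t\<bar> * \<delta> s t)) + kdbl j (\<lambda>s t. ennreal (M1 * ?i) * ennreal \<bar>B t t\<bar>)"
        by (rule kdbl_add) measurable
      also have "kdbl j (\<lambda>s t. ennreal (M1 * ?i) * ennreal \<bar>B t t\<bar>) = ennreal (M1 * ?i) * kdbl j (\<lambda>s t. ennreal \<bar>B t t\<bar>)"
        by (rule kdbl_cmult) measurable
      also have "kdbl j (\<lambda>s t. ennreal \<bar>B t t\<bar>) = b"
        unfolding b_def by (rule kdbl_snd) measurable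
      finally show ?thesis by (simp add: mult.commute)
    qed
    show "(\<lambda>j. kdbl j (\<lambda>s t. ennreal \<bar>\<phi> s * B s t - \<phi> t * B t t\<bar>)) \<longlonglongrightarrow> 0"
      by (rule tendsto_sandwich[OF _ _ tendsto_const lim2]) (use le in auto)
  qed
  have L3: "(\<lambda>j. pair_integral (\<lambda>s t. kern j (s - t) * (deriv \<phi> s * D s t))) \<longlonglongrightarrow> (LINT s|lborel. deriv \<phi> s * D s s)"
  proof (rule kern_limit_fst)
    show "pair_integrable (\<lambda>s t. kern j (s - t) * (deriv \<phi> s * D s t))" for j
      by (rule kint[OF _ M1(2) D_int]) measurable
    show "pair_measurable (\<lambda>s t. deriv \<phi> s * D s t)" using D_meas by (simp add: split_beta')
    show "integrable lborel (\<lambda>s. deriv \<phi> s * D s s)" by (rule GD) measurable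
    have lim: "(\<lambda>j. kdbl j (\<lambda>s t. ennreal (\<bar>M1 * C * h s\<bar> * \<delta> s t))) \<longlonglongrightarrow> 0"
      using h_sq by (intro kdbl_product_tendsto(1)) (auto simp: power_mult_distrib)
    have "ennreal \<bar>deriv \<phi> s * D s t - deriv \<phi> s * D s s\<bar> \<le> ennreal (\<bar>M1 * C * h s\<bar> * \<delta> s t)" for s t
    proof (rule ennreal_leI)
      have "\<bar>deriv \<phi> s * D s t - deriv \<phi> s * D s s\<bar> = \<bar>deriv \<phi> s\<bar> * \<bar>D s t - D s s\<bar>"
        by (simp add: abs_mult right_diff_distrib[symmetric])
      also have "\<dots> \<le> M1 * (h s * (C * \<delta> s t))"
        using M1 D_diff[of s t] by (intro mult_mono) auto
      finally show "\<bar>deriv \<phi> s * D s t - deriv \<phi> s * D s s\<bar> \<le> \<bar>M1 * C * h s\<bar> * \<delta> s t"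
        using M1 nonneg(1)[of s] nonneg(5) by (simp add: abs_mult mult_ac)
    qed
    then show "(\<lambda>j. kdbl j (\<lambda>s t. ennreal \<bar>deriv \<phi> s * D s t - deriv \<phi> s * D s s\<bar>)) \<longlonglongrightarrow> 0"
      by (intro tendsto_sandwich[OF _ _ tendsto_const lim] always_eventually allI kdbl_mono) auto
  qed
  have "\<forall>\<^sub>F j in sequentially. pair_integral (\<lambda>s t. kern j (s - t) * (\<phi> s * B s t)) + pair_integral (\<lambda>s t. kern j (s - t) * (\<phi> s * B t s))
     = - pair_integral (\<lambda>s t. kern j (s - t) * (deriv \<phi> s * D s t))"
    using ev by eventually_elim (intro weak_kern(1)[OF phi], use a(2) in force)
  then have "(\<lambda>j. - pair_integral (\<lambda>s t. kern j (s - t) * (deriv \<phi> s * D s t))) \<longlonglongrightarrow> (LINT s|lborel. \<phi> s * B s s) + (LINT s|lborel. \<phi> s * B s s)"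
    by (rule Lim_transform_eventually[OF tendsto_add[OF L2 L1]])
  from LIMSEQ_unique[OF this tendsto_minus[OF L3]] show ?thesis
    using integral_mult_right_zero[of lborel 2 "\<lambda>t. \<phi> t * B t t"] by (simp add: mult.left_commute)
qed

end

section \<open>The squared distance of two times as a primitive, and its oscillation\<close>

lemma prim_minus: "integrable lborel f \<Longrightarrow> integrable lborel g \<Longrightarrow> prim (\<lambda>t. f t - g t) t = prim f t - prim g t"
  unfolding prim_def
  by (simp add: right_diff_distrib integrable_indicator_mult)

lemma prim_cmult: "prim (\<lambda>t. c * f t) t = c * prim f t"
  unfolding prim_def by (simp add: mult.left_commute)

text \<open>An interval of positive length is not a null set; this is how witnesses are drawn from
  almost everywhere statements.\<close>

lemma AE_interval_ex:
  fixes a b :: real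
  assumes "AE t in lborel. t \<in> {a<..<b} \<longrightarrow> P t" "a < b"
  obtains t where "t \<in> {a<..<b}" "P t"
proof -
  have "\<exists>t\<in>{a<..<b}. P t"
  proof (rule ccontr)
    assume n: "\<not> (\<exists>t\<in>{a<..<b}. P t)"
    have "AE t in lborel. t \<notin> {a<..<b}" using assms(1) by eventually_elim (use n in auto)
    then have "{a<..<b} \<in> null_sets lborel"
      by (subst (asm) AE_iff_null_sets[symmetric]) auto
    then show False using assms(2) by auto
  qed
  then show ?thesis using that by blast
qed

context energy_pair
begin

abbreviation m :: "real \<Rightarrow> real \<Rightarrow> real" where "m s t \<equiv> D s s + D t t - 2 * D s t"

lemma Dsec_int: "integrable lborel (D s)"
  by (rule Bochner_Integration.integrable_bound[of _ "\<lambda>t. h s * h t"])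
     (use h_int sec_meas[OF D_meas] D_bound in \<open>auto intro!: AE_I2 order_trans[OF _ abs_ge_self]\<close>)

lemma Bsec_int: "integrable lborel (B s)"
  by (rule Bochner_Integration.integrable_bound[of _ "\<lambda>t. \<nu> s * \<beta> t"])
     (use \<beta>_int sec_meas[OF B_meas] B_bound in \<open>auto intro!: AE_I2 order_trans[OF _ abs_ge_self]\<close>)

lemma energy_prim:
  obtains C0 where "AE t in lborel. t \<in> {0<..<T} \<longrightarrow> D t t = C0 + 2 * prim (\<lambda>\<tau>. B \<tau> \<tau>) t"
proof -
  have nI: "integrable lborel (\<lambda>t. D t t)" using h_sq by (simp add: D_diag)
  have bI: "integrable lborel (\<lambda>t. 2 * B t t)" using Bdiag_int by simp
  obtain C0 where "AE t in lborel. t \<in> {0<..<T} \<longrightarrow> D t t = C0 + prim (\<lambda>\<tau>. 2 * B \<tau> \<tau>) t"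
    by (rule du_Bois_Reymond[OF T nI bI weak_energy])
  then show ?thesis by (intro that) (simp add: prim_cmult)
qed

text \<open>The weak derivative in \<tau> of the squared distance \<open>m s \<tau>\<close>: twice
  the derivative functional at \<tau>, applied to v(\<tau>) - v(s).\<close>

definition bs :: "real \<Rightarrow> real \<Rightarrow> real" where "bs s \<tau> = 2 * (B \<tau> \<tau> - B s \<tau>)"

lemma bs_int: "integrable lborel (bs s)"
  unfolding bs_def[abs_def] using Bdiag_int Bsec_int by simp

lemma bs_le: "\<bar>bs s \<tau>\<bar> \<le> 2 * (\<nu> \<tau> * \<beta> \<tau>) + 2 * (\<nu> s * \<beta> \<tau>)"
  using B_bound[of \<tau> \<tau>] B_bound[of s \<tau>] unfolding bs_def by argo

text \<open>Expanding the square leaves D at the diagonal, known from \<open>energy_prim\<close>,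
  and the section D s, to which the lemma of du Bois-Reymond applies for each s. The additive
  constant stays undetermined and is found in \<open>distance_formula\<close>.\<close>

lemma distance_prim:
  "AE s in lborel. \<exists>c. AE t in lborel. t \<in> {0<..<T} \<longrightarrow> m s t = c + prim (bs s) t"
proof -
  obtain C0 where C0: "AE t in lborel. t \<in> {0<..<T} \<longrightarrow> D t t = C0 + 2 * prim (\<lambda>\<tau>. B \<tau> \<tau>) t"
    by (rule energy_prim)
  show ?thesis
    using weak
  proof eventually_elim
    case (elim s)
    obtain c where c: "AE t in lborel. t \<in> {0<..<T} \<longrightarrow> D s t = c + prim (B s) t"
      by (rule du_Bois_Reymond[OF T Dsec_int Bsec_int bspec[OF elim]])
    have "AE t in lborel. t \<in> {0<..<T} \<longrightarrow> m s t = (D s s + C0 - 2 * c) + prim (bs s) t"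
      using C0 c
    proof eventually_elim
      case (elim t)
      have "prim (bs s) t = 2 * (prim (\<lambda>\<tau>. B \<tau> \<tau>) t - prim (B s) t)"
        unfolding bs_def[abs_def] prim_cmult prim_minus[OF Bdiag_int Bsec_int] ..
      then show ?case using elim by auto
    qed
    then show ?case by blast
  qed
qed

text \<open>Identifies the continuous representative of $t \mapsto \|v(s)-v(t)\|^2$ at the diagonal point $t = s$,
  which has measure zero.\<close>

lemma diag_liminf:
  "AE s in lborel. liminf (\<lambda>j. \<integral>\<^sup>+t. ennreal (kern j (s - t)) * ennreal (m s t) \<partial>lborel) = 0"
proof -
  have mm: "(\<lambda>(s, t). ennreal (m s t)) \<in> borel_measurable (lborel \<Otimes>\<^sub>M lborel)"
  proof -
    have [measurable]: "(\<lambda>t. D t t) \<in> borel_measurable borel" by (rule diag_meas[OF D_meas])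
    have "(\<lambda>p. D (fst p) (snd p)) \<in> borel_measurable (lborel \<Otimes>\<^sub>M lborel)" using D_meas by (simp add: split_beta')
    moreover have "(\<lambda>p. D (fst p) (fst p)) \<in> borel_measurable (lborel \<Otimes>\<^sub>M lborel)" by measurable
    moreover have "(\<lambda>p. D (snd p) (snd p)) \<in> borel_measurable (lborel \<Otimes>\<^sub>M lborel)" by measurable
    ultimately have "(\<lambda>p. ennreal (m (fst p) (snd p))) \<in> borel_measurable (lborel \<Otimes>\<^sub>M lborel)"
      by (intro measurable_compose[OF _ measurable_ennreal] borel_measurable_diff borel_measurable_add borel_measurable_times) auto
    then show ?thesis by (simp add: split_beta')
  qed
  let ?g = "\<lambda>j s. \<integral>\<^sup>+t. ennreal (kern j (s - t)) * ennreal (m s t) \<partial>lborel"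
  have gm: "?g j \<in> borel_measurable lborel" for j
    by (rule lborel.borel_measurable_nn_integral) (use mm in \<open>measurable\<close>)
  have dm: "(\<lambda>(s, t). ennreal ((\<delta> s t)\<^sup>2)) \<in> borel_measurable (lborel \<Otimes>\<^sub>M lborel)"
    using \<delta>_meas by (simp add: split_beta')
  have le: "(\<integral>\<^sup>+s. ?g j s \<partial>lborel) \<le> ennreal (C\<^sup>2) * kdbl j (\<lambda>s t. ennreal ((\<delta> s t)\<^sup>2))" for j
  proof -
    have "(\<integral>\<^sup>+s. ?g j s \<partial>lborel) = kdbl j (\<lambda>s t. ennreal (m s t))" by (simp add: kdbl_def)
    also have "\<dots> \<le> kdbl j (\<lambda>s t. ennreal (C\<^sup>2) * ennreal ((\<delta> s t)\<^sup>2))"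
      by (rule kdbl_mono) (use m_le in \<open>simp add: ennreal_mult[symmetric] ennreal_leI\<close>)
    also have "\<dots> = ennreal (C\<^sup>2) * kdbl j (\<lambda>s t. ennreal ((\<delta> s t)\<^sup>2))"
      by (rule kdbl_cmult[OF dm])
    finally show ?thesis .
  qed
  have lim: "(\<lambda>j. ennreal (C\<^sup>2) * kdbl j (\<lambda>s t. ennreal ((\<delta> s t)\<^sup>2))) \<longlonglongrightarrow> 0"
    using ennreal_tendsto_cmult[OF _ kern_\<delta>, of "ennreal (C\<^sup>2)"] by simp
  have "(\<lambda>j. \<integral>\<^sup>+s. ?g j s \<partial>lborel) \<longlonglongrightarrow> 0"
    by (rule tendsto_sandwich[OF _ _ tendsto_const lim]) (use le in auto)
  then have "liminf (\<lambda>j. \<integral>\<^sup>+s. ?g j s \<partial>lborel) = 0"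
    by (intro lim_imp_Liminf) auto
  \<comment> \<open>Fatou's lemma turns the convergence of the integrals over s into a statement for
    almost every single s.\<close>
  then have "(\<integral>\<^sup>+s. liminf (\<lambda>j. ?g j s) \<partial>lborel) = 0"
    using nn_integral_liminf[of ?g lborel] gm by simp
  then show ?thesis
    by (subst (asm) nn_integral_0_iff_AE) (use gm in auto)
qed

text \<open>Q is the continuous version of t -> m s t, and the claim is Q s = 0. A negative value
  contradicts m \<ge> 0 at nearby times; a positive one keeps the kernel means above half of it and
  contradicts \<open>diag_liminf\<close>.\<close>

lemma distance_formula:
  "AE s in lborel. s \<in> {0<..<T} \<longrightarrow> (AE t in lborel. t \<in> {0<..<T} \<longrightarrow> m s t = prim (bs s) t - prim (bs s) s)"
  using distance_prim diag_liminf
proof eventually_elim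
  case (elim s)
  show ?case
  proof
    assume s: "s \<in> {0<..<T}"
    obtain c where c: "AE t in lborel. t \<in> {0<..<T} \<longrightarrow> m s t = c + prim (bs s) t" using elim(1) by blast
    define Q where "Q t = c + prim (bs s) t" for t
    have "isCont (prim (bs s)) s"
      using continuous_prim[OF bs_int[of s]] by (simp add: continuous_on_eq_continuous_at)
    then have Q: "isCont Q s" unfolding Q_def by (intro continuous_intros)
    have near: "\<exists>d>0. \<forall>t. \<bar>t - s\<bar> < d \<longrightarrow> \<bar>Q t - Q s\<bar> < e" if "e > 0" for e
      using Q that unfolding continuous_at_eps_delta by (simp add: dist_real_def)
    have "Q s \<ge> 0"
    proof (rule ccontr)
      assume "\<not> Q s \<ge> 0"
      then obtain d where d: "d > 0" "\<And>t. \<bar>t - s\<bar> < d \<Longrightarrow> \<bar>Q t - Q s\<bar> < - Q s" using near[of "- Q s"] by auto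
      have "AE t in lborel. t \<in> {max 0 (s - d)<..<s} \<longrightarrow> Q t \<ge> 0"
        using c
      proof eventually_elim
        case (elim t)
        then show ?case using s m_nonneg[of s t] by (auto simp: Q_def)
      qed
      then obtain t where "t \<in> {max 0 (s - d)<..<s}" "Q t \<ge> 0"
        by (rule AE_interval_ex) (use s d in auto)
      then show False using d(2)[of t] by auto
    qed
    moreover have "Q s \<le> 0"
    proof (rule ccontr)
      assume "\<not> Q s \<le> 0"
      then have pos: "Q s > 0" by simp
      then obtain d where d: "d > 0" "\<And>t. \<bar>t - s\<bar> < d \<Longrightarrow> \<bar>Q t - Q s\<bar> < Q s / 2" using near[of "Q s / 2"] by auto
      \<comment> \<open>The kernel now sees only times t < s that are inside the interval and so
        close to s that Q exceeds half its value at s.\<close>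
      have "\<forall>\<^sub>F j in sequentially. inverse (real (Suc j)) < min d s"
        by (rule order_tendstoD(2)[OF LIMSEQ_inverse_real_of_nat]) (use d s in auto)
      then have "\<forall>\<^sub>F j in sequentially. ennreal (Q s / 2) \<le> (\<integral>\<^sup>+t. ennreal (kern j (s - t)) * ennreal (m s t) \<partial>lborel)"
      proof eventually_elim
        case (elim j)
        have "ennreal (Q s / 2) = (\<integral>\<^sup>+t. ennreal (kern j (s - t)) * ennreal (Q s / 2) \<partial>lborel)"
          by (simp add: nn_integral_multc kern_nn_integral_right)
        also have "\<dots> \<le> (\<integral>\<^sup>+t. ennreal (kern j (s - t)) * ennreal (m s t) \<partial>lborel)"
        proof (rule nn_integral_mono_AE)
          show "AE t in lborel. ennreal (kern j (s - t)) * ennreal (Q s / 2) \<le> ennreal (kern j (s - t)) * ennreal (m s t)"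
            using c
          proof eventually_elim
            fix t assume t: "t \<in> {0<..<T} \<longrightarrow> m s t = c + prim (bs s) t"
            show "ennreal (kern j (s - t)) * ennreal (Q s / 2) \<le> ennreal (kern j (s - t)) * ennreal (m s t)"
            proof (cases "kern j (s - t) = 0")
              case False
              then have "0 < s - t" "s - t < inverse (real (Suc j))" using kern_outside[of "s - t" j] by auto
              then have "t \<in> {0<..<T}" "\<bar>t - s\<bar> < d" using s elim by auto
              then have "m s t = Q t" "\<bar>Q t - Q s\<bar> < Q s / 2" using t d(2)[of t] unfolding Q_def[symmetric] by auto
              then have "Q s / 2 \<le> m s t" by arith
              then show ?thesis by (intro mult_left_mono ennreal_leI) auto
            qed simp
          qed
        qed
        finally show ?case .
      qed
      then have "ennreal (Q s / 2) \<le> liminf (\<lambda>j. \<integral>\<^sup>+t. ennreal (kern j (s - t)) * ennreal (m s t) \<partial>lborel)"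
        by (rule Liminf_bounded)
      then show False using elim(2) pos by simp
    qed
    ultimately have "c = - prim (bs s) s" by (simp add: Q_def)
    then show "AE t in lborel. t \<in> {0<..<T} \<longrightarrow> m s t = prim (bs s) t - prim (bs s) s"
      using c by simp
  qed
qed

text \<open>The density of ||v||_V^2 + ||w||_{V^*}^2. The increment of its primitive over an
  interval bounds the squared oscillation there, so it acts as a modulus of continuity in H.\<close>

definition wt :: "real \<Rightarrow> real" where "wt t = (\<nu> t)\<^sup>2 + (\<beta> t)\<^sup>2"

lemma wt_int: "integrable lborel wt" using \<nu>_sq \<beta>_sq by (simp add: wt_def[abs_def])

lemma prim_interval:
  assumes f: "integrable lborel f" and "a \<le> b"
  shows "prim f b - prim f a = (LINT \<tau>|lborel. indicator {a<..<b} \<tau> * f \<tau>)"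
proof -
  have [measurable]: "f \<in> borel_measurable borel" using f by auto
  have "prim f b - prim f a = (LINT \<tau>|lborel. indicator {a<..b} \<tau> * f \<tau>)"
    by (rule prim_diff[OF assms])
  also have "\<dots> = (LINT \<tau>|lborel. indicator {a<..<b} \<tau> * f \<tau>)"
  proof (rule integral_cong_AE)
    show "AE \<tau> in lborel. indicator {a<..b} \<tau> * f \<tau> = indicator {a<..<b} \<tau> * f \<tau>"
      using AE_lborel_singleton[of b] by eventually_elim (auto simp: indicator_def)
  qed measurable
  finally show ?thesis .
qed

text \<open>The point $r$ is chosen such that $\nu(r)^2$ does not exceed its mean over the interval.\<close>

lemma oscillation:
  assumes ab: "0 \<le> a" "a < b" "b \<le> T"
  obtains r where "r \<in> {a<..<b}"
    "AE t in lborel. t \<in> {a<..<b} \<longrightarrow> m r t \<le> 2 * (prim wt b - prim wt a)"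
proof -
  let ?U = "{a<..<b}" and ?l = "b - a"
  define S1 S2 where "S1 = (LINT t|lborel. indicator ?U t * (\<nu> t)\<^sup>2)" and "S2 = (LINT t|lborel. indicator ?U t * (\<beta> t)\<^sup>2)"
  have wt: "prim wt b - prim wt a = S1 + S2"
    using prim_interval[OF wt_int, of a b] ab integrable_indicator_mult[OF \<nu>_sq, of ?U] integrable_indicator_mult[OF \<beta>_sq, of ?U]
    by (simp add: wt_def distrib_left S1_def S2_def)
  have indU: "integrable lborel (indicator ?U :: real \<Rightarrow> real)" "(LINT t|lborel. indicator ?U t) = ?l"
    using ab by auto
  \<comment> \<open>If the square of \<nu> exceeded its mean almost everywhere on the interval, a
    nonnegative function with integral zero would be positive almost everywhere there.\<close>
  have "\<not> (AE r in lborel. r \<in> ?U \<longrightarrow> (\<nu> r)\<^sup>2 > S1 / ?l)"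
  proof
    assume ae: "AE r in lborel. r \<in> ?U \<longrightarrow> (\<nu> r)\<^sup>2 > S1 / ?l"
    let ?f = "\<lambda>r. indicator ?U r * (\<nu> r)\<^sup>2 - S1 / ?l * indicator ?U r"
    have I: "integrable lborel ?f"
      using integrable_indicator_mult[OF \<nu>_sq, of ?U] indU by simp
    have "(LINT r|lborel. ?f r) = S1 - S1 / ?l * ?l"
      using integrable_indicator_mult[OF \<nu>_sq, of ?U] indU by (simp add: S1_def)
    then have z: "(LINT r|lborel. ?f r) = 0" using ab by simp
    have nn: "AE r in lborel. 0 \<le> ?f r"
      using ae by eventually_elim (auto simp: indicator_def)
    have "AE r in lborel. ?f r = 0"
      using z by (subst (asm) integral_nonneg_eq_0_iff_AE[OF I nn])
    with ae have "AE r in lborel. r \<in> ?U \<longrightarrow> False"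
      by eventually_elim (auto simp: indicator_def)
    then show False by (rule AE_interval_ex) (use ab in auto)
  qed
  moreover note distance_formula
  ultimately obtain r where r: "r \<in> ?U" "(\<nu> r)\<^sup>2 \<le> S1 / ?l"
    "r \<in> {0<..<T} \<longrightarrow> (AE t in lborel. t \<in> {0<..<T} \<longrightarrow> m r t = prim (bs r) t - prim (bs r) r)"
  proof -
    assume n: "\<not> (AE r in lborel. r \<in> ?U \<longrightarrow> (\<nu> r)\<^sup>2 > S1 / ?l)"
      and ae: "AE r in lborel. r \<in> {0<..<T} \<longrightarrow> (AE t in lborel. t \<in> {0<..<T} \<longrightarrow> m r t = prim (bs r) t - prim (bs r) r)"
    have "\<exists>r. r \<in> ?U \<and> (\<nu> r)\<^sup>2 \<le> S1 / ?l \<and> (r \<in> {0<..<T} \<longrightarrow> (AE t in lborel. t \<in> {0<..<T} \<longrightarrow> m r t = prim (bs r) t - prim (bs r) r))"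
    proof (rule ccontr)
      assume nex: "\<not> ?thesis"
      have "AE r in lborel. r \<in> ?U \<longrightarrow> (\<nu> r)\<^sup>2 > S1 / ?l"
        using ae by (rule eventually_mono) (use nex in \<open>meson not_le\<close>)
      with n show False by blast
    qed
    then show ?thesis using that by blast
  qed
  have rJ: "r \<in> {0<..<T}" using r(1) ab by auto
  have bI: "integrable lborel (\<lambda>t. indicator ?U t * \<beta> t)" by (rule integrable_indicator_mult[OF \<beta>_int]) simp
  have pI: "integrable lborel (\<lambda>t. indicator ?U t * (\<nu> t * \<beta> t))"
    by (rule integrable_indicator_mult[OF product_int[OF \<nu>_meas \<beta>_meas \<nu>_sq \<beta>_sq]]) simp
  \<comment> \<open>Cauchy-Schwarz against the indicator of the interval, whose square has integral
    b - a.\<close>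
  have CS: "(LINT t|lborel. indicator ?U t * \<beta> t)\<^sup>2 \<le> ?l * S2"
  proof -
    have e: "(indicator ?U t * \<beta> t)\<^sup>2 = indicator ?U t * (\<beta> t)\<^sup>2" "(indicator ?U t)\<^sup>2 = (indicator ?U t :: real)"
      "indicator ?U t * (indicator ?U t * \<beta> t) = indicator ?U t * \<beta> t" for t
      by (auto simp: indicator_def)
    have "(LINT t|lborel. indicator ?U t * (indicator ?U t * \<beta> t)) \<le>
        sqrt (LINT t|lborel. (indicator ?U t)\<^sup>2) * sqrt (LINT t|lborel. (indicator ?U t * \<beta> t)\<^sup>2)"
      by (rule Cauchy_Schwarz_integral) (use bI indU integrable_indicator_mult[OF \<beta>_sq, of ?U] in \<open>simp_all only: e sets_lborel borel_open open_greaterThanLessThan\<close>)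
    then have "(LINT t|lborel. indicator ?U t * \<beta> t) \<le> sqrt (?l * S2)"
      unfolding e indU S2_def[symmetric] real_sqrt_mult .
    moreover have "0 \<le> (LINT t|lborel. indicator ?U t * \<beta> t)"
      by (rule Bochner_Integration.integral_nonneg) (simp add: nonneg)
    ultimately have "(LINT t|lborel. indicator ?U t * \<beta> t)\<^sup>2 \<le> (sqrt (?l * S2))\<^sup>2" by (rule power_mono)
    moreover have "S2 \<ge> 0" unfolding S2_def by (rule Bochner_Integration.integral_nonneg) simp
    ultimately show ?thesis using ab by simp
  qed
  \<comment> \<open>Young's inequality balanced with the square root of the length: the choice of r
    bounds the square of \<nu> r times the length by S1, and CS bounds the squared integral of
    \<beta> divided by the length by S2.\<close>
  have "2 * \<nu> r * (LINT t|lborel. indicator ?U t * \<beta> t) \<le> S1 + S2"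
  proof -
    let ?x = "LINT t|lborel. indicator ?U t * \<beta> t"
    have l: "?l > 0" using ab by simp
    have "2 * (\<nu> r * sqrt ?l) * (?x / sqrt ?l) \<le> (\<nu> r * sqrt ?l)\<^sup>2 + (?x / sqrt ?l)\<^sup>2" by (rule sum_squares_bound)
    also have "2 * (\<nu> r * sqrt ?l) * (?x / sqrt ?l) = 2 * \<nu> r * ?x" using l by simp
    also have "(\<nu> r * sqrt ?l)\<^sup>2 + (?x / sqrt ?l)\<^sup>2 = (\<nu> r)\<^sup>2 * ?l + ?x\<^sup>2 / ?l"
      using l by (simp add: power_mult_distrib power_divide)
    also have "\<dots> \<le> S1 + S2"
      using r(2) CS l by (intro add_mono) (simp_all add: field_simps)
    finally show ?thesis .
  qed
  moreover have "2 * (LINT t|lborel. indicator ?U t * (\<nu> t * \<beta> t)) \<le> S1 + S2"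
  proof -
    have "2 * (LINT t|lborel. indicator ?U t * (\<nu> t * \<beta> t)) = (LINT t|lborel. 2 * (indicator ?U t * (\<nu> t * \<beta> t)))" by simp
    also have "\<dots> \<le> (LINT t|lborel. indicator ?U t * (\<nu> t)\<^sup>2 + indicator ?U t * (\<beta> t)\<^sup>2)"
    proof (rule integral_mono)
      show "2 * (indicator ?U t * (\<nu> t * \<beta> t)) \<le> indicator ?U t * (\<nu> t)\<^sup>2 + indicator ?U t * (\<beta> t)\<^sup>2" for t
        using sum_squares_bound[of "\<nu> t" "\<beta> t"] by (auto simp: indicator_def mult.assoc)
      show "integrable lborel (\<lambda>t. indicator ?U t * (\<nu> t)\<^sup>2 + indicator ?U t * (\<beta> t)\<^sup>2)"
        by (intro Bochner_Integration.integrable_add integrable_indicator_mult \<nu>_sq \<beta>_sq) auto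
    qed (use pI in simp)
    also have "\<dots> = S1 + S2"
      unfolding S1_def S2_def
      by (intro Bochner_Integration.integral_add integrable_indicator_mult \<nu>_sq \<beta>_sq) auto
    finally show ?thesis .
  qed
  ultimately have bd: "2 * (LINT t|lborel. indicator ?U t * (\<nu> t * \<beta> t)) + 2 * \<nu> r * (LINT t|lborel. indicator ?U t * \<beta> t) \<le> 2 * (prim wt b - prim wt a)"
    unfolding wt by argo
  \<comment> \<open>By \<open>bs_le\<close> the increment from r to t splits into a part with \<nu>
    at the running time and a part with \<nu> frozen at r. Both are enlarged from the range between
    r and t to the whole interval, and each is at most S1 + S2.\<close>
  have osc: "prim (bs r) t - prim (bs r) r \<le> 2 * (prim wt b - prim wt a)" if t: "t \<in> ?U" for t
  proof -
    let ?A = "{min r t<..<max r t}"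
    have "prim (bs r) t - prim (bs r) r \<le> \<bar>prim (bs r) (max r t) - prim (bs r) (min r t)\<bar>"
      by (cases "r \<le> t") (auto simp: max_def min_def)
    also have "\<dots> = \<bar>LINT \<tau>|lborel. indicator ?A \<tau> * bs r \<tau>\<bar>"
      by (subst prim_interval[OF bs_int]) auto
    also have "\<dots> \<le> (LINT \<tau>|lborel. \<bar>indicator ?A \<tau> * bs r \<tau>\<bar>)" by (rule integral_abs_bound)
    also have "\<dots> \<le> (LINT \<tau>|lborel. 2 * (indicator ?U \<tau> * (\<nu> \<tau> * \<beta> \<tau>)) + 2 * \<nu> r * (indicator ?U \<tau> * \<beta> \<tau>))"
    proof (rule integral_mono)
      show "integrable lborel (\<lambda>\<tau>. \<bar>indicator ?A \<tau> * bs r \<tau>\<bar>)"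
        by (intro integrable_abs integrable_indicator_mult bs_int) simp
      show "integrable lborel (\<lambda>\<tau>. 2 * (indicator ?U \<tau> * (\<nu> \<tau> * \<beta> \<tau>)) + 2 * \<nu> r * (indicator ?U \<tau> * \<beta> \<tau>))"
        using pI bI by simp
      show "\<bar>indicator ?A \<tau> * bs r \<tau>\<bar> \<le> 2 * (indicator ?U \<tau> * (\<nu> \<tau> * \<beta> \<tau>)) + 2 * \<nu> r * (indicator ?U \<tau> * \<beta> \<tau>)" for \<tau>
      proof (cases "\<tau> \<in> ?A")
        case True
        then have "\<tau> \<in> ?U" using t r(1) by auto
        then show ?thesis using True bs_le[of r \<tau>] by simp
      next
        case False
        then have z: "indicator ?A \<tau> = (0::real)" by (rule indicator_simps(2))
        have "\<bar>indicator ?A \<tau> * bs r \<tau>\<bar> = 0" unfolding z by simp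
        also have "0 \<le> 2 * (indicator ?U \<tau> * (\<nu> \<tau> * \<beta> \<tau>)) + 2 * \<nu> r * (indicator ?U \<tau> * \<beta> \<tau>)"
          by (intro add_nonneg_nonneg mult_nonneg_nonneg nonneg) auto
        finally show ?thesis .
      qed
    qed
    also have "\<dots> \<le> 2 * (prim wt b - prim wt a)" using bd pI bI by simp
    finally show ?thesis .
  qed
  have "AE t in lborel. t \<in> {0<..<T} \<longrightarrow> m r t = prim (bs r) t - prim (bs r) r" using r(3) rJ by blast
  then have "AE t in lborel. t \<in> ?U \<longrightarrow> m r t \<le> 2 * (prim wt b - prim wt a)"
  proof eventually_elim
    case (elim t)
    show ?case using elim osc[of t] ab by auto
  qed
  with r(1) show ?thesis by (rule that)
qed

text \<open>This later shows that the continuous representative agrees with v at almost every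
  time.\<close>

lemma distance_small:
  "AE r in lborel. r \<in> {0<..<T} \<longrightarrow> (\<forall>e>0. \<exists>d>0. AE t in lborel. t \<in> {0<..<T} \<and> \<bar>t - r\<bar> < d \<longrightarrow> m r t < e)"
  using distance_formula
proof eventually_elim
  case (elim r)
  show ?case
  proof (intro impI allI)
    fix e :: real assume r: "r \<in> {0<..<T}" and e: "e > 0"
    have "isCont (prim (bs r)) r"
      using continuous_prim[OF bs_int[of r]] by (simp add: continuous_on_eq_continuous_at)
    then obtain d where d: "d > 0" "\<And>t. \<bar>t - r\<bar> < d \<Longrightarrow> \<bar>prim (bs r) t - prim (bs r) r\<bar> < e"
      using e unfolding continuous_at_eps_delta by (auto simp: dist_real_def)
    have "AE t in lborel. t \<in> {0<..<T} \<and> \<bar>t - r\<bar> < d \<longrightarrow> m r t < e"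
      using elim[rule_format, OF r] by eventually_elim (use d(2) in force)
    with d(1) show "\<exists>d>0. AE t in lborel. t \<in> {0<..<T} \<and> \<bar>t - r\<bar> < d \<longrightarrow> m r t < e" by blast
  qed
qed

end

section \<open>Completeness of $L^2$ and continuous representatives\<close>

text \<open>On a finite measure space geometric decay of the increments in mean square gives
  summable first moments, so the telescoping series converges absolutely almost everywhere.\<close>

lemma AE_convergent_geometric:
  fixes f :: "nat \<Rightarrow> 'a \<Rightarrow> 'b::euclidean_space"
  assumes fin: "emeasure M (space M) \<noteq> \<infinity>" and [measurable]: "\<And>k. f k \<in> borel_measurable M"
    and le: "\<And>k. (\<integral>\<^sup>+x. ennreal ((norm (f (Suc k) x - f k x))\<^sup>2) \<partial>M) \<le> ennreal ((1/4) ^ k)"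
  obtains F where "F \<in> borel_measurable M" "AE x in M. (\<lambda>k. f k x) \<longlonglongrightarrow> F x"
proof -
  let ?d = "\<lambda>k x. norm (f (Suc k) x - f k x)"
  obtain c where c: "emeasure M (space M) = ennreal c" "c \<ge> 0"
    using fin by (cases "emeasure M (space M)") auto
  have 1: "(\<integral>\<^sup>+x. ennreal (?d k x) \<partial>M) \<le> ennreal ((1/2) ^ k * (1 + c))" for k
  proof -
    \<comment> \<open>Exchanges the first power for a square: either a is at most 2^-k, or 1 \<le>
      2^k a. The constant term is integrable because the measure is finite, and 2^k times 4^-k
      leaves 2^-k.\<close>
    have p: "a \<le> 2 ^ k * a\<^sup>2 + (1/2) ^ k" if "a \<ge> 0" for a :: real
    proof (cases "a \<le> (1/2) ^ k")
      case True
      then show ?thesis by (simp add: add_increasing)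
    next
      case False
      then have "1 \<le> 2 ^ k * a" by (simp add: power_one_over field_simps)
      then have "1 * a \<le> (2 ^ k * a) * a" using that by (intro mult_right_mono)
      moreover have "0 \<le> (1/2::real) ^ k" by simp
      ultimately show ?thesis unfolding power2_eq_square by argo
    qed
    have "(\<integral>\<^sup>+x. ennreal (?d k x) \<partial>M) \<le> (\<integral>\<^sup>+x. ennreal (2 ^ k) * ennreal ((?d k x)\<^sup>2) + ennreal ((1/2) ^ k) \<partial>M)"
    proof (rule nn_integral_mono)
      fix x
      have "ennreal (?d k x) \<le> ennreal (2 ^ k * (?d k x)\<^sup>2 + (1/2) ^ k)" by (rule ennreal_leI[OF p]) simp
      then show "ennreal (?d k x) \<le> ennreal (2 ^ k) * ennreal ((?d k x)\<^sup>2) + ennreal ((1/2) ^ k)"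
        by (simp only: ennreal_plus ennreal_mult zero_le_power zero_le_numeral zero_le_power2 mult_nonneg_nonneg divide_nonneg_nonneg zero_le_one)
    qed
    also have "\<dots> = ennreal (2 ^ k) * (\<integral>\<^sup>+x. ennreal ((?d k x)\<^sup>2) \<partial>M) + ennreal ((1/2) ^ k) * ennreal c"
      by (subst nn_integral_add) (simp_all add: nn_integral_cmult c del: ennreal_power)
    also have "\<dots> \<le> ennreal (2 ^ k) * ennreal ((1/4) ^ k) + ennreal ((1/2) ^ k) * ennreal c"
      by (intro add_mono mult_left_mono le) auto
    also have "\<dots> = ennreal (2 ^ k * (1/4) ^ k + (1/2) ^ k * c)"
      using c(2) by (simp only: ennreal_plus ennreal_mult zero_le_power zero_le_numeral mult_nonneg_nonneg divide_nonneg_nonneg zero_le_one)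
    also have "2 ^ k * (1/4) ^ k = (1/2::real) ^ k" unfolding power_mult_distrib[symmetric] by simp
    finally show ?thesis by (simp add: distrib_left)
  qed
  have sm: "summable (\<lambda>k. (1/2::real) ^ k * (1 + c))" by (intro summable_mult2 summable_geometric) simp
  have "(\<integral>\<^sup>+x. (\<Sum>k. ennreal (?d k x)) \<partial>M) = (\<Sum>k. \<integral>\<^sup>+x. ennreal (?d k x) \<partial>M)"
    by (rule nn_integral_suminf) measurable
  also have "\<dots> \<le> (\<Sum>k. ennreal ((1/2) ^ k * (1 + c)))"
    by (intro suminf_le 1 summableI)
  finally have "(\<integral>\<^sup>+x. (\<Sum>k. ennreal (?d k x)) \<partial>M) \<le> (\<Sum>k. ennreal ((1/2) ^ k * (1 + c)))" .
  moreover have "(\<Sum>k. ennreal ((1/2) ^ k * (1 + c))) \<noteq> top"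
    by (rule ennreal_suminf_neq_top[OF sm]) (use c(2) in simp)
  ultimately have "(\<integral>\<^sup>+x. (\<Sum>k. ennreal (?d k x)) \<partial>M) \<noteq> \<infinity>"
    unfolding infinity_ennreal_def using neq_top_trans by blast
  then have "AE x in M. (\<Sum>k. ennreal (?d k x)) \<noteq> \<infinity>"
    by (intro nn_integral_PInf_AE) measurable
  then have "AE x in M. (\<lambda>k. f k x) \<longlonglongrightarrow> lim (\<lambda>k. f k x)"
  proof eventually_elim
    case (elim x)
    then have "summable (\<lambda>k. ?d k x)" by (intro summable_suminf_not_top) auto
    then have "summable (\<lambda>k. f (Suc k) x - f k x)" by (rule summable_norm_cancel)
    then have "(\<lambda>n. \<Sum>k<n. f (Suc k) x - f k x) \<longlonglongrightarrow> (\<Sum>k. f (Suc k) x - f k x)" by (rule summable_LIMSEQ)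
    moreover have "(\<Sum>k<n. f (Suc k) x - f k x) = f n x - f 0 x" for n by (rule sum_lessThan_telescope)
    ultimately have "(\<lambda>n. (f n x - f 0 x) + f 0 x) \<longlonglongrightarrow> (\<Sum>k. f (Suc k) x - f k x) + f 0 x"
      by (intro tendsto_add tendsto_const) simp
    then have "convergent (\<lambda>n. f n x)" unfolding convergent_def by auto
    then show ?case by (simp add: convergent_LIMSEQ_iff)
  qed
  moreover have "(\<lambda>x. lim (\<lambda>k. f k x)) \<in> borel_measurable M" by measurable
  ultimately show ?thesis by (intro that)
qed

lemma L2_nn_integral:
  assumes "g \<in> L2 S"
  shows "(\<integral>\<^sup>+x. ennreal ((norm (g x))\<^sup>2) \<partial>lebesgue_on S) = ennreal ((L2_norm S g)\<^sup>2)"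
  by (subst nn_integral_eq_integral[OF L2_integrable_sq[OF assms]]) (auto simp: L2_norm_sq)

lemma L2_Fatou:
  fixes F :: "'a::euclidean_space \<Rightarrow> 'b::euclidean_space"
  assumes f: "\<And>j::nat. f j \<in> L2 S" and F: "F \<in> borel_measurable (lebesgue_on S)"
    and lim: "AE x in lebesgue_on S. (\<lambda>j. f j x) \<longlonglongrightarrow> F x"
    and le: "\<forall>\<^sub>F j in sequentially. L2_norm S (f j) \<le> C"
  shows "F \<in> L2 S" "L2_norm S F \<le> C"
proof -
  have C: "C \<ge> 0"
    using eventually_happens[OF le] by (metis L2_norm_nonneg order_trans sequentially_bot)
  note [measurable] = F L2_measurable[OF f]
  have "(\<integral>\<^sup>+x. ennreal ((norm (F x))\<^sup>2) \<partial>lebesgue_on S) = (\<integral>\<^sup>+x. liminf (\<lambda>j. ennreal ((norm (f j x))\<^sup>2)) \<partial>lebesgue_on S)"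
  proof (rule nn_integral_cong_AE)
    show "AE x in lebesgue_on S. ennreal ((norm (F x))\<^sup>2) = liminf (\<lambda>j. ennreal ((norm (f j x))\<^sup>2))"
      using lim
    proof eventually_elim
      case (elim x)
      have "(\<lambda>j. ennreal ((norm (f j x))\<^sup>2)) \<longlonglongrightarrow> ennreal ((norm (F x))\<^sup>2)"
        by (intro tendsto_ennrealI tendsto_power tendsto_norm elim)
      from lim_imp_Liminf[OF sequentially_bot this] show ?case by (rule sym)
    qed
  qed
  also have "\<dots> \<le> liminf (\<lambda>j. \<integral>\<^sup>+x. ennreal ((norm (f j x))\<^sup>2) \<partial>lebesgue_on S)"
    by (rule nn_integral_liminf) measurable
  also have "\<dots> \<le> liminf (\<lambda>j. ennreal (C\<^sup>2))"
    by (rule Liminf_mono, rule eventually_mono[OF le]) (simp add: L2_nn_integral[OF f] ennreal_leI power_mono)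
  also have "\<dots> = ennreal (C\<^sup>2)" by (simp add: Liminf_const)
  finally have b: "(\<integral>\<^sup>+x. ennreal ((norm (F x))\<^sup>2) \<partial>lebesgue_on S) \<le> ennreal (C\<^sup>2)" .
  have "integrable (lebesgue_on S) (\<lambda>x. (norm (F x))\<^sup>2)"
    by (rule integrableI_nonneg) (use b in \<open>auto simp: top.not_eq_extremum order_le_less_trans\<close>)
  then show FL: "F \<in> L2 S" using F by (rule L2I[rotated])
  have "ennreal ((L2_norm S F)\<^sup>2) \<le> ennreal (C\<^sup>2)" using b L2_nn_integral[OF FL] by simp
  then have "(L2_norm S F)\<^sup>2 \<le> C\<^sup>2" by (simp add: ennreal_le_iff)
  then show "L2_norm S F \<le> C" by (rule power2_le_imp_le[OF _ C])
qed

text \<open>The rate is built into the hypothesis, which spares the passage to a subsequence. The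
  almost everywhere limit obeys the tail bounds by Fatou's lemma.\<close>

lemma L2_complete:
  fixes f :: "nat \<Rightarrow> 'a::euclidean_space \<Rightarrow> 'b::euclidean_space"
  assumes S: "S \<in> lmeasurable" and f: "\<And>k. f k \<in> L2 S"
    and le: "\<And>k. L2_norm S (f (Suc k) - f k) \<le> (1/2) ^ k"
  obtains F where "F \<in> L2 S" "\<And>k. L2_norm S (f k - F) \<le> 2 * (1/2) ^ k"
proof -
  have fin: "emeasure (lebesgue_on S) (space (lebesgue_on S)) \<noteq> \<infinity>"
    using finite_measure.emeasure_finite[OF finite_measure_lebesgue_on[OF S]] by simp
  have "(\<integral>\<^sup>+x. ennreal ((norm (f (Suc k) x - f k x))\<^sup>2) \<partial>lebesgue_on S) \<le> ennreal ((1/4) ^ k)" for k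
  proof -
    have "(L2_norm S (f (Suc k) - f k))\<^sup>2 \<le> ((1/2) ^ k)\<^sup>2" by (rule power_mono[OF le]) simp
    also have "((1/2) ^ k)\<^sup>2 = ((1/4::real) ^ k)" by (simp add: power2_eq_square flip: power_mult_distrib)
    finally show ?thesis
      using L2_nn_integral[OF L2_minus[OF f[of "Suc k"] f[of k]]] by (simp add: ennreal_leI)
  qed
  then obtain F where F: "F \<in> borel_measurable (lebesgue_on S)" "AE x in lebesgue_on S. (\<lambda>k. f k x) \<longlonglongrightarrow> F x"
    by (rule AE_convergent_geometric[OF fin L2_measurable[OF f]])
  \<comment> \<open>The subtracted term is the part of the geometric series not yet used; without it
    the induction on n would not close.\<close>
  have tail: "L2_norm S (f k - f (k + n)) \<le> 2 * (1/2) ^ k - 2 * (1/2) ^ (k + n)" for k n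
  proof (induction n)
    case 0
    have "f k - f k = (\<lambda>x. 0)" by (simp add: fun_eq_iff)
    then show ?case by (simp add: L2_norm_zero)
  next
    case (Suc n)
    have "L2_norm S (f k - f (k + Suc n)) \<le> L2_norm S (f k - f (k + n)) + L2_norm S (f (Suc (k + n)) - f (k + n))"
      using L2_norm_triangle[OF f[of k] f[of "k + n"] f[of "k + Suc n"]] L2_norm_minus_commute[of S "f (k + n)"] by simp
    also have "\<dots> \<le> (2 * (1/2) ^ k - 2 * (1/2) ^ (k + n)) + (1/2) ^ (k + n)"
      by (intro add_mono Suc.IH le)
    finally show ?case by (simp add: fun_diff_def)
  qed
  have k: "f k - F \<in> L2 S \<and> L2_norm S (f k - F) \<le> 2 * (1/2) ^ k" for k
  proof -
    have ev: "\<forall>\<^sub>F j in sequentially. L2_norm S (f k - f j) \<le> 2 * (1/2) ^ k"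
      using eventually_ge_at_top[of k]
    proof eventually_elim
      case (elim j)
      have "L2_norm S (f k - f j) \<le> 2 * (1/2) ^ k - 2 * (1/2) ^ j" using tail[of k "j - k"] elim by simp
      also have "\<dots> \<le> 2 * (1/2) ^ k" by simp
      finally show ?case .
    qed
    have "AE x in lebesgue_on S. (\<lambda>j. (f k - f j) x) \<longlonglongrightarrow> (f k - F) x"
      using F(2) by eventually_elim (auto intro!: tendsto_intros)
    moreover have "f k - F \<in> borel_measurable (lebesgue_on S)"
      using borel_measurable_diff[OF L2_measurable[OF f[of k]] F(1)] by (simp add: fun_diff_def)
    ultimately show ?thesis
      using L2_Fatou[OF L2_minus[OF f[of k] f] _ _ ev] by blast
  qed
  have "f 0 - (f 0 - F) \<in> L2 S" by (rule L2_minus[OF f]) (use k[of 0] in blast)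
  moreover have "f 0 - (f 0 - F) = F" by (simp add: fun_eq_iff)
  ultimately have "F \<in> L2 S" by (simp only:)
  then show ?thesis using k by (intro that) auto
qed

text \<open>Passes from the completed measure of the definitions to Borel functions on the line,
  where product measures are available. Measurability of f comes from completeness of Lebesgue
  measure.\<close>

lemma lebesgue_on_to_lborel:
  fixes f g :: "'a::euclidean_space \<Rightarrow> real"
  assumes S: "S \<in> sets borel" and g: "g \<in> borel_measurable borel" and ae: "AE t in lborel. t \<in> S \<longrightarrow> f t = g t"
  shows "(LINT t|lebesgue_on S. f t) = (LINT t|lborel. indicator S t * g t)"
    "integrable (lebesgue_on S) f \<longleftrightarrow> integrable lborel (\<lambda>t. indicator S t * g t)"
    "f \<in> borel_measurable (lebesgue_on S)"
proof -
  have SL: "S \<in> sets lebesgue" using S by simp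
  have gm: "(\<lambda>t. indicator S t * g t) \<in> borel_measurable lborel" using S g by simp
  have ae': "AE t in lebesgue. indicator S t * g t = indicator S t *\<^sub>R f t"
    unfolding AE_completion_iff using ae by eventually_elim (auto simp: indicator_def)
  have fm: "(\<lambda>t. indicator S t *\<^sub>R f t) \<in> borel_measurable lebesgue"
    by (rule borel_measurable_AE[OF measurable_completion[OF gm] ae'])
  show "f \<in> borel_measurable (lebesgue_on S)"
    using fm by (subst borel_measurable_restrict_space_iff) (use SL in auto)
  show "(LINT t|lebesgue_on S. f t) = (LINT t|lborel. indicator S t * g t)"
    unfolding lebesgue_on_integrable_iff(2)[OF SL] integral_completion[OF gm, symmetric]
    by (rule integral_cong_AE[OF fm measurable_completion[OF gm]]) (use ae' in auto)
  have "integrable (lebesgue_on S) f \<longleftrightarrow> integrable lebesgue (\<lambda>t. indicator S t * g t)"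
    unfolding lebesgue_on_integrable_iff(1)[OF SL]
    by (rule integrable_cong_AE[OF fm measurable_completion[OF gm]]) (use ae' in auto)
  also have "\<dots> \<longleftrightarrow> integrable lborel (\<lambda>t. indicator S t * g t)" by (rule integrable_completion[OF gm])
  finally show "integrable (lebesgue_on S) f \<longleftrightarrow> integrable lborel (\<lambda>t. indicator S t * g t)" .
qed

text \<open>The condition under the choice operator in \<open>cont_rep\<close>, named so that
  existence and uniqueness can be stated.\<close>

definition continuous_rep :: "real \<Rightarrow> (real^'d::finite) set \<Rightarrow> (real \<Rightarrow> 'd vfield) \<Rightarrow> (real \<Rightarrow> 'd vfield) \<Rightarrow> bool" where
  "continuous_rep T \<Omega> v c \<longleftrightarrow> (\<forall>t\<in>{0..T}. c t \<in> L2 \<Omega>) \<and>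
     (\<forall>t\<in>{0..T}. ((\<lambda>s. L2_norm \<Omega> (c s - c t)) \<longlongrightarrow> 0) (at t within {0..T})) \<and>
     (AE t in lebesgue_on {0<..<T}. AE x in lebesgue_on \<Omega>. c t x = v t x)"

section \<open>From evolution triples to scalar functions of two times\<close>

context bounded_open
begin

text \<open>The representative lies in \<open>V\<close> at every time, so the weak equation may be
  tested with \<xi> = v'(s) for each s separately. Joint measurability of both pairings comes from
  simple approximations, and C is the constant of Poincare's inequality.\<close>

lemma energy_pair_of_W:
  assumes T: "0 < T" and C: "C \<ge> 0" "\<And>v. v \<in> V \<Omega> \<Longrightarrow> L2_norm \<Omega> v \<le> C * V_norm \<Omega> v"
    and v': "seminormed_set.approx (V \<Omega>) (V_norm \<Omega>) T v' sv" "AE t in lborel. t \<in> {0<..<T} \<longrightarrow> v' t = v t"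
    and w': "seminormed_set.approx (V_dual \<Omega>) (V_dual_norm \<Omega>) T w' sw" "AE t in lborel. t \<in> {0<..<T} \<longrightarrow> w' t = w t"
    and weak: "weak_dt T \<Omega> v w"
  shows "energy_pair T (\<lambda>s t. LINT x|lebesgue_on \<Omega>. v' s x \<bullet> v' t x) (\<lambda>s t. w' t (v' s)) (\<lambda>s t. V_norm \<Omega> (v' s - v' t))
    (\<lambda>t. L2_norm \<Omega> (v' t)) (\<lambda>t. V_norm \<Omega> (v' t)) (\<lambda>t. V_dual_norm \<Omega> (w' t)) C"
proof -
  interpret NV: seminormed_set "V \<Omega>" "V_norm \<Omega>" by (rule seminormed_set_V)
  interpret ND: seminormed_set "V_dual \<Omega>" "V_dual_norm \<Omega>" by (rule seminormed_set_V_dual)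
  let ?D = "\<lambda>s t. LINT x|lebesgue_on \<Omega>. v' s x \<bullet> v' t x"
  let ?B = "\<lambda>s t. w' t (v' s)"
  have vV: "v' t \<in> V \<Omega>" "sv n t \<in> V \<Omega>" and svS: "simple_function lborel (sv n)" and vlim: "(\<lambda>n. V_norm \<Omega> (sv n t - v' t)) \<longlonglongrightarrow> 0"
    and v0: "t \<notin> {0<..<T} \<Longrightarrow> v' t = (\<lambda>_. 0)" for n t using v'(1) by (auto simp: NV.approx_def)
  have wV: "w' t \<in> V_dual \<Omega>" "sw n t \<in> V_dual \<Omega>" and swS: "simple_function lborel (sw n)" and wlim: "(\<lambda>n. V_dual_norm \<Omega> (sw n t - w' t)) \<longlonglongrightarrow> 0"
    and w0: "t \<notin> {0<..<T} \<Longrightarrow> w' t = (\<lambda>_. 0)" for n t using w'(1) by (auto simp: ND.approx_def)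
  note vL = V_L2[OF vV(1)] V_L2[OF vV(2)]
  have Clim: "(\<lambda>n. L2_norm \<Omega> (sv n t - v' t)) \<longlonglongrightarrow> 0" for t
  proof (rule tendsto_sandwich[OF _ _ tendsto_const tendsto_mult_right_zero[OF vlim[of t], of C]])
    show "\<forall>\<^sub>F n in sequentially. L2_norm \<Omega> (sv n t - v' t) \<le> C * V_norm \<Omega> (sv n t - v' t)"
      using C(2)[OF V_diff(1)[OF vV(2,1)]] by simp
  qed simp
  have inner_diff: "\<bar>(LINT x|lebesgue_on \<Omega>. a x \<bullet> b x) - (LINT x|lebesgue_on \<Omega>. a x \<bullet> c x)\<bar> \<le> L2_norm \<Omega> a * L2_norm \<Omega> (b - c)"
    if "a \<in> L2 \<Omega>" "b \<in> L2 \<Omega>" "c \<in> L2 \<Omega>" for a b c :: "'d vfield"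
  proof -
    have "(LINT x|lebesgue_on \<Omega>. a x \<bullet> b x) - (LINT x|lebesgue_on \<Omega>. a x \<bullet> c x) = (LINT x|lebesgue_on \<Omega>. a x \<bullet> (b - c) x)"
      using L2_inner_integrable[OF that(1,2)] L2_inner_integrable[OF that(1,3)] by (simp add: inner_diff_right)
    then show ?thesis using L2_inner_le[OF that(1) L2_minus[OF that(2,3)]] by simp
  qed
  have sym: "?D s t = ?D t s" for s t by (simp add: inner_commute)
  have svn: "(\<lambda>n. L2_norm \<Omega> (sv n t)) \<longlonglongrightarrow> L2_norm \<Omega> (v' t)" for t
    by (rule seminormed_set.N_tendsto[OF seminormed_set_L2 vL(2) vL(1) Clim])
  have Dlim: "(\<lambda>n. LINT x|lebesgue_on \<Omega>. sv n s x \<bullet> sv n t x) \<longlonglongrightarrow> ?D s t" for s t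
  proof -
    have "(\<lambda>n. (LINT x|lebesgue_on \<Omega>. sv n s x \<bullet> sv n t x) - ?D s t) \<longlonglongrightarrow> 0"
    proof (rule Lim_null_comparison)
      show "(\<lambda>n. L2_norm \<Omega> (sv n s) * L2_norm \<Omega> (sv n t - v' t) + L2_norm \<Omega> (v' t) * L2_norm \<Omega> (sv n s - v' s)) \<longlonglongrightarrow> 0"
        using tendsto_add[OF tendsto_mult[OF svn[of s] Clim[of t]] tendsto_mult[OF tendsto_const Clim[of s], of "L2_norm \<Omega> (v' t)"]] by simp
      have "\<bar>(LINT x|lebesgue_on \<Omega>. sv n s x \<bullet> sv n t x) - ?D s t\<bar> \<le>
          L2_norm \<Omega> (sv n s) * L2_norm \<Omega> (sv n t - v' t) + L2_norm \<Omega> (v' t) * L2_norm \<Omega> (sv n s - v' s)" for n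
        using inner_diff[OF vL(2)[of n s] vL(2)[of n t] vL(1)[of t]] inner_diff[OF vL(1)[of t] vL(2)[of n s] vL(1)[of s]]
        by (simp add: inner_commute[of "v' t _"])
      then show "\<forall>\<^sub>F n in sequentially. norm ((LINT x|lebesgue_on \<Omega>. sv n s x \<bullet> sv n t x) - ?D s t) \<le>
          L2_norm \<Omega> (sv n s) * L2_norm \<Omega> (sv n t - v' t) + L2_norm \<Omega> (v' t) * L2_norm \<Omega> (sv n s - v' s)" by simp
    qed
    then show ?thesis by (simp add: LIM_zero_iff)
  qed
  have Dm: "pair_measurable ?D"
  proof -
    have "(\<lambda>p. ?D (fst p) (snd p)) \<in> borel_measurable (lborel \<Otimes>\<^sub>M lborel)"
    proof (rule borel_measurable_LIMSEQ_real[OF Dlim])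
      show "(\<lambda>p. LINT x|lebesgue_on \<Omega>. sv n (fst p) x \<bullet> sv n (snd p) x) \<in> borel_measurable (lborel \<Otimes>\<^sub>M lborel)" for n
        by (rule borel_measurable_simple_function[OF simple_function_compose2[where h = "\<lambda>a b. LINT x|lebesgue_on \<Omega>. a x \<bullet> b x",
          OF simple_function_comp[OF measurable_fst svS] simple_function_comp[OF measurable_snd svS]]])
    qed
    then show ?thesis by (simp add: split_beta')
  qed
  have Blim: "(\<lambda>n. sw n t (sv n s)) \<longlonglongrightarrow> ?B s t" for s t
  proof -
    have "(\<lambda>n. sw n t (sv n s) - ?B s t) \<longlonglongrightarrow> 0"
    proof (rule Lim_null_comparison)
      show "(\<lambda>n. V_dual_norm \<Omega> (sw n t - w' t) * V_norm \<Omega> (sv n s) + V_dual_norm \<Omega> (w' t) * V_norm \<Omega> (sv n s - v' s)) \<longlonglongrightarrow> 0"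
        using tendsto_add[OF tendsto_mult[OF wlim[of t] NV.N_tendsto[OF vV(2,1) vlim, of s]] tendsto_mult[OF tendsto_const vlim[of s], of "V_dual_norm \<Omega> (w' t)"]] by simp
      have "\<bar>sw n t (sv n s) - ?B s t\<bar> \<le> V_dual_norm \<Omega> (sw n t - w' t) * V_norm \<Omega> (sv n s) + V_dual_norm \<Omega> (w' t) * V_norm \<Omega> (sv n s - v' s)" for n
        using V_dual_le[OF V_dual_diff[OF wV(2)[of n t] wV(1)[of t]] vV(2)[of n s]]
          V_dual_le[OF wV(1)[of t] V_diff(1)[OF vV(2)[of n s] vV(1)[of s]]] V_dual_diff_arg[OF wV(1)[of t] vV(2)[of n s] vV(1)[of s]]
        by simp
      then show "\<forall>\<^sub>F n in sequentially. norm (sw n t (sv n s) - ?B s t) \<le>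
          V_dual_norm \<Omega> (sw n t - w' t) * V_norm \<Omega> (sv n s) + V_dual_norm \<Omega> (w' t) * V_norm \<Omega> (sv n s - v' s)" by simp
    qed
    then show ?thesis by (simp add: LIM_zero_iff)
  qed
  have Bm: "pair_measurable ?B"
  proof -
    have "(\<lambda>p. ?B (fst p) (snd p)) \<in> borel_measurable (lborel \<Otimes>\<^sub>M lborel)"
    proof (rule borel_measurable_LIMSEQ_real[OF Blim])
      show "(\<lambda>p. sw n (snd p) (sv n (fst p))) \<in> borel_measurable (lborel \<Otimes>\<^sub>M lborel)" for n
        by (rule borel_measurable_simple_function[OF simple_function_compose2[where h = "\<lambda>a b. b a",
          OF simple_function_comp[OF measurable_fst svS] simple_function_comp[OF measurable_snd swS]]])
    qed
    then show ?thesis by (simp add: split_beta')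
  qed
  have Ddiag: "?D s s = (L2_norm \<Omega> (v' s))\<^sup>2" for s by (simp add: L2_norm_sq power2_norm_eq_inner)
  have hm: "(\<lambda>t. L2_norm \<Omega> (v' t)) \<in> borel_measurable borel"
  proof -
    have "(\<lambda>t::real. (t, t)) \<in> lborel \<rightarrow>\<^sub>M lborel \<Otimes>\<^sub>M lborel" by measurable
    from measurable_compose[OF this Dm] have "(\<lambda>t. ?D t t) \<in> borel_measurable borel" by simp
    then have "(\<lambda>t. sqrt (?D t t)) \<in> borel_measurable borel" by measurable
    then show ?thesis unfolding Ddiag by simp
  qed
  have m_eq: "?D s s + ?D t t - 2 * ?D s t = (L2_norm \<Omega> (v' s - v' t))\<^sup>2" for s t
    by (simp add: L2_norm_diff_sq[OF vL(1) vL(1)] Ddiag)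
  have hd: "L2_norm \<Omega> (v' s - v' t) \<le> C * V_norm \<Omega> (v' s - v' t)" for s t
    by (rule C(2)[OF V_diff(1)[OF vV(1) vV(1)]])
  have vsq: "integrable lborel (\<lambda>t. (V_norm \<Omega> (v' t))\<^sup>2)" using v'(1) by (simp add: NV.approx_def)
  have wsq: "integrable lborel (\<lambda>t. (V_dual_norm \<Omega> (w' t))\<^sup>2)" using w'(1) by (simp add: ND.approx_def)
  show ?thesis
  proof
    show "0 < T" by (rule T)
    show "pair_measurable ?D" "pair_measurable ?B" by (fact Dm Bm)+
    show "pair_measurable (\<lambda>s t. V_norm \<Omega> (v' s - v' t))" by (rule NV.approx_measurable(4)[OF v'(1)])
    show "(\<lambda>t. L2_norm \<Omega> (v' t)) \<in> borel_measurable borel" by (rule hm)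
    show "(\<lambda>t. V_norm \<Omega> (v' t)) \<in> borel_measurable borel" by (rule NV.approx_measurable(1)[OF v'(1)])
    show "(\<lambda>t. V_dual_norm \<Omega> (w' t)) \<in> borel_measurable borel" by (rule ND.approx_measurable(1)[OF w'(1)])
    fix s t
    show "?D s t = ?D t s" by (rule sym)
    show "?D s s = (L2_norm \<Omega> (v' s))\<^sup>2" by (rule Ddiag)
    show "\<bar>?D s t\<bar> \<le> L2_norm \<Omega> (v' s) * L2_norm \<Omega> (v' t)" by (rule L2_inner_le[OF vL(1) vL(1)])
    show "\<bar>?D s t - ?D s s\<bar> \<le> L2_norm \<Omega> (v' s) * (C * V_norm \<Omega> (v' s - v' t))"
    proof -
      have "\<bar>?D s t - ?D s s\<bar> \<le> L2_norm \<Omega> (v' s) * L2_norm \<Omega> (v' t - v' s)" by (rule inner_diff[OF vL(1) vL(1) vL(1)])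
      also have "\<dots> \<le> L2_norm \<Omega> (v' s) * (C * V_norm \<Omega> (v' s - v' t))"
        unfolding L2_norm_minus_commute[of \<Omega> "v' t"] by (intro mult_left_mono hd) simp
      finally show ?thesis .
    qed
    show "0 \<le> ?D s s + ?D t t - 2 * ?D s t" unfolding m_eq by simp
    show "?D s s + ?D t t - 2 * ?D s t \<le> C\<^sup>2 * (V_norm \<Omega> (v' s - v' t))\<^sup>2"
      unfolding m_eq power_mult_distrib[symmetric] by (rule power_mono[OF hd]) simp
    show "\<bar>?B s t\<bar> \<le> V_norm \<Omega> (v' s) * V_dual_norm \<Omega> (w' t)"
      using V_dual_le[OF wV(1)[of t] vV(1)[of s]] by (simp add: mult.commute)
    show "\<bar>?B s t - ?B t t\<bar> \<le> V_norm \<Omega> (v' s - v' t) * V_dual_norm \<Omega> (w' t)"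
      using V_dual_le[OF wV(1)[of t] V_diff(1)[OF vV(1)[of s] vV(1)[of t]]] V_dual_diff_arg[OF wV(1)[of t] vV(1)[of s] vV(1)[of t]]
      by (simp add: mult.commute)
    show "0 \<le> L2_norm \<Omega> (v' s)" "0 \<le> V_norm \<Omega> (v' s)" "0 \<le> V_dual_norm \<Omega> (w' s)" "0 \<le> V_norm \<Omega> (v' s - v' t)" "0 \<le> C"
      using C(1) V_dual_norm_nonneg[OF wV(1)] by auto
    show "V_norm \<Omega> (v' s - v' t) = V_norm \<Omega> (v' t - v' s)" by (rule NV.N_commute[OF vV(1) vV(1)])
    show "integrable lborel (\<lambda>t. (L2_norm \<Omega> (v' t))\<^sup>2)"
    proof (rule Bochner_Integration.integrable_bound)
      show "integrable lborel (\<lambda>t. C\<^sup>2 * (V_norm \<Omega> (v' t))\<^sup>2)" using vsq by simp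
      show "(\<lambda>t. (L2_norm \<Omega> (v' t))\<^sup>2) \<in> borel_measurable lborel" using hm by measurable
      have "(L2_norm \<Omega> (v' t))\<^sup>2 \<le> C\<^sup>2 * (V_norm \<Omega> (v' t))\<^sup>2" for t
        unfolding power_mult_distrib[symmetric] by (rule power_mono[OF C(2)[OF vV(1)]]) simp
      then show "AE t in lborel. norm ((L2_norm \<Omega> (v' t))\<^sup>2) \<le> norm (C\<^sup>2 * (V_norm \<Omega> (v' t))\<^sup>2)" by simp
    qed
    show "integrable lborel (\<lambda>t. (V_norm \<Omega> (v' t))\<^sup>2)" by (rule vsq)
    show "integrable lborel (\<lambda>t. (V_dual_norm \<Omega> (w' t))\<^sup>2)" by (rule wsq)
    show "L2_norm \<Omega> (v' t) = 0" if "t \<notin> {0<..<T}" unfolding v0[OF that] by (rule L2_norm_zero)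
    show "V_norm \<Omega> (v' t) = 0" if "t \<notin> {0<..<T}" unfolding v0[OF that] by (rule V_norm_zero)
    show "V_dual_norm \<Omega> (w' t) = 0" if "t \<notin> {0<..<T}" unfolding w0[OF that] by (rule V_dual_zero(2))
    show "(\<lambda>j. kdbl j (\<lambda>s t. ennreal ((V_norm \<Omega> (v' s - v' t))\<^sup>2))) \<longlonglongrightarrow> 0"
      by (rule NV.approx_kern_tendsto[OF v'(1)])
    have secm: "f s \<in> borel_measurable borel" if "pair_measurable f" for f s
      using measurable_compose[OF measurable_Pair1'[of s lborel lborel], of "\<lambda>(s, t). f s t"] that by simp
    show "AE s in lborel. \<forall>\<phi>\<in>test_functions {0<..<T}.
       (LINT t|lborel. \<phi> t * ?B s t) = - (LINT t|lborel. deriv \<phi> t * ?D s t)"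
    proof (intro AE_I2 ballI)
      fix s and \<phi> :: "real \<Rightarrow> real" assume phi: "\<phi> \<in> test_functions {0<..<T}"
      note dphi = test_functions_deriv_real(2)[OF phi]
      have ind: "indicator {0<..<T} t * (\<psi> t * r) = \<psi> t * r" if "\<psi> \<in> test_functions {0<..<T}" for \<psi> :: "real \<Rightarrow> real" and t r
        using test_functions_outside[OF that, of t] by (auto simp: indicator_def)
      have 1: "(LINT t|lebesgue_on {0<..<T}. \<phi> t * w t (v' s)) = (LINT t|lborel. indicator {0<..<T} t * (\<phi> t * ?B s t))"
      proof (rule lebesgue_on_to_lborel(1))
        show "(\<lambda>t. \<phi> t * ?B s t) \<in> borel_measurable borel"
          using secm[OF Bm, of s] test_functions_measurable[OF phi] by (intro borel_measurable_times)
        show "AE t in lborel. t \<in> {0<..<T} \<longrightarrow> \<phi> t * w t (v' s) = \<phi> t * ?B s t"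
          using w'(2) by eventually_elim auto
      qed simp
      have 2: "(LINT t|lebesgue_on {0<..<T}. deriv \<phi> t * (LINT x|lebesgue_on \<Omega>. v t x \<bullet> v' s x)) = (LINT t|lborel. indicator {0<..<T} t * (deriv \<phi> t * ?D s t))"
      proof (rule lebesgue_on_to_lborel(1))
        show "(\<lambda>t. deriv \<phi> t * ?D s t) \<in> borel_measurable borel"
          using secm[OF Dm, of s] test_functions_measurable[OF dphi] by (intro borel_measurable_times)
        show "AE t in lborel. t \<in> {0<..<T} \<longrightarrow> deriv \<phi> t * (LINT x|lebesgue_on \<Omega>. v t x \<bullet> v' s x) = deriv \<phi> t * ?D s t"
          using v'(2) by eventually_elim (auto simp: inner_commute)
      qed simp
      show "(LINT t|lborel. \<phi> t * ?B s t) = - (LINT t|lborel. deriv \<phi> t * ?D s t)"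
        using weak[unfolded weak_dt_def, rule_format, OF phi vV(1)[of s]]
        unfolding 1 2 unfolding ind[OF phi] ind[OF dphi] .
    qed
  qed
qed

end

section \<open>The continuous representative and its energy balance\<close>

context bounded_open
begin

text \<open>Stated for an arbitrary weak derivative w, so that it can be applied to a difference
  together with the difference of two chosen derivatives. The value c t is the essential limit of v
  at t, and the energy balance is the primitive from \<open>energy_prim\<close> extended to the end
  points by continuity.\<close>

lemma W_continuous_rep:
  assumes T: "0 < T" and v: "v \<in> L2_V T \<Omega>" and w: "w \<in> L2_V_dual T \<Omega>" and weak: "weak_dt T \<Omega> v w"
  obtains c where "continuous_rep T \<Omega> v c"
    "(L2_norm \<Omega> (c T))\<^sup>2 - (L2_norm \<Omega> (c 0))\<^sup>2 = 2 * (LINT t|lebesgue_on {0<..<T}. w t (v t))"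
    "integrable (lebesgue_on {0<..<T}) (\<lambda>t. w t (v t))"
proof -
  let ?J = "{0<..<T}"
  interpret NV: seminormed_set "V \<Omega>" "V_norm \<Omega>" by (rule seminormed_set_V)
  interpret ND: seminormed_set "V_dual \<Omega>" "V_dual_norm \<Omega>" by (rule seminormed_set_V_dual)
  obtain C where C: "C \<ge> 0" "\<And>v. v \<in> V \<Omega> \<Longrightarrow> L2_norm \<Omega> v \<le> C * V_norm \<Omega> v" using Poincare by metis
  obtain v' sv where v': "NV.approx T v' sv" "AE t in lborel. t \<in> ?J \<longrightarrow> v' t = v t" by (rule NV.approx_exists[OF v])
  obtain w' sw where w': "ND.approx T w' sw" "AE t in lborel. t \<in> ?J \<longrightarrow> w' t = w t" by (rule ND.approx_exists[OF w])
  have vV: "v' t \<in> V \<Omega>" for t using v'(1) by (simp add: NV.approx_def)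
  note vL = V_L2[OF vV]
  define D where "D s t = (LINT x|lebesgue_on \<Omega>. v' s x \<bullet> v' t x)" for s t
  define b where "b t = w' t (v' t)" for t
  interpret E: energy_pair T "\<lambda>s t. LINT x|lebesgue_on \<Omega>. v' s x \<bullet> v' t x" "\<lambda>s t. w' t (v' s)"
      "\<lambda>s t. V_norm \<Omega> (v' s - v' t)" "\<lambda>t. L2_norm \<Omega> (v' t)" "\<lambda>t. V_norm \<Omega> (v' t)" "\<lambda>t. V_dual_norm \<Omega> (w' t)" C
    by (rule energy_pair_of_W[OF T C v' w' weak])
  have Ddiag: "D s s = (L2_norm \<Omega> (v' s))\<^sup>2" for s by (simp add: D_def L2_norm_sq power2_norm_eq_inner)
  have m_eq: "E.m s t = (L2_norm \<Omega> (v' s - v' t))\<^sup>2" for s t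
    unfolding D_def[symmetric] using L2_norm_diff_sq[OF vL[of s] vL[of t]] by (simp add: Ddiag D_def[symmetric])
  \<comment> \<open>Says that c is the essential limit of v' at \<open>t0\<close> in H. The value of
    v' at \<open>t0\<close> itself is irrelevant, so the notion also makes sense at the end
    points.\<close>
  define near where "near t0 c \<longleftrightarrow> c \<in> L2 \<Omega> \<and> (\<forall>e>0. \<exists>d>0. AE t in lborel. t \<in> ?J \<and> \<bar>t - t0\<bar> < d \<longrightarrow> L2_norm \<Omega> (v' t - c) < e)" for t0 c
  \<comment> \<open>The two neighbourhoods meet in an interval of positive length inside the time
    interval, and a common good time there is inserted into the triangle inequality. Both continuity
    of c and its agreement with v rest on this.\<close>
  have join: "L2_norm \<Omega> (c1 - c0) < e0 + e1"
    if t: "t0 \<in> {0..T}" "t1 \<in> {0..T}" "\<bar>t1 - t0\<bar> < d0" and L: "c0 \<in> L2 \<Omega>" "c1 \<in> L2 \<Omega>" and d: "d0 > 0" "d1 > 0"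
      and a0: "AE t in lborel. t \<in> ?J \<and> \<bar>t - t0\<bar> < d0 \<longrightarrow> L2_norm \<Omega> (v' t - c0) < e0"
      and a1: "AE t in lborel. t \<in> ?J \<and> \<bar>t - t1\<bar> < d1 \<longrightarrow> L2_norm \<Omega> (v' t - c1) < e1" for t0 t1 d0 d1 c0 c1 e0 e1
  proof -
    let ?a = "max (max 0 (t0 - d0)) (t1 - d1)" and ?b = "min (min T (t0 + d0)) (t1 + d1)"
    have "AE t in lborel. t \<in> {?a<..<?b} \<longrightarrow> L2_norm \<Omega> (v' t - c0) < e0 \<and> L2_norm \<Omega> (v' t - c1) < e1"
      using a0 a1 by eventually_elim auto
    moreover have "?a < ?b" using t d T by (auto simp: abs_less_iff)
    ultimately obtain t where "L2_norm \<Omega> (v' t - c0) < e0 \<and> L2_norm \<Omega> (v' t - c1) < e1" by (rule AE_interval_ex)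
    then show ?thesis
      using L2_norm_triangle[OF L(2) vL[of t] L(1)] L2_norm_minus_commute[of \<Omega> c1 "v' t"] by linarith
  qed
  have near_ex: "\<exists>c. near t0 c" if t0: "t0 \<in> {0..T}" for t0
  proof -
    \<comment> \<open>Neighbourhoods of \<open>t0\<close> cut off at 0 and T, so that the end points
      need no separate treatment.\<close>
    define a where "a k = max 0 (t0 - inverse (real (Suc k)))" for k
    define bb where "bb k = min T (t0 + inverse (real (Suc k)))" for k
    define \<mu> where "\<mu> k = prim E.wt (bb k) - prim E.wt (a k)" for k
    have ip: "inverse (real (Suc k)) > 0" for k by simp
    have ab: "0 \<le> a k" "a k < bb k" "bb k \<le> T" for k
    proof -
      obtain i where i: "i = inverse (real (Suc k))" "i > 0" using ip by blast
      show "0 \<le> a k" "a k < bb k" "bb k \<le> T"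
        unfolding a_def bb_def i(1)[symmetric] using t0 T i(2) by auto
    qed
    have "\<exists>r. r \<in> {a k<..<bb k} \<and> (AE t in lborel. t \<in> {a k<..<bb k} \<longrightarrow> E.m r t \<le> 2 * \<mu> k)" for k
    proof -
      obtain r where "r \<in> {a k<..<bb k}"
          "AE t in lborel. t \<in> {a k<..<bb k} \<longrightarrow> E.m r t \<le> 2 * (prim E.wt (bb k) - prim E.wt (a k))"
        by (rule E.oscillation[OF ab(1)[of k] ab(2)[of k] ab(3)[of k]])
      then show ?thesis unfolding \<mu>_def by blast
    qed
    then have "\<exists>r. \<forall>k. r k \<in> {a k<..<bb k} \<and> (AE t in lborel. t \<in> {a k<..<bb k} \<longrightarrow> E.m (r k) t \<le> 2 * \<mu> k)"
      by (intro choice allI)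
    then obtain r where r: "\<And>k. AE t in lborel. t \<in> {a k<..<bb k} \<longrightarrow> E.m (r k) t \<le> 2 * \<mu> k" by blast
    define \<rho> where "\<rho> k = sqrt (2 * \<mu> k)" for k
    have r\<rho>: "AE t in lborel. t \<in> {a k<..<bb k} \<longrightarrow> L2_norm \<Omega> (v' (r k) - v' t) \<le> \<rho> k" for k
      using r[of k] unfolding m_eq \<rho>_def by eventually_elim (auto intro: real_le_rsqrt)
    have "(\<lambda>k. a k) \<longlonglongrightarrow> max 0 (t0 - 0)" "(\<lambda>k. bb k) \<longlonglongrightarrow> min T (t0 + 0)"
      unfolding a_def bb_def by (intro tendsto_intros LIMSEQ_inverse_real_of_nat)+
    then have lims: "a \<longlonglongrightarrow> t0" "bb \<longlonglongrightarrow> t0" using t0 by auto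
    have cp: "isCont (prim E.wt) t0"
      using continuous_prim[OF E.wt_int] by (simp add: continuous_on_eq_continuous_at)
    have "\<mu> \<longlonglongrightarrow> prim E.wt t0 - prim E.wt t0"
      unfolding \<mu>_def[abs_def] by (intro tendsto_diff isCont_tendsto_compose[OF cp] lims)
    then have "(\<lambda>k. sqrt (2 * \<mu> k)) \<longlonglongrightarrow> sqrt (2 * 0)" by (intro tendsto_intros) simp
    then have \<rho>0: "\<rho> \<longlonglongrightarrow> 0" unfolding \<rho>_def[abs_def] by simp
    have "\<exists>K. \<forall>k\<ge>K. \<rho> k \<le> (1/2) ^ Suc i" for i
    proof -
      have "\<forall>\<^sub>F k in sequentially. \<rho> k < (1/2) ^ Suc i" by (rule order_tendstoD(2)[OF \<rho>0]) simp
      then show ?thesis unfolding eventually_sequentially by (meson less_imp_le)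
    qed
    then obtain K where K: "\<And>i k. k \<ge> K i \<Longrightarrow> \<rho> k \<le> (1/2) ^ Suc i" by metis
    \<comment> \<open>Summing the thresholds makes the indices monotone while each stays above its
      own threshold; monotonicity nests the intervals, so two consecutive base points can be
      compared at a common time.\<close>
    define \<kappa> where "\<kappa> i = (\<Sum>j\<le>i. K j)" for i
    have \<kappa>: "\<rho> (\<kappa> i) \<le> (1/2) ^ Suc i" "\<kappa> i \<le> \<kappa> (Suc i)" for i
    proof -
      have "K i \<le> \<kappa> i" unfolding \<kappa>_def by (rule member_le_sum) auto
      then show "\<rho> (\<kappa> i) \<le> (1/2) ^ Suc i" by (rule K)
      show "\<kappa> i \<le> \<kappa> (Suc i)" by (simp add: \<kappa>_def)
    qed
    have nested: "{a l<..<bb l} \<subseteq> {a k<..<bb k}" if "k \<le> l" for k l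
    proof -
      have "inverse (real (Suc l)) \<le> inverse (real (Suc k))" using that by (intro le_imp_inverse_le) auto
      moreover have "{max 0 (t0 - x)<..<min T (t0 + x)} \<subseteq> {max 0 (t0 - y)<..<min T (t0 + y)}" if "x \<le> y" for x y
        using that by auto
      ultimately show ?thesis unfolding a_def bb_def by blast
    qed
    have step: "L2_norm \<Omega> (v' (r (\<kappa> (Suc i))) - v' (r (\<kappa> i))) \<le> (1/2) ^ i" for i
    proof -
      let ?k = "\<kappa> i" and ?l = "\<kappa> (Suc i)"
      have "AE t in lborel. t \<in> {a ?l<..<bb ?l} \<longrightarrow> L2_norm \<Omega> (v' (r ?k) - v' t) \<le> \<rho> ?k \<and> L2_norm \<Omega> (v' (r ?l) - v' t) \<le> \<rho> ?l"
        using r\<rho>[of ?k] r\<rho>[of ?l]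
      proof eventually_elim
        case (elim t)
        then show ?case using nested[OF \<kappa>(2)[of i]] by blast
      qed
      then obtain t where t: "L2_norm \<Omega> (v' (r ?k) - v' t) \<le> \<rho> ?k \<and> L2_norm \<Omega> (v' (r ?l) - v' t) \<le> \<rho> ?l"
        using ab(2)[of ?l] by (rule AE_interval_ex)
      have "L2_norm \<Omega> (v' (r ?l) - v' (r ?k)) \<le> \<rho> ?l + \<rho> ?k"
        using L2_norm_triangle[OF vL[of "r ?l"] vL[of t] vL[of "r ?k"]] t L2_norm_minus_commute[of \<Omega> "v' t" "v' (r ?k)"] by linarith
      also have "\<dots> \<le> (1/2) ^ Suc (Suc i) + (1/2) ^ Suc i" by (intro add_mono \<kappa>)
      also have "\<dots> \<le> (1/2) ^ i" by simp
      finally show ?thesis .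
    qed
    have "\<exists>F. F \<in> L2 \<Omega> \<and> (\<forall>i. L2_norm \<Omega> (v' (r (\<kappa> i)) - F) \<le> 2 * (1/2) ^ i)"
    proof (rule L2_complete[OF dom_lmeasurable vL step])
      fix F assume "F \<in> L2 \<Omega>" "\<And>i. L2_norm \<Omega> (v' (r (\<kappa> i)) - F) \<le> 2 * (1/2) ^ i"
      then show ?thesis by blast
    qed
    then obtain F where F: "F \<in> L2 \<Omega>" "\<And>i. L2_norm \<Omega> (v' (r (\<kappa> i)) - F) \<le> 2 * (1/2) ^ i" by blast
    have "near t0 F"
      unfolding near_def
    proof (intro conjI allI impI F(1))
      fix e :: real assume e: "e > 0"
      obtain i where i: "(1/2::real) ^ i < e / 3"
        using real_arch_pow_inv[of "e / 3" "1/2"] e by auto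
      let ?k = "\<kappa> i"
      have "AE t in lborel. t \<in> ?J \<and> \<bar>t - t0\<bar> < inverse (real (Suc ?k)) \<longrightarrow> L2_norm \<Omega> (v' t - F) < e"
        using r\<rho>[of ?k]
      proof eventually_elim
        case (elim t)
        show ?case
        proof
          assume t: "t \<in> ?J \<and> \<bar>t - t0\<bar> < inverse (real (Suc ?k))"
          then have "t \<in> {a ?k<..<bb ?k}" by (auto simp: a_def bb_def abs_less_iff simp del: of_nat_Suc)
          then have "L2_norm \<Omega> (v' (r ?k) - v' t) \<le> (1/2) ^ Suc i" using elim \<kappa>(1)[of i] by (meson order_trans)
          then have "L2_norm \<Omega> (v' t - F) \<le> (1/2) ^ Suc i + 2 * (1/2) ^ i"
            using L2_norm_triangle[OF vL[of t] vL[of "r ?k"] F(1)] F(2)[of i] L2_norm_minus_commute[of \<Omega> "v' t" "v' (r ?k)"] by linarith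
          also have "\<dots> \<le> 3 * (1/2) ^ i" by simp
          also have "\<dots> < e" using i by simp
          finally show "L2_norm \<Omega> (v' t - F) < e" .
        qed
      qed
      then show "\<exists>d>0. AE t in lborel. t \<in> ?J \<and> \<bar>t - t0\<bar> < d \<longrightarrow> L2_norm \<Omega> (v' t - F) < e"
        using ip[of ?k] by blast
    qed
    then show ?thesis by blast
  qed
  define c where "c t = (SOME c. near t c)" for t
  have c: "near t (c t)" if "t \<in> {0..T}" for t
    unfolding c_def using someI_ex[OF near_ex[OF that]] .
  have cL: "c t \<in> L2 \<Omega>" if "t \<in> {0..T}" for t using c[OF that] by (simp add: near_def)
  have nearD: "\<exists>d>0. AE t in lborel. t \<in> ?J \<and> \<bar>t - t0\<bar> < d \<longrightarrow> L2_norm \<Omega> (v' t - f) < e" if "near t0 f" "e > 0" for t0 f e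
    using that by (simp add: near_def)
  have cont: "((\<lambda>s. L2_norm \<Omega> (c s - c t)) \<longlongrightarrow> 0) (at t within {0..T})" if t: "t \<in> {0..T}" for t
  proof (rule tendstoI)
    fix e :: real assume e: "e > 0"
    obtain d where d: "d > 0" "AE s in lborel. s \<in> ?J \<and> \<bar>s - t\<bar> < d \<longrightarrow> L2_norm \<Omega> (v' s - c t) < e / 2"
      using nearD[OF c[OF t], of "e / 2"] e by auto
    have "L2_norm \<Omega> (c s - c t) < e" if s: "s \<in> {0..T}" "\<bar>s - t\<bar> < d" for s
    proof -
      obtain d1 where d1: "d1 > 0" "AE r in lborel. r \<in> ?J \<and> \<bar>r - s\<bar> < d1 \<longrightarrow> L2_norm \<Omega> (v' r - c s) < e / 2"
        using nearD[OF c[OF s(1)], of "e / 2"] e by auto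
      from join[OF t s(1,2) cL[OF t] cL[OF s(1)] d(1) d1(1) d(2) d1(2)] show ?thesis by simp
    qed
    then show "\<forall>\<^sub>F s in at t within {0..T}. dist (L2_norm \<Omega> (c s - c t)) 0 < e"
      using d(1) unfolding eventually_at by (auto simp: dist_real_def intro!: exI[of _ d])
  qed
  have JL: "?J \<in> sets lebesgue" by simp
  have eqv: "AE t in lebesgue_on ?J. AE x in lebesgue_on \<Omega>. c t x = v t x"
    unfolding AE_lebesgue_on_iff[OF JL]
    using E.distance_small v'(2)
  proof eventually_elim
    case (elim r)
    show ?case
    proof
      assume r: "r \<in> ?J"
      then have r': "r \<in> {0..T}" by auto
      \<comment> \<open>For almost every r the value v' r is itself an essential limit at r;
        \<open>join\<close> with both centres at r then gives distance zero from c r.\<close>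
      have "near r (v' r)"
        unfolding near_def
      proof (intro conjI vL allI impI)
        fix e :: real assume e: "e > 0"
        then have "e\<^sup>2 > 0" by simp
        then obtain d where d: "d > 0" "AE t in lborel. t \<in> ?J \<and> \<bar>t - r\<bar> < d \<longrightarrow> E.m r t < e\<^sup>2"
          using elim(1)[rule_format, OF r, of "e\<^sup>2"] by blast
        have "AE t in lborel. t \<in> ?J \<and> \<bar>t - r\<bar> < d \<longrightarrow> L2_norm \<Omega> (v' t - v' r) < e"
          using d(2) unfolding m_eq
          by eventually_elim (use e in \<open>auto simp: L2_norm_minus_commute[of \<Omega> "v' r"] intro: power2_less_imp_less\<close>)
        with d(1) show "\<exists>d>0. AE t in lborel. t \<in> ?J \<and> \<bar>t - r\<bar> < d \<longrightarrow> L2_norm \<Omega> (v' t - v' r) < e" by blast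
      qed
      have small: "L2_norm \<Omega> (v' r - c r) < e + e" if e: "e > 0" for e
      proof -
        obtain d0 where d0: "d0 > 0" "AE t in lborel. t \<in> ?J \<and> \<bar>t - r\<bar> < d0 \<longrightarrow> L2_norm \<Omega> (v' t - c r) < e"
          using nearD[OF c[OF r'] e] by blast
        obtain d1 where d1: "d1 > 0" "AE t in lborel. t \<in> ?J \<and> \<bar>t - r\<bar> < d1 \<longrightarrow> L2_norm \<Omega> (v' t - v' r) < e"
          using nearD[OF \<open>near r (v' r)\<close> e] by blast
        show ?thesis
          by (rule join[OF r' r' _ cL[OF r'] vL d0(1) d1(1) d0(2) d1(2)]) (use d0(1) in simp)
      qed
      have "L2_norm \<Omega> (v' r - c r) = 0"
      proof (rule ccontr)
        assume "L2_norm \<Omega> (v' r - c r) \<noteq> 0"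
        then have "L2_norm \<Omega> (v' r - c r) > 0" using L2_norm_nonneg[of \<Omega> "v' r - c r"] by linarith
        then show False using small[of "L2_norm \<Omega> (v' r - c r) / 2"] by simp
      qed
      from L2_norm_eq_0_AE[OF L2_minus[OF vL cL[OF r']] this]
      show "AE x in lebesgue_on \<Omega>. c r x = v r x"
        using elim(2) r by (auto elim!: eventually_mono)
    qed
  qed
  have rep: "continuous_rep T \<Omega> v c" unfolding continuous_rep_def using cL cont eqv by blast
  have "\<exists>C0. AE t in lborel. t \<in> ?J \<longrightarrow> D t t = C0 + 2 * prim b t"
    unfolding D_def b_def[abs_def] by (rule E.energy_prim) (rule exI)
  then obtain C0 where C0: "AE t in lborel. t \<in> ?J \<longrightarrow> D t t = C0 + 2 * prim b t" by blast
  have bI: "integrable lborel b" using E.Bdiag_int unfolding b_def[symmetric] .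
  \<comment> \<open>The primitive formula holds only at almost every time. For each n such a time is
    picked within 1/(n+1) of \<open>t0\<close> where v' is also 1/(n+1)-close to c; both sides then
    pass to the limit.\<close>
  have energy: "(L2_norm \<Omega> (c t0))\<^sup>2 = C0 + 2 * prim b t0" if t0: "t0 \<in> {0..T}" for t0
  proof -
    have "\<exists>t. \<bar>t - t0\<bar> < inverse (real (Suc n)) \<and> L2_norm \<Omega> (v' t - c t0) < inverse (real (Suc n)) \<and> D t t = C0 + 2 * prim b t" for n
    proof -
      let ?i = "inverse (real (Suc n))"
      have ip: "?i > 0" by simp
      obtain d where d: "d > 0" "AE t in lborel. t \<in> ?J \<and> \<bar>t - t0\<bar> < d \<longrightarrow> L2_norm \<Omega> (v' t - c t0) < ?i"
        using nearD[OF c[OF t0] ip] by blast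
      let ?a = "max 0 (t0 - min d ?i)" and ?b = "min T (t0 + min d ?i)"
      have "max 0 (t0 - x) < min T (t0 + x)" if "x > 0" for x using t0 T that by auto
      then have ab: "?a < ?b" using d(1) ip by (simp only: min_less_iff_conj)
      have "AE t in lborel. t \<in> {?a<..<?b} \<longrightarrow> \<bar>t - t0\<bar> < ?i \<and> L2_norm \<Omega> (v' t - c t0) < ?i \<and> D t t = C0 + 2 * prim b t"
        using d(2) C0
      proof eventually_elim
        case (elim t)
        show ?case
        proof
          assume "t \<in> {?a<..<?b}"
          moreover have "t \<in> ?J \<and> \<bar>t - t0\<bar> < x" if "t \<in> {max 0 (t0 - x)<..<min T (t0 + x)}" for x
            using that by (auto simp: abs_less_iff)
          ultimately have "t \<in> ?J" "\<bar>t - t0\<bar> < min d ?i" by blast+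
          then show "\<bar>t - t0\<bar> < ?i \<and> L2_norm \<Omega> (v' t - c t0) < ?i \<and> D t t = C0 + 2 * prim b t"
            using elim by simp
        qed
      qed
      then show ?thesis by (rule AE_interval_ex[OF _ ab]) blast
    qed
    then obtain t where t: "\<And>n. \<bar>t n - t0\<bar> < inverse (real (Suc n))" "\<And>n. L2_norm \<Omega> (v' (t n) - c t0) < inverse (real (Suc n))"
        "\<And>n. D (t n) (t n) = C0 + 2 * prim b (t n)" by metis
    have "(\<lambda>n. t n - t0) \<longlonglongrightarrow> 0"
      by (rule Lim_null_comparison[OF _ LIMSEQ_inverse_real_of_nat])
         (intro always_eventually allI, unfold real_norm_def, rule less_imp_le[OF t(1)])
    then have tl: "t \<longlonglongrightarrow> t0" by (simp add: LIM_zero_iff)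
    have "(\<lambda>n. L2_norm \<Omega> (v' (t n) - c t0)) \<longlonglongrightarrow> 0"
      by (rule Lim_null_comparison[OF _ LIMSEQ_inverse_real_of_nat])
         (intro always_eventually allI, unfold real_norm_def abs_of_nonneg[OF L2_norm_nonneg], rule less_imp_le[OF t(2)])
    then have "(\<lambda>n. L2_norm \<Omega> (v' (t n))) \<longlonglongrightarrow> L2_norm \<Omega> (c t0)"
      by (rule seminormed_set.N_tendsto[OF seminormed_set_L2 vL cL[OF t0]])
    then have 1: "(\<lambda>n. D (t n) (t n)) \<longlonglongrightarrow> (L2_norm \<Omega> (c t0))\<^sup>2"
      unfolding Ddiag by (intro tendsto_power)
    have "isCont (prim b) t0"
      using continuous_prim[OF bI] by (simp add: continuous_on_eq_continuous_at)
    then have "(\<lambda>n. C0 + 2 * prim b (t n)) \<longlonglongrightarrow> C0 + 2 * prim b t0"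
      by (intro tendsto_intros isCont_tendsto_compose[OF _ tl])
    with 1 show ?thesis unfolding t(3) by (rule LIMSEQ_unique)
  qed
  have bm: "b \<in> borel_measurable borel" using bI by auto
  have ae: "AE t in lborel. t \<in> ?J \<longrightarrow> w t (v t) = b t"
    using v'(2) w'(2) by eventually_elim (simp add: b_def)
  have Jb: "?J \<in> sets borel" by simp
  have "(LINT t|lebesgue_on ?J. w t (v t)) = prim b T - prim b 0"
    using lebesgue_on_to_lborel(1)[OF Jb bm ae] E.prim_interval[OF bI, of 0 T] T by simp
  moreover have "(L2_norm \<Omega> (c T))\<^sup>2 - (L2_norm \<Omega> (c 0))\<^sup>2 = 2 * (prim b T - prim b 0)"
    using energy[of T] energy[of 0] T by simp
  moreover have "integrable (lebesgue_on ?J) (\<lambda>t. w t (v t))"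
    unfolding lebesgue_on_to_lborel(2)[OF Jb bm ae] by (rule integrable_indicator_mult[OF bI]) simp
  ultimately show ?thesis using rep by (intro that) auto
qed

lemma Ioo_sets_lebesgue: "{a<..<b::real} \<in> sets lebesgue" by simp

text \<open>The two agree at almost every time, and every t is a limit of such times. The conclusion
  is in the seminorm because c t is itself only a representative.\<close>

lemma continuous_rep_unique:
  assumes T: "0 < T" and c: "continuous_rep T \<Omega> v c" and c': "continuous_rep T \<Omega> v c'" and t: "t \<in> {0..T}"
  shows "L2_norm \<Omega> (c t - c' t) = 0"
proof -
  let ?J = "{0<..<T}"
  have L: "c s \<in> L2 \<Omega>" "c' s \<in> L2 \<Omega>" if "s \<in> {0..T}" for s
    using c c' that by (auto simp: continuous_rep_def)
  have "AE s in lebesgue_on ?J. AE x in lebesgue_on \<Omega>. c s x = v s x" "AE s in lebesgue_on ?J. AE x in lebesgue_on \<Omega>. c' s x = v s x"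
    using c c' by (auto simp: continuous_rep_def)
  then have ae: "AE s in lborel. s \<in> ?J \<longrightarrow> L2_norm \<Omega> (c s - c' s) = 0"
    unfolding AE_lebesgue_on_iff[OF Ioo_sets_lebesgue]
  proof eventually_elim
    case (elim s)
    show ?case
    proof
      assume s: "s \<in> ?J"
      then have s': "s \<in> {0..T}" by auto
      have "AE x in lebesgue_on \<Omega>. (c s - c' s) x = 0"
        using elim(1)[rule_format, OF s] elim(2)[rule_format, OF s] by eventually_elim simp
      then have "L2_norm \<Omega> (c s - c' s) = L2_norm \<Omega> (\<lambda>x. 0 :: real^'d)"
        by (rule L2_norm_cong_AE[OF _ L2_measurable[OF L2_minus[OF L(1)[OF s'] L(2)[OF s']]] L2_measurable[OF L2_zero]])
      then show "L2_norm \<Omega> (c s - c' s) = 0" by (simp add: L2_norm_zero)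
    qed
  qed
  have small: "L2_norm \<Omega> (c t - c' t) < 2 * e" if e: "e > 0" for e
  proof -
    have ev: "\<forall>\<^sub>F s in at t within {0..T}. dist (L2_norm \<Omega> (c s - c t)) 0 < e \<and> dist (L2_norm \<Omega> (c' s - c' t)) 0 < e"
      using c c' t e by (intro eventually_conj tendstoD) (auto simp: continuous_rep_def)
    then obtain d where d: "d > 0" "\<And>s. s \<in> {0..T} \<Longrightarrow> s \<noteq> t \<Longrightarrow> dist s t < d \<Longrightarrow>
        L2_norm \<Omega> (c s - c t) < e \<and> L2_norm \<Omega> (c' s - c' t) < e"
      unfolding eventually_at by auto
    have ab: "max 0 (t - d) < min T (t + d)" using t d(1) T by auto
    \<comment> \<open>The limit within the interval says nothing at t itself, hence the additional
      condition s \<noteq> t.\<close>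
    have "AE s in lborel. s \<in> {max 0 (t - d)<..<min T (t + d)} \<longrightarrow> L2_norm \<Omega> (c s - c' s) = 0 \<and> s \<noteq> t"
      using ae AE_lborel_singleton[of t] by eventually_elim auto
    then obtain s where s: "s \<in> {max 0 (t - d)<..<min T (t + d)}" "L2_norm \<Omega> (c s - c' s) = 0 \<and> s \<noteq> t"
      using ab by (rule AE_interval_ex)
    have s': "s \<in> {0..T}" "dist s t < d" using s(1) by (auto simp: dist_real_def abs_less_iff)
    have n: "L2_norm \<Omega> (c s - c t) < e" "L2_norm \<Omega> (c' s - c' t) < e" using d(2)[OF s'(1) _ s'(2)] s(2) by auto
    show ?thesis
      using n s(2) L2_norm_triangle[OF L(1)[OF t] L(1)[OF s'(1)] L(2)[OF t]] L2_norm_triangle[OF L(1)[OF s'(1)] L(2)[OF s'(1)] L(2)[OF t]]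
        L2_norm_minus_commute[of \<Omega> "c t" "c s"] by linarith
  qed
  show ?thesis
  proof (rule ccontr)
    assume "L2_norm \<Omega> (c t - c' t) \<noteq> 0"
    then have "L2_norm \<Omega> (c t - c' t) > 0" using L2_norm_nonneg[of \<Omega> "c t - c' t"] by linarith
    then show False using small[of "L2_norm \<Omega> (c t - c' t) / 2"] by simp
  qed
qed

lemma cont_rep_W:
  assumes T: "0 < T" and v: "v \<in> W T \<Omega>"
  shows "continuous_rep T \<Omega> v (cont_rep T \<Omega> v)"
proof -
  obtain w where w: "w \<in> L2_V_dual T \<Omega>" "weak_dt T \<Omega> v w" and vV: "v \<in> L2_V T \<Omega>"
    using v by (auto simp: W_def)
  obtain c where "continuous_rep T \<Omega> v c" by (rule W_continuous_rep[OF T vV w])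
  then have "\<exists>c. continuous_rep T \<Omega> v c" by blast
  from someI_ex[OF this] show ?thesis
    unfolding cont_rep_def continuous_rep_def .
qed

end

section \<open>The space $L^2(Q)$\<close>

text \<open>A Lipschitz map of two arguments sends pairs of simple functions to simple functions and
  preserves their convergence, and with the value at zero it has at most linear growth. Every field
  in the final identity is put into its Bochner space by this rule.\<close>

lemma bochner_L2_combine:
  fixes \<Phi> :: "('a \<Rightarrow> 'b::real_vector) \<Rightarrow> ('c \<Rightarrow> 'd::real_vector) \<Rightarrow> ('e \<Rightarrow> 'f::real_vector)"
  assumes X: "seminormed_set X N" and Y: "seminormed_set Y N'" and Z: "seminormed_set Z N''"
    and mem: "\<And>a b. a \<in> X \<Longrightarrow> b \<in> Y \<Longrightarrow> \<Phi> a b \<in> Z"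
    and zero: "N'' (\<Phi> (\<lambda>_. 0) (\<lambda>_. 0)) = 0"
    and le: "\<And>a a' b b'. a \<in> X \<Longrightarrow> a' \<in> X \<Longrightarrow> b \<in> Y \<Longrightarrow> b' \<in> Y \<Longrightarrow> N'' (\<Phi> a b - \<Phi> a' b') \<le> C * (N (a - a') + N' (b - b'))"
    and g: "g \<in> bochner_L2 {0<..<T} X N" and h: "h \<in> bochner_L2 {0<..<T} Y N'"
  shows "(\<lambda>t. \<Phi> (g t) (h t)) \<in> bochner_L2 {0<..<T} Z N''"
proof -
  interpret X: seminormed_set X N by fact
  interpret Y: seminormed_set Y N' by fact
  interpret Z: seminormed_set Z N'' by fact
  let ?J = "{0<..<T}"
  obtain g' s where g': "X.approx T g' s" "AE t in lborel. t \<in> ?J \<longrightarrow> g' t = g t" by (rule X.approx_exists[OF g])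
  obtain h' r where h': "Y.approx T h' r" "AE t in lborel. t \<in> ?J \<longrightarrow> h' t = h t" by (rule Y.approx_exists[OF h])
  have gX: "g' t \<in> X" "s n t \<in> X" and sS: "simple_function lborel (s n)" and gl: "(\<lambda>n. N (s n t - g' t)) \<longlonglongrightarrow> 0" for n t
    using g'(1) by (auto simp: X.approx_def)
  have hY: "h' t \<in> Y" "r n t \<in> Y" and rS: "simple_function lborel (r n)" and hl: "(\<lambda>n. N' (r n t - h' t)) \<longlonglongrightarrow> 0" for n t
    using h'(1) by (auto simp: Y.approx_def)
  have JL: "?J \<in> sets lebesgue" and Jb: "?J \<in> sets borel" by simp_all
  have eq: "AE t in lborel. t \<in> ?J \<longrightarrow> g' t = g t \<and> h' t = h t"
    using g'(2) h'(2) by eventually_elim simp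
  have lim: "(\<lambda>n. N'' (\<Phi> (s n t) (r n t) - \<Phi> (g' t) (h' t))) \<longlonglongrightarrow> 0" for t
  proof (rule tendsto_sandwich[OF _ _ tendsto_const])
    show "(\<lambda>n. C * (N (s n t - g' t) + N' (r n t - h' t))) \<longlonglongrightarrow> 0"
      using tendsto_mult[OF tendsto_const tendsto_add[OF gl hl], of C] by simp
    show "\<forall>\<^sub>F n in sequentially. N'' (\<Phi> (s n t) (r n t) - \<Phi> (g' t) (h' t)) \<le> C * (N (s n t - g' t) + N' (r n t - h' t))"
      by (intro always_eventually allI le gX hY)
    show "\<forall>\<^sub>F n in sequentially. 0 \<le> N'' (\<Phi> (s n t) (r n t) - \<Phi> (g' t) (h' t))"
      by (intro always_eventually allI Z.N_nonneg Z.diff_mem mem gX hY)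
  qed
  have meas: "(\<lambda>t. N'' (\<Phi> (g' t) (h' t))) \<in> borel_measurable borel"
  proof -
    have "(\<lambda>t. N'' (\<Phi> (g' t) (h' t))) \<in> borel_measurable lborel"
    proof (rule borel_measurable_LIMSEQ_real)
      show "(\<lambda>n. N'' (\<Phi> (s n t) (r n t))) \<longlonglongrightarrow> N'' (\<Phi> (g' t) (h' t))" for t
        by (rule Z.N_tendsto[OF _ _ lim]) (intro mem gX hY)+
      show "(\<lambda>t. N'' (\<Phi> (s n t) (r n t))) \<in> borel_measurable lborel" for n
        by (rule borel_measurable_simple_function[OF simple_function_compose2[where h = "\<lambda>a b. N'' (\<Phi> a b)", OF sS rS]])
    qed
    then show ?thesis by simp
  qed
  have bound: "N'' (\<Phi> (g' t) (h' t)) \<le> \<bar>C\<bar> * (N (g' t) + N' (h' t))" for t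
  proof -
    have "N'' (\<Phi> (g' t) (h' t)) \<le> N'' (\<Phi> (g' t) (h' t) - \<Phi> (\<lambda>_. 0) (\<lambda>_. 0)) + N'' (\<Phi> (\<lambda>_. 0) (\<lambda>_. 0))"
      by (intro Z.N_le_add mem gX hY X.zero_mem Y.zero_mem)
    also have "\<dots> \<le> C * (N (g' t - (\<lambda>_. 0)) + N' (h' t - (\<lambda>_. 0)))"
      unfolding zero using le[OF gX(1) X.zero_mem hY(1) Y.zero_mem, of t t] by simp
    also have "\<dots> = C * (N (g' t) + N' (h' t))" by (simp add: fun_diff_def)
    also have "\<dots> \<le> \<bar>C\<bar> * (N (g' t) + N' (h' t))"
      by (intro mult_right_mono add_nonneg_nonneg X.N_nonneg Y.N_nonneg gX hY) simp
    finally show ?thesis .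
  qed
  have int: "integrable lborel (\<lambda>t. (N'' (\<Phi> (g' t) (h' t)))\<^sup>2)"
  proof (rule Bochner_Integration.integrable_bound)
    show "integrable lborel (\<lambda>t. C\<^sup>2 * (2 * ((N (g' t))\<^sup>2 + (N' (h' t))\<^sup>2)))"
      using g'(1) h'(1) by (simp add: X.approx_def Y.approx_def)
    show "(\<lambda>t. (N'' (\<Phi> (g' t) (h' t)))\<^sup>2) \<in> borel_measurable lborel" using meas by simp
    have "(N'' (\<Phi> (g' t) (h' t)))\<^sup>2 \<le> C\<^sup>2 * (2 * ((N (g' t))\<^sup>2 + (N' (h' t))\<^sup>2))" for t
    proof -
      have "(N'' (\<Phi> (g' t) (h' t)))\<^sup>2 \<le> (\<bar>C\<bar> * (N (g' t) + N' (h' t)))\<^sup>2"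
        by (rule power_mono[OF bound Z.N_nonneg[OF mem[OF gX(1) hY(1)]]])
      also have "\<dots> = C\<^sup>2 * (N (g' t) + N' (h' t))\<^sup>2" by (simp add: power_mult_distrib)
      also have "(N (g' t) + N' (h' t))\<^sup>2 \<le> 2 * ((N (g' t))\<^sup>2 + (N' (h' t))\<^sup>2)"
        using sum_squares_bound[of "N (g' t)" "N' (h' t)"] by (simp add: power2_sum)
      finally show ?thesis by (simp add: mult_left_mono)
    qed
    then show "AE t in lborel. norm ((N'' (\<Phi> (g' t) (h' t)))\<^sup>2) \<le> norm (C\<^sup>2 * (2 * ((N (g' t))\<^sup>2 + (N' (h' t))\<^sup>2)))"
      by (auto intro!: AE_I2 order_trans[OF _ abs_ge_self])
  qed
  have ae: "AE t in lborel. t \<in> ?J \<longrightarrow> (N'' (\<Phi> (g t) (h t)))\<^sup>2 = (N'' (\<Phi> (g' t) (h' t)))\<^sup>2"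
    using eq by eventually_elim simp
  have sqm: "(\<lambda>t. (N'' (\<Phi> (g' t) (h' t)))\<^sup>2) \<in> borel_measurable borel" using meas by measurable
  show ?thesis
    unfolding bochner_L2_def
  proof (intro CollectI conjI exI[of _ "\<lambda>n t. \<Phi> (s n t) (r n t)"] allI)
    show "AE t in lebesgue_on ?J. \<Phi> (g t) (h t) \<in> Z"
      unfolding AE_lebesgue_on_iff[OF JL] using eq
      by eventually_elim (metis mem gX(1) hY(1))
    show "simple_function (lebesgue_on ?J) (\<lambda>t. \<Phi> (s n t) (r n t))" for n
    proof -
      have S: "simple_function lborel (\<lambda>t. \<Phi> (s n t) (r n t))" by (rule simple_function_compose2[OF sS rS])
      have "(\<lambda>t::real. t) \<in> lebesgue_on ?J \<rightarrow>\<^sub>M lborel"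
        using id_borel_measurable_lebesgue_on[of ?J] by (simp add: id_def)
      from simple_function_comp[OF this S] show ?thesis .
    qed
    show "(\<lambda>t. \<Phi> (s n t) (r n t)) ` ?J \<subseteq> Z" for n using mem gX(2) hY(2) by blast
    show "AE t in lebesgue_on ?J. (\<lambda>n. N'' (\<Phi> (s n t) (r n t) - \<Phi> (g t) (h t))) \<longlonglongrightarrow> 0"
      unfolding AE_lebesgue_on_iff[OF JL] using eq
    proof eventually_elim
      case (elim t)
      show ?case using lim[of t] elim by auto
    qed
    show "integrable (lebesgue_on ?J) (\<lambda>t. (N'' (\<Phi> (g t) (h t)))\<^sup>2)"
      unfolding lebesgue_on_to_lborel(2)[OF Jb sqm ae] by (rule integrable_indicator_mult[OF int]) simp
  qed
qed

text \<open>The Borel version from the completion is available for real functions, so it is taken in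
  each coordinate and reassembled.\<close>

lemma borel_representative:
  fixes a :: "'a::euclidean_space \<Rightarrow> 'b::euclidean_space"
  assumes S: "S \<in> sets lebesgue" and a: "a \<in> borel_measurable (lebesgue_on S)"
  shows "\<exists>b\<in>borel_measurable borel. AE x in lebesgue_on S. a x = b x"
proof -
  have "(\<lambda>x. indicator S x *\<^sub>R a x) \<in> borel_measurable lebesgue"
    using a S by (subst (asm) borel_measurable_restrict_space_iff) auto
  then have "(\<lambda>x. (indicator S x *\<^sub>R a x) \<bullet> i) \<in> borel_measurable lebesgue" for i
    by (intro borel_measurable_inner borel_measurable_const)
  then have "\<exists>b\<in>borel_measurable lborel. AE x in lborel. (indicator S x *\<^sub>R a x) \<bullet> i = b x" for i
    by (rule completion_ex_borel_measurable_real)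
  then obtain b where b: "\<And>i. b i \<in> borel_measurable lborel" "\<And>i. AE x in lborel. (indicator S x *\<^sub>R a x) \<bullet> i = b i x"
    by metis
  have "AE x in lborel. \<forall>i\<in>Basis. (indicator S x *\<^sub>R a x) \<bullet> i = b i x"
    using b(2) by (intro AE_finite_allI) auto
  then have "AE x in lborel. x \<in> S \<longrightarrow> a x = (\<Sum>i\<in>Basis. b i x *\<^sub>R i)"
  proof eventually_elim
    case (elim x)
    show ?case
    proof
      assume "x \<in> S"
      then have "(\<Sum>i\<in>Basis. b i x *\<^sub>R i) = (\<Sum>i\<in>Basis. (a x \<bullet> i) *\<^sub>R i)"
        using elim by (intro sum.cong) auto
      then show "a x = (\<Sum>i\<in>Basis. b i x *\<^sub>R i)" by (simp add: euclidean_representation)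
    qed
  qed
  moreover have "(\<lambda>x. \<Sum>i\<in>Basis. b i x *\<^sub>R i) \<in> borel_measurable borel" using b(1) by simp
  ultimately show ?thesis unfolding AE_lebesgue_on_iff[OF S] by (rule bexI)
qed

lemma nn_integral_lebesgue_on:
  "S \<in> sets lebesgue \<Longrightarrow> (\<integral>\<^sup>+x. q x \<partial>lebesgue_on S) = (\<integral>\<^sup>+x. q x * indicator S x \<partial>lborel)"
  by (subst nn_integral_restrict_space) (auto simp: nn_integral_completion)

text \<open>The conditions under the choice operator in \<open>Q_rep\<close> are equivalent for g
  and h, so the chosen representatives are literally equal.\<close>

lemma Q_norm_cong:
  assumes "AE t in lebesgue_on {0<..<T}. AE x in lebesgue_on \<Omega>. g t x = h t x"
  shows "Q_norm T \<Omega> g = Q_norm T \<Omega> h"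
proof -
  have "(AE t in lebesgue_on {0<..<T}. AE x in lebesgue_on \<Omega>. F (t, x) = g t x) \<longleftrightarrow>
      (AE t in lebesgue_on {0<..<T}. AE x in lebesgue_on \<Omega>. F (t, x) = h t x)" for F
  proof
    assume "AE t in lebesgue_on {0<..<T}. AE x in lebesgue_on \<Omega>. F (t, x) = g t x"
    with assms show "AE t in lebesgue_on {0<..<T}. AE x in lebesgue_on \<Omega>. F (t, x) = h t x"
    proof eventually_elim
      case (elim t)
      then show ?case by eventually_elim simp
    qed
  next
    assume "AE t in lebesgue_on {0<..<T}. AE x in lebesgue_on \<Omega>. F (t, x) = h t x"
    with assms show "AE t in lebesgue_on {0<..<T}. AE x in lebesgue_on \<Omega>. F (t, x) = g t x"
    proof eventually_elim
      case (elim t)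
      then show ?case by eventually_elim simp
    qed
  qed
  then show ?thesis unfolding Q_norm_def Q_rep_def by simp
qed

section \<open>Jointly measurable representatives on the space-time cylinder\<close>

context bounded_open
begin

text \<open>For a function that is simple in time a joint representative is explicit. A fast
  subsequence of such approximations converges almost everywhere on the cylinder, and the limit is
  then identified slice by slice.\<close>

lemma Q_rep_exists:
  fixes g :: "real \<Rightarrow> real^'d \<Rightarrow> 'e::euclidean_space"
  assumes T: "0 < T" and g: "g \<in> bochner_L2 {0<..<T} (L2 \<Omega>) (L2_norm \<Omega>)"
  shows "\<exists>F. F \<in> borel_measurable (lebesgue_on ({0<..<T} \<times> \<Omega>)) \<and>
     (AE t in lebesgue_on {0<..<T}. AE x in lebesgue_on \<Omega>. F (t, x) = g t x)"
proof -
  let ?J = "{0<..<T}"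
  have JL: "?J \<in> sets lebesgue" by simp
  interpret L: seminormed_set "L2 \<Omega> :: (real^'d \<Rightarrow> 'e) set" "L2_norm \<Omega>" by (rule seminormed_set_L2)
  obtain g' s where g': "L.approx T g' s" "AE t in lborel. t \<in> ?J \<longrightarrow> g' t = g t" by (rule L.approx_exists[OF g])
  have gL: "g' t \<in> L2 \<Omega>" "s n t \<in> L2 \<Omega>" and sS: "simple_function lborel (s n)" and gl: "(\<lambda>n. L2_norm \<Omega> (s n t - g' t)) \<longlonglongrightarrow> 0"
    and sI: "integrable lborel (\<lambda>t. (L2_norm \<Omega> (s n t - g' t))\<^sup>2)" for n t
    using g'(1) by (auto simp: L.approx_def)
  \<comment> \<open>The increment of index i is at most twice the sum of two consecutive errors, and
    2 (1/4)^(i+1)/4 + 2 (1/4)^i/4 is below the (1/4)^i required by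
    \<open>AE_convergent_geometric\<close>.\<close>
  have "\<exists>k\<ge>i. (LINT t|lborel. (L2_norm \<Omega> (s k t - g' t))\<^sup>2) < (1/4) ^ i / 4" for i
  proof -
    have "(\<lambda>n. LINT t|lborel. (L2_norm \<Omega> (s n t - g' t))\<^sup>2) \<longlonglongrightarrow> 0" using g'(1) by (simp add: L.approx_def)
    then have "\<forall>\<^sub>F n in sequentially. (LINT t|lborel. (L2_norm \<Omega> (s n t - g' t))\<^sup>2) < (1/4) ^ i / 4"
      by (rule order_tendstoD) simp
    from eventually_conj[OF this eventually_ge_at_top[of i]] show ?thesis
      by (auto simp: eventually_sequentially)
  qed
  then have "\<exists>\<kappa>. \<forall>i. \<kappa> i \<ge> i \<and> (LINT t|lborel. (L2_norm \<Omega> (s (\<kappa> i) t - g' t))\<^sup>2) < (1/4) ^ i / 4"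
    by (intro choice allI)
  then obtain \<kappa> where \<kappa>: "\<And>i. \<kappa> i \<ge> i" "\<And>i. (LINT t|lborel. (L2_norm \<Omega> (s (\<kappa> i) t - g' t))\<^sup>2) < (1/4) ^ i / 4" by blast
  \<comment> \<open>Elements of \<open>L2\<close> are only Lebesgue measurable in space; a Borel
    version of each value is needed for measurability in the product sigma-algebra.\<close>
  define br :: "(real^'d \<Rightarrow> 'e) \<Rightarrow> real^'d \<Rightarrow> 'e" where
    "br a = (SOME b. b \<in> borel_measurable borel \<and> (AE x in lebesgue_on \<Omega>. a x = b x))" for a
  have br: "br a \<in> borel_measurable borel" "AE x in lebesgue_on \<Omega>. a x = br a x" if a: "a \<in> L2 \<Omega>" for a
  proof -
    have "\<exists>b. b \<in> borel_measurable borel \<and> (AE x in lebesgue_on \<Omega>. a x = b x)"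
      using borel_representative[OF dom_sets L2_measurable[OF a]] by blast
    from someI_ex[OF this] show "br a \<in> borel_measurable borel" "AE x in lebesgue_on \<Omega>. a x = br a x"
      unfolding br_def by blast+
  qed
  let ?M = "lborel \<Otimes>\<^sub>M lborel :: (real \<times> (real^'d)) measure"
  let ?A = "?J \<times> \<Omega>"
  have Om: "\<Omega> \<in> sets lborel" using open_dom by simp
  have A: "?A \<in> sets ?M" using Om by (intro pair_measureI) auto
  define F where "F i p = br (s (\<kappa> i) (fst p)) (snd p)" for i p
  have Fm: "F i \<in> borel_measurable ?M" for i
  proof -
    let ?s = "s (\<kappa> i)"
    have fin: "finite (range ?s)" using simple_functionD(1)[OF sS, of "\<kappa> i"] by simp
    \<comment> \<open>Separates the variables: a finite sum over the values of the simple function,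
      each term an indicator in time times a Borel function in space.\<close>
    have "F i p = (\<Sum>y\<in>range ?s. indicator (?s -` {y}) (fst p) *\<^sub>R br y (snd p))" for p
    proof -
      have "(\<Sum>y\<in>range ?s. indicator (?s -` {y}) (fst p) *\<^sub>R br y (snd p)) = (\<Sum>y\<in>{?s (fst p)}. indicator (?s -` {y}) (fst p) *\<^sub>R br y (snd p))"
        by (rule sum.mono_neutral_right[OF fin]) auto
      then show ?thesis by (simp add: F_def)
    qed
    moreover have "(\<lambda>p. \<Sum>y\<in>range ?s. indicator (?s -` {y}) (fst p) *\<^sub>R br y (snd p)) \<in> borel_measurable ?M"
    proof (intro borel_measurable_sum borel_measurable_scaleR)
      fix y assume "y \<in> range ?s"
      then have y: "y \<in> L2 \<Omega>" using gL(2) by auto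
      have "?s -` {y} \<in> sets lborel" using simple_functionD(2)[OF sS, of "\<kappa> i" "{y}"] by simp
      then show "(\<lambda>p. indicator (?s -` {y}) (fst p) :: real) \<in> borel_measurable ?M" by measurable
      show "(\<lambda>p. br y (snd p)) \<in> borel_measurable ?M"
        by (rule measurable_compose[OF measurable_snd]) (use br(1)[OF y] in simp)
    qed
    ultimately show ?thesis by (simp cong: measurable_cong)
  qed
  let ?R = "restrict_space ?M ?A"
  have Rm: "F i \<in> borel_measurable ?R" for i by (rule measurable_restrict_space1[OF Fm])
  have fin: "emeasure ?R (space ?R) \<noteq> \<infinity>"
  proof -
    have "emeasure ?R (space ?R) = emeasure ?M ?A"
      using A by (simp add: space_restrict_space space_pair_measure emeasure_restrict_space)
    also have "\<dots> = emeasure lborel ?J * emeasure lborel \<Omega>"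
      using Om by (intro lborel.emeasure_pair_measure_Times) auto
    also have "\<dots> < \<infinity>"
      using emeasure_bounded_finite[of ?J] emeasure_bounded_finite[OF bounded_dom] by (simp add: ennreal_mult_less_top)
    finally show ?thesis by simp
  qed
  have step: "(\<integral>\<^sup>+p. ennreal ((norm (F (Suc i) p - F i p))\<^sup>2) \<partial>?R) \<le> ennreal ((1/4) ^ i)" for i
  proof -
    let ?d = "\<lambda>t. s (\<kappa> (Suc i)) t - s (\<kappa> i) t"
    have m: "(\<lambda>p. ennreal ((norm (F (Suc i) p - F i p))\<^sup>2) * indicator ?A p) \<in> borel_measurable ?M"
    proof -
      have "(\<lambda>p. F (Suc i) p - F i p) \<in> borel_measurable ?M" by (rule borel_measurable_diff[OF Fm Fm])
      from measurable_compose[OF this, of "\<lambda>y. ennreal ((norm y)\<^sup>2)" borel]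
      have "(\<lambda>p. ennreal ((norm (F (Suc i) p - F i p))\<^sup>2)) \<in> borel_measurable ?M" by simp
      then show ?thesis by (rule borel_measurable_times_ennreal[OF _ borel_measurable_indicator[OF A]])
    qed
    have "(\<integral>\<^sup>+p. ennreal ((norm (F (Suc i) p - F i p))\<^sup>2) \<partial>?R) = (\<integral>\<^sup>+p. ennreal ((norm (F (Suc i) p - F i p))\<^sup>2) * indicator ?A p \<partial>?M)"
      using A by (subst nn_integral_restrict_space) (auto simp: space_pair_measure)
    also have "\<dots> = (\<integral>\<^sup>+t. \<integral>\<^sup>+x. ennreal ((norm (F (Suc i) (t, x) - F i (t, x)))\<^sup>2) * indicator ?A (t, x) \<partial>lborel \<partial>lborel)"
      by (rule lborel.nn_integral_fst[OF m, symmetric])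
    also have "\<dots> \<le> (\<integral>\<^sup>+t. ennreal ((L2_norm \<Omega> (?d t))\<^sup>2) \<partial>lborel)"
    proof (rule nn_integral_mono)
      fix t
      have ae: "AE x in lebesgue_on \<Omega>. ennreal ((norm (F (Suc i) (t, x) - F i (t, x)))\<^sup>2) = ennreal ((norm (?d t x))\<^sup>2)"
        using br(2)[OF gL(2)[of "\<kappa> (Suc i)" t]] br(2)[OF gL(2)[of "\<kappa> i" t]]
        by eventually_elim (simp add: F_def)
      have "(\<integral>\<^sup>+x. ennreal ((norm (F (Suc i) (t, x) - F i (t, x)))\<^sup>2) * indicator ?A (t, x) \<partial>lborel)
          \<le> (\<integral>\<^sup>+x. ennreal ((norm (F (Suc i) (t, x) - F i (t, x)))\<^sup>2) * indicator \<Omega> x \<partial>lborel)"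
        by (intro nn_integral_mono) (auto simp: indicator_def)
      also have "\<dots> = (\<integral>\<^sup>+x. ennreal ((norm (F (Suc i) (t, x) - F i (t, x)))\<^sup>2) \<partial>lebesgue_on \<Omega>)"
        by (rule nn_integral_lebesgue_on[OF dom_sets, symmetric])
      also have "\<dots> = (\<integral>\<^sup>+x. ennreal ((norm (?d t x))\<^sup>2) \<partial>lebesgue_on \<Omega>)" by (rule nn_integral_cong_AE[OF ae])
      also have "\<dots> = ennreal ((L2_norm \<Omega> (?d t))\<^sup>2)" by (rule L2_nn_integral[OF L2_minus[OF gL(2) gL(2)]])
      finally show "(\<integral>\<^sup>+x. ennreal ((norm (F (Suc i) (t, x) - F i (t, x)))\<^sup>2) * indicator ?A (t, x) \<partial>lborel) \<le> ennreal ((L2_norm \<Omega> (?d t))\<^sup>2)" .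
    qed
    also have "\<dots> \<le> (\<integral>\<^sup>+t. ennreal (2 * (L2_norm \<Omega> (s (\<kappa> (Suc i)) t - g' t))\<^sup>2 + 2 * (L2_norm \<Omega> (s (\<kappa> i) t - g' t))\<^sup>2) \<partial>lborel)"
    proof (intro nn_integral_mono ennreal_leI)
      fix t
      let ?a = "L2_norm \<Omega> (s (\<kappa> (Suc i)) t - g' t)" and ?b = "L2_norm \<Omega> (s (\<kappa> i) t - g' t)"
      have "L2_norm \<Omega> (?d t) \<le> ?a + ?b"
        using L2_norm_triangle[OF gL(2)[of "\<kappa> (Suc i)" t] gL(1)[of t] gL(2)[of "\<kappa> i" t]] L2_norm_minus_commute[of \<Omega> "g' t"] by simp
      then have "(L2_norm \<Omega> (?d t))\<^sup>2 \<le> (?a + ?b)\<^sup>2" by (rule power_mono) simp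
      also have "\<dots> \<le> 2 * ?a\<^sup>2 + 2 * ?b\<^sup>2" using sum_squares_bound[of ?a ?b] by (simp add: power2_sum)
      finally show "(L2_norm \<Omega> (?d t))\<^sup>2 \<le> 2 * ?a\<^sup>2 + 2 * ?b\<^sup>2" .
    qed
    also have "\<dots> = ennreal (LINT t|lborel. 2 * (L2_norm \<Omega> (s (\<kappa> (Suc i)) t - g' t))\<^sup>2 + 2 * (L2_norm \<Omega> (s (\<kappa> i) t - g' t))\<^sup>2)"
      by (rule nn_integral_eq_integral) (use sI in auto)
    also have "\<dots> \<le> ennreal ((1/4) ^ i)"
    proof (rule ennreal_leI)
      have "(LINT t|lborel. 2 * (L2_norm \<Omega> (s (\<kappa> (Suc i)) t - g' t))\<^sup>2 + 2 * (L2_norm \<Omega> (s (\<kappa> i) t - g' t))\<^sup>2) =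
          2 * (LINT t|lborel. (L2_norm \<Omega> (s (\<kappa> (Suc i)) t - g' t))\<^sup>2) + 2 * (LINT t|lborel. (L2_norm \<Omega> (s (\<kappa> i) t - g' t))\<^sup>2)"
        using sI by simp
      also have "\<dots> \<le> 2 * ((1/4) ^ Suc i / 4) + 2 * ((1/4) ^ i / 4)"
        using \<kappa>(2)[of i] \<kappa>(2)[of "Suc i"] by (intro add_mono mult_left_mono) auto
      also have "\<dots> \<le> (1/4) ^ i" by simp
      finally show "(LINT t|lborel. 2 * (L2_norm \<Omega> (s (\<kappa> (Suc i)) t - g' t))\<^sup>2 + 2 * (L2_norm \<Omega> (s (\<kappa> i) t - g' t))\<^sup>2) \<le> (1/4) ^ i" .
    qed
    finally show ?thesis .
  qed
  obtain G where G: "G \<in> borel_measurable ?R" "AE p in ?R. (\<lambda>i. F i p) \<longlonglongrightarrow> G p"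
    by (rule AE_convergent_geometric[OF fin Rm step])
  define G1 where "G1 p = indicator ?A p *\<^sub>R G p" for p
  have G1m: "G1 \<in> borel_measurable ?M"
    using G(1) A unfolding G1_def[abs_def]
    by (subst (asm) borel_measurable_restrict_space_iff) (auto simp: space_pair_measure)
  have ae1: "AE p in ?M. p \<in> ?A \<longrightarrow> (\<lambda>i. F i p) \<longlonglongrightarrow> G1 p"
  proof -
    have "AE p in ?M. p \<in> ?A \<longrightarrow> (\<lambda>i. F i p) \<longlonglongrightarrow> G p"
      using G(2) A by (subst (asm) AE_restrict_space_iff) (auto simp: space_pair_measure)
    then show ?thesis by eventually_elim (simp add: G1_def)
  qed
  have G1L: "G1 \<in> borel_measurable (lebesgue_on ?A)"
    by (rule measurable_restrict_space1, rule measurable_completion) (use G1m in \<open>simp add: lborel_prod\<close>)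
  have "AE t in lebesgue_on ?J. AE x in lebesgue_on \<Omega>. G1 (t, x) = g t x"
    unfolding AE_lebesgue_on_iff[OF JL]
    using lborel_pair.AE_pair[OF ae1] g'(2)
  proof eventually_elim
    case (elim t)
    show ?case
    proof
      assume t: "t \<in> ?J"
      have "AE x in lebesgue_on \<Omega>. (\<lambda>i. F i (t, x)) \<longlonglongrightarrow> G1 (t, x)"
        unfolding AE_lebesgue_on_iff[OF dom_sets] using elim(1) by eventually_elim (use t in auto)
      moreover have "AE x in lebesgue_on \<Omega>. \<forall>i. s (\<kappa> i) t x = F i (t, x)"
        unfolding AE_all_countable F_def using br(2)[OF gL(2)] by simp
      ultimately have lim: "AE x in lebesgue_on \<Omega>. (\<lambda>i. (s (\<kappa> i) t - g' t) x) \<longlonglongrightarrow> G1 (t, x) - g' t x"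
        by eventually_elim (auto intro!: tendsto_intros)
      have sec: "(\<lambda>x. G1 (t, x)) \<in> borel_measurable lborel"
        by (rule measurable_compose[OF measurable_Pair1' G1m]) simp
      have Fm: "(\<lambda>x. G1 (t, x) - g' t x) \<in> borel_measurable (lebesgue_on \<Omega>)"
        by (intro borel_measurable_diff L2_measurable[OF gL(1)] measurable_restrict_space1 measurable_completion sec)
      have kinf: "filterlim \<kappa> at_top sequentially"
        by (rule filterlim_at_top_mono[OF filterlim_ident]) (use \<kappa>(1) in simp)
      have l0: "(\<lambda>i. L2_norm \<Omega> (s (\<kappa> i) t - g' t)) \<longlonglongrightarrow> 0"
        by (rule filterlim_compose[OF gl kinf])
      \<comment> \<open>On a fixed slice the subsequence converges to g' t in the norm and to
        \<open>G1\<close> almost everywhere; Fatou's lemma makes the distance of the two limits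
        smaller than every e.\<close>
      have small: "(\<lambda>x. G1 (t, x) - g' t x) \<in> L2 \<Omega> \<and> L2_norm \<Omega> (\<lambda>x. G1 (t, x) - g' t x) \<le> e" if e: "e > 0" for e
      proof -
        have ev: "\<forall>\<^sub>F i in sequentially. L2_norm \<Omega> (s (\<kappa> i) t - g' t) \<le> e"
          using order_tendstoD(2)[OF l0 e] by eventually_elim simp
        show ?thesis
          using L2_Fatou[of "\<lambda>i. s (\<kappa> i) t - g' t", OF L2_minus[OF gL(2) gL(1)] Fm lim ev] by blast
      qed
      have "L2_norm \<Omega> (\<lambda>x. G1 (t, x) - g' t x) \<le> 0" by (rule field_le_epsilon) (use small in simp)
      then have "L2_norm \<Omega> (\<lambda>x. G1 (t, x) - g' t x) = 0" using L2_norm_nonneg by (metis order_antisym)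
      from L2_norm_eq_0_AE[OF _ this] small[of 1]
      have "AE x in lebesgue_on \<Omega>. G1 (t, x) - g' t x = 0" by simp
      then show "AE x in lebesgue_on \<Omega>. G1 (t, x) = g t x"
        using elim(2) t by (auto elim!: eventually_mono)
    qed
  qed
  with G1L show ?thesis by blast
qed

text \<open>Tonelli's theorem. As \<open>Q_rep\<close> is measurable only for the completed measure
  on the cylinder, its square is first exchanged for an almost everywhere equal Borel function, to
  which the product theorem applies.\<close>

lemma Q_norm_sq:
  fixes g :: "real \<Rightarrow> 'd tfield"
  assumes T: "0 < T" and g: "g \<in> L2_Y T \<Omega>"
  shows "(Q_norm T \<Omega> g)\<^sup>2 = (LINT t|lebesgue_on {0<..<T}. (L2_norm \<Omega> (g t))\<^sup>2)"
proof -
  let ?J = "{0<..<T}" and ?A = "{0<..<T} \<times> \<Omega>"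
  have JL: "?J \<in> sets lebesgue" by simp
  have "Q_rep T \<Omega> g \<in> borel_measurable (lebesgue_on ?A) \<and> (AE t in lebesgue_on ?J. AE x in lebesgue_on \<Omega>. Q_rep T \<Omega> g (t, x) = g t x)"
    unfolding Q_rep_def by (rule someI_ex[OF Q_rep_exists[OF T g]])
  then obtain F where F: "F = Q_rep T \<Omega> g" "F \<in> borel_measurable (lebesgue_on ?A)"
      "AE t in lebesgue_on ?J. AE x in lebesgue_on \<Omega>. F (t, x) = g t x" by blast
  have Ab: "?A \<in> sets borel" by (intro borel_open open_Times open_dom) auto
  then have AL: "?A \<in> sets lebesgue" by simp
  define q where "q p = indicator ?A p * (norm (F p))\<^sup>2" for p
  have "(\<lambda>p. indicator ?A p *\<^sub>R F p) \<in> borel_measurable lebesgue"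
    using F(2) AL by (subst (asm) borel_measurable_restrict_space_iff) auto
  then have "(\<lambda>p. (norm (indicator ?A p *\<^sub>R F p))\<^sup>2) \<in> borel_measurable lebesgue" by measurable
  moreover have "(\<lambda>p. (norm (indicator ?A p *\<^sub>R F p))\<^sup>2) = q" by (auto simp: fun_eq_iff q_def indicator_def)
  ultimately have qm: "q \<in> borel_measurable lebesgue" by simp
  obtain q' where q': "q' \<in> borel_measurable lborel" "AE p in lborel. q p = q' p"
    using completion_ex_borel_measurable_real[OF qm] by blast
  have ae2: "AE t in lborel. AE x in lborel. q (t, x) = q' (t, x)"
  proof -
    have "AE p in lborel \<Otimes>\<^sub>M lborel. q p = q' p" using q'(2) by (simp only: lborel_prod)
    from lborel_pair.AE_pair[OF this] show ?thesis .
  qed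
  have gL: "AE t in lebesgue_on ?J. g t \<in> L2 \<Omega>" and gI: "integrable (lebesgue_on ?J) (\<lambda>t. (L2_norm \<Omega> (g t))\<^sup>2)"
    using g by (auto simp: bochner_L2_def)
  have inner: "AE t in lborel. (\<integral>\<^sup>+x. ennreal (q' (t, x)) \<partial>lborel) = ennreal ((L2_norm \<Omega> (g t))\<^sup>2) * indicator ?J t"
    using ae2 F(3)[unfolded AE_lebesgue_on_iff[OF JL]] gL[unfolded AE_lebesgue_on_iff[OF JL]]
  proof eventually_elim
    case (elim t)
    have "(\<integral>\<^sup>+x. ennreal (q' (t, x)) \<partial>lborel) = (\<integral>\<^sup>+x. ennreal (q (t, x)) \<partial>lborel)"
      by (rule nn_integral_cong_AE) (use elim(1) in eventually_elim, simp)
    also have "\<dots> = ennreal ((L2_norm \<Omega> (g t))\<^sup>2) * indicator ?J t"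
    proof (cases "t \<in> ?J")
      case False
      then have "q (t, x) = 0" for x by (auto simp: q_def indicator_def)
      then show ?thesis using False by simp
    next
      case True
      have "(\<integral>\<^sup>+x. ennreal (q (t, x)) \<partial>lborel) = (\<integral>\<^sup>+x. ennreal ((norm (F (t, x)))\<^sup>2) * indicator \<Omega> x \<partial>lborel)"
        using True by (intro nn_integral_cong) (auto simp: q_def indicator_def)
      also have "\<dots> = (\<integral>\<^sup>+x. ennreal ((norm (F (t, x)))\<^sup>2) \<partial>lebesgue_on \<Omega>)"
        by (rule nn_integral_lebesgue_on[OF dom_sets, symmetric])
      also have "\<dots> = (\<integral>\<^sup>+x. ennreal ((norm (g t x))\<^sup>2) \<partial>lebesgue_on \<Omega>)"
        by (rule nn_integral_cong_AE) (use elim(2)[rule_format, OF True] in eventually_elim, simp)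
      also have "\<dots> = ennreal ((L2_norm \<Omega> (g t))\<^sup>2)"
        by (rule L2_nn_integral) (use elim(3) True in blast)
      finally show ?thesis using True by simp
    qed
    finally show ?case .
  qed
  have nn: "(\<integral>\<^sup>+p. ennreal ((norm (F p))\<^sup>2) \<partial>lebesgue_on ?A) = (\<integral>\<^sup>+t. ennreal ((L2_norm \<Omega> (g t))\<^sup>2) \<partial>lebesgue_on ?J)"
  proof -
    have "(\<integral>\<^sup>+p. ennreal ((norm (F p))\<^sup>2) \<partial>lebesgue_on ?A) = (\<integral>\<^sup>+p. ennreal ((norm (F p))\<^sup>2) * indicator ?A p \<partial>lborel)"
      by (rule nn_integral_lebesgue_on[OF AL])
    also have "\<dots> = (\<integral>\<^sup>+p. ennreal (q' p) \<partial>lborel)"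
    proof (rule nn_integral_cong_AE)
      show "AE p in lborel. ennreal ((norm (F p))\<^sup>2) * indicator ?A p = ennreal (q' p)"
        using q'(2)
      proof eventually_elim
        case (elim p)
        have "ennreal ((norm (F p))\<^sup>2) * indicator ?A p = ennreal (q p)"
          by (cases "p \<in> ?A") (simp_all add: q_def indicator_def)
        then show ?case using elim by simp
      qed
    qed
    also have "\<dots> = (\<integral>\<^sup>+p. ennreal (q' p) \<partial>(lborel \<Otimes>\<^sub>M lborel))" by (simp add: lborel_prod)
    also have "\<dots> = (\<integral>\<^sup>+t. \<integral>\<^sup>+x. ennreal (q' (t, x)) \<partial>lborel \<partial>lborel)"
      by (rule lborel.nn_integral_fst[symmetric]) (use q'(1) in \<open>simp add: lborel_prod\<close>)
    also have "\<dots> = (\<integral>\<^sup>+t. ennreal ((L2_norm \<Omega> (g t))\<^sup>2) * indicator ?J t \<partial>lborel)"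
      by (rule nn_integral_cong_AE[OF inner])
    also have "\<dots> = (\<integral>\<^sup>+t. ennreal ((L2_norm \<Omega> (g t))\<^sup>2) \<partial>lebesgue_on ?J)"
      by (rule nn_integral_lebesgue_on[OF JL, symmetric])
    finally show ?thesis .
  qed
  have "(Q_norm T \<Omega> g)\<^sup>2 = (LINT p|lebesgue_on ?A. (norm (F p))\<^sup>2)"
    unfolding Q_norm_def F(1)[symmetric] by (rule L2_norm_sq)
  also have "\<dots> = enn2real (\<integral>\<^sup>+p. ennreal ((norm (F p))\<^sup>2) \<partial>lebesgue_on ?A)"
    by (rule integral_eq_nn_integral) (use F(2) in auto)
  also have "\<dots> = (LINT t|lebesgue_on ?J. (L2_norm \<Omega> (g t))\<^sup>2)"
    unfolding nn by (rule integral_eq_nn_integral[symmetric]) (use gI in auto)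
  finally show ?thesis .
qed

end

section \<open>The error identity\<close>

lemma bochner_L2_mono:
  assumes "g \<in> bochner_L2 I X N" "X \<subseteq> Y" shows "g \<in> bochner_L2 I Y N"
proof -
  obtain s where s: "\<forall>n. simple_function (lebesgue_on I) (s n) \<and> s n ` I \<subseteq> X"
    "AE t in lebesgue_on I. (\<lambda>n. N (s n t - g t)) \<longlonglongrightarrow> 0"
    and gX: "AE t in lebesgue_on I. g t \<in> X" and int: "integrable (lebesgue_on I) (\<lambda>t. (N (g t))\<^sup>2)"
    using assms(1) unfolding bochner_L2_def by blast
  have gY: "AE t in lebesgue_on I. g t \<in> Y" using gX by eventually_elim (use assms(2) in blast)
  have s': "\<forall>n. simple_function (lebesgue_on I) (s n) \<and> s n ` I \<subseteq> Y" using s(1) assms(2) by blast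
  show ?thesis unfolding bochner_L2_def using gY s' s(2) int by blast
qed

section \<open>Algebra of the deviator\<close>

lemma deviator_diff: "deviator (A - B) = deviator A - deviator B"
  by (simp add: deviator_def trace_sub diff_divide_distrib scaleR_diff_left)

lemma trace_scaleR: "trace (c *\<^sub>R A) = c * trace (A :: real^'d::finite^'d)"
  by (simp add: trace_def sum_distrib_left)

lemma deviator_scaleR: "deviator (c *\<^sub>R A) = c *\<^sub>R deviator A"
  by (simp add: deviator_def trace_scaleR scaleR_diff_right)

lemma deviator_add: "deviator (A + B) = deviator A + deviator B"
  by (simp add: deviator_def trace_add add_divide_distrib scaleR_add_left)

lemma deviator_mat_1: "deviator (mat 1 :: real^'d::finite^'d) = 0"
  by (simp add: deviator_def trace_I)

lemma deviator_traceless: "trace A = 0 \<Longrightarrow> deviator A = A"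
  by (simp add: deviator_def)

lemma inner_mat_1: "mat 1 \<bullet> (B :: real^'d::finite^'d) = trace B"
proof -
  have "mat 1 \<bullet> B = (\<Sum>i\<in>UNIV. \<Sum>j\<in>UNIV. (if i = j then 1 else 0) * B $ i $ j)"
    by (simp add: inner_vec_def mat_def)
  also have "\<dots> = (\<Sum>i\<in>UNIV. B $ i $ i)"
    by (intro sum.cong refl) (simp add: if_distrib[of "\<lambda>x. x * _"] cong: if_cong)
  finally show ?thesis by (simp add: trace_def)
qed

text \<open>Multiples of the identity are orthogonal to trace-free matrices.\<close>

lemma deviator_inner: "trace B = 0 \<Longrightarrow> deviator A \<bullet> B = A \<bullet> B"
  by (simp add: deviator_def inner_diff_left inner_mat_1)

lemma bounded_linear_deviator: "bounded_linear (deviator :: real^'d::finite^'d \<Rightarrow> _)"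
  by (rule linear_conv_bounded_linear[THEN iffD1]) (intro linearI deviator_add deviator_scaleR)

lemma L2_bounded_linear:
  fixes l :: "'b::euclidean_space \<Rightarrow> 'c::euclidean_space"
  assumes l: "bounded_linear l"
  obtains K where "K \<ge> 0" "\<And>S (f :: 'a::euclidean_space \<Rightarrow> 'b). f \<in> L2 S \<Longrightarrow> (\<lambda>x. l (f x)) \<in> L2 S"
    "\<And>S (f :: 'a \<Rightarrow> 'b). f \<in> L2 S \<Longrightarrow> L2_norm S (\<lambda>x. l (f x)) \<le> K * L2_norm S f"
proof -
  obtain K where K: "K > 0" "\<And>x. norm (l x) \<le> norm x * K" using bounded_linear.pos_bounded[OF l] by blast
  have lm: "l \<in> borel_measurable borel"
    by (rule borel_measurable_continuous_onI[OF linear_continuous_on[OF l]])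
  have "(\<lambda>x. l (f x)) \<in> L2 S \<and> L2_norm S (\<lambda>x. l (f x)) \<le> K * L2_norm S f" if f: "f \<in> L2 S" for S and f :: "'a \<Rightarrow> 'b"
  proof -
    have m: "(\<lambda>x. l (f x)) \<in> borel_measurable (lebesgue_on S)" by (rule measurable_compose[OF L2_measurable[OF f] lm])
    have "AE x in lebesgue_on S. norm (l (f x)) \<le> K * norm (f x)" using K(2) by (simp add: mult.commute)
    from L2_dominated[OF f m this] show ?thesis using K(1) by simp
  qed
  then show ?thesis using K(1) by (intro that[of K]) auto
qed

lemma L2_norm_split_le:
  assumes "f \<in> L2 S" "g \<in> L2 S" "L2_norm S f \<le> a" "L2_norm S g \<le> b" "h = f - g"
  shows "L2_norm S h \<le> a + b"
  using L2_norm_triangle_minus[OF assms(1,2)] assms(3-5) by simp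

context seminormed_set
begin

lemma N_diff_diff:
  assumes "a \<in> X" "b \<in> X" "a' \<in> X" "b' \<in> X"
  shows "N ((a - b) - (a' - b')) \<le> N (a - a') + N (b - b')"
proof -
  have "(a - b) - (a' - b') = (a - a') - (b - b')" by (simp add: fun_eq_iff)
  then show ?thesis using N_diff_le[OF diff_mem[OF assms(1,3)] diff_mem[OF assms(2,4)]] by simp
qed

lemma bochner_diff:
  assumes "g \<in> bochner_L2 {0<..<T} X N" "h \<in> bochner_L2 {0<..<T} X N"
  shows "(\<lambda>t. g t - h t) \<in> bochner_L2 {0<..<T} X N"
proof (rule bochner_L2_combine[where \<Phi> = "\<lambda>a b. a - b" and C = 1, OF seminormed_set_axioms seminormed_set_axioms seminormed_set_axioms _ _ _ assms])
  show "N (a - b - (a' - b')) \<le> 1 * (N (a - a') + N (b - b'))" if "a \<in> X" "a' \<in> X" "b \<in> X" "b' \<in> X" for a a' b b'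
    using N_diff_diff[OF that(1,3,2,4)] by simp
qed (auto intro: diff_mem N_diff_self zero_mem)

text \<open>\<open>weak_dt\<close> is an equation between integrals and asserts no integrability of
  its integrands; this supplies it, so that the weak equations of two functions may be
  subtracted.\<close>

lemma functional_integrable:
  assumes g: "g \<in> bochner_L2 {0<..<T} X N" and psi: "\<psi> \<in> test_functions {0<..<T}"
    and l: "\<And>a b. a \<in> X \<Longrightarrow> b \<in> X \<Longrightarrow> \<bar>l a - l b\<bar> \<le> K * N (a - b)" and l0: "l (\<lambda>_. 0) = 0" and K: "K \<ge> (0::real)"
  shows "integrable (lebesgue_on {0<..<T}) (\<lambda>t. \<psi> t * l (g t))"
proof -
  let ?J = "{0<..<T}"
  obtain g' s where g': "approx T g' s" "AE t in lborel. t \<in> ?J \<longrightarrow> g' t = g t" by (rule approx_exists[OF g])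
  have gX: "g' t \<in> X" "s n t \<in> X" and sS: "simple_function lborel (s n)" and gl: "(\<lambda>n. N (s n t - g' t)) \<longlonglongrightarrow> 0"
    and g0: "t \<notin> ?J \<Longrightarrow> g' t = (\<lambda>_. 0)" and gI: "integrable lborel (\<lambda>t. (N (g' t))\<^sup>2)" for n t
    using g'(1) by (auto simp: approx_def)
  have lm: "(\<lambda>t. l (g' t)) \<in> borel_measurable lborel"
  proof (rule borel_measurable_LIMSEQ_real)
    show "(\<lambda>n. l (s n t)) \<longlonglongrightarrow> l (g' t)" for t
    proof -
      have "(\<lambda>n. l (s n t) - l (g' t)) \<longlonglongrightarrow> 0"
      proof (rule Lim_null_comparison)
        show "(\<lambda>n. K * N (s n t - g' t)) \<longlonglongrightarrow> 0" using tendsto_mult[OF tendsto_const gl, of K] by simp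
        show "\<forall>\<^sub>F n in sequentially. norm (l (s n t) - l (g' t)) \<le> K * N (s n t - g' t)"
          by (intro always_eventually allI) (simp add: l gX)
      qed
      then show ?thesis by (simp add: LIM_zero_iff)
    qed
    show "(\<lambda>t. l (s n t)) \<in> borel_measurable lborel" for n
      by (rule borel_measurable_simple_function[OF simple_function_compose1[OF sS]])
  qed
  obtain M where M: "M > 0" "\<And>x. norm (\<psi> x) \<le> M" using test_functions_bounded[OF psi] by blast
  have NI: "integrable lborel (\<lambda>t. N (g' t))"
    by (rule integrable_of_square[OF approx_measurable(1)[OF g'(1)] gI, where T = T]) (subst g0, assumption, rule N_zero)
  have pm: "(\<lambda>t. \<psi> t * l (g' t)) \<in> borel_measurable borel"
    using lm test_functions_measurable[OF psi] by simp
  have int: "integrable lborel (\<lambda>t. \<psi> t * l (g' t))"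
  proof (rule Bochner_Integration.integrable_bound)
    show "integrable lborel (\<lambda>t. M * (K * N (g' t)))" using NI by simp
    show "(\<lambda>t. \<psi> t * l (g' t)) \<in> borel_measurable lborel" using pm by simp
    have "\<bar>\<psi> t * l (g' t)\<bar> \<le> M * (K * N (g' t))" for t
    proof -
      have "\<bar>l (g' t)\<bar> \<le> K * N (g' t)" using l[OF gX(1)[of t] zero_mem] l0 by (simp add: fun_diff_def)
      then show ?thesis using M(2)[of t] unfolding abs_mult by (intro mult_mono) auto
    qed
    then show "AE t in lborel. norm (\<psi> t * l (g' t)) \<le> norm (M * (K * N (g' t)))"
      by (auto intro!: AE_I2 order_trans[OF _ abs_ge_self])
  qed
  have ae: "AE t in lborel. t \<in> ?J \<longrightarrow> \<psi> t * l (g t) = \<psi> t * l (g' t)"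
    using g'(2) by eventually_elim simp
  have Jb: "?J \<in> sets borel" by simp
  show ?thesis
    unfolding lebesgue_on_to_lborel(2)[OF Jb pm ae] by (rule integrable_indicator_mult[OF int]) simp
qed

end

context bounded_open
begin

lemma weak_dt_diff:
  assumes v: "v \<in> L2_V T \<Omega>" "v2 \<in> L2_V T \<Omega>" and w: "w \<in> L2_V_dual T \<Omega>" "w2 \<in> L2_V_dual T \<Omega>"
    and weak: "weak_dt T \<Omega> v w" "weak_dt T \<Omega> v2 w2"
  shows "weak_dt T \<Omega> (\<lambda>t. v t - v2 t) (\<lambda>t. w t - w2 t)"
  unfolding weak_dt_def
proof (intro ballI)
  let ?J = "{0<..<T}"
  fix \<phi> :: "real \<Rightarrow> real" and \<xi> assume phi: "\<phi> \<in> test_functions ?J" and xi: "\<xi> \<in> V \<Omega>"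
  note dphi = test_functions_deriv_real(2)[OF phi]
  obtain C where C: "C \<ge> 0" "\<And>v. v \<in> V \<Omega> \<Longrightarrow> L2_norm \<Omega> v \<le> C * V_norm \<Omega> v" using Poincare by metis
  have I1: "integrable (lebesgue_on ?J) (\<lambda>t. \<phi> t * g t \<xi>)" if "g \<in> L2_V_dual T \<Omega>" for g
  proof (rule seminormed_set.functional_integrable[where l = "\<lambda>F. F \<xi>", OF seminormed_set_V_dual that phi])
    show "\<bar>F \<xi> - G \<xi>\<bar> \<le> V_norm \<Omega> \<xi> * V_dual_norm \<Omega> (F - G)" if "F \<in> V_dual \<Omega>" "G \<in> V_dual \<Omega>" for F G
      using V_dual_le[OF V_dual_diff[OF that] xi] by (simp add: mult.commute)
  qed auto
  have I2: "integrable (lebesgue_on ?J) (\<lambda>t. deriv \<phi> t * (LINT x|lebesgue_on \<Omega>. g t x \<bullet> \<xi> x))" if "g \<in> L2_V T \<Omega>" for g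
  proof (rule seminormed_set.functional_integrable[where l = "\<lambda>a. LINT x|lebesgue_on \<Omega>. a x \<bullet> \<xi> x", OF seminormed_set_V that dphi])
    fix a b assume ab: "a \<in> V \<Omega>" "b \<in> V \<Omega>"
    have "(LINT x|lebesgue_on \<Omega>. a x \<bullet> \<xi> x) - (LINT x|lebesgue_on \<Omega>. b x \<bullet> \<xi> x) = (LINT x|lebesgue_on \<Omega>. (a - b) x \<bullet> \<xi> x)"
      using L2_inner_integrable[OF V_L2[OF ab(1)] V_L2[OF xi]] L2_inner_integrable[OF V_L2[OF ab(2)] V_L2[OF xi]]
      by (simp add: inner_diff_left)
    also have "\<bar>\<dots>\<bar> \<le> L2_norm \<Omega> (a - b) * L2_norm \<Omega> \<xi>"
      by (rule L2_inner_le[OF V_L2[OF V_diff(1)[OF ab]] V_L2[OF xi]])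
    also have "\<dots> \<le> (C * V_norm \<Omega> (a - b)) * L2_norm \<Omega> \<xi>"
      by (rule mult_right_mono[OF C(2)[OF V_diff(1)[OF ab]]]) simp
    finally show "\<bar>(LINT x|lebesgue_on \<Omega>. a x \<bullet> \<xi> x) - (LINT x|lebesgue_on \<Omega>. b x \<bullet> \<xi> x)\<bar> \<le> (C * L2_norm \<Omega> \<xi>) * V_norm \<Omega> (a - b)"
      by (simp add: mult_ac)
  qed (use C(1) in auto)
  have vV: "AE t in lebesgue_on ?J. v t \<in> V \<Omega>" "AE t in lebesgue_on ?J. v2 t \<in> V \<Omega>"
    using v by (auto simp: bochner_L2_def)
  let ?I = "\<lambda>g t. LINT x|lebesgue_on \<Omega>. g t x \<bullet> \<xi> x"
  have ae: "AE t in lebesgue_on ?J. deriv \<phi> t * ?I v t - deriv \<phi> t * ?I v2 t = deriv \<phi> t * (LINT x|lebesgue_on \<Omega>. (v t - v2 t) x \<bullet> \<xi> x)"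
    using vV
  proof eventually_elim
    case (elim t)
    show ?case
      using L2_inner_integrable[OF V_L2[OF elim(1)] V_L2[OF xi]] L2_inner_integrable[OF V_L2[OF elim(2)] V_L2[OF xi]]
      by (simp add: inner_diff_left right_diff_distrib)
  qed
  have dI: "integrable (lebesgue_on ?J) (\<lambda>t. deriv \<phi> t * ?I (\<lambda>t. v t - v2 t) t)"
    by (rule I2[OF seminormed_set.bochner_diff[OF seminormed_set_V v]])
  have "(LINT t|lebesgue_on ?J. \<phi> t * (w t - w2 t) \<xi>) = (LINT t|lebesgue_on ?J. \<phi> t * w t \<xi>) - (LINT t|lebesgue_on ?J. \<phi> t * w2 t \<xi>)"
    using I1[OF w(1)] I1[OF w(2)] by (simp add: right_diff_distrib)
  also have "\<dots> = - ((LINT t|lebesgue_on ?J. deriv \<phi> t * ?I v t) - (LINT t|lebesgue_on ?J. deriv \<phi> t * ?I v2 t))"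
    using weak[unfolded weak_dt_def, rule_format, OF phi xi] by simp
  also have "(LINT t|lebesgue_on ?J. deriv \<phi> t * ?I v t) - (LINT t|lebesgue_on ?J. deriv \<phi> t * ?I v2 t) =
      (LINT t|lebesgue_on ?J. deriv \<phi> t * ?I v t - deriv \<phi> t * ?I v2 t)"
    by (rule Bochner_Integration.integral_diff[OF I2[OF v(1)] I2[OF v(2)], symmetric])
  also have "\<dots> = (LINT t|lebesgue_on ?J. deriv \<phi> t * (LINT x|lebesgue_on \<Omega>. (v t - v2 t) x \<bullet> \<xi> x))"
    by (rule integral_cong_AE[OF _ borel_measurable_integrable[OF dI] ae])
       (rule borel_measurable_integrable[OF Bochner_Integration.integrable_diff[OF I2[OF v(1)] I2[OF v(2)]]])
  finally show "(LINT t|lebesgue_on ?J. \<phi> t * (w t - w2 t) \<xi>) =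
      - (LINT t|lebesgue_on ?J. deriv \<phi> t * (LINT x|lebesgue_on \<Omega>. (v t - v2 t) x \<bullet> \<xi> x))" .
qed

lemma W_dt:
  assumes "v \<in> W T \<Omega>"
  shows "v \<in> L2_V T \<Omega>" "dt T \<Omega> v \<in> L2_V_dual T \<Omega>" "weak_dt T \<Omega> v (dt T \<Omega> v)"
proof -
  show "v \<in> L2_V T \<Omega>" using assms by (simp add: W_def)
  have "\<exists>w. w \<in> L2_V_dual T \<Omega> \<and> weak_dt T \<Omega> v w" using assms by (auto simp: W_def)
  from someI_ex[OF this] show "dt T \<Omega> v \<in> L2_V_dual T \<Omega>" "weak_dt T \<Omega> v (dt T \<Omega> v)"
    unfolding dt_def by blast+
qed

lemma continuous_rep_diff:
  assumes c: "continuous_rep T \<Omega> v c" and c': "continuous_rep T \<Omega> v' c'"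
  shows "continuous_rep T \<Omega> (\<lambda>t. v t - v' t) (\<lambda>t. c t - c' t)"
proof -
  have L: "c t \<in> L2 \<Omega>" "c' t \<in> L2 \<Omega>" if "t \<in> {0..T}" for t using c c' that by (auto simp: continuous_rep_def)
  have "((\<lambda>s. L2_norm \<Omega> ((c s - c' s) - (c t - c' t))) \<longlongrightarrow> 0) (at t within {0..T})" if t: "t \<in> {0..T}" for t
  proof (rule Lim_null_comparison)
    show "((\<lambda>s. L2_norm \<Omega> (c s - c t) + L2_norm \<Omega> (c' s - c' t)) \<longlongrightarrow> 0) (at t within {0..T})"
      using c c' t by (intro tendsto_add_zero) (auto simp: continuous_rep_def)
    have "L2_norm \<Omega> ((c s - c' s) - (c t - c' t)) \<le> L2_norm \<Omega> (c s - c t) + L2_norm \<Omega> (c' s - c' t)" if s: "s \<in> {0..T}" for s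
      by (rule seminormed_set.N_diff_diff[OF seminormed_set_L2 L[OF s] L[OF t]])
    then show "\<forall>\<^sub>F s in at t within {0..T}. norm (L2_norm \<Omega> ((c s - c' s) - (c t - c' t))) \<le> L2_norm \<Omega> (c s - c t) + L2_norm \<Omega> (c' s - c' t)"
      unfolding eventually_at by (intro exI[of _ 1]) auto
  qed
  moreover have "AE t in lebesgue_on {0<..<T}. AE x in lebesgue_on \<Omega>. (c t - c' t) x = (v t - v' t) x"
  proof -
    have "AE t in lebesgue_on {0<..<T}. AE x in lebesgue_on \<Omega>. c t x = v t x" "AE t in lebesgue_on {0<..<T}. AE x in lebesgue_on \<Omega>. c' t x = v' t x"
      using c c' by (auto simp: continuous_rep_def)
    then show ?thesis
    proof eventually_elim
      case (elim t)
      then show ?case by eventually_elim simp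
    qed
  qed
  ultimately show ?thesis unfolding continuous_rep_def using L2_minus[OF L] by blast
qed

text \<open>The error identity at one instant. Both equations enter for the single test function l -
  v only, and a, b stand for the two time derivatives at this instant. The cross term of the
  expanded square is minus twice the inner product, which is how (a - b) (l - v) appears with a plus
  sign.\<close>

lemma pointwise_identity:
  fixes y :: "'d tfield"
  assumes y: "y \<in> L2 \<Omega>" and v: "v \<in> V \<Omega>" and l: "l \<in> V \<Omega>" and q: "q \<in> L2 \<Omega>"
    and dv: "AE x in lebesgue_on \<Omega>. div_field \<Omega> v x = 0" and dl: "AE x in lebesgue_on \<Omega>. div_field \<Omega> l x = 0"
    and A2: "(\<lambda>x. deviator (y x - (grad \<Omega> v x - q x *\<^sub>R mat 1))) \<in> L2 \<Omega>"
    and A3: "(\<lambda>x. deviator (y x) - grad \<Omega> l x) \<in> L2 \<Omega>"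
    and eqs: "b (l - v) + neg_laplace \<Omega> v (l - v) + pressure_grad \<Omega> q (l - v) = F (l - v)"
      "div_dual \<Omega> y (l - v) = a (l - v) - (F (l - v) :: real)"
  shows "(L2_norm \<Omega> (\<lambda>x. deviator (y x) - grad \<Omega> l x))\<^sup>2 =
    (L2_norm \<Omega> (\<lambda>x. deviator (y x - (grad \<Omega> v x - q x *\<^sub>R mat 1))))\<^sup>2 + (L2_norm \<Omega> (grad \<Omega> (l - v)))\<^sup>2 + 2 * (a - b) (l - v)"
proof -
  let ?A2 = "\<lambda>x. deviator (y x - (grad \<Omega> v x - q x *\<^sub>R mat 1))" and ?A3 = "\<lambda>x. deviator (y x) - grad \<Omega> l x"
  let ?G = "grad \<Omega> (l - v)"
  note E = V_diff[OF l v]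
  have GL: "?G \<in> L2 \<Omega>" by (rule V_grad_L2[OF E(1)])
  have tG: "AE x in lebesgue_on \<Omega>. trace (?G x) = 0"
    using E(3) dv dl by eventually_elim (simp add: div_field_def trace_sub)
  have dev2: "deviator (y x - (grad \<Omega> v x - q x *\<^sub>R mat 1)) = deviator (y x) - grad \<Omega> v x" if "div_field \<Omega> v x = 0" for x
    using that by (simp add: deviator_diff deviator_scaleR deviator_mat_1 deviator_traceless div_field_def)
  \<comment> \<open>The divergence of l - v is the trace of its gradient and vanishes almost
    everywhere, so the pressure tests to zero.\<close>
  have p0: "pressure_grad \<Omega> q (l - v) = 0"
  proof -
    have "(LINT x|lebesgue_on \<Omega>. q x * div_field \<Omega> (l - v) x) = 0"
      by (rule integral_eq_zero_AE) (use tG in eventually_elim, simp add: div_field_def)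
    then show ?thesis by (simp add: pressure_grad_def)
  qed
  \<comment> \<open>\<open>div_dual\<close> carries the minus sign, hence y enters negatively; the
    right-hand side F cancels.\<close>
  have ab: "(a - b) (l - v) = (LINT x|lebesgue_on \<Omega>. grad \<Omega> v x \<bullet> ?G x) - (LINT x|lebesgue_on \<Omega>. y x \<bullet> ?G x)"
    using eqs p0 by (simp add: neg_laplace_def div_dual_def L_adjoint_def)
  have "(LINT x|lebesgue_on \<Omega>. ?A2 x \<bullet> ?G x) = (LINT x|lebesgue_on \<Omega>. y x \<bullet> ?G x - grad \<Omega> v x \<bullet> ?G x)"
  proof (rule integral_cong_AE)
    show "(\<lambda>x. ?A2 x \<bullet> ?G x) \<in> borel_measurable (lebesgue_on \<Omega>)"
      by (rule borel_measurable_integrable[OF L2_inner_integrable[OF A2 GL]])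
    show "(\<lambda>x. y x \<bullet> ?G x - grad \<Omega> v x \<bullet> ?G x) \<in> borel_measurable (lebesgue_on \<Omega>)"
      by (intro borel_measurable_diff borel_measurable_integrable L2_inner_integrable y GL V_grad_L2 v)
    show "AE x in lebesgue_on \<Omega>. ?A2 x \<bullet> ?G x = y x \<bullet> ?G x - grad \<Omega> v x \<bullet> ?G x"
      using tG dv by eventually_elim (simp add: dev2 inner_diff_left deviator_inner)
  qed
  also have "\<dots> = - (a - b) (l - v)"
    unfolding ab by (subst Bochner_Integration.integral_diff) (auto intro: L2_inner_integrable y GL V_grad_L2 v)
  finally have ip: "(LINT x|lebesgue_on \<Omega>. ?A2 x \<bullet> ?G x) = - (a - b) (l - v)" .
  have "L2_norm \<Omega> ?A3 = L2_norm \<Omega> (?A2 - ?G)"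
  proof (rule L2_norm_cong_AE[OF _ L2_measurable[OF A3] L2_measurable[OF L2_minus[OF A2 GL]]])
    show "AE x in lebesgue_on \<Omega>. ?A3 x = (?A2 - ?G) x"
      using E(3) dv by eventually_elim (simp add: dev2)
  qed
  then show ?thesis using L2_norm_diff_sq[OF A2 GL] ip by simp
qed

end

theorem lemma5p4:
  fixes \<Omega> :: "(real^'d::finite) set" and T :: real
    and f :: "real \<Rightarrow> 'd vfield \<Rightarrow> real"
    and u0 :: "'d vfield"
    and u :: "real \<Rightarrow> 'd vfield"
    and p :: "real \<Rightarrow> real^'d \<Rightarrow> real"
    and z y :: "real \<Rightarrow> 'd tfield"
    and lam :: "real \<Rightarrow> 'd vfield"
  assumes "bounded \<Omega>" and "lipschitz_domain \<Omega>" and "0 < T"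
    and "f \<in> L2_V_dual T \<Omega>" and "u0 \<in> H_sigma \<Omega>"
    and "u \<in> W T \<Omega>" and "p \<in> L2_mean_zero_time T \<Omega>"
    and momentum: "AE t in lebesgue_on {0<..<T}. \<forall>v\<in>V \<Omega>.
           dt T \<Omega> u t v + neg_laplace \<Omega> (u t) v + pressure_grad \<Omega> (p t) v = f t v"
    and incompressible: "AE t in lebesgue_on {0<..<T}. AE x in lebesgue_on \<Omega>.
           div_field \<Omega> (u t) x = 0"
    and initial: "AE x in lebesgue_on \<Omega>. cont_rep T \<Omega> u 0 x = u0 x"
    and z: "AE t in lebesgue_on {0<..<T}. AE x in lebesgue_on \<Omega>.
           z t x = grad \<Omega> (u t) x - p t x *\<^sub>R mat 1"
    and "y \<in> L2_Y T \<Omega>" and "lam \<in> W T \<Omega>" and "lam \<in> L2_V_sigma T \<Omega>"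
    and constraint: "AE t in lebesgue_on {0<..<T}. \<forall>v\<in>V \<Omega>.
           div_dual \<Omega> (y t) v = dt T \<Omega> lam t v - f t v"
  shows "1/2 * (Q_norm T \<Omega> (\<lambda>t x. deviator (y t x - z t x)))\<^sup>2
       + 1/2 * (Q_norm T \<Omega> (\<lambda>t. grad \<Omega> (lam t - u t)))\<^sup>2
       + 1/2 * (L2_norm \<Omega> (cont_rep T \<Omega> (lam - u) T))\<^sup>2
       = 1/2 * (Q_norm T \<Omega> (\<lambda>t x. deviator (y t x) - grad \<Omega> (lam t) x))\<^sup>2
       + 1/2 * (L2_norm \<Omega> (cont_rep T \<Omega> lam 0 - u0))\<^sup>2"
proof -
  let ?J = "{0<..<T}"
  interpret bounded_open \<Omega>
    using assms(1,2) by unfold_locales (auto simp: lipschitz_domain_def)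
  note uW = W_dt[OF \<open>u \<in> W T \<Omega>\<close>] and lW = W_dt[OF \<open>lam \<in> W T \<Omega>\<close>]
  \<comment> \<open>By \<open>weak_dt_diff\<close> this is a weak derivative of the difference,
    which is all that \<open>W_continuous_rep\<close> requires of it.\<close>
  define w where "w t = dt T \<Omega> lam t - dt T \<Omega> u t" for t
  \<comment> \<open>The given z is fixed only up to null sets; the work is done with this explicit
    version and transferred by \<open>Q_norm_cong\<close> at the end.\<close>
  define z0 where "z0 t x = grad \<Omega> (u t) x - p t x *\<^sub>R mat 1" for t x
  have pL: "p \<in> bochner_L2 ?J (L2 \<Omega>) (L2_norm \<Omega>)"
    by (rule bochner_L2_mono[OF \<open>p \<in> L2_mean_zero_time T \<Omega>\<close>]) (auto simp: L2_mean_zero_def)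
  obtain K where K: "K \<ge> 0" "\<And>S (f :: real^'d \<Rightarrow> real^'d^'d). f \<in> L2 S \<Longrightarrow> (\<lambda>x. deviator (f x)) \<in> L2 S"
    "\<And>S (f :: real^'d \<Rightarrow> real^'d^'d). f \<in> L2 S \<Longrightarrow> L2_norm S (\<lambda>x. deviator (f x)) \<le> K * L2_norm S f"
    using L2_bounded_linear[OF bounded_linear_deviator] by metis
  have bm: "bounded_linear (\<lambda>c. c *\<^sub>R (mat 1 :: real^'d^'d))" by (rule bounded_linear_scaleR_left)
  obtain c1 where c1: "c1 \<ge> 0" "\<And>S (f :: real^'d \<Rightarrow> real). f \<in> L2 S \<Longrightarrow> (\<lambda>x. f x *\<^sub>R (mat 1 :: real^'d^'d)) \<in> L2 S"
    "\<And>S (f :: real^'d \<Rightarrow> real). f \<in> L2 S \<Longrightarrow> L2_norm S (\<lambda>x. f x *\<^sub>R (mat 1 :: real^'d^'d)) \<le> c1 * L2_norm S f"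
    using L2_bounded_linear[OF bm] by metis
  note SL = seminormed_set_L2 and SV = seminormed_set_V
  \<comment> \<open>The constant adds the Lipschitz constant 1 of the gradient with respect to the
    norm of V and the constant c1 of the embedding of scalars as multiples of the identity.\<close>
  have z0L: "z0 \<in> L2_Y T \<Omega>"
  proof -
    have "(\<lambda>t. (\<lambda>a b x. grad \<Omega> a x - b x *\<^sub>R mat 1) (u t) (p t)) \<in> L2_Y T \<Omega>"
    proof (rule bochner_L2_combine[where C = "1 + c1", OF SV SL SL _ _ _ uW(1) pL])
      show "(\<lambda>x. grad \<Omega> a x - b x *\<^sub>R mat 1) \<in> L2 \<Omega>" if "a \<in> V \<Omega>" "b \<in> L2 \<Omega>" for a and b :: "real^'d \<Rightarrow> real"
        by (intro L2_diff V_grad_L2 c1(2) that)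
      show "L2_norm \<Omega> (\<lambda>x. grad \<Omega> (\<lambda>_. 0) x - 0 *\<^sub>R mat 1) = 0"
        using V_norm_zero by (simp add: V_norm_def)
      fix a a' and b b' :: "real^'d \<Rightarrow> real" assume m: "a \<in> V \<Omega>" "a' \<in> V \<Omega>" "b \<in> L2 \<Omega>" "b' \<in> L2 \<Omega>"
      have "L2_norm \<Omega> ((\<lambda>x. grad \<Omega> a x - b x *\<^sub>R mat 1) - (\<lambda>x. grad \<Omega> a' x - b' x *\<^sub>R mat 1)) \<le> V_norm \<Omega> (a - a') + c1 * L2_norm \<Omega> (b - b')"
      proof (rule L2_norm_split_le)
        show "grad \<Omega> a - grad \<Omega> a' \<in> L2 \<Omega>" by (intro L2_minus V_grad_L2 m)
        show "(\<lambda>x. (b - b') x *\<^sub>R (mat 1 :: real^'d^'d)) \<in> L2 \<Omega>" by (intro c1(2) L2_minus m)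
        show "L2_norm \<Omega> (grad \<Omega> a - grad \<Omega> a') \<le> V_norm \<Omega> (a - a')" by (simp add: V_diff(2)[OF m(1,2)])
        show "L2_norm \<Omega> (\<lambda>x. (b - b') x *\<^sub>R (mat 1 :: real^'d^'d)) \<le> c1 * L2_norm \<Omega> (b - b')" by (intro c1(3) L2_minus m)
      qed (simp add: fun_eq_iff scaleR_diff_left)
      also have "\<dots> \<le> (1 + c1) * (V_norm \<Omega> (a - a') + L2_norm \<Omega> (b - b'))"
        using c1(1) by (simp add: algebra_simps)
      finally show "L2_norm \<Omega> ((\<lambda>x. grad \<Omega> a x - b x *\<^sub>R mat 1) - (\<lambda>x. grad \<Omega> a' x - b' x *\<^sub>R mat 1)) \<le> (1 + c1) * (V_norm \<Omega> (a - a') + L2_norm \<Omega> (b - b'))" .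
    qed
    then show ?thesis by (simp add: z0_def[abs_def])
  qed
  have A2: "(\<lambda>t x. deviator (y t x - z0 t x)) \<in> L2_Y T \<Omega>"
  proof -
    have "(\<lambda>t. (\<lambda>a b x. deviator (a x - b x)) (y t) (z0 t)) \<in> L2_Y T \<Omega>"
    proof (rule bochner_L2_combine[where C = K, OF SL SL SL _ _ _ \<open>y \<in> L2_Y T \<Omega>\<close> z0L])
      show "(\<lambda>x. deviator (a x - b x)) \<in> L2 \<Omega>" if "a \<in> L2 \<Omega>" "b \<in> L2 \<Omega>" for a b :: "'d tfield"
        by (intro K(2) L2_diff that)
      show "L2_norm \<Omega> (\<lambda>x. deviator ((0 :: real^'d^'d) - 0)) = 0"
        using deviator_diff[of "0 :: real^'d^'d" 0] by (simp add: L2_norm_zero)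
      fix a a' b b' :: "'d tfield" assume m: "a \<in> L2 \<Omega>" "a' \<in> L2 \<Omega>" "b \<in> L2 \<Omega>" "b' \<in> L2 \<Omega>"
      have "(\<lambda>x. deviator (a x - b x)) - (\<lambda>x. deviator (a' x - b' x)) = (\<lambda>x. deviator (((a - a') - (b - b')) x))"
        by (simp add: fun_eq_iff deviator_diff)
      then have "L2_norm \<Omega> ((\<lambda>x. deviator (a x - b x)) - (\<lambda>x. deviator (a' x - b' x))) \<le> K * L2_norm \<Omega> ((a - a') - (b - b'))"
        using K(3)[OF L2_minus[OF L2_minus[OF m(1,2)] L2_minus[OF m(3,4)]]] by simp
      also have "\<dots> \<le> K * (L2_norm \<Omega> (a - a') + L2_norm \<Omega> (b - b'))"
        by (intro mult_left_mono L2_norm_triangle_minus L2_minus m K(1))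
      finally show "L2_norm \<Omega> ((\<lambda>x. deviator (a x - b x)) - (\<lambda>x. deviator (a' x - b' x))) \<le> K * (L2_norm \<Omega> (a - a') + L2_norm \<Omega> (b - b'))" .
    qed
    then show ?thesis by simp
  qed
  have A3: "(\<lambda>t x. deviator (y t x) - grad \<Omega> (lam t) x) \<in> L2_Y T \<Omega>"
  proof -
    have "(\<lambda>t. (\<lambda>a b x. deviator (a x) - grad \<Omega> b x) (y t) (lam t)) \<in> L2_Y T \<Omega>"
    proof (rule bochner_L2_combine[where C = "1 + K", OF SL SV SL _ _ _ \<open>y \<in> L2_Y T \<Omega>\<close> lW(1)])
      show "(\<lambda>x. deviator (a x) - grad \<Omega> b x) \<in> L2 \<Omega>" if "a \<in> L2 \<Omega>" "b \<in> V \<Omega>" for a :: "'d tfield" and b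
        by (intro L2_diff K(2) V_grad_L2 that)
      have "deviator (0 :: real^'d^'d) = 0" using deviator_diff[of "0 :: real^'d^'d" 0] by simp
      then show "L2_norm \<Omega> (\<lambda>x. deviator 0 - grad \<Omega> (\<lambda>_. 0) x) = 0"
        using V_norm_zero by (simp add: V_norm_def L2_norm_def)
      fix a a' :: "'d tfield" and b b' assume m: "a \<in> L2 \<Omega>" "a' \<in> L2 \<Omega>" "b \<in> V \<Omega>" "b' \<in> V \<Omega>"
      have "L2_norm \<Omega> ((\<lambda>x. deviator (a x) - grad \<Omega> b x) - (\<lambda>x. deviator (a' x) - grad \<Omega> b' x)) \<le> K * L2_norm \<Omega> (a - a') + V_norm \<Omega> (b - b')"
      proof (rule L2_norm_split_le)
        show "(\<lambda>x. deviator ((a - a') x)) \<in> L2 \<Omega>" by (intro K(2) L2_minus m)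
        show "grad \<Omega> b - grad \<Omega> b' \<in> L2 \<Omega>" by (intro L2_minus V_grad_L2 m)
        show "L2_norm \<Omega> (\<lambda>x. deviator ((a - a') x)) \<le> K * L2_norm \<Omega> (a - a')" by (intro K(3) L2_minus m)
        show "L2_norm \<Omega> (grad \<Omega> b - grad \<Omega> b') \<le> V_norm \<Omega> (b - b')" by (simp add: V_diff(2)[OF m(3,4)])
      qed (simp add: fun_eq_iff deviator_diff)
      also have "\<dots> \<le> (1 + K) * (L2_norm \<Omega> (a - a') + V_norm \<Omega> (b - b'))"
        using K(1) by (simp add: algebra_simps)
      finally show "L2_norm \<Omega> ((\<lambda>x. deviator (a x) - grad \<Omega> b x) - (\<lambda>x. deviator (a' x) - grad \<Omega> b' x)) \<le> (1 + K) * (L2_norm \<Omega> (a - a') + V_norm \<Omega> (b - b'))" .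
    qed
    then show ?thesis by simp
  qed
  have A4: "(\<lambda>t. grad \<Omega> (lam t - u t)) \<in> L2_Y T \<Omega>"
  proof (rule bochner_L2_combine[where \<Phi> = "\<lambda>a b. grad \<Omega> (a - b)" and C = 1, OF SV SV SL _ _ _ lW(1) uW(1)])
    show "grad \<Omega> (a - b) \<in> L2 \<Omega>" if "a \<in> V \<Omega>" "b \<in> V \<Omega>" for a b by (rule V_grad_L2[OF V_diff(1)[OF that]])
    show "L2_norm \<Omega> (grad \<Omega> ((\<lambda>_. 0) - (\<lambda>_. 0))) = 0"
      using seminormed_set.N_diff_self[OF SV V_zero] by (simp add: V_norm_def)
    show "L2_norm \<Omega> (grad \<Omega> (a - b) - grad \<Omega> (a' - b')) \<le> 1 * (V_norm \<Omega> (a - a') + V_norm \<Omega> (b - b'))"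
      if m: "a \<in> V \<Omega>" "a' \<in> V \<Omega>" "b \<in> V \<Omega>" "b' \<in> V \<Omega>" for a a' b b'
      using seminormed_set.N_diff_diff[OF SV m(1,3,2,4)] V_diff(2)[OF V_diff(1)[OF m(1,3)] V_diff(1)[OF m(2,4)]] by simp
  qed
  have eV: "(\<lambda>t. lam t - u t) \<in> L2_V T \<Omega>" by (rule seminormed_set.bochner_diff[OF SV lW(1) uW(1)])
  have wV: "w \<in> L2_V_dual T \<Omega>"
    unfolding w_def[abs_def] by (rule seminormed_set.bochner_diff[OF seminormed_set_V_dual lW(2) uW(2)])
  have ew: "weak_dt T \<Omega> (\<lambda>t. lam t - u t) w"
    unfolding w_def[abs_def] by (rule weak_dt_diff[OF lW(1) uW(1) lW(2) uW(2) lW(3) uW(3)])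
  obtain c where c: "continuous_rep T \<Omega> (\<lambda>t. lam t - u t) c"
    "(L2_norm \<Omega> (c T))\<^sup>2 - (L2_norm \<Omega> (c 0))\<^sup>2 = 2 * (LINT t|lebesgue_on ?J. w t (lam t - u t))"
    "integrable (lebesgue_on ?J) (\<lambda>t. w t (lam t - u t))"
    by (rule W_continuous_rep[OF \<open>0 < T\<close> eV wV ew])
  have eq_norm: "L2_norm \<Omega> f = L2_norm \<Omega> g" if "f \<in> L2 \<Omega>" "g \<in> L2 \<Omega>" "L2_norm \<Omega> (f - g) = 0" for f g :: "'d vfield"
    using seminormed_set.N_abs_diff[OF SL that(1,2)] that(3) by simp
  have T0: "0 \<in> {0..T}" "T \<in> {0..T}" using \<open>0 < T\<close> by auto
  have lu: "lam - u = (\<lambda>t. lam t - u t)" by (simp add: fun_eq_iff)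
  have "lam - u \<in> W T \<Omega>" unfolding W_def lu using eV wV ew by blast
  note re = cont_rep_W[OF \<open>0 < T\<close> this]
  \<comment> \<open>\<open>cont_rep\<close> of the difference and c are independently chosen
    continuous representatives of the same function; they agree in the norm at each time.\<close>
  have endT: "L2_norm \<Omega> (cont_rep T \<Omega> (lam - u) T) = L2_norm \<Omega> (c T)"
    using re c(1) T0 continuous_rep_unique[OF \<open>0 < T\<close> re[unfolded lu] c(1) T0(2)]
    by (intro eq_norm) (auto simp: continuous_rep_def lu)
  note rl = cont_rep_W[OF \<open>0 < T\<close> \<open>lam \<in> W T \<Omega>\<close>] and ru = cont_rep_W[OF \<open>0 < T\<close> \<open>u \<in> W T \<Omega>\<close>]
  have L0: "cont_rep T \<Omega> lam 0 \<in> L2 \<Omega>" "cont_rep T \<Omega> u 0 \<in> L2 \<Omega>" "c 0 \<in> L2 \<Omega>" "u0 \<in> L2 \<Omega>"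
    using rl ru c(1) T0 \<open>u0 \<in> H_sigma \<Omega>\<close> by (auto simp: continuous_rep_def H_sigma_def)
  \<comment> \<open>At time 0 the representatives of \<open>lam\<close> and u are chosen separately.
    Their difference is a continuous representative of \<open>lam - u\<close> and hence agrees with
    c in the norm.\<close>
  have "L2_norm \<Omega> (cont_rep T \<Omega> lam 0 - cont_rep T \<Omega> u 0) = L2_norm \<Omega> (c 0)"
    by (rule eq_norm[OF L2_minus[OF L0(1,2)] L0(3) continuous_rep_unique[OF \<open>0 < T\<close> continuous_rep_diff[OF rl ru] c(1) T0(1)]])
  moreover have "L2_norm \<Omega> (cont_rep T \<Omega> lam 0 - cont_rep T \<Omega> u 0) = L2_norm \<Omega> (cont_rep T \<Omega> lam 0 - u0)"
    by (rule L2_norm_cong_AE[OF _ L2_measurable[OF L2_minus[OF L0(1,2)]] L2_measurable[OF L2_minus[OF L0(1,4)]]])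
       (use initial in eventually_elim, simp)
  ultimately have end0: "L2_norm \<Omega> (cont_rep T \<Omega> lam 0 - u0) = L2_norm \<Omega> (c 0)" by simp
  let ?N2 = "\<lambda>t. (L2_norm \<Omega> (\<lambda>x. deviator (y t x - z0 t x)))\<^sup>2" and ?N3 = "\<lambda>t. (L2_norm \<Omega> (\<lambda>x. deviator (y t x) - grad \<Omega> (lam t) x))\<^sup>2"
    and ?N4 = "\<lambda>t. (L2_norm \<Omega> (grad \<Omega> (lam t - u t)))\<^sup>2" and ?we = "\<lambda>t. w t (lam t - u t)"
  have I: "integrable (lebesgue_on ?J) ?N2" "integrable (lebesgue_on ?J) ?N3" "integrable (lebesgue_on ?J) ?N4"
    using A2 A3 A4 by (auto simp: bochner_L2_def)
  have mem: "AE t in lebesgue_on ?J. y t \<in> L2 \<Omega>" "AE t in lebesgue_on ?J. u t \<in> V \<Omega>" "AE t in lebesgue_on ?J. lam t \<in> V_sigma \<Omega>"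
    "AE t in lebesgue_on ?J. p t \<in> L2 \<Omega>" "AE t in lebesgue_on ?J. (\<lambda>x. deviator (y t x - z0 t x)) \<in> L2 \<Omega>"
    "AE t in lebesgue_on ?J. (\<lambda>x. deviator (y t x) - grad \<Omega> (lam t) x) \<in> L2 \<Omega>"
    using \<open>y \<in> L2_Y T \<Omega>\<close> uW(1) \<open>lam \<in> L2_V_sigma T \<Omega>\<close> pL A2 A3 by (auto simp: bochner_L2_def)
  \<comment> \<open>The test function \<open>lam t - u t\<close> depends on t. It may be inserted
    because both equations are given with the quantifier over \<open>V\<close> inside the almost
    everywhere statement.\<close>
  have pt: "AE t in lebesgue_on ?J. ?N3 t = ?N2 t + ?N4 t + 2 * ?we t"
    using mem momentum constraint incompressible
  proof eventually_elim
    case (elim t)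
    have l: "lam t \<in> V \<Omega>" "AE x in lebesgue_on \<Omega>. div_field \<Omega> (lam t) x = 0" using elim(3) by (auto simp: V_sigma_def)
    have e: "lam t - u t \<in> V \<Omega>" by (rule V_diff(1)[OF l(1) elim(2)])
    show ?case
      unfolding w_def z0_def
      by (rule pointwise_identity[where a = "dt T \<Omega> lam t" and b = "dt T \<Omega> u t" and F = "f t", OF elim(1,2) l(1) elim(4,9) l(2) elim(5)[unfolded z0_def] elim(6)
          elim(7)[rule_format, OF e] elim(8)[rule_format, OF e]])
  qed
  have "(LINT t|lebesgue_on ?J. ?N3 t) = (LINT t|lebesgue_on ?J. ?N2 t + ?N4 t + 2 * ?we t)"
    by (rule integral_cong_AE[OF borel_measurable_integrable[OF I(2)] _ pt]) (use I c(3) in simp)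
  also have "\<dots> = (LINT t|lebesgue_on ?J. ?N2 t) + (LINT t|lebesgue_on ?J. ?N4 t) + 2 * (LINT t|lebesgue_on ?J. ?we t)"
    using I c(3) by simp
  finally have main: "(LINT t|lebesgue_on ?J. ?N3 t) = (LINT t|lebesgue_on ?J. ?N2 t) + (LINT t|lebesgue_on ?J. ?N4 t) + 2 * (LINT t|lebesgue_on ?J. ?we t)" .
  have "Q_norm T \<Omega> (\<lambda>t x. deviator (y t x - z t x)) = Q_norm T \<Omega> (\<lambda>t x. deviator (y t x - z0 t x))"
  proof (rule Q_norm_cong)
    show "AE t in lebesgue_on ?J. AE x in lebesgue_on \<Omega>. deviator (y t x - z t x) = deviator (y t x - z0 t x)"
      using z
    proof eventually_elim
      case (elim t)
      then show ?case by eventually_elim (simp add: z0_def)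
    qed
  qed
  then have "(Q_norm T \<Omega> (\<lambda>t x. deviator (y t x - z t x)))\<^sup>2 = (LINT t|lebesgue_on ?J. ?N2 t)"
    using Q_norm_sq[OF \<open>0 < T\<close> A2] by simp
  then show ?thesis
    using Q_norm_sq[OF \<open>0 < T\<close> A3] Q_norm_sq[OF \<open>0 < T\<close> A4] main c(2) unfolding endT end0 by (simp add: field_simps)
qed

end
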